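(* Let $K$ be a field complete with respect to a (possibly trivial) non-Archimedean valuation, let $M\cong\mathbb{Z}^d$ be a lattice with dual $N$, and let $\mathcal{A}=\mathcal{A}(a,r)$ be an affine hyperplane arrangement in $M_{\mathbb{R}}$ defined by a primitive spanning configuration $a\in N^E$ ($E$ a finite set) and $r\in\mathbb{Z}^E$. Let $\mathfrak{M}_{\mathcal{A}}\subseteq\mathfrak{B}_{\mathcal{A}}$ be the hypertoric variety in its Lawrence toric variety. Then the tropicalization $\mathrm{Trop}(\mathfrak{M}_{\mathcal{A}})$ of the hypertoric variety is the set-theoretic disjoint union of cones $C^{(F,\mathcal{R})}_{\mathcal{F}}$ indexed by a flat $F$ of $\mathcal{A}_0$, a face $\mathcal{R}$ of the localization $\mathcal{A}_F$, and a flag of flats $\mathcal{F}$ of the restriction $\mathcal{A}_0^F$. These cones satisfy $$\dim C^{(F,\mathcal{R})}_{\mathcal{F}} = d+\ell(\mathcal{F})-\operatorname{codim}\mathcal{R}.$$ This gives $\mathrm{Trop}(\mathfrak{M}_{\mathcal{A}})$ the combinatorial structure of a finite polyhedral complex, under the closure relation $$C^{(F',\mathcal{R}')}_{\mathcal{F}'}\subseteq\overline{C^{(F,\mathcal{R})}_{\mathcal{F}}}$$ if and only if the following conditions hold: (i) $F\subseteq F'$; (ii) $\mathcal{R}'\subseteq\overline{\mathcal{R}}$; (iii) $F'$ is a flat in $\mathcal{F}$, and $\mathrm{trunc}_{F'}(\mathcal{F})$ is a refinement of $\mathcal{F}'$. Moreover, this gives each stratum $\mathrm{Trop}(\mathfrak{M}_{\mathcal{A}}\cap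 O(\sigma_{F,\mathcal{R}}))$ the structure of a polyhedral fan, which is balanced when all cones are given weight one.
   Context: **Arrangements.** $M\cong\mathbb{Z}^d$, $N=\mathrm{Hom}(M,\mathbb{Z})$, $M_{\mathbb{R}}=M\otimes\mathbb{R}$, $N_{\mathbb{R}}=N\otimes\mathbb{R}$. A tuple $a=(a_e)_{e\in E}\in N^E$ of nonzero vectors is a primitive spanning configuration if each $a_e$ is primitive and the $a_e$ generate $N$. The arrangement $\mathcal{A}=\mathcal{A}(a,r)$ is the multiset of hyperplanes $H_e=\{m\in M_{\mathbb{R}}: \langle m,a_e\rangle+r_e=0\}$, $e\in E$, with closed halfspaces $H_e^+=\{\langle m,a_e\rangle+r_e\le 0\}$ and $H_e^-=\{\langle m,a_e\rangle+r_e\ge 0\}$. For $S\subseteq E$, the localization $\mathcal{A}_S$ is the arrangement $\{H_e: e\in S\}$ in $M_{\mathbb{R}}$. The sign vector $\mathrm{sgn}_{\mathcal{A}_S}(m)\in\{+,0,-\}^S$ has $e$-entry $+$ if $m\in H_e^+\setminus H_e$, $0$ if $m\in H_e$, $-$ if $m\in H_e^-\setminus H_e$. A face of $\mathcal{A}_S$ is a nonempty fiber of $\mathrm{sgn}_{\mathcal{A}_S}$; a vertex is a one-point face. For a face $\mathcal{R}$ of $\mathcal{A}_S$, $S^{\pm}(\mathcal{R})=\{e\in S: \mathcal{R}\subseteq H_e^{\pm}\}$; $\overline{\mathcal{R}}$ is its closure and $\operatorname{codim}\mathcal{R}$ its codimension in $M_{\mathbb{R}}$. **Matroid.** $\mathcal{A}_0=\mathcal{A}(a,0)$,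 with hyperplanes $(H_e)_0$. For $S\subseteq E$, $\operatorname{rk}S=\operatorname{codim}\bigcap_{e\in S}(H_e)_0$. A subset $F\subseteq E$ is a flat of $\mathcal{A}_0$ if it is maximal among subsets of its rank. The restriction $\mathcal{A}_0^F$ is the arrangement $\{(H_e)_0\cap H_F: e\notin F\}$ in $H_F=\bigcap_{e\in F}(H_e)_0$; its flats are identified with the flats of $\mathcal{A}_0$ containing $F$. A flag $\mathcal{F}$ of flats of $\mathcal{A}_0^F$ is a chain $F=F_0\subsetneq F_1\subsetneq\dots\subsetneq F_k=E$ of flats of $\mathcal{A}_0$; its length is $\ell(\mathcal{F})=k$. If $F'=F_i$ is a flat in $\mathcal{F}$, then $\mathrm{trunc}_{F'}(\mathcal{F})$ is the flag $F'=F_i\subsetneq F_{i+1}\subsetneq\dots\subsetneq F_k=E$ of flats of $\mathcal{A}_0^{F'}$. **Lawrence toric variety.** Let $\Lambda=\ker(\mathbb{Z}^E\to N,\ \delta_e\mapsto a_e)$, embedded in $\mathbb{Z}^E\oplus\mathbb{Z}^E$ (with bases $\delta_e^+$, $\delta_e^-$) via $\delta_e\mapsto\delta_e^+-\delta_e^-$. Let $\widetilde N=(\mathbb{Z}^E\oplus\mathbb{Z}^E)/\Lambda$ (free of rank $|E|+d$), $\rho_e^{\pm}$ the image of $\delta_e^{\pm}$, and $\widetilde M$ the dual lattice. For $S\subseteq E$ and a face $\mathcal{R}$ of $\mathcal{A}_S$, $\sigma_{S,\mathcal{R}}\subseteq\widetilde N_{\mathbb{R}}$ is the cone generated by $\{\rho_e^+: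 e\in S^+(\mathcal{R})\}\cup\{\rho_f^-: f\in S^-(\mathcal{R})\}$. The Lawrence toric variety $\mathfrak{B}_{\mathcal{A}}$ is the toric $K$-variety with dense torus $\widetilde T=\mathrm{Spec}\,K[\widetilde M]$ and fan $\Delta_{\mathcal{A}}$, the fan whose maximal cones are $\sigma_{E,\xi}$ for $\xi$ a vertex of $\mathcal{A}$; the cones of $\Delta_{\mathcal{A}}$ are exactly the $\sigma_{S,\mathcal{R}}$. $O(\sigma)$ denotes the torus orbit of a cone $\sigma$, and $\widetilde N_{\mathbb{R}}(\sigma)=\widetilde N_{\mathbb{R}}/\mathbb{R}\sigma$. **Hypertoric variety.** The map $\widetilde N\to\mathbb{Z}^E$, $\rho_e^{\pm}\mapsto\delta_e$, induces a surjective toric morphism $\Phi:\mathfrak{B}_{\mathcal{A}}\to\mathbb{A}^E$. Let $L_{\mathcal{A}_0}\subseteq\mathbb{A}^E=\mathrm{Spec}\,K[x_e: e\in E]$ be the linear subspace cut out by the forms $\sum_e c_e x_e$ for all relations $\sum_e c_e a_e=0$ in $N$. The hypertoric variety is $\mathfrak{M}_{\mathcal{A}}=\Phi^{-1}(L_{\mathcal{A}_0})$. **Tropicalization.** Let $\mathbb{T}=\mathbb{R}\cup\{\infty\}$. For a toric variety with cocharacter lattice $N'$, character lattice $M'$ and fan $\Delta$, the space $\overline{N'}{}_{\mathbb{R}}^{\Delta}$ is obtained by gluing the spaces of monoid homomorphisms $\mathrm{Hom}(\sigma^\vee\cap M',\mathbb{T})$, $\sigma\in\Delta$ (topology of pointwise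 convergence); as a set it is $\bigsqcup_{\sigma\in\Delta}N'_{\mathbb{R}}(\sigma)$, with $N'_{\mathbb{R}}(\sigma)=N'_{\mathbb{R}}/\mathbb{R}\sigma$. The map $\mathrm{trop}$ from the Berkovich analytification to $\overline{N'}{}_{\mathbb{R}}^{\Delta}$ restricts a valuation on $K[\sigma^\vee\cap M']$ to $\sigma^\vee\cap M'$. For a closed subvariety $X$, $\mathrm{Trop}(X)=\mathrm{trop}(X^{\mathrm{an}})$; $\mathrm{Trop}(X)\cap N'_{\mathbb{R}}(\sigma)=\mathrm{Trop}(X\cap O(\sigma))$. Closures of the cones $C^{(F,\mathcal{R})}_{\mathcal{F}}$ are taken in $\overline{\widetilde N}{}_{\mathbb{R}}^{\Delta_{\mathcal{A}}}$. The morphism $\Phi$ induces $\mathrm{Trop}(\Phi):\overline{\widetilde N}{}_{\mathbb{R}}^{\Delta_{\mathcal{A}}}\to\mathbb{T}^E$, which restricts to linear maps $\widetilde N_{\mathbb{R}}(\sigma_{F,\mathcal{R}})\to\mathbb{R}^{E\setminus F}$ induced by $\rho_e^{\pm}\mapsto\delta_e$ and maps $\mathrm{Trop}(\mathfrak{M}_{\mathcal{A}}\cap O(\sigma_{F,\mathcal{R}}))$ onto $\mathrm{Trop}(L_{\mathcal{A}_0}\cap\mathbb{G}_m^{E\setminus F})$, where $\mathbb{G}_m^{E\setminus F}$ is the orbit of $\mathbb{A}^E$ on which exactly the coordinates in $F$ vanish. **The cones.** For a flag $\mathcal{F}: F=F_0\subsetneq\dots\subsetneq F_k=E$ of flats of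 $\mathcal{A}_0^F$, let $\beta^{(F)}_{\mathcal{F}}\subseteq\mathbb{R}^{E\setminus F}$ be the cone generated by $\delta_{F_1\setminus F},\dots,\delta_{F_{k-1}\setminus F},\pm\delta_{E\setminus F}$, where $\delta_S=\sum_{e\in S}\delta_e$; these are the cones of the Bergman fan of $\mathcal{A}_0^F$, with support $\mathrm{Trop}(L_{\mathcal{A}_0}\cap\mathbb{G}_m^{E\setminus F})$. Then $C^{(F,\mathcal{R})}_{\mathcal{F}}$ is the preimage of $\beta^{(F)}_{\mathcal{F}}$ under $\mathrm{Trop}(\mathfrak{M}_{\mathcal{A}}\cap O(\sigma_{F,\mathcal{R}}))\to\mathrm{Trop}(L_{\mathcal{A}_0}\cap\mathbb{G}_m^{E\setminus F})$. The fan structure on the stratum $\mathrm{Trop}(\mathfrak{M}_{\mathcal{A}}\cap O(\sigma_{F,\mathcal{R}}))$ is the one with cones $C^{(F,\mathcal{R})}_{\mathcal{F}}$ for $F$ and $\mathcal{R}$ fixed.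
   Formalization: Added: real-independent subfamilies of a stay independent over the residue field of K (else false, e.g. a=((1,0),(1,2),(0,1)), K=Q_2). Disjointness is of relative interiors and across different (F,R); closures of two cells of the complex meet in a union of cells. *)

theory Defs
  imports
    "HOL-Analysis.Analysis"
    "HOL-Library.Poly_Mapping"
    "HOL-Computational_Algebra.Primes"
begin

section \<open>Valued fields\<close>

text \<open>The value group is written additively, with values in the real numbers together with
  \<open>\<infinity>\<close>.\<close>

definition nonarch_valuation :: "('k::field \<Rightarrow> ereal) \<Rightarrow> bool" where
  "nonarch_valuation v \<longleftrightarrow>
     (\<forall>x. v x \<noteq> -\<infinity>) \<and> (\<forall>x. v x = \<infinity> \<longleftrightarrow> x = 0) \<and>
     (\<forall>x y. v (x * y) = v x + v y) \<and> (\<forall>x y. min (v x) (v y) \<le> v (x + y))"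

definition complete_valuation :: "('k::field \<Rightarrow> ereal) \<Rightarrow> bool" where
  "complete_valuation v \<longleftrightarrow> nonarch_valuation v \<and>
     (\<forall>x :: nat \<Rightarrow> 'k.
        (\<forall>c::real. \<exists>n0. \<forall>m\<ge>n0. \<forall>n\<ge>n0. ereal c \<le> v (x m - x n)) \<longrightarrow>
        (\<exists>l. \<forall>c::real. \<exists>n0. \<forall>n\<ge>n0. ereal c \<le> v (x n - l)))"


section \<open>Lattices and quotients\<close>

definition int_comb :: "'i set \<Rightarrow> ('i \<Rightarrow> 'v::real_vector) \<Rightarrow> 'v set" where
  "int_comb I f = {\<Sum>i\<in>I. of_int (c i) *\<^sub>R f i | c :: 'i \<Rightarrow> int. True}"

text \<open>A lattice \<open>L\<close> of rank \<open>d\<close> is realised in a Euclidean space of which \<open>L\<close> spans a subspace, so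
  \<open>span L\<close> is \<open>L \<otimes> \<real>\<close> (rank zero is allowed). The inner product identifies \<open>span L\<close> with its dual,
  and so \<open>Hom(L, \<int>)\<close> with \<open>dual_lattice L\<close>.\<close>

definition is_lattice :: "nat \<Rightarrow> 'v::euclidean_space set \<Rightarrow> bool" where
  "is_lattice d L \<longleftrightarrow> (\<exists>B. independent B \<and> card B = d \<and> L = int_comb B (\<lambda>b. b))"

definition dual_lattice :: "'v::euclidean_space set \<Rightarrow> 'v set" where
  "dual_lattice L = {u \<in> span L. \<forall>x\<in>L. x \<bullet> u \<in> \<int>}"

definition primitive_in :: "'v::real_vector set \<Rightarrow> 'v \<Rightarrow> bool" where
  "primitive_in L x \<longleftrightarrow> x \<in> L \<and> x \<noteq> 0 \<and>
     (\<forall>(k::int). \<forall>y\<in>L. x = of_int k *\<^sub>R y \<longrightarrow> \<bar>k\<bar> = 1)"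

text \<open>The quotient of a Euclidean space by \<open>span U\<close> is modelled by the orthogonal complement of
  \<open>U\<close>; the quotient map is then the orthogonal projection \<open>quot_map U\<close>. A vector orthogonal to \<open>U\<close>
  has the same inner product with \<open>x\<close> and with \<open>quot_map U x\<close>, so this is compatible with the
  identification of dual spaces above.\<close>

definition quot_map :: "'v::euclidean_space set \<Rightarrow> 'v \<Rightarrow> 'v" where
  "quot_map U x = (THE y. y \<in> orthogonal_comp U \<and> x - y \<in> span U)"

lemma quot_map_ex1:
  fixes U :: "'v::euclidean_space set"
  shows "\<exists>!y. y \<in> orthogonal_comp U \<and> x - y \<in> span U"
proof -
  obtain y z where yz: "y \<in> span U" "\<And>w. w \<in> span U \<Longrightarrow> orthogonal z w" "x = y + z"
    using orthogonal_subspace_decomp_exists [of U x] by metis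
  show ?thesis
  proof (rule ex1I [of _ z])
    show "z \<in> orthogonal_comp U \<and> x - z \<in> span U"
      using yz by (auto simp: orthogonal_comp_def orthogonal_commute span_base)
  next
    fix t assume t: "t \<in> orthogonal_comp U \<and> x - t \<in> span U"
    have 1: "t - z \<in> span U"
      using span_diff [OF yz(1), of "x - t"] t yz(3) by simp
    have "t - z \<in> orthogonal_comp U"
      using t yz(2) subspace_diff [OF subspace_orthogonal_comp]
      by (auto simp: orthogonal_comp_def orthogonal_def inner_diff_right span_base inner_commute)
    hence "\<And>w. w \<in> U \<Longrightarrow> orthogonal (t - z) w"
      by (auto simp: orthogonal_comp_def orthogonal_commute)
    hence "orthogonal (t - z) (t - z)"
      using 1 orthogonal_to_span by blast
    thus "t = z" by (simp add: orthogonal_self)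
  qed
qed

lemma quot_map:
  fixes U :: "'v::euclidean_space set"
  shows "quot_map U x \<in> orthogonal_comp U" "x - quot_map U x \<in> span U"
  using theI' [OF quot_map_ex1 [of U x]] unfolding quot_map_def by auto


section \<open>Polyhedral fans and balancing\<close>

definition rational_cone :: "'v::euclidean_space set \<Rightarrow> 'v set \<Rightarrow> bool" where
  "rational_cone N C \<longleftrightarrow> (\<exists>G. finite G \<and> G \<subseteq> N \<and> C = convex_cone hull G)"

definition polyhedral_fan :: "'v::euclidean_space set \<Rightarrow> 'v set set \<Rightarrow> bool" where
  "polyhedral_fan N \<Sigma> \<longleftrightarrow> finite \<Sigma> \<and> (\<forall>C\<in>\<Sigma>. rational_cone N C) \<and>
     (\<forall>C\<in>\<Sigma>. \<forall>D. D face_of C \<and> D \<noteq> {} \<longrightarrow> D \<in> \<Sigma>) \<and>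
     (\<forall>C\<in>\<Sigma>. \<forall>D\<in>\<Sigma>. C \<inter> D face_of C \<and> C \<inter> D face_of D)"

text \<open>\<open>u\<close> represents the primitive generator of the ray that \<open>C\<close> induces modulo \<open>span \<tau>\<close>, where \<open>\<tau>\<close>
  is a facet of \<open>C\<close>; it is determined by \<open>C\<close> and \<open>\<tau>\<close> up to adding elements of \<open>span \<tau>\<close>.\<close>

definition normal_vector :: "'v::euclidean_space set \<Rightarrow> 'v set \<Rightarrow> 'v set \<Rightarrow> 'v \<Rightarrow> bool" where
  "normal_vector N \<tau> C u \<longleftrightarrow> u \<in> N \<inter> C \<and>
     N \<inter> span C = {x + of_int k *\<^sub>R u | x (k::int). x \<in> N \<inter> span \<tau>}"

definition balanced_fan :: "'v::euclidean_space set \<Rightarrow> 'v set set \<Rightarrow> ('v set \<Rightarrow> int) \<Rightarrow> bool" where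
  "balanced_fan N \<Sigma> wt \<longleftrightarrow> (\<exists>n.
     (\<forall>C\<in>\<Sigma>. \<exists>D\<in>\<Sigma>. C \<subseteq> D \<and> dim D = n) \<and> (\<forall>C\<in>\<Sigma>. dim C \<le> n) \<and>
     (\<forall>\<tau>\<in>\<Sigma>. Suc (dim \<tau>) = n \<longrightarrow>
        (\<exists>u. (\<forall>C\<in>\<Sigma>. dim C = n \<and> \<tau> \<subseteq> C \<longrightarrow> normal_vector N \<tau> C (u C)) \<and>
             (\<Sum>C\<in>{C\<in>\<Sigma>. dim C = n \<and> \<tau> \<subseteq> C}. of_int (wt C) *\<^sub>R u C) \<in> span \<tau>)))"


section \<open>Tropicalization in toric varieties\<close>

text \<open>\<open>N\<close> is the cocharacter lattice of the torus, \<open>dual_lattice N\<close> its character lattice.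
  The semigroup algebra of a monoid \<open>S\<close> of characters consists of the finitely supported functions
  with support in \<open>S\<close>, with the convolution product; \<open>Poly_Mapping.single u 1\<close> is the character
  \<open>u\<close> and \<open>Poly_Mapping.single 0 c\<close> the constant \<open>c\<close>.\<close>

definition cone_monoid :: "'v::euclidean_space set \<Rightarrow> 'v set \<Rightarrow> 'v set" where
  "cone_monoid N \<sigma> = {u \<in> dual_lattice N. \<forall>x\<in>\<sigma>. 0 \<le> x \<bullet> u}"

definition semigroup_algebra :: "'v::monoid_add set \<Rightarrow> ('v \<Rightarrow>\<^sub>0 'k::field) set" where
  "semigroup_algebra S = {p. Poly_Mapping.keys p \<subseteq> S}"

definition ideal_gen ::
    "'v::monoid_add set \<Rightarrow> ('v \<Rightarrow>\<^sub>0 'k::field) set \<Rightarrow> ('v \<Rightarrow>\<^sub>0 'k) set" where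
  "ideal_gen S G = {\<Sum>f\<in>A. h f * f | A h. finite A \<and> A \<subseteq> G \<and> (\<forall>f\<in>A. h f \<in> semigroup_algebra S)}"

text \<open>Points of the Berkovich analytification of the closed subscheme of \<open>Spec K[S]\<close> with ideal \<open>I\<close>,
  as valuations (minus the logarithm of multiplicative seminorms).\<close>

definition berkovich ::
    "('k::field \<Rightarrow> ereal) \<Rightarrow> 'v::monoid_add set \<Rightarrow> ('v \<Rightarrow>\<^sub>0 'k) set \<Rightarrow> (('v \<Rightarrow>\<^sub>0 'k) \<Rightarrow> ereal) set" where
  "berkovich v S I = {val.
     (\<forall>f\<in>semigroup_algebra S. val f \<noteq> -\<infinity>) \<and>
     (\<forall>f\<in>semigroup_algebra S. \<forall>g\<in>semigroup_algebra S.
        val (f * g) = val f + val g \<and> min (val f) (val g) \<le> val (f + g)) \<and>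
     (\<forall>c. val (Poly_Mapping.single 0 c) = v c) \<and>
     (\<forall>f\<in>I. val f = \<infinity>)}"

definition trop_homs :: "'v::monoid_add set \<Rightarrow> ('v \<Rightarrow> ereal) set" where
  "trop_homs S = {w \<in> extensional S. (\<forall>u\<in>S. w u \<noteq> -\<infinity>) \<and> w 0 = 0 \<and>
     (\<forall>u\<in>S. \<forall>u'\<in>S. w (u + u') = w u + w u')}"

definition trop_homs_topology :: "'v::monoid_add set \<Rightarrow> ('v \<Rightarrow> ereal) topology" where
  "trop_homs_topology S = subtopology (product_topology (\<lambda>_. euclidean) S) (trop_homs S)"

text \<open>A point of the extended tropicalization space is a pair of a cone \<open>\<tau>\<close> of the fan and a point of
  the quotient of \<open>span N\<close> by the span of \<open>\<tau>\<close>. The affine chart of \<open>\<sigma>\<close> consists of the strata of the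
  faces of \<open>\<sigma>\<close>; the point \<open>(\<tau>, y)\<close> is identified with the monoid homomorphism that is pairing with
  \<open>y\<close> on the characters orthogonal to \<open>\<tau>\<close> and \<open>\<infinity>\<close> on the other ones.\<close>

definition trop_chart_points :: "'v::euclidean_space set \<Rightarrow> 'v set set \<Rightarrow> 'v set \<Rightarrow> ('v set \<times> 'v) set" where
  "trop_chart_points N \<Delta> \<sigma> = {(\<tau>, y). \<tau> \<in> \<Delta> \<and> \<tau> face_of \<sigma> \<and> y \<in> quot_map \<tau> ` span N}"

definition trop_chart :: "'v::euclidean_space set \<Rightarrow> 'v set \<Rightarrow> 'v set \<times> 'v \<Rightarrow> 'v \<Rightarrow> ereal" where
  "trop_chart N \<sigma> = (\<lambda>(\<tau>, y). \<lambda>u\<in>cone_monoid N \<sigma>. if \<forall>x\<in>\<tau>. x \<bullet> u = 0 then ereal (y \<bullet> u) else \<infinity>)"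

definition trop_glue ::
    "'v::euclidean_space set \<Rightarrow> 'v set set \<Rightarrow> 'v set \<Rightarrow> ('v \<Rightarrow> ereal) \<Rightarrow> 'v set \<times> 'v" where
  "trop_glue N \<Delta> \<sigma> w = (THE p. p \<in> trop_chart_points N \<Delta> \<sigma> \<and> trop_chart N \<sigma> p = w)"

definition trop_toric_openin ::
    "'v::euclidean_space set \<Rightarrow> 'v set set \<Rightarrow> ('v set \<times> 'v) set \<Rightarrow> bool" where
  "trop_toric_openin N \<Delta> U \<longleftrightarrow> U \<subseteq> (\<Union>\<sigma>\<in>\<Delta>. trop_chart_points N \<Delta> \<sigma>) \<and>
     (\<forall>\<sigma>\<in>\<Delta>. openin (trop_homs_topology (cone_monoid N \<sigma>))
        {w \<in> trop_homs (cone_monoid N \<sigma>). trop_glue N \<Delta> \<sigma> w \<in> U})"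

definition trop_toric :: "'v::euclidean_space set \<Rightarrow> 'v set set \<Rightarrow> ('v set \<times> 'v) topology" where
  "trop_toric N \<Delta> = topology (trop_toric_openin N \<Delta>)"

lemma istopology_trop_toric: "istopology (trop_toric_openin N \<Delta>)"
  unfolding istopology_def
proof (intro conjI allI impI)
  fix U V assume "trop_toric_openin N \<Delta> U" "trop_toric_openin N \<Delta> V"
  moreover have "{w \<in> H. f w \<in> U \<inter> V} = {w \<in> H. f w \<in> U} \<inter> {w \<in> H. f w \<in> V}"
    for H :: "('a \<Rightarrow> ereal) set" and f by auto
  ultimately show "trop_toric_openin N \<Delta> (U \<inter> V)"
    unfolding trop_toric_openin_def by (auto simp: openin_Int)
next
  fix \<U> assume "\<forall>U\<in>\<U>. trop_toric_openin N \<Delta> U"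
  moreover have "{w \<in> H. f w \<in> \<Union>\<U>} = (\<Union>U\<in>\<U>. {w \<in> H. f w \<in> U})"
    for H :: "('a \<Rightarrow> ereal) set" and f by auto
  ultimately show "trop_toric_openin N \<Delta> (\<Union>\<U>)"
    unfolding trop_toric_openin_def by (auto intro!: openin_Union)
qed

lemma openin_trop_toric: "openin (trop_toric N \<Delta>) = trop_toric_openin N \<Delta>"
  by (simp add: trop_toric_def istopology_trop_toric topology_inverse')

text \<open>A closed subscheme of a toric variety is given by its ideals \<open>I \<sigma>\<close> in the coordinate rings of the
  affine charts.\<close>

definition Trop ::
    "('k::field \<Rightarrow> ereal) \<Rightarrow> 'v::euclidean_space set \<Rightarrow> 'v set set \<Rightarrow> ('v set \<Rightarrow> ('v \<Rightarrow>\<^sub>0 'k) set) \<Rightarrow>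
      ('v set \<times> 'v) set" where
  "Trop v N \<Delta> I = (\<Union>\<sigma>\<in>\<Delta>.
     (\<lambda>val. trop_glue N \<Delta> \<sigma> (\<lambda>u\<in>cone_monoid N \<sigma>. val (Poly_Mapping.single u 1))) `
       berkovich v (cone_monoid N \<sigma>) (I \<sigma>))"

definition Trop_torus ::
    "('k::field \<Rightarrow> ereal) \<Rightarrow> 'v::euclidean_space set \<Rightarrow> ('v \<Rightarrow>\<^sub>0 'k) set \<Rightarrow> 'v set" where
  "Trop_torus v N J = {y \<in> span N. \<exists>val\<in>berkovich v (dual_lattice N) J.
     \<forall>u\<in>dual_lattice N. val (Poly_Mapping.single u 1) = ereal (y \<bullet> u)}"

text \<open>The orbit of \<open>\<sigma>\<close> is the torus with cocharacter lattice \<open>quot_map \<sigma> ` N\<close>, embedded in the chart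
  of \<open>\<sigma>\<close> by sending the characters that are not orthogonal to \<open>\<sigma>\<close> to zero.\<close>

definition orbit_restrict :: "'v::euclidean_space set \<Rightarrow> ('v \<Rightarrow>\<^sub>0 'k::field) \<Rightarrow> ('v \<Rightarrow>\<^sub>0 'k)" where
  "orbit_restrict \<sigma> p =
     (\<Sum>u\<in>{u \<in> Poly_Mapping.keys p. \<forall>x\<in>\<sigma>. x \<bullet> u = 0}. Poly_Mapping.single u (Poly_Mapping.lookup p u))"

definition Trop_orbit ::
    "('k::field \<Rightarrow> ereal) \<Rightarrow> 'v::euclidean_space set \<Rightarrow> ('v set \<Rightarrow> ('v \<Rightarrow>\<^sub>0 'k) set) \<Rightarrow> 'v set \<Rightarrow> 'v set" where
  "Trop_orbit v N I \<sigma> = Trop_torus v (quot_map \<sigma> ` N) (orbit_restrict \<sigma> ` I \<sigma>)"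

text \<open>A subset \<open>X\<close> of the extended tropicalization space has the combinatorial structure of a finite
  polyhedral complex with cells \<open>{s j} \<times> C j\<close>, \<open>j \<in> J\<close>: each cell is a rational polyhedral cone in
  the stratum of \<open>s j\<close>, its faces there are cells, and the closures of any two cells meet in a union
  of cells (in particular, the closure of a cell is a union of cells).\<close>

definition polyhedral_complex ::
    "'v::euclidean_space set \<Rightarrow> 'v set set \<Rightarrow> ('v set \<times> 'v) set \<Rightarrow>
      'j set \<Rightarrow> ('j \<Rightarrow> 'v set) \<Rightarrow> ('j \<Rightarrow> 'v set) \<Rightarrow> bool" where
  "polyhedral_complex N \<Delta> X J s C \<longleftrightarrow>
     finite J \<and> X = (\<Union>j\<in>J. {s j} \<times> C j) \<and>
     (\<forall>j\<in>J. s j \<in> \<Delta> \<and> rational_cone (quot_map (s j) ` N) (C j)) \<and>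
     (\<forall>j\<in>J. \<forall>D. D face_of C j \<and> D \<noteq> {} \<longrightarrow> (\<exists>k\<in>J. s k = s j \<and> C k = D)) \<and>
     (\<forall>i\<in>J. \<forall>j\<in>J.
        let Z = trop_toric N \<Delta> closure_of ({s i} \<times> C i) \<inter> trop_toric N \<Delta> closure_of ({s j} \<times> C j)
        in Z = (\<Union>k\<in>{k\<in>J. {s k} \<times> C k \<subseteq> Z}. {s k} \<times> C k))"


section \<open>Hyperplane arrangements\<close>

definition primitive_spanning :: "'m::euclidean_space set \<Rightarrow> 'e::finite set \<Rightarrow> ('e \<Rightarrow> 'm) \<Rightarrow> bool" where
  "primitive_spanning M E a \<longleftrightarrow>
     (\<forall>e\<in>E. primitive_in (dual_lattice M) (a e)) \<and> dual_lattice M = int_comb E a"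

definition hyperplane :: "'m::euclidean_space set \<Rightarrow> ('e \<Rightarrow> 'm) \<Rightarrow> ('e \<Rightarrow> int) \<Rightarrow> 'e \<Rightarrow> 'm set" where
  "hyperplane M a r e = {m \<in> span M. m \<bullet> a e + of_int (r e) = 0}"

definition halfspace_pos :: "'m::euclidean_space set \<Rightarrow> ('e \<Rightarrow> 'm) \<Rightarrow> ('e \<Rightarrow> int) \<Rightarrow> 'e \<Rightarrow> 'm set" where
  "halfspace_pos M a r e = {m \<in> span M. m \<bullet> a e + of_int (r e) \<le> 0}"

definition halfspace_neg :: "'m::euclidean_space set \<Rightarrow> ('e \<Rightarrow> 'm) \<Rightarrow> ('e \<Rightarrow> int) \<Rightarrow> 'e \<Rightarrow> 'm set" where
  "halfspace_neg M a r e = {m \<in> span M. m \<bullet> a e + of_int (r e) \<ge> 0}"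

definition sign_vector ::
    "'m::euclidean_space set \<Rightarrow> ('e \<Rightarrow> 'm) \<Rightarrow> ('e \<Rightarrow> int) \<Rightarrow> 'e set \<Rightarrow> 'm \<Rightarrow> 'e \<Rightarrow> int" where
  "sign_vector M a r S m = (\<lambda>e\<in>S.
     if m \<in> halfspace_pos M a r e - hyperplane M a r e then 1
     else if m \<in> hyperplane M a r e then 0 else -1)"

definition arr_faces ::
    "'m::euclidean_space set \<Rightarrow> ('e \<Rightarrow> 'm) \<Rightarrow> ('e \<Rightarrow> int) \<Rightarrow> 'e set \<Rightarrow> 'm set set" where
  "arr_faces M a r S =
     {{m \<in> span M. sign_vector M a r S m = s} | s. True} - {{}}"

definition codim_face :: "'m::euclidean_space set \<Rightarrow> 'm set \<Rightarrow> int" where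
  "codim_face M R = int (dim M) - aff_dim R"

definition pos_part ::
    "'m::euclidean_space set \<Rightarrow> ('e \<Rightarrow> 'm) \<Rightarrow> ('e \<Rightarrow> int) \<Rightarrow> 'e set \<Rightarrow> 'm set \<Rightarrow> 'e set" where
  "pos_part M a r S R = {e\<in>S. R \<subseteq> halfspace_pos M a r e}"

definition neg_part ::
    "'m::euclidean_space set \<Rightarrow> ('e \<Rightarrow> 'm) \<Rightarrow> ('e \<Rightarrow> int) \<Rightarrow> 'e set \<Rightarrow> 'm set \<Rightarrow> 'e set" where
  "neg_part M a r S R = {e\<in>S. R \<subseteq> halfspace_neg M a r e}"

definition arr_rank :: "'m::euclidean_space set \<Rightarrow> ('e \<Rightarrow> 'm) \<Rightarrow> 'e set \<Rightarrow> nat" where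
  "arr_rank M a S = dim M - dim {m \<in> span M. \<forall>e\<in>S. m \<in> hyperplane M a (\<lambda>_. 0) e}"

definition is_flat :: "'m::euclidean_space set \<Rightarrow> 'e set \<Rightarrow> ('e \<Rightarrow> 'm) \<Rightarrow> 'e set \<Rightarrow> bool" where
  "is_flat M E a F \<longleftrightarrow> F \<subseteq> E \<and> (\<forall>S. F \<subset> S \<and> S \<subseteq> E \<longrightarrow> arr_rank M a S \<noteq> arr_rank M a F)"

text \<open>A flag \<open>F = F\<^sub>0 \<subset> \<dots> \<subset> F\<^sub>k = E\<close> is represented by the set of its members.\<close>

definition is_flag :: "'m::euclidean_space set \<Rightarrow> 'e set \<Rightarrow> ('e \<Rightarrow> 'm) \<Rightarrow> 'e set \<Rightarrow> 'e set set \<Rightarrow> bool" where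
  "is_flag M E a F \<F> \<longleftrightarrow> F \<in> \<F> \<and> E \<in> \<F> \<and> chain_subset \<F> \<and>
     (\<forall>G\<in>\<F>. is_flat M E a G \<and> F \<subseteq> G)"

definition flag_length :: "'e::finite set set \<Rightarrow> nat" where
  "flag_length \<F> = card \<F> - 1"

definition flag_trunc :: "'e set \<Rightarrow> 'e set set \<Rightarrow> 'e set set" where
  "flag_trunc F' \<F> = {G\<in>\<F>. F' \<subseteq> G}"

definition flag_refines :: "'e set set \<Rightarrow> 'e set set \<Rightarrow> bool" where
  "flag_refines \<F> \<F>' \<longleftrightarrow> \<F>' \<subseteq> \<F>"

text \<open>Linear independence of subfamilies of \<open>a\<close> over the real numbers is preserved over the residue
  field of \<open>v\<close>. The residue characteristic is the prime \<open>p\<close> with \<open>v p > 0\<close>, if there is one, and zero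
  otherwise; so this holds if the residue characteristic is zero, and for every \<open>v\<close> if \<open>a\<close> is
  unimodular. It cannot be dropped: for \<open>a = ((1,0), (1,2), (0,1))\<close> the linear space attached to \<open>a\<close>
  is given by \<open>x\<^sub>1 - x\<^sub>2 + 2 x\<^sub>3 = 0\<close>, and over the 2-adic numbers, or in characteristic two, its
  tropicalization is not the support of the Bergman fan of \<open>a\<close>.\<close>

definition residually_independent ::
    "('k::field \<Rightarrow> ereal) \<Rightarrow> 'm::euclidean_space set \<Rightarrow> 'e::finite set \<Rightarrow> ('e \<Rightarrow> 'm) \<Rightarrow> bool" where
  "residually_independent v M E a \<longleftrightarrow>
     (\<forall>p::nat. prime p \<and> v (of_nat p) > 0 \<longrightarrow>
       (\<forall>S\<subseteq>E. (\<forall>c :: 'e \<Rightarrow> real. (\<Sum>e\<in>S. c e *\<^sub>R a e) = 0 \<longrightarrow> (\<forall>e\<in>S. c e = 0)) \<longrightarrow>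
         (\<forall>c :: 'e \<Rightarrow> int. (\<exists>n\<in>dual_lattice M. (\<Sum>e\<in>S. of_int (c e) *\<^sub>R a e) = of_nat p *\<^sub>R n) \<longrightarrow>
           (\<forall>e\<in>S. int p dvd c e))))"


section \<open>Lawrence toric variety and hypertoric variety\<close>

definition coord_lattice :: "'e::finite set \<Rightarrow> (real^'e) set" where
  "coord_lattice E = int_comb E (\<lambda>e. axis e 1)"

definition lawrence_rel ::
    "'e::finite set \<Rightarrow> ('e \<Rightarrow> 'm::euclidean_space) \<Rightarrow> ((real^'e) \<times> (real^'e)) set" where
  "lawrence_rel E a = (\<lambda>c. (c, - c)) ` {c \<in> coord_lattice E. (\<Sum>e\<in>E. (c $ e) *\<^sub>R a e) = 0}"

definition lawrence_lattice ::
    "'e::finite set \<Rightarrow> ('e \<Rightarrow> 'm::euclidean_space) \<Rightarrow> ((real^'e) \<times> (real^'e)) set" where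
  "lawrence_lattice E a = quot_map (lawrence_rel E a) ` (coord_lattice E \<times> coord_lattice E)"

definition rho_pos ::
    "'e::finite set \<Rightarrow> ('e \<Rightarrow> 'm::euclidean_space) \<Rightarrow> 'e \<Rightarrow> (real^'e) \<times> (real^'e)" where
  "rho_pos E a e = quot_map (lawrence_rel E a) (axis e 1, 0)"

definition rho_neg ::
    "'e::finite set \<Rightarrow> ('e \<Rightarrow> 'm::euclidean_space) \<Rightarrow> 'e \<Rightarrow> (real^'e) \<times> (real^'e)" where
  "rho_neg E a e = quot_map (lawrence_rel E a) (0, axis e 1)"

definition lawrence_cone ::
    "'m::euclidean_space set \<Rightarrow> 'e::finite set \<Rightarrow> ('e \<Rightarrow> 'm) \<Rightarrow> ('e \<Rightarrow> int) \<Rightarrow>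
      'e set \<Rightarrow> 'm set \<Rightarrow> ((real^'e) \<times> (real^'e)) set" where
  "lawrence_cone M E a r S R =
     convex_cone hull (rho_pos E a ` pos_part M a r S R \<union> rho_neg E a ` neg_part M a r S R)"

definition lawrence_fan ::
    "'m::euclidean_space set \<Rightarrow> 'e::finite set \<Rightarrow> ('e \<Rightarrow> 'm) \<Rightarrow> ('e \<Rightarrow> int) \<Rightarrow>
      ((real^'e) \<times> (real^'e)) set set" where
  "lawrence_fan M E a r =
     {\<tau>. \<tau> \<noteq> {} \<and> (\<exists>\<xi>. {\<xi>} \<in> arr_faces M a r E \<and> \<tau> face_of lawrence_cone M E a r E {\<xi>})}"

text \<open>The linear map of the cocharacter spaces underlying the morphism from the Lawrence toric variety
  to affine space; it vanishes on \<open>lawrence_rel\<close> and sends \<open>rho_pos\<close> and \<open>rho_neg\<close> to the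
  coordinate vectors.\<close>

definition lawrence_phi :: "(real^'e) \<times> (real^'e) \<Rightarrow> real^'e" where
  "lawrence_phi z = fst z + snd z"

definition char_pullback ::
    "('v::euclidean_space \<Rightarrow> 'w::euclidean_space) \<Rightarrow> ('w \<Rightarrow>\<^sub>0 'k::field) \<Rightarrow> ('v \<Rightarrow>\<^sub>0 'k)" where
  "char_pullback f p =
     (\<Sum>u\<in>Poly_Mapping.keys p. Poly_Mapping.single (adjoint f u) (Poly_Mapping.lookup p u))"

definition linear_forms :: "'e::finite set \<Rightarrow> ('e \<Rightarrow> 'm::euclidean_space) \<Rightarrow> ((real^'e) \<Rightarrow>\<^sub>0 'k::field) set" where
  "linear_forms E a = {\<Sum>e\<in>E. Poly_Mapping.single (axis e 1) (of_int (c e)) | c :: 'e \<Rightarrow> int.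
     (\<Sum>e\<in>E. of_int (c e) *\<^sub>R a e) = 0}"

definition hypertoric_ideal ::
    "'e::finite set \<Rightarrow> ('e \<Rightarrow> 'm::euclidean_space) \<Rightarrow> ((real^'e) \<times> (real^'e)) set \<Rightarrow>
      (((real^'e) \<times> (real^'e)) \<Rightarrow>\<^sub>0 'k::field) set" where
  "hypertoric_ideal E a \<sigma> =
     ideal_gen (cone_monoid (lawrence_lattice E a) \<sigma>) (char_pullback lawrence_phi ` linear_forms E a)"

definition Trop_hypertoric ::
    "('k::field \<Rightarrow> ereal) \<Rightarrow> 'm::euclidean_space set \<Rightarrow> 'e::finite set \<Rightarrow> ('e \<Rightarrow> 'm) \<Rightarrow> ('e \<Rightarrow> int) \<Rightarrow>
      (((real^'e) \<times> (real^'e)) set \<times> ((real^'e) \<times> (real^'e))) set" where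
  "Trop_hypertoric v M E a r =
     Trop v (lawrence_lattice E a) (lawrence_fan M E a r) (hypertoric_ideal E a)"

definition Trop_hypertoric_orbit ::
    "('k::field \<Rightarrow> ereal) \<Rightarrow> 'm::euclidean_space set \<Rightarrow> 'e::finite set \<Rightarrow> ('e \<Rightarrow> 'm) \<Rightarrow> ('e \<Rightarrow> int) \<Rightarrow>
      'e set \<Rightarrow> 'm set \<Rightarrow> ((real^'e) \<times> (real^'e)) set" where
  "Trop_hypertoric_orbit v M E a r F R =
     Trop_orbit v (lawrence_lattice E a) (hypertoric_ideal E a) (lawrence_cone M E a r F R)"


section \<open>The cones\<close>

definition indicator_vec :: "'e::finite set \<Rightarrow> real^'e" where
  "indicator_vec S = (\<Sum>e\<in>S. axis e 1)"

definition bergman_cone :: "'e::finite set \<Rightarrow> 'e set \<Rightarrow> 'e set set \<Rightarrow> (real^'e) set" where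
  "bergman_cone E F \<F> = convex_cone hull
     ((\<lambda>G. indicator_vec (G - F)) ` (\<F> - {F, E}) \<union> {indicator_vec (E - F), - indicator_vec (E - F)})"

text \<open>The map from the stratum of the cone of \<open>(F, R)\<close> to \<open>\<real>\<^bsup>E - F\<^esup>\<close> induced by \<open>lawrence_phi\<close>.\<close>

definition stratum_phi :: "'e::finite set \<Rightarrow> (real^'e) \<times> (real^'e) \<Rightarrow> real^'e" where
  "stratum_phi F y = (\<chi> e. if e \<in> F then 0 else lawrence_phi y $ e)"

definition hyp_cone ::
    "('k::field \<Rightarrow> ereal) \<Rightarrow> 'm::euclidean_space set \<Rightarrow> 'e::finite set \<Rightarrow> ('e \<Rightarrow> 'm) \<Rightarrow> ('e \<Rightarrow> int) \<Rightarrow>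
      'e set \<Rightarrow> 'm set \<Rightarrow> 'e set set \<Rightarrow> ((real^'e) \<times> (real^'e)) set" where
  "hyp_cone v M E a r F R \<F> =
     {y \<in> Trop_hypertoric_orbit v M E a r F R. stratum_phi F y \<in> bergman_cone E F \<F>}"

definition hyp_cell ::
    "('k::field \<Rightarrow> ereal) \<Rightarrow> 'm::euclidean_space set \<Rightarrow> 'e::finite set \<Rightarrow> ('e \<Rightarrow> 'm) \<Rightarrow> ('e \<Rightarrow> int) \<Rightarrow>
      'e set \<Rightarrow> 'm set \<Rightarrow> 'e set set \<Rightarrow> (((real^'e) \<times> (real^'e)) set \<times> ((real^'e) \<times> (real^'e))) set" where
  "hyp_cell v M E a r F R \<F> = {lawrence_cone M E a r F R} \<times> hyp_cone v M E a r F R \<F>"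

definition cone_index ::
    "'m::euclidean_space set \<Rightarrow> 'e::finite set \<Rightarrow> ('e \<Rightarrow> 'm) \<Rightarrow> ('e \<Rightarrow> int) \<Rightarrow>
      ('e set \<times> 'm set \<times> 'e set set) set" where
  "cone_index M E a r =
     {(F, R, \<F>). is_flat M E a F \<and> R \<in> arr_faces M a r F \<and> is_flag M E a F \<F>}"

end

theory Submission
  imports Defs
begin

text \<open>
  Fix a flat \<open>F\<close> and a face of the localization at \<open>F\<close>. A point \<open>y\<close> of the corresponding stratum defines
  values \<open>w e\<close> of the coordinates \<open>x\<^sub>e\<close> of affine space, equal to \<open>\<infinity>\<close> for \<open>e \<in> F\<close>. If \<open>y\<close> is a
  tropical point, then every superlevel set of \<open>w\<close> is a flat, since otherwise some integral linear relation
  with a unit coefficient would have a unique term of least value. Conversely, if all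
  superlevel sets are flats, a basis chosen greedily by decreasing \<open>w\<close> expresses every \<open>x\<^sub>e\<close> as a linear
  form in the basis variables whose Gauss valuation is \<open>w e\<close>, and substituting these forms gives a valuation
  on the stratum that vanishes on the ideal. So the stratum of the tropicalization consists of
  the \<open>y\<close> whose superlevel sets form a flag \<open>\<F>\<close> of flats, the cone of \<open>\<F>\<close> is given by the superlevel
  sets belonging to \<open>\<F>\<close>, and its relative interior by equality. The balancing condition at a flag with a gap
  between \<open>G\<^sub>1\<close> and \<open>G\<^sub>2\<close> holds since the flats that fill the gap partition \<open>G\<^sub>2 - G\<^sub>1\<close>.

  For the closure relation, the conditions that the superlevel sets belong to \<open>\<F>\<close> and that the characters
  not orthogonal to the cone of the stratum take the value \<open>\<infinity>\<close> are closed in every chart; and every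
  point satisfying them is a limit of points of the cell, obtained by moving to infinity along the relative
  interior of the cone of its own stratum.
\<close>

section \<open>Non-Archimedean valuations\<close>

text \<open>All lattices sit in real vector spaces, while relations, characters and ideals are
  integral. One device mediates between the two: a rational-linear map from the reals to the
  rationals that fixes 1 and is close to the identity on finitely many numbers
  (\<open>rational_approx_additive\<close>). Applied to coordinates, it turns real solutions of
  integral systems into rational ones and can be made to preserve signs.

  The span of the Lawrence lattice is kept as pairs \<open>(x, y)\<close> of coordinate vectors such
  that \<open>x $ e - y $ e\<close> is a functional evaluated at \<open>a e\<close>. Pairing with a
  ray then reads off one coordinate, so cones, faces and strata become sign patterns.

  The arithmetic obstacle is the residue characteristic, which may divide numerators or denominators
  of coefficients found by real linear algebra. This threatens both directions: a relation has to
  isolate one term with a coefficient of valuation 0, and the substituted linear forms have to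
  attain their Gauss values. Residual independence enters for these two purposes, in
  \<open>integral_expression\<close> and \<open>adapted_unit_coefficient\<close>.\<close>

lemma nonarch_valuation_one:
  assumes "nonarch_valuation v" shows "v 1 = 0"
proof -
  have "v (1 * 1) = v 1 + v 1" "v 1 \<noteq> \<infinity>" "v 1 \<noteq> -\<infinity>"
    using assms unfolding nonarch_valuation_def by (blast, simp_all)
  thus ?thesis by (cases "v 1") auto
qed

locale valued_field =
  fixes v :: "'k::field \<Rightarrow> ereal"
  assumes valuation: "nonarch_valuation v"
begin

lemma v_mult: "v (x * y) = v x + v y"
  and v_eq_PInf_iff: "v x = \<infinity> \<longleftrightarrow> x = 0"
  and v_not_MInf: "v x \<noteq> -\<infinity>"
  and v_add: "min (v x) (v y) \<le> v (x + y)"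
  using valuation unfolding nonarch_valuation_def by auto

lemma v_0 [simp]: "v 0 = \<infinity>" by (simp add: v_eq_PInf_iff)
lemma v_1 [simp]: "v 1 = 0" by (rule nonarch_valuation_one[OF valuation])

lemma v_real: "x \<noteq> 0 \<Longrightarrow> \<exists>c. v x = ereal c"
  using v_eq_PInf_iff[of x] v_not_MInf[of x] by (cases "v x") auto

lemma v_minus: "v (- x) = v x"
proof -
  have "v (-1) + v (-1) = 0" using v_mult[of "-1" "-1"] by simp
  hence "v (-1) = 0" using v_not_MInf[of "-1"] by (cases "v (-1)") auto
  thus ?thesis using v_mult[of "-1" x] by simp
qed

lemma v_sum_ge: "(\<And>i. i \<in> A \<Longrightarrow> t \<le> v (f i)) \<Longrightarrow> t \<le> v (sum f A)"
proof (induction A rule: infinite_finite_induct)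
  case (insert i A)
  thus ?case using v_add[of "f i" "sum f A"] by (auto simp: min_def split: if_splits intro: order_trans)
qed auto

lemma v_sum_gt: "t < \<infinity> \<Longrightarrow> (\<And>i. i \<in> A \<Longrightarrow> t < v (f i)) \<Longrightarrow> t < v (sum f A)"
proof (induction A rule: infinite_finite_induct)
  case (insert i A)
  thus ?case using v_add[of "f i" "sum f A"] by (auto simp: min_def split: if_splits intro: less_le_trans)
qed auto

lemma v_add_eq: assumes "v x < v y" shows "v (x + y) = v x"
proof (rule antisym)
  show "v x \<le> v (x + y)" using v_add[of x y] assms by (auto simp: min_def split: if_splits)
  have "min (v (x + y)) (v (- y)) \<le> v x" using v_add[of "x + y" "- y"] by simp
  thus "v (x + y) \<le> v x" using assms by (auto simp: v_minus min_def split: if_splits)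
qed

lemma v_of_nat_nonneg: "0 \<le> v (of_nat n)"
proof (induction n)
  case (Suc n)
  thus ?case using v_add[of 1 "of_nat n"] by (auto simp: min_def split: if_splits)
qed auto

lemma v_of_int_nonneg: "0 \<le> v (of_int c)"
  by (cases c rule: int_cases2) (auto simp: v_of_nat_nonneg v_minus)

text \<open>Strong induction splits off one prime factor at a time; a factor of valuation 0 leaves
  the value of the cofactor unchanged. Positivity is thus traced to a prime of positive valuation,
  the kind of prime that \<open>residually_independent\<close> speaks about.\<close>

lemma v_of_nat_pos_prime:
  assumes "n > 0" "0 < v (of_nat n)" shows "\<exists>p. prime p \<and> p dvd n \<and> 0 < v (of_nat p)"
  using assms
proof (induction n rule: less_induct)
  case (less n)
  have "n \<noteq> 1" using less.prems by auto
  then obtain p where p: "prime p" "p dvd n" using prime_factor_nat by blast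
  show ?case
  proof (cases "0 < v (of_nat p)")
    case False
    hence vp: "v (of_nat p) = 0" using v_of_nat_nonneg[of p] by (simp add: antisym not_less)
    obtain m where m: "n = p * m" using p by blast
    have "v (of_nat n) = v (of_nat m)" using v_mult[of "of_nat p" "of_nat m"] vp by (simp add: m)
    moreover have "m < n" "m > 0" using m less.prems(1) prime_gt_1_nat[OF p(1)] by auto
    ultimately show ?thesis using less.IH[of m] less.prems m by (metis dvd_mult)
  qed (use p in auto)
qed

text \<open>Otherwise Bezout writes 1 as a sum of two elements of positive valuation, and 1 itself
  would have positive valuation.\<close>

lemma v_of_int_pos_dvd:
  assumes "prime p" "0 < v (of_nat p)" "0 < v (of_int c)" shows "int p dvd c"
proof (rule ccontr)
  assume "\<not> int p dvd c"
  hence "coprime (int p) c" using assms(1) by (simp add: prime_imp_coprime)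
  then obtain x y where xy: "x * int p + y * c = 1" using bezout_int[of "int p" c]
    by (metis coprime_imp_gcd_eq_1)
  have "(1::'k) = of_int x * of_nat p + of_int y * of_int c"
    using arg_cong[OF xy, of "of_int :: int \<Rightarrow> 'k"] by simp
  moreover have "0 < v (of_int x * of_nat p)" "0 < v (of_int y * of_int c)"
    using assms v_of_int_nonneg[of x] v_of_int_nonneg[of y] by (auto simp: v_mult add_nonneg_pos)
  ultimately have "0 < v 1" using v_add[of "of_int x * of_nat p" "of_int y * of_int c"]
    by (metis min_less_iff_conj order_less_le_trans)
  thus False by simp
qed

lemma v_of_int_zero_iff:
  assumes "\<And>p. prime p \<Longrightarrow> 0 < v (of_nat p) \<Longrightarrow> \<not> int p dvd c" "c \<noteq> 0"
  shows "v (of_int c) = 0"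
proof (rule ccontr)
  assume "v (of_int c) \<noteq> 0"
  hence *: "0 < v (of_int c)" using v_of_int_nonneg[of c] by (simp add: order_less_le)
  have "v (of_nat (nat \<bar>c\<bar>)) = v (of_int c)" by (cases "c \<ge> 0") (auto simp: v_minus)
  thus False using v_of_nat_pos_prime[of "nat \<bar>c\<bar>"] assms * by (auto simp: nat_abs_dvd_iff dvd_nat_abs_iff)
qed

end

section \<open>Algebra homomorphisms out of semigroup algebras\<close>

lemma poly_mapping_sum_single:
  assumes "finite A" "Poly_Mapping.keys p \<subseteq> A"
  shows "p = (\<Sum>k\<in>A. Poly_Mapping.single k (Poly_Mapping.lookup p k))"
proof (rule poly_mapping_eqI)
  fix k
  have "(\<Sum>j\<in>A. if j = k then Poly_Mapping.lookup p j else 0) = Poly_Mapping.lookup p k"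
    using assms by (auto simp: in_keys_iff)
  thus "Poly_Mapping.lookup p k =
      Poly_Mapping.lookup (\<Sum>j\<in>A. Poly_Mapping.single j (Poly_Mapping.lookup p j)) k"
    by (simp add: lookup_sum lookup_single when_def)
qed

lemma mult_sum_single:
  fixes p q :: "'v::monoid_add \<Rightarrow>\<^sub>0 'k::semiring_0"
  shows "p * q = (\<Sum>k\<in>Poly_Mapping.keys p. \<Sum>l\<in>Poly_Mapping.keys q.
     Poly_Mapping.single (k + l) (Poly_Mapping.lookup p k * Poly_Mapping.lookup q l))"
proof -
  have "p * q = (\<Sum>k\<in>Poly_Mapping.keys p. Poly_Mapping.single k (Poly_Mapping.lookup p k)) *
      (\<Sum>k\<in>Poly_Mapping.keys q. Poly_Mapping.single k (Poly_Mapping.lookup q k))"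
    using poly_mapping_sum_single[OF finite_keys order_refl] by metis
  thus ?thesis by (simp add: sum_product mult_single)
qed

lemma semigroup_algebra_mult:
  assumes "f \<in> semigroup_algebra S" "g \<in> semigroup_algebra S" "\<And>x y. x \<in> S \<Longrightarrow> y \<in> S \<Longrightarrow> x + y \<in> S"
  shows "f * g \<in> semigroup_algebra S"
  using keys_mult[of f g] assms unfolding semigroup_algebra_def by blast

lemma semigroup_algebra_add:
  "f \<in> semigroup_algebra S \<Longrightarrow> g \<in> semigroup_algebra S \<Longrightarrow> f + g \<in> semigroup_algebra S"
  using keys_add[of f g] unfolding semigroup_algebra_def by blast

lemma semigroup_algebra_sum:
  "(\<And>i. i \<in> A \<Longrightarrow> f i \<in> semigroup_algebra S) \<Longrightarrow> sum f A \<in> semigroup_algebra S"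
proof (induction A rule: infinite_finite_induct)
  case (insert i A)
  thus ?case by (auto intro: semigroup_algebra_add)
qed (auto simp: semigroup_algebra_def)

lemma semigroup_algebra_single: "u \<in> S \<Longrightarrow> Poly_Mapping.single u c \<in> semigroup_algebra S"
  by (simp add: semigroup_algebra_def)

text \<open>The linear extension of a map on exponents, with scalars entering as multiples of the
  exponent 0. Pullback of characters, restriction to an orbit and the later substitution of linear
  forms are all instances.\<close>

definition alg_ext :: "('v \<Rightarrow> ('w::comm_monoid_add \<Rightarrow>\<^sub>0 'k::field)) \<Rightarrow> ('v \<Rightarrow>\<^sub>0 'k) \<Rightarrow> ('w \<Rightarrow>\<^sub>0 'k)" where
  "alg_ext h p = (\<Sum>u\<in>Poly_Mapping.keys p. Poly_Mapping.single 0 (Poly_Mapping.lookup p u) * h u)"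

lemma alg_ext_superset:
  assumes "finite A" "Poly_Mapping.keys p \<subseteq> A"
  shows "alg_ext h p = (\<Sum>u\<in>A. Poly_Mapping.single 0 (Poly_Mapping.lookup p u) * h u)"
  unfolding alg_ext_def using assms by (intro sum.mono_neutral_left) (auto simp: in_keys_iff)

lemma alg_ext_add: "alg_ext h (p + q) = alg_ext h p + alg_ext h q"
proof -
  let ?A = "Poly_Mapping.keys p \<union> Poly_Mapping.keys q"
  have "alg_ext h (p + q) = (\<Sum>u\<in>?A. Poly_Mapping.single 0 (Poly_Mapping.lookup (p + q) u) * h u)"
    using keys_add[of p q] by (intro alg_ext_superset) auto
  also have "\<dots> = (\<Sum>u\<in>?A. Poly_Mapping.single 0 (Poly_Mapping.lookup p u) * h u) +
       (\<Sum>u\<in>?A. Poly_Mapping.single 0 (Poly_Mapping.lookup q u) * h u)"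
    by (simp add: lookup_add single_add distrib_right sum.distrib)
  also have "\<dots> = alg_ext h p + alg_ext h q"
    by (simp add: alg_ext_superset[of ?A p] alg_ext_superset[of ?A q])
  finally show ?thesis .
qed

lemma alg_ext_zero [simp]: "alg_ext h 0 = 0" by (simp add: alg_ext_def)

lemma alg_ext_single: "alg_ext h (Poly_Mapping.single u c) = Poly_Mapping.single 0 c * h u"
  by (simp add: alg_ext_def)

lemma alg_ext_sum: "alg_ext h (sum f A) = (\<Sum>i\<in>A. alg_ext h (f i))"
  by (induction A rule: infinite_finite_induct) (auto simp: alg_ext_add)

text \<open>Multiplicativity of \<open>h\<close> is asked only on \<open>S\<close>: restriction to
  an orbit is multiplicative only inside the cone monoid, where nonnegativity prevents cancellation,
  and the substitution of linear forms needs nonnegative exponents.\<close>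

lemma alg_ext_mult:
  fixes h :: "'v::monoid_add \<Rightarrow> ('w::comm_monoid_add \<Rightarrow>\<^sub>0 'k::field)"
  assumes "p \<in> semigroup_algebra S" "q \<in> semigroup_algebra S"
    and h: "\<And>x y. x \<in> S \<Longrightarrow> y \<in> S \<Longrightarrow> h (x + y) = h x * h y"
  shows "alg_ext h (p * q) = alg_ext h p * alg_ext h q"
proof -
  have "alg_ext h (p * q) = (\<Sum>k\<in>Poly_Mapping.keys p. \<Sum>l\<in>Poly_Mapping.keys q.
     Poly_Mapping.single 0 (Poly_Mapping.lookup p k * Poly_Mapping.lookup q l) * h (k + l))"
    by (subst mult_sum_single) (simp add: alg_ext_sum alg_ext_single)
  also have "\<dots> = (\<Sum>k\<in>Poly_Mapping.keys p. \<Sum>l\<in>Poly_Mapping.keys q.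
     (Poly_Mapping.single 0 (Poly_Mapping.lookup p k) * h k) *
     (Poly_Mapping.single 0 (Poly_Mapping.lookup q l) * h l))"
  proof (intro sum.cong refl)
    fix k l assume "k \<in> Poly_Mapping.keys p" "l \<in> Poly_Mapping.keys q"
    hence "h (k + l) = h k * h l" using assms(1,2) by (auto simp: semigroup_algebra_def intro!: h)
    moreover have "Poly_Mapping.single (0::'w) (Poly_Mapping.lookup p k * Poly_Mapping.lookup q l) =
      Poly_Mapping.single 0 (Poly_Mapping.lookup p k) * Poly_Mapping.single 0 (Poly_Mapping.lookup q l)"
      by (simp add: mult_single)
    ultimately show "Poly_Mapping.single 0 (Poly_Mapping.lookup p k * Poly_Mapping.lookup q l) * h (k + l) =
      (Poly_Mapping.single 0 (Poly_Mapping.lookup p k) * h k) *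
      (Poly_Mapping.single 0 (Poly_Mapping.lookup q l) * h l)" by (simp add: ac_simps)
  qed
  also have "\<dots> = alg_ext h p * alg_ext h q" by (simp add: alg_ext_def sum_product)
  finally show ?thesis .
qed

lemma orbit_restrict_alg_ext:
  fixes p :: "'v::euclidean_space \<Rightarrow>\<^sub>0 'k::field"
  shows "orbit_restrict \<sigma> p =
    alg_ext (\<lambda>u. if \<forall>x\<in>\<sigma>. x \<bullet> u = 0 then Poly_Mapping.single u 1 else 0) p"
  unfolding orbit_restrict_def alg_ext_def
  by (intro sum.mono_neutral_cong_left) (auto simp: mult_single)

lemma char_pullback_alg_ext:
  "char_pullback f p = alg_ext (\<lambda>u. Poly_Mapping.single (adjoint f u) 1) p"
  unfolding char_pullback_def alg_ext_def by (simp add: mult_single)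

section \<open>Gauss valuations\<close>

text \<open>The infimum runs over all exponents, but for a valuation those outside the support
  contribute \<infinity>. So it is a minimum over the support, and the zero polynomial gets
  \<infinity>.\<close>

definition gauss :: "('k::field \<Rightarrow> ereal) \<Rightarrow> 'v::real_inner \<Rightarrow> ('v \<Rightarrow>\<^sub>0 'k) \<Rightarrow> ereal" where
  "gauss v y p = (INF u. v (Poly_Mapping.lookup p u) + ereal (y \<bullet> u))"

text \<open>Strict convexity of the norm: a sum of maximal norm has only one representation.\<close>

lemma max_norm_sum_unique:
  fixes x y x' y' :: "'v::real_inner"
  assumes "x + y = x' + y'" "norm (x + y') \<le> norm (x + y)" "norm (x' + y) \<le> norm (x + y)"
  shows "x = x'"
proof -
  have d: "x - x' = y' - y" using assms(1) by (simp add: algebra_simps)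
  have s: "(x + y') + (x' + y) = 2 *\<^sub>R (x + y)" using assms(1) by (simp add: algebra_simps scaleR_2)
  have "(norm (x + y' - (x' + y)))\<^sup>2 =
      2 * (norm (x + y'))\<^sup>2 + 2 * (norm (x' + y))\<^sup>2 - (norm ((x + y') + (x' + y)))\<^sup>2"
    by (simp add: power2_norm_eq_inner inner_simps inner_commute)
  also have "\<dots> \<le> 2 * (norm (x + y))\<^sup>2 + 2 * (norm (x + y))\<^sup>2 - (2 * norm (x + y))\<^sup>2"
    unfolding s using assms(2,3) by (intro diff_mono add_mono mult_left_mono power_mono) auto
  also have "\<dots> = 0" by (simp add: power_mult_distrib)
  finally have "x + y' = x' + y" by simp
  hence "x - x' = y - y'" by (simp add: algebra_simps)
  hence "x - x' = - (x - x')" using d by simp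
  hence "(x - x') + (x - x') = 0" using eq_neg_iff_add_eq_0 by blast
  hence "2 *\<^sub>R (x - x') = 0" by (simp only: scaleR_2)
  thus ?thesis by simp
qed

context valued_field
begin

lemma gauss_ge_iff:
  "t \<le> gauss v y p \<longleftrightarrow> (\<forall>u. t \<le> v (Poly_Mapping.lookup p u) + ereal (y \<bullet> u))"
  by (simp add: gauss_def le_INF_iff)

lemma gauss_le: "gauss v y p \<le> v (Poly_Mapping.lookup p u) + ereal (y \<bullet> u)"
  unfolding gauss_def by (rule INF_lower) auto

lemma gauss_zero [simp]: "gauss v y 0 = \<infinity>"
  by (simp add: gauss_def top_ereal_def)

lemma gauss_add: "min (gauss v y p) (gauss v y q) \<le> gauss v y (p + q)"
  unfolding gauss_ge_iff
proof
  fix u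
  have "min (gauss v y p) (gauss v y q) \<le>
      min (v (Poly_Mapping.lookup p u) + ereal (y \<bullet> u)) (v (Poly_Mapping.lookup q u) + ereal (y \<bullet> u))"
    by (intro min.mono gauss_le)
  also have "\<dots> \<le> min (v (Poly_Mapping.lookup p u)) (v (Poly_Mapping.lookup q u)) + ereal (y \<bullet> u)"
    by (auto simp: min_def)
  also have "\<dots> \<le> v (Poly_Mapping.lookup (p + q) u) + ereal (y \<bullet> u)"
    by (intro add_right_mono) (simp add: lookup_add v_add)
  finally show "min (gauss v y p) (gauss v y q) \<le> v (Poly_Mapping.lookup (p + q) u) + ereal (y \<bullet> u)" .
qed

lemma gauss_attained:
  assumes "p \<noteq> 0"
  shows "\<exists>u\<in>Poly_Mapping.keys p. gauss v y p = v (Poly_Mapping.lookup p u) + ereal (y \<bullet> u)"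
proof -
  let ?f = "\<lambda>u. v (Poly_Mapping.lookup p u) + ereal (y \<bullet> u)"
  have "finite (?f ` Poly_Mapping.keys p)" "?f ` Poly_Mapping.keys p \<noteq> {}" using assms by auto
  then obtain u where u: "u \<in> Poly_Mapping.keys p" "\<And>w. w \<in> Poly_Mapping.keys p \<Longrightarrow> ?f u \<le> ?f w"
    using ex_is_arg_min_if_finite[of "Poly_Mapping.keys p" ?f] by (auto simp: is_arg_min_linorder)
  have "?f u \<le> ?f w" for w
    using u(2)[of w] by (cases "w \<in> Poly_Mapping.keys p") (auto simp: in_keys_iff)
  hence "?f u \<le> gauss v y p" by (simp add: gauss_ge_iff)
  thus ?thesis using u(1) gauss_le by (metis antisym)
qed

lemma gauss_real:
  assumes "p \<noteq> 0" shows "\<exists>c. gauss v y p = ereal c"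
proof -
  obtain u where u: "u \<in> Poly_Mapping.keys p" "gauss v y p = v (Poly_Mapping.lookup p u) + ereal (y \<bullet> u)"
    using gauss_attained[OF assms] by blast
  then obtain c where "v (Poly_Mapping.lookup p u) = ereal c" using v_real by (metis in_keys_iff)
  thus ?thesis using u by auto
qed

lemma gauss_not_MInf: "gauss v y p \<noteq> -\<infinity>"
  using gauss_real[of p y] by (cases "p = 0") auto

lemma gauss_single: "gauss v y (Poly_Mapping.single k c) = v c + ereal (y \<bullet> k)"
proof (rule antisym)
  show "gauss v y (Poly_Mapping.single k c) \<le> v c + ereal (y \<bullet> k)"
    using gauss_le[of y "Poly_Mapping.single k c" k] by simp
qed (auto simp: gauss_ge_iff lookup_single when_def)

text \<open>Only pairs of exponents that are minimal for both factors can reach the sum of the two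
  values, but several such pairs may have the same sum, and their products may cancel. So a minimal
  pair whose sum has the largest norm is taken: by \<open>max_norm_sum_unique\<close> no other
  minimal pair has that sum, and the coefficient there keeps the least value. This takes the place
  of a monomial order on real exponents.\<close>

lemma gauss_mult: "gauss v y (p * q) = gauss v y p + gauss v y q"
proof (cases "p = 0 \<or> q = 0")
  case True thus ?thesis using gauss_not_MInf[of y p] gauss_not_MInf[of y q] by auto
next
  case False
  let ?val = "\<lambda>p u. v (Poly_Mapping.lookup p u) + ereal (y \<bullet> u)"
  obtain gp gq where g: "gauss v y p = ereal gp" "gauss v y q = ereal gq"
    using gauss_real False by metis
  have look: "Poly_Mapping.lookup (p * q) w = (\<Sum>(k,l)\<in>Poly_Mapping.keys p \<times> Poly_Mapping.keys q.
      if k + l = w then Poly_Mapping.lookup p k * Poly_Mapping.lookup q l else 0)" for w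
    by (subst mult_sum_single)
      (simp add: lookup_sum lookup_single when_def sum.cartesian_product case_prod_unfold)
  have trm: "ereal (gp + gq - y \<bullet> (k + l)) \<le> v (Poly_Mapping.lookup p k * Poly_Mapping.lookup q l)" for k l
    using gauss_le[of y p k] gauss_le[of y q l] g
    by (cases "v (Poly_Mapping.lookup p k)"; cases "v (Poly_Mapping.lookup q l)")
      (auto simp: v_mult inner_simps)
  have ge: "gauss v y p + gauss v y q \<le> gauss v y (p * q)"
    unfolding gauss_ge_iff
  proof
    fix w
    have "ereal (gp + gq - y \<bullet> w) \<le> v (Poly_Mapping.lookup (p * q) w)"
      unfolding look by (rule v_sum_ge) (use trm in auto)
    thus "gauss v y p + gauss v y q \<le> ?val (p * q) w"
      using g by (cases "v (Poly_Mapping.lookup (p * q) w)") auto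
  qed
  define A where "A = {u\<in>Poly_Mapping.keys p. ?val p u = ereal gp}"
  define B where "B = {u\<in>Poly_Mapping.keys q. ?val q u = ereal gq}"
  have AB: "finite (A \<times> B)" "A \<times> B \<noteq> {}"
    using gauss_attained[of p y] gauss_attained[of q y] False g by (auto simp: A_def B_def)
  let ?n = "\<lambda>(x, y). norm (x + y)"
  obtain m where m: "m \<in> A \<times> B" "\<And>n. n \<in> A \<times> B \<Longrightarrow> ?n n \<le> ?n m"
    using ex_is_arg_min_if_finite[OF AB, of "\<lambda>x. - ?n x"] unfolding is_arg_min_linorder neg_le_iff_le
    by blast
  obtain x0 y0 where m0: "m = (x0, y0)" by force
  have x0: "x0 \<in> A" "y0 \<in> B" and mx: "\<And>x y. x \<in> A \<Longrightarrow> y \<in> B \<Longrightarrow> norm (x + y) \<le> norm (x0 + y0)"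
    using m m0 by auto
  define w where "w = x0 + y0"
  define c where "c = gp + gq - y \<bullet> w"
  have fin: "finite (Poly_Mapping.keys p \<times> Poly_Mapping.keys q)" by simp
  let ?F = "\<lambda>(k,l). if k + l = w then Poly_Mapping.lookup p k * Poly_Mapping.lookup q l else 0"
  let ?R = "Poly_Mapping.keys p \<times> Poly_Mapping.keys q - {(x0, y0)}"
  have split: "Poly_Mapping.lookup (p * q) w =
      Poly_Mapping.lookup p x0 * Poly_Mapping.lookup q y0 + sum ?F ?R"
    unfolding look using x0 by (subst sum.remove[OF fin, of "(x0, y0)"]) (auto simp: A_def B_def w_def)
  have lead: "v (Poly_Mapping.lookup p x0 * Poly_Mapping.lookup q y0) = ereal c"
    using x0 unfolding A_def B_def c_def w_def
    by (cases "v (Poly_Mapping.lookup p x0)"; cases "v (Poly_Mapping.lookup q y0)")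
      (auto simp: v_mult inner_simps)
  have "ereal c < v (?F kl)" if "kl \<in> ?R" for kl
  proof -
    obtain k l where kl: "kl = (k, l)" by force
    have in': "k \<in> Poly_Mapping.keys p" "l \<in> Poly_Mapping.keys q" "(k, l) \<noteq> (x0, y0)" using that kl by auto
    have "ereal c < v (Poly_Mapping.lookup p k * Poly_Mapping.lookup q l)" if e: "k + l = w"
    proof -
      \<comment> \<open>A second minimal pair with sum \<open>w\<close> contradicts uniqueness,
        since the mixed sums \<open>x0 + l\<close> and \<open>k + y0\<close> also come from minimal
        pairs and so obey the norm bound.\<close>
      have "\<not> (k \<in> A \<and> l \<in> B)"
      proof
        assume kl: "k \<in> A \<and> l \<in> B"
        have "x0 = k" using max_norm_sum_unique[of x0 y0 k l] mx[of x0 l] mx[of k y0] kl x0 e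
          by (simp add: w_def)
        thus False using e in'(3) by (auto simp: w_def)
      qed
      hence "?val p k \<noteq> ereal gp \<or> ?val q l \<noteq> ereal gq" using in' by (auto simp: A_def B_def)
      moreover have "ereal gp \<le> ?val p k" "ereal gq \<le> ?val q l" using gauss_le g by metis+
      ultimately show ?thesis using e[symmetric]
        by (cases "v (Poly_Mapping.lookup p k)"; cases "v (Poly_Mapping.lookup q l)")
          (auto simp: v_mult inner_simps c_def)
    qed
    thus ?thesis by (simp add: kl)
  qed
  hence "ereal c < v (sum ?F ?R)" by (intro v_sum_gt) auto
  hence "v (Poly_Mapping.lookup (p * q) w) = ereal c"
    using v_add_eq[of "Poly_Mapping.lookup p x0 * Poly_Mapping.lookup q y0" "sum ?F ?R"]
    by (simp only: split lead)
  hence "gauss v y (p * q) \<le> ereal (gp + gq)" using gauss_le[of y "p * q" w] by (simp add: c_def)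
  thus ?thesis using ge g by (simp add: antisym)
qed

lemma gauss_one [simp]: "gauss v y 1 = 0"
  using gauss_single[of y 0 1] by simp

lemma gauss_power: "gauss v y p = ereal c \<Longrightarrow> gauss v y (p ^ n) = ereal (of_nat n * c)"
  by (induction n) (auto simp: gauss_mult algebra_simps)

lemma gauss_prod:
  "(\<And>i. i \<in> A \<Longrightarrow> gauss v y (f i) = ereal (c i)) \<Longrightarrow> gauss v y (prod f A) = ereal (sum c A)"
  by (induction A rule: infinite_finite_induct) (auto simp: gauss_mult)

lemma gauss_sum_ge: "(\<And>i. i \<in> A \<Longrightarrow> t \<le> gauss v y (f i)) \<Longrightarrow> t \<le> gauss v y (sum f A)"
proof (induction A rule: infinite_finite_induct)
  case (insert i A)
  thus ?case using gauss_add[of y "f i" "sum f A"] by (auto simp: min_def split: if_splits intro: order_trans)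
qed auto

end

section \<open>Rational approximation\<close>

interpretation rat_real: vector_space "\<lambda>(q::rat) (x::real). of_rat q * x"
  by unfold_locales (auto simp: algebra_simps of_rat_add of_rat_mult)

interpretation rat_real_pair: vector_space_pair
    "\<lambda>(q::rat) (x::real). of_rat q * x" "\<lambda>(q::rat) (x::real). of_rat q * x" ..

text \<open>The values of the map are chosen on a basis of the real numbers over the rational numbers that
  contains 1. Applied to coordinates, such a map preserves all linear equations with rational
  coefficients.\<close>

lemma rational_approx_additive:
  fixes X :: "real set"
  assumes "finite X" "\<epsilon> > 0"
  shows "\<exists>f :: real \<Rightarrow> real. (\<forall>x y. f (x + y) = f x + f y) \<and> (\<forall>x. f x \<in> \<rat>) \<and>
    (\<forall>q\<in>\<rat>. \<forall>x. f (q * x) = q * f x) \<and> f 1 = 1 \<and> (\<forall>x\<in>X. \<bar>f x - x\<bar> < \<epsilon>)"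
proof -
  have "rat_real.independent {1}" by (simp add: rat_real.dependent_def rat_real.span_empty)
  from rat_real.maximal_independent_subset_extend[OF subset_UNIV this]
  obtain B where B: "{1} \<subseteq> B" "rat_real.independent B" "UNIV \<subseteq> rat_real.span B"
    by metis
  define rep where "rep x b = (of_rat (rat_real.representation B x b) :: real)" for x b
  define K where "K = (\<Union>x\<in>X. {b. rat_real.representation B x b \<noteq> 0})"
  have finK: "finite K" unfolding K_def using assms(1) by (auto intro: rat_real.finite_representation)
  \<comment> \<open>Moving each basis element by less than \<open>\<epsilon> / C\<close> moves every
    element of \<open>X\<close> by less than \<open>\<epsilon>\<close>, since \<open>C\<close>
    exceeds each sum of absolute coefficients; the 1 keeps \<open>C\<close> positive.\<close>
  define C where "C = 1 + (\<Sum>x\<in>X. \<Sum>b\<in>K. \<bar>rep x b\<bar>)"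
  have C: "C > 0" unfolding C_def by (intro add_pos_nonneg sum_nonneg) auto
  have "\<exists>q\<in>\<rat>. \<bar>q - b\<bar> < \<epsilon> / C \<and> (b = 1 \<longrightarrow> q = 1)" for b
  proof (cases "b = 1")
    case False
    have "b < b + \<epsilon> / C" using C assms(2) by simp
    then obtain q where "q \<in> \<rat>" "b < q" "q < b + \<epsilon> / C" using Rats_dense_in_real by blast
    thus ?thesis using False by (intro bexI[of _ q]) auto
  qed (use C assms(2) in auto)
  then obtain g where g: "\<And>b. g b \<in> \<rat>" "\<And>b. \<bar>g b - b\<bar> < \<epsilon> / C" "g 1 = 1" by metis
  obtain f where f: "Vector_Spaces.linear (\<lambda>(q::rat) (x::real). of_rat q * x) (\<lambda>(q::rat) (x::real). of_rat q * x) f"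
    and fB: "\<And>b. b \<in> B \<Longrightarrow> f b = g b"
    using rat_real_pair.linear_independent_extend[OF B(2), of g] by blast
  interpret f: Vector_Spaces.linear "\<lambda>(q::rat) (x::real). of_rat q * x" "\<lambda>(q::rat) (x::real). of_rat q * x" f
    by (rule f)
  have xrep: "x = (\<Sum>b | rat_real.representation B x b \<noteq> 0. rep x b * b)" for x
  proof -
    have "x \<in> rat_real.span B" using B(3) by blast
    thus ?thesis unfolding rep_def by (rule rat_real.sum_nonzero_representation_eq[OF B(2), symmetric])
  qed
  have fin: "finite {b. rat_real.representation B x b \<noteq> 0}" for x by (rule rat_real.finite_representation)
  have inB: "b \<in> B" if "rat_real.representation B x b \<noteq> 0" for x b
    using that rat_real.representation_ne_zero by blast
  have frep: "f x = (\<Sum>b | rat_real.representation B x b \<noteq> 0. rep x b * g b)" for x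
  proof -
    have "f x = (\<Sum>b | rat_real.representation B x b \<noteq> 0. f (rep x b * b))"
      by (subst xrep) (simp add: f.sum)
    also have "\<dots> = (\<Sum>b | rat_real.representation B x b \<noteq> 0. rep x b * g b)"
      by (intro sum.cong) (auto simp: rep_def f.scale fB inB)
    finally show ?thesis .
  qed
  show ?thesis
  proof (intro exI conjI allI ballI)
    show "f (x + y) = f x + f y" for x y by (rule f.add)
    show "f x \<in> \<rat>" for x unfolding frep by (rule Rats_sum) (auto simp: rep_def g)
    show "f (q * x) = q * f x" if "q \<in> \<rat>" for q x using that f.scale by (auto elim!: Rats_cases)
    show "f 1 = 1" using B(1) fB g(3) by auto
    show "\<bar>f x - x\<bar> < \<epsilon>" if x: "x \<in> X" for x
    proof -
      have sub: "{b. rat_real.representation B x b \<noteq> 0} \<subseteq> K" using x by (auto simp: K_def)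
      have "f x - x = (\<Sum>b | rat_real.representation B x b \<noteq> 0. rep x b * (g b - b))"
        using frep[of x] xrep[of x] by (simp add: right_diff_distrib sum_subtractf)
      also have "\<dots> = (\<Sum>b\<in>K. rep x b * (g b - b))"
        using sub finK by (intro sum.mono_neutral_left) (auto simp: rep_def)
      finally have "\<bar>f x - x\<bar> \<le> (\<Sum>b\<in>K. \<bar>rep x b * (g b - b)\<bar>)" using sum_abs by metis
      also have "\<dots> \<le> (\<Sum>b\<in>K. \<bar>rep x b\<bar> * (\<epsilon> / C))"
        unfolding abs_mult by (intro sum_mono mult_left_mono less_imp_le[OF g(2)]) auto
      also have "\<dots> = (\<Sum>b\<in>K. \<bar>rep x b\<bar>) * (\<epsilon> / C)" by (rule sum_distrib_right[symmetric])
      also have "\<dots> < C * (\<epsilon> / C)"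
      proof (rule mult_strict_right_mono)
        have "(\<Sum>b\<in>K. \<bar>rep x b\<bar>) \<le> (\<Sum>x\<in>X. \<Sum>b\<in>K. \<bar>rep x b\<bar>)"
          using x assms(1) by (intro member_le_sum[of x X "\<lambda>x. \<Sum>b\<in>K. \<bar>rep x b\<bar>"]) (auto intro: sum_nonneg)
        thus "(\<Sum>b\<in>K. \<bar>rep x b\<bar>) < C" by (simp add: C_def)
      qed (use C assms(2) in auto)
      finally show ?thesis using C by simp
    qed
  qed
qed

lemma common_denominator:
  assumes "finite A" "\<And>i. i \<in> A \<Longrightarrow> q i \<in> \<rat>"
  shows "\<exists>D::int. D > 0 \<and> (\<forall>i\<in>A. of_int D * q i \<in> (\<int>::real set))"
  using assms
proof (induction A rule: finite_induct)
  case empty show ?case by (intro exI[of _ 1]) auto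
next
  case (insert i A)
  then obtain D where D: "D > 0" "\<forall>i\<in>A. of_int D * q i \<in> \<int>" by auto
  obtain m n where mn: "n > 0" "q i = of_int m / of_int n" using insert.prems Rats_cases' by (metis insertI1)
  have "of_int (D * n) * q j \<in> \<int>" if "j \<in> insert i A" for j
  proof (cases "j = i")
    case True thus ?thesis using mn by simp
  next
    case False
    have "of_int n * (of_int D * q j) \<in> \<int>"
      by (rule Ints_mult) (use D that False in auto)
    thus ?thesis by (simp add: ac_simps)
  qed
  thus ?case using D(1) mn(1) by (intro exI[of _ "D * n"]) (auto simp del: of_int_mult)
qed

section \<open>Quotient maps and cones\<close>

lemma orthogonal_comp_iff: "u \<in> orthogonal_comp U \<longleftrightarrow> (\<forall>x\<in>U. x \<bullet> u = 0)"
  by (simp add: orthogonal_comp_def orthogonal_def)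

lemma orthogonal_comp_span: "u \<in> orthogonal_comp U \<Longrightarrow> x \<in> span U \<Longrightarrow> x \<bullet> u = 0"
  using orthogonal_to_span[of x U u] by (auto simp: orthogonal_comp_iff orthogonal_def inner_commute)

lemma quot_map_eqI:
  fixes U :: "'v::euclidean_space set"
  shows "y \<in> orthogonal_comp U \<Longrightarrow> x - y \<in> span U \<Longrightarrow> quot_map U x = y"
  unfolding quot_map_def by (rule the1_equality[OF quot_map_ex1]) simp

lemma linear_quot_map: "linear (quot_map U)"
proof (rule linearI)
  fix x y :: 'a
  have "(x - quot_map U x) + (y - quot_map U y) \<in> span U" by (intro span_add quot_map)
  thus "quot_map U (x + y) = quot_map U x + quot_map U y"
    by (intro quot_map_eqI subspace_add[OF subspace_orthogonal_comp] quot_map) (simp add: algebra_simps)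
next
  fix c and x :: 'a
  have "c *\<^sub>R (x - quot_map U x) \<in> span U" by (intro span_scale quot_map)
  thus "quot_map U (c *\<^sub>R x) = c *\<^sub>R quot_map U x"
    by (intro quot_map_eqI subspace_scale[OF subspace_orthogonal_comp] quot_map) (simp add: algebra_simps)
qed

lemma quot_map_ident: "x \<in> orthogonal_comp U \<Longrightarrow> quot_map U x = x"
  by (rule quot_map_eqI) (auto simp: span_zero)

lemma quot_map_eq_0: "x \<in> span U \<Longrightarrow> quot_map U x = 0"
  by (rule quot_map_eqI) (auto simp: orthogonal_comp_iff)

lemma inner_quot_map:
  fixes U :: "'v::euclidean_space set"
  assumes "u \<in> orthogonal_comp U" shows "quot_map U x \<bullet> u = x \<bullet> u"
proof -
  have "(x - quot_map U x) \<bullet> u = 0" using assms quot_map(2) by (rule orthogonal_comp_span)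
  thus ?thesis by (simp add: inner_diff_left)
qed

lemma convex_cone_hull_induct [consumes 1, case_names base zero add scale]:
  assumes "x \<in> convex_cone hull G" "\<And>g. g \<in> G \<Longrightarrow> P g" "P 0"
    "\<And>x y. P x \<Longrightarrow> P y \<Longrightarrow> P (x + y)" "\<And>c x. P x \<Longrightarrow> 0 \<le> c \<Longrightarrow> P (c *\<^sub>R x)"
  shows "P x"
proof -
  have "convex_cone {x. P x}" 
    unfolding convex_cone_def convex_def conic_def using assms(3-5) by auto
  hence "convex_cone hull G \<subseteq> {x. P x}" using assms(2) by (intro hull_minimal) auto
  thus ?thesis using assms(1) by auto
qed

lemma convex_cone_hull_sum:
  "(\<And>i. i \<in> A \<Longrightarrow> f i \<in> convex_cone hull G) \<Longrightarrow> sum f A \<in> convex_cone hull G"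
  by (induction A rule: infinite_finite_induct) (auto intro: convex_cone_hull_add convex_cone_hull_contains_0)

lemma convex_cone_hull_subset_span: "convex_cone hull G \<subseteq> span G"
  using convex_cone_hull_induct[of _ G "\<lambda>x. x \<in> span G"]
  by (auto intro: span_base span_add span_scale span_zero)

lemma convex_cone_hull_subset_subspace:
  "subspace V \<Longrightarrow> G \<subseteq> V \<Longrightarrow> convex_cone hull G \<subseteq> V"
  using convex_cone_hull_subset_span[of G] span_minimal by blast

lemma convex_cone_hull_nonneg:
  "x \<in> convex_cone hull G \<Longrightarrow> (\<And>g. g \<in> G \<Longrightarrow> 0 \<le> g \<bullet> u) \<Longrightarrow> 0 \<le> x \<bullet> u"
  by (induction rule: convex_cone_hull_induct) (auto simp: inner_simps)

lemma convex_cone_hull_orthogonal: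
  "x \<in> convex_cone hull G \<Longrightarrow> (\<And>g. g \<in> G \<Longrightarrow> g \<bullet> u = 0) \<Longrightarrow> x \<bullet> u = 0"
  by (induction rule: convex_cone_hull_induct) (auto simp: inner_simps)

text \<open>All generators pair nonnegatively with \<open>u\<close>, so a combination that pairs to
  0 involves only generators that pair to 0. The induction carries nonnegativity along, because a
  vanishing sum splits into vanishing summands only with it.\<close>

lemma convex_cone_hull_exposed:
  assumes "\<And>g. g \<in> G \<Longrightarrow> 0 \<le> g \<bullet> u"
  shows "{x \<in> convex_cone hull G. x \<bullet> u = 0} = convex_cone hull {g\<in>G. g \<bullet> u = 0}"
proof (intro equalityI subsetI)
  fix x assume x: "x \<in> {x \<in> convex_cone hull G. x \<bullet> u = 0}"
  hence "x \<in> convex_cone hull G" by simp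
  hence "0 \<le> x \<bullet> u \<and> (x \<bullet> u = 0 \<longrightarrow> x \<in> convex_cone hull {g\<in>G. g \<bullet> u = 0})"
  proof (induction rule: convex_cone_hull_induct)
    case (base g) thus ?case using assms by (auto intro: hull_inc)
  next
    case zero thus ?case by (auto intro: convex_cone_hull_contains_0)
  next
    case (add x y) thus ?case by (auto simp: inner_simps add_nonneg_eq_0_iff intro: convex_cone_hull_add)
  next
    case (scale c x) thus ?case by (auto intro: convex_cone_hull_mul convex_cone_hull_contains_0)
  qed
  thus "x \<in> convex_cone hull {g\<in>G. g \<bullet> u = 0}" using x by auto
next
  fix x assume x: "x \<in> convex_cone hull {g\<in>G. g \<bullet> u = 0}"
  thus "x \<in> {x \<in> convex_cone hull G. x \<bullet> u = 0}"
    using hull_mono[of "{g\<in>G. g \<bullet> u = 0}" G] convex_cone_hull_orthogonal[OF x, of u] by auto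
qed

lemma inner_span_eq_0: "x \<in> span S \<Longrightarrow> (\<And>y. y \<in> S \<Longrightarrow> y \<bullet> u = 0) \<Longrightarrow> x \<bullet> u = 0"
  by (rule orthogonal_comp_span) (auto simp: orthogonal_comp_iff)

section \<open>The Lawrence lattice\<close>

lemma coord_lattice_iff:
  "c \<in> coord_lattice E \<longleftrightarrow> (\<forall>e\<in>E. c $ e \<in> \<int>) \<and> (\<forall>e. e \<notin> E \<longrightarrow> c $ e = 0)"
proof
  have ax: "(\<Sum>e\<in>E. of_int (k e) *\<^sub>R axis e (1::real)) $ i = (if i \<in> E then of_int (k i) else 0)" for k i
  proof -
    have "(\<Sum>e\<in>E. of_int (k e) *\<^sub>R axis e (1::real)) $ i = (\<Sum>e\<in>E. if e = i then of_int (k e) else 0)"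
      unfolding sum_component by (intro sum.cong) (auto simp: axis_def)
    thus ?thesis by simp
  qed
  {
    assume "c \<in> coord_lattice E"
    then obtain k where "c = (\<Sum>e\<in>E. of_int (k e) *\<^sub>R axis e (1::real))"
      by (auto simp: coord_lattice_def int_comb_def)
    thus "(\<forall>e\<in>E. c $ e \<in> \<int>) \<and> (\<forall>e. e \<notin> E \<longrightarrow> c $ e = 0)" by (simp add: ax del: sum_component)
  }
  assume c: "(\<forall>e\<in>E. c $ e \<in> \<int>) \<and> (\<forall>e. e \<notin> E \<longrightarrow> c $ e = 0)"
  have "c = (\<Sum>e\<in>E. of_int \<lfloor>c $ e\<rfloor> *\<^sub>R axis e (1::real))"
    unfolding vec_eq_iff ax using c by (auto elim!: Ints_cases)
  thus "c \<in> coord_lattice E" by (auto simp: coord_lattice_def int_comb_def)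
qed

definition supported :: "'e set \<Rightarrow> real^'e::finite \<Rightarrow> bool" where
  "supported E x \<longleftrightarrow> (\<forall>e. e \<notin> E \<longrightarrow> x $ e = 0)"

lemma supported_inner: "supported E x \<Longrightarrow> x \<bullet> y = (\<Sum>e\<in>E. x $ e * y $ e)"
  by (auto simp: inner_vec_def supported_def intro!: sum.mono_neutral_right)

lemma supported_expand: "supported E x \<Longrightarrow> x = (\<Sum>e\<in>E. x $ e *\<^sub>R axis e 1)"
proof -
  assume s: "supported E x"
  have "(\<Sum>e\<in>E. x $ e *\<^sub>R axis e 1) $ i = (\<Sum>e\<in>E. if e = i then x $ e else 0)" for i
    unfolding sum_component by (intro sum.cong) (auto simp: axis_def)
  thus ?thesis using s by (auto simp: vec_eq_iff supported_def)
qed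

section \<open>Linear relations of the configuration and functionals on the lattice\<close>

locale arrangement =
  fixes M :: "'m::euclidean_space set" and E :: "'e::finite set" and a :: "'e \<Rightarrow> 'm"
    and r :: "'e \<Rightarrow> int" and d :: nat
  assumes lattice: "is_lattice d M" and spanning: "primitive_spanning M E a"
begin

lemma lattice_basis:
  obtains B where "finite B" "independent B" "card B = d" "M = int_comb B (\<lambda>b. b)" "B \<subseteq> M" "span M = span B"
proof -
  obtain B where B: "independent B" "card B = d" "M = int_comb B (\<lambda>b. b)"
    using lattice by (auto simp: is_lattice_def)
  have fin: "finite B" using B(1) by (rule independent_imp_finite)
  have "b \<in> M" if "b \<in> B" for b
  proof -
    have "(\<Sum>i\<in>B. of_int (if i = b then 1 else 0) *\<^sub>R i) = (\<Sum>i\<in>B. if i = b then i else 0)"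
      by (intro sum.cong) auto
    also have "\<dots> = b" using fin that by simp
    finally show ?thesis unfolding B(3) int_comb_def by (auto intro!: exI[of _ "\<lambda>i. if i = b then 1 else 0"])
  qed
  moreover have "M \<subseteq> span B" unfolding B(3) int_comb_def by (auto intro!: span_sum span_scale intro: span_base)
  ultimately have "span M = span B" by (meson span_mono span_span span_minimal subspace_span subset_antisym subsetI)
  thus ?thesis using that B fin \<open>\<And>b. b \<in> B \<Longrightarrow> b \<in> M\<close> by blast
qed

lemma dim_M: "dim M = d"
  using lattice_basis by (metis dim_eq_card_independent dim_span)

lemma a_dual: "e \<in> E \<Longrightarrow> a e \<in> dual_lattice M"
  and a_nonzero: "e \<in> E \<Longrightarrow> a e \<noteq> 0"
  and dual_int_comb: "dual_lattice M = int_comb E a"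
  using spanning by (auto simp: primitive_spanning_def primitive_in_def)

lemma a_span: "e \<in> E \<Longrightarrow> a e \<in> span M"
  and a_integral: "e \<in> E \<Longrightarrow> x \<in> M \<Longrightarrow> x \<bullet> a e \<in> \<int>"
  using a_dual by (auto simp: dual_lattice_def)

text \<open>The vectors \<open>a e\<close> generate the dual lattice, and the coordinate functionals
  of a lattice basis belong to it; so every coordinate of \<open>m\<close> vanishes.\<close>

lemma orthogonal_a_zero:
  assumes m: "m \<in> span M" "\<And>e. e \<in> E \<Longrightarrow> m \<bullet> a e = 0" shows "m = 0"
proof -
  obtain B where B: "finite B" "independent B" "M = int_comb B (\<lambda>b. b)" "span M = span B" "B \<subseteq> M"
    using lattice_basis by metis
  have dual0: "m \<bullet> n = 0" if "n \<in> dual_lattice M" for n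
    using that m(2) unfolding dual_int_comb int_comb_def by (auto simp: inner_sum_right)
  obtain c where c: "m = (\<Sum>b\<in>B. c b *\<^sub>R b)" using m(1) span_finite[OF B(1)] B(4) by auto
  have "c b = 0" if b: "b \<in> B" for b
  proof -
    obtain g where g: "linear g" "\<And>x. x \<in> B \<Longrightarrow> g x = (if x = b then 1 else (0::real))"
      using linear_independent_extend[OF B(2), of "\<lambda>x. if x = b then 1 else 0"] by auto
    have gi: "g x = x \<bullet> adjoint g 1" for x using adjoint_works[OF g(1), of x 1] by (simp add: inner_commute)
    \<comment> \<open>The dual lattice lies in \<open>span M\<close>, so the vector representing the
      coordinate functional is first projected there.\<close>
    obtain y z where yz: "y \<in> span M" "\<And>w. w \<in> span M \<Longrightarrow> orthogonal z w" "adjoint g 1 = y + z"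
      using orthogonal_subspace_decomp_exists[of M "adjoint g 1"] by metis
    have gy: "x \<bullet> y = g x" if "x \<in> span M" for x
      using yz(2)[OF that] by (simp add: gi yz(3) inner_simps orthogonal_def inner_commute)
    have gs: "g (\<Sum>i\<in>B. k i *\<^sub>R i) = k b" for k
    proof -
      have "g (\<Sum>i\<in>B. k i *\<^sub>R i) = (\<Sum>i\<in>B. if i = b then k i else 0)"
        by (auto simp: linear_sum[OF g(1)] linear_scale[OF g(1)] g(2) intro!: sum.cong)
      thus ?thesis using B(1) b by simp
    qed
    have "y \<in> dual_lattice M"
      unfolding dual_lattice_def
    proof (intro CollectI conjI yz(1) ballI)
      fix x assume x: "x \<in> M"
      then obtain k where "x = (\<Sum>i\<in>B. of_int (k i) *\<^sub>R i)" unfolding B(3) int_comb_def by auto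
      thus "x \<bullet> y \<in> \<int>" using gy[OF span_base[OF x]] gs by simp
    qed
    hence "g m = 0" using dual0 gy[OF m(1)] by simp
    thus ?thesis using gs c by simp
  qed
  thus ?thesis using c by simp
qed

lemma orthogonal_M_zero: "n \<in> span M \<Longrightarrow> (\<And>x. x \<in> M \<Longrightarrow> x \<bullet> n = 0) \<Longrightarrow> n = 0"
  using inner_span_eq_0[of n M n] by simp

lemma sum_a_span: "S \<subseteq> E \<Longrightarrow> (\<Sum>e\<in>S. c e *\<^sub>R a e) \<in> span M"
  using a_span by (intro span_sum span_scale) auto

text \<open>Testing the relation against a lattice vector gives an equation with the integer
  coefficients \<open>x \<bullet> a e\<close>, and such equations survive any additive map that
  commutes with rational factors.\<close>

lemma additive_relation:
  assumes f: "\<And>x y. f (x + y) = f x + f y" "\<And>q x. q \<in> \<rat> \<Longrightarrow> f (q * x) = q * f x"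
    and S: "S \<subseteq> E" and c: "(\<Sum>e\<in>S. c e *\<^sub>R a e) = 0"
  shows "(\<Sum>e\<in>S. f (c e) *\<^sub>R a e) = 0"
proof (rule orthogonal_M_zero[OF sum_a_span[OF S]])
  fix x assume x: "x \<in> M"
  have f0: "f 0 = 0" using f(1)[of 0 0] by simp
  have fsum: "f (sum g A) = (\<Sum>i\<in>A. f (g i))" for g :: "'e \<Rightarrow> real" and A
    by (induction A rule: infinite_finite_induct) (auto simp: f0 f(1))
  have "x \<bullet> (\<Sum>e\<in>S. f (c e) *\<^sub>R a e) = (\<Sum>e\<in>S. (x \<bullet> a e) * f (c e))"
    by (simp add: inner_sum_right mult.commute)
  also have "\<dots> = (\<Sum>e\<in>S. f ((x \<bullet> a e) * c e))"
    using x S a_integral Ints_subset_Rats by (intro sum.cong refl f(2)[symmetric]) blast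
  also have "\<dots> = f (x \<bullet> (\<Sum>e\<in>S. c e *\<^sub>R a e))" by (simp add: fsum inner_sum_right mult.commute)
  finally show "x \<bullet> (\<Sum>e\<in>S. f (c e) *\<^sub>R a e) = 0" using c f0 by simp
qed

text \<open>Real relations are limits of rational ones. If the sum for \<open>c\<close> were
  nonzero, replacing \<open>c\<close> by a rational relation within
  \<open>\<bar>?s\<bar> / ?X\<close> would change it by less than its absolute value, so it would
  stay nonzero; but after clearing denominators the hypothesis makes it zero.\<close>

lemma real_relation_of_integer_relations:
  fixes x :: "'e \<Rightarrow> real"
  assumes int: "\<And>k :: 'e \<Rightarrow> int. (\<Sum>e\<in>E. of_int (k e) *\<^sub>R a e) = 0 \<Longrightarrow> (\<Sum>e\<in>E. of_int (k e) * x e) = 0"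
    and c: "(\<Sum>e\<in>E. c e *\<^sub>R a e) = 0"
  shows "(\<Sum>e\<in>E. c e * x e) = 0"
proof (rule ccontr)
  let ?s = "\<Sum>e\<in>E. c e * x e" and ?X = "1 + (\<Sum>e\<in>E. \<bar>x e\<bar>)"
  assume s: "?s \<noteq> 0"
  have X: "?X > 0" by (intro add_pos_nonneg sum_nonneg) auto
  have "finite (c ` E)" "\<bar>?s\<bar> / ?X > 0" using s X by (auto intro: divide_pos_pos)
  from rational_approx_additive[OF this]
  obtain f :: "real \<Rightarrow> real" where f: "\<forall>x y. f (x + y) = f x + f y" "\<forall>x. f x \<in> \<rat>"
    "\<forall>q\<in>\<rat>. \<forall>x. f (q * x) = q * f x" "f 1 = 1" "\<forall>y\<in>c ` E. \<bar>f y - y\<bar> < \<bar>?s\<bar> / ?X"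
    by (elim exE conjE) (rule that)
  have rel: "(\<Sum>e\<in>E. f (c e) *\<^sub>R a e) = 0" using additive_relation[of f E c] f(1,3) c by blast
  obtain D :: int where D: "D > 0" "\<forall>e\<in>E. of_int D * f (c e) \<in> \<int>"
    using common_denominator[of E "\<lambda>e. f (c e)"] f(2) by auto
  define k where "k e = \<lfloor>of_int D * f (c e)\<rfloor>" for e
  have k: "of_int (k e) = of_int D * f (c e)" if "e \<in> E" for e
    using D(2) that by (metis Ints_cases floor_of_int k_def)
  have "(\<Sum>e\<in>E. of_int (k e) *\<^sub>R a e) = of_int D *\<^sub>R (\<Sum>e\<in>E. f (c e) *\<^sub>R a e)"
    by (simp add: k scaleR_sum_right)
  hence "(\<Sum>e\<in>E. of_int (k e) * x e) = 0" using rel int by simp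
  hence "of_int D * (\<Sum>e\<in>E. f (c e) * x e) = 0" by (simp add: k sum_distrib_left ac_simps)
  hence z: "(\<Sum>e\<in>E. f (c e) * x e) = 0" using D(1) by simp
  have "\<bar>?s\<bar> = \<bar>\<Sum>e\<in>E. (f (c e) - c e) * x e\<bar>"
    using z by (simp add: left_diff_distrib sum_subtractf)
  also have "\<dots> \<le> (\<Sum>e\<in>E. \<bar>(f (c e) - c e) * x e\<bar>)" by (rule sum_abs)
  also have "\<dots> \<le> (\<Sum>e\<in>E. (\<bar>?s\<bar> / ?X) * \<bar>x e\<bar>)"
    unfolding abs_mult using f(5) by (intro sum_mono mult_right_mono) (auto intro: less_imp_le)
  also have "\<dots> = (\<bar>?s\<bar> / ?X) * (\<Sum>e\<in>E. \<bar>x e\<bar>)" by (rule sum_distrib_left[symmetric])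
  also have "\<dots> < (\<bar>?s\<bar> / ?X) * ?X" using s X by (intro mult_strict_left_mono) auto
  finally show False using X by simp
qed

text \<open>Split the vector of values orthogonally into one of the form
  \<open>m \<bullet> a e\<close> and a remainder \<open>z\<close>. Orthogonality of \<open>z\<close>
  to all vectors of that form says that \<open>z\<close> is itself a relation, so it annihilates the
  values and is orthogonal to itself.\<close>

lemma functional_of_relations:
  fixes x :: "'e \<Rightarrow> real"
  assumes int: "\<And>k :: 'e \<Rightarrow> int. (\<Sum>e\<in>E. of_int (k e) *\<^sub>R a e) = 0 \<Longrightarrow> (\<Sum>e\<in>E. of_int (k e) * x e) = 0"
  shows "\<exists>m\<in>span M. \<forall>e\<in>E. x e = m \<bullet> a e"
proof -
  define h where "h m = (\<chi> e. if e \<in> E then m \<bullet> a e else (0::real))" for m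
  have h: "linear h" by (rule linearI) (auto simp: h_def vec_eq_iff inner_simps)
  define T where "T = h ` span M"
  define X where "X = (\<chi> e. if e \<in> E then x e else 0)"
  have T: "span T = T" unfolding T_def using h by (metis linear_span_image span_span)
  obtain y z where yz: "y \<in> span T" "\<And>w. w \<in> span T \<Longrightarrow> orthogonal z w" "X = y + z"
    using orthogonal_subspace_decomp_exists[of T X] by metis
  have sup: "supported E (h m)" "supported E X" for m by (auto simp: supported_def h_def X_def)
  have "(\<Sum>e\<in>E. z $ e *\<^sub>R a e) = 0"
  proof (rule orthogonal_M_zero[OF sum_a_span[OF order_refl]])
    fix m assume "m \<in> M"
    hence "h m \<in> span T" by (simp add: T T_def span_base)
    hence "z \<bullet> h m = 0" using yz(2) by (simp add: orthogonal_def)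
    hence "(\<Sum>e\<in>E. h m $ e * z $ e) = 0" using supported_inner[OF sup(1)] by (simp add: inner_commute)
    thus "m \<bullet> (\<Sum>e\<in>E. z $ e *\<^sub>R a e) = 0" by (simp add: inner_sum_right h_def mult.commute)
  qed
  hence "(\<Sum>e\<in>E. z $ e * x e) = 0" 
    using real_relation_of_integer_relations[of x "\<lambda>e. z $ e"] int by blast
  hence "X \<bullet> z = 0" using supported_inner[OF sup(2)] by (simp add: X_def mult.commute)
  hence "z \<bullet> z = 0" using yz by (simp add: inner_simps orthogonal_def inner_commute)
  hence "X \<in> T" using yz T by simp
  then obtain m where m: "m \<in> span M" "X = h m" by (auto simp: T_def)
  have "x e = m \<bullet> a e" if "e \<in> E" for e
    using arg_cong[OF m(2), of "\<lambda>X. X $ e"] that by (simp add: X_def h_def)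
  thus ?thesis using m by auto
qed

end

text \<open>\<open>w\<close> is only additive, so integral and real dependence have to agree on
  \<open>G\<close>. They do: integer coordinates force the real coefficients over an independent
  subset to be rational, so some multiple is an integral combination, on which \<open>w\<close>
  agrees with the linear extension.\<close>

lemma additive_on_integral_group:
  fixes G :: "'v::euclidean_space set" and w :: "'v \<Rightarrow> real"
  assumes int: "\<And>u b. u \<in> G \<Longrightarrow> b \<in> Basis \<Longrightarrow> u \<bullet> b \<in> \<int>"
    and G: "0 \<in> G" "\<And>x y. x \<in> G \<Longrightarrow> y \<in> G \<Longrightarrow> x + y \<in> G" "\<And>x. x \<in> G \<Longrightarrow> - x \<in> G"
    and w: "\<And>x y. x \<in> G \<Longrightarrow> y \<in> G \<Longrightarrow> w (x + y) = w x + w y"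
  shows "\<exists>y\<in>span G. \<forall>u\<in>G. w u = y \<bullet> u"
proof -
  have w0: "w 0 = 0" using w[OF G(1) G(1)] by simp
  have wneg: "w (- x) = - w x" if "x \<in> G" for x using w[OF that G(3)[OF that]] w0 by simp
  have nat: "of_nat n *\<^sub>R x \<in> G \<and> w (of_nat n *\<^sub>R x) = of_nat n * w x" if "x \<in> G" for n x
    by (induction n) (auto simp: G w0 algebra_simps that w)
  have int': "of_int k *\<^sub>R x \<in> G \<and> w (of_int k *\<^sub>R x) = of_int k * w x" if "x \<in> G" for k x
  proof (cases k rule: int_cases2)
    case (nonneg n) thus ?thesis using nat[OF that, of n] by simp
  next
    case (nonpos n) thus ?thesis using nat[OF that, of n] G(3) wneg by fastforce
  qed
  have wsum: "sum g A \<in> G \<and> w (sum g A) = (\<Sum>i\<in>A. w (g i))"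
    if "\<And>i. i \<in> A \<Longrightarrow> g i \<in> G" for g :: "'v \<Rightarrow> 'v" and A
    using that by (induction A rule: infinite_finite_induct) (auto simp: G w0 w)
  obtain B where B: "B \<subseteq> G" "independent B" "G \<subseteq> span B" using maximal_independent_subset[of G] by blast
  have finB: "finite B" using B(2) by (rule independent_imp_finite)
  obtain g where g: "linear g" "\<And>x. x \<in> B \<Longrightarrow> g x = w x"
    using linear_independent_extend[OF B(2), of w] by auto
  have gi: "g x = x \<bullet> adjoint g 1" for x using adjoint_works[OF g(1), of x 1] by (simp add: inner_commute)
  obtain y z where yz: "y \<in> span G" "\<And>w. w \<in> span G \<Longrightarrow> orthogonal z w" "adjoint g 1 = y + z"
    using orthogonal_subspace_decomp_exists[of G "adjoint g 1"] by metis
  from rational_approx_additive[of "{}" 1]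
  obtain f :: "real \<Rightarrow> real" where f: "\<forall>x y. f (x + y) = f x + f y" "\<forall>x. f x \<in> \<rat>"
    "\<forall>q\<in>\<rat>. \<forall>x. f (q * x) = q * f x" "f 1 = 1" by auto
  have f0: "f 0 = 0" using f(1)[rule_format, of 0 0] by simp
  have fsum: "f (sum h A) = (\<Sum>i\<in>A. f (h i))" for h :: "'v \<Rightarrow> real" and A
    by (induction A rule: infinite_finite_induct) (auto simp: f0 f(1))
  have fint: "f q = q" if "q \<in> \<int>" for q
    using f(3)[rule_format, of q 1] f(4) that Ints_subset_Rats by auto
  have "w u = y \<bullet> u" if u: "u \<in> G" for u
  proof -
    obtain q where q: "u = (\<Sum>b\<in>B. q b *\<^sub>R b)" using u B(3) span_finite[OF finB] by auto
    \<comment> \<open>\<open>f\<close> fixes integers and hence the coordinates of \<open>u\<close>;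
      by uniqueness of coefficients it also fixes every \<open>q b\<close>, which is therefore
      rational.\<close>
    have "(\<Sum>b\<in>B. f (q b) *\<^sub>R b) = u"
    proof (rule euclidean_eqI)
      fix i :: 'v assume i: "i \<in> Basis"
      have "(\<Sum>b\<in>B. f (q b) *\<^sub>R b) \<bullet> i = (\<Sum>b\<in>B. (b \<bullet> i) * f (q b))"
        by (simp add: inner_sum_left mult.commute)
      also have "\<dots> = (\<Sum>b\<in>B. f ((b \<bullet> i) * q b))"
        using f(3) int i B(1) Ints_subset_Rats by (intro sum.cong refl) fastforce
      also have "\<dots> = f (u \<bullet> i)" by (simp add: fsum q inner_sum_left mult.commute)
      also have "\<dots> = u \<bullet> i" using int[OF u i] by (rule fint)
      finally show "(\<Sum>b\<in>B. f (q b) *\<^sub>R b) \<bullet> i = u \<bullet> i" .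
    qed
    hence "(\<Sum>b\<in>B. (f (q b) - q b) *\<^sub>R b) = 0" using q by (simp add: algebra_simps sum_subtractf)
    hence "f (q b) = q b" if "b \<in> B" for b
      using independentD[OF B(2) finB order_refl, of "\<lambda>b. f (q b) - q b" b] that by simp
    hence "q b \<in> \<rat>" if "b \<in> B" for b using f(2) that by metis
    then obtain D :: int where D: "D > 0" "\<forall>b\<in>B. of_int D * q b \<in> \<int>"
      using common_denominator[OF finB, of q] by auto
    define k where "k b = \<lfloor>of_int D * q b\<rfloor>" for b
    have k: "of_int (k b) = of_int D * q b" if "b \<in> B" for b
      using D(2) that by (metis Ints_cases floor_of_int k_def)
    have Du: "of_int D *\<^sub>R u = (\<Sum>b\<in>B. of_int (k b) *\<^sub>R b)" by (simp add: q k scaleR_sum_right)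
    have "of_int D * w u = w (of_int D *\<^sub>R u)" using int'[OF u] by simp
    also have "\<dots> = (\<Sum>b\<in>B. w (of_int (k b) *\<^sub>R b))" unfolding Du
      using wsum[of B "\<lambda>b. of_int (k b) *\<^sub>R b"] int' B(1) by (simp add: subset_iff)
    also have "\<dots> = (\<Sum>b\<in>B. of_int (k b) * w b)" using int' B(1) by (intro sum.cong) auto
    also have "\<dots> = g (of_int D *\<^sub>R u)"
      unfolding Du by (simp add: linear_sum[OF g(1)] linear_scale[OF g(1)] g(2))
    also have "\<dots> = of_int D * g u" by (simp add: linear_scale[OF g(1)])
    finally have "w u = g u" using D(1) by simp
    also have "\<dots> = y \<bullet> u" using yz(2)[OF span_base[OF u]]
      by (simp add: gi yz(3) inner_simps orthogonal_def inner_commute)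
    finally show ?thesis .
  qed
  thus ?thesis using yz(1) by auto
qed

text \<open>The pullback of the coordinate \<open>x_e\<close> to the Lawrence torus: the adjoint of
  \<open>lawrence_phi\<close> applied to the coordinate vector, which pairs to 1 with both rays over
  \<open>e\<close>.\<close>

definition unit_char :: "'e::finite \<Rightarrow> (real^'e) \<times> (real^'e)" where
  "unit_char e = (axis e 1, axis e 1)"

lemma inner_unit_char: "z \<bullet> unit_char e = lawrence_phi z $ e"
  by (simp add: unit_char_def lawrence_phi_def inner_prod_def inner_axis)

lemma lawrence_phi_component: "lawrence_phi z $ e = fst z $ e + snd z $ e"
  by (simp add: lawrence_phi_def)

lemma linear_lawrence_phi: "linear lawrence_phi"
  by (rule linearI) (auto simp: lawrence_phi_def algebra_simps)

section \<open>Coordinates on the span of the Lawrence lattice\<close>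

context arrangement
begin

abbreviation "N \<equiv> lawrence_lattice E a"
abbreviation "\<rho>p \<equiv> rho_pos E a"
abbreviation "\<rho>n \<equiv> rho_neg E a"

text \<open>Explicit form of the real span of the Lawrence lattice (\<open>span_N\<close>):
  orthogonality to the relations means that the difference of the two components comes from a
  functional. Through the inner product it contains the characters as well.\<close>

definition VN :: "((real^'e) \<times> (real^'e)) set" where
  "VN = {z. supported E (fst z) \<and> supported E (snd z) \<and>
     (\<exists>m\<in>span M. \<forall>e\<in>E. fst z $ e - snd z $ e = m \<bullet> a e)}"

lemma VN_I: "supported E (fst z) \<Longrightarrow> supported E (snd z) \<Longrightarrow> m \<in> span M \<Longrightarrow>
    (\<And>e. e \<in> E \<Longrightarrow> fst z $ e - snd z $ e = m \<bullet> a e) \<Longrightarrow> z \<in> VN"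
  by (auto simp: VN_def)

lemma VN_supported: "z \<in> VN \<Longrightarrow> e \<notin> E \<Longrightarrow> fst z $ e = 0" "z \<in> VN \<Longrightarrow> e \<notin> E \<Longrightarrow> snd z $ e = 0"
  by (auto simp: VN_def supported_def)

lemma VN_functional: "z \<in> VN \<Longrightarrow> \<exists>m\<in>span M. \<forall>e\<in>E. fst z $ e - snd z $ e = m \<bullet> a e"
  by (auto simp: VN_def)

lemma subspace_VN: "subspace VN"
proof (rule subspaceI)
  show "0 \<in> VN" by (rule VN_I[of _ 0]) (auto simp: supported_def span_zero)
next
  fix x y assume xy: "x \<in> VN" "y \<in> VN"
  then obtain m m' where "m \<in> span M" "\<forall>e\<in>E. fst x $ e - snd x $ e = m \<bullet> a e"
     "m' \<in> span M" "\<forall>e\<in>E. fst y $ e - snd y $ e = m' \<bullet> a e" using VN_functional by meson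
  thus "x + y \<in> VN" using VN_supported[OF xy(1)] VN_supported[OF xy(2)]
    by (intro VN_I[of _ "m + m'"]) (auto simp: supported_def span_add inner_simps, smt (verit))
next
  fix c x assume x: "x \<in> VN"
  then obtain m where "m \<in> span M" "\<forall>e\<in>E. fst x $ e - snd x $ e = m \<bullet> a e" using VN_functional by meson
  thus "c *\<^sub>R x \<in> VN" using VN_supported[OF x]
    by (intro VN_I[of _ "c *\<^sub>R m"])
      (auto simp: supported_def span_scale inner_simps simp flip: right_diff_distrib)
qed

lemma VN_of_relations:
  assumes "supported E (fst z)" "supported E (snd z)"
    and "\<And>k :: 'e \<Rightarrow> int. (\<Sum>e\<in>E. of_int (k e) *\<^sub>R a e) = 0 \<Longrightarrow>
      (\<Sum>e\<in>E. of_int (k e) * (fst z $ e - snd z $ e)) = 0"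
  shows "z \<in> VN"
  using functional_of_relations[of "\<lambda>e. fst z $ e - snd z $ e"] assms by (auto simp: VN_def)

lemma VN_orthogonal: assumes z: "z \<in> VN" shows "z \<in> orthogonal_comp (lawrence_rel E a)"
  unfolding orthogonal_comp_iff lawrence_rel_def
proof clarify
  fix c assume c: "c \<in> coord_lattice E" "(\<Sum>e\<in>E. (c $ e) *\<^sub>R a e) = 0"
  obtain m where m: "\<forall>e\<in>E. fst z $ e - snd z $ e = m \<bullet> a e" using VN_functional[OF z] by auto
  have sup: "supported E c" using c(1) by (auto simp: coord_lattice_iff supported_def)
  have "(c, - c) \<bullet> z = c \<bullet> (fst z - snd z)" by (simp add: inner_prod_def inner_simps)
  also have "\<dots> = (\<Sum>e\<in>E. c $ e * (m \<bullet> a e))" using m by (simp add: supported_inner[OF sup])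
  also have "\<dots> = m \<bullet> (\<Sum>e\<in>E. (c $ e) *\<^sub>R a e)" by (simp add: inner_sum_right)
  finally show "(c, - c) \<bullet> z = 0" using c(2) by simp
qed

lemma orthogonal_VN:
  assumes z: "z \<in> orthogonal_comp (lawrence_rel E a)" "supported E (fst z)" "supported E (snd z)"
  shows "z \<in> VN"
proof (rule VN_of_relations[OF z(2,3)])
  fix k :: "'e \<Rightarrow> int" assume k: "(\<Sum>e\<in>E. of_int (k e) *\<^sub>R a e) = 0"
  define c where "c = (\<chi> e. if e \<in> E then real_of_int (k e) else 0)"
  have sup: "supported E c" by (auto simp: supported_def c_def)
  have "c \<in> coord_lattice E" "(\<Sum>e\<in>E. (c $ e) *\<^sub>R a e) = 0" using k by (auto simp: coord_lattice_iff c_def)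
  hence "(c, - c) \<bullet> z = 0" using z(1) by (auto simp: orthogonal_comp_iff lawrence_rel_def)
  hence "c \<bullet> (fst z - snd z) = 0" by (simp add: inner_prod_def inner_simps)
  thus "(\<Sum>e\<in>E. of_int (k e) * (fst z $ e - snd z $ e)) = 0"
    unfolding supported_inner[OF sup] by (simp add: c_def)
qed

lemma supported_span_rel:
  assumes "z \<in> span (lawrence_rel E a)" shows "supported E (fst z) \<and> supported E (snd z)"
proof -
  have "subspace {z :: (real^'e) \<times> (real^'e). supported E (fst z) \<and> supported E (snd z)}"
    by (auto simp: subspace_def supported_def)
  moreover have "lawrence_rel E a \<subseteq> {z. supported E (fst z) \<and> supported E (snd z)}"
    by (auto simp: lawrence_rel_def coord_lattice_iff supported_def)
  ultimately show ?thesis using assms span_minimal by blast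
qed

lemma quot_VN:
  assumes "supported E (fst z)" "supported E (snd z)"
  shows "quot_map (lawrence_rel E a) z \<in> VN"
proof -
  let ?q = "quot_map (lawrence_rel E a) z"
  have "supported E (fst (z - ?q)) \<and> supported E (snd (z - ?q))" using quot_map(2) by (rule supported_span_rel)
  hence "supported E (fst ?q)" "supported E (snd ?q)" using assms by (auto simp: supported_def)
  thus ?thesis using quot_map(1) by (intro orthogonal_VN) auto
qed

lemma rho_in_N: assumes "e \<in> E" shows "\<rho>p e \<in> N" "\<rho>n e \<in> N"
proof -
  have "axis e 1 \<in> coord_lattice E" "0 \<in> coord_lattice E" using assms by (auto simp: coord_lattice_iff axis_def)
  thus "\<rho>p e \<in> N" "\<rho>n e \<in> N" unfolding lawrence_lattice_def rho_pos_def rho_neg_def by auto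
qed

lemma rho_VN: assumes "e \<in> E" shows "\<rho>p e \<in> VN" "\<rho>n e \<in> VN"
  unfolding rho_pos_def rho_neg_def using assms by (auto intro!: quot_VN simp: supported_def axis_def)

text \<open>Projecting along the relations does not affect the pairing with a vector orthogonal to
  them. Every condition on the rays thereby becomes a condition on single coordinates of
  \<open>u\<close>.\<close>

lemma rho_inner: assumes "u \<in> VN" shows "\<rho>p e \<bullet> u = fst u $ e" "\<rho>n e \<bullet> u = snd u $ e"
  unfolding rho_pos_def rho_neg_def using inner_quot_map[OF VN_orthogonal[OF assms]]
  by (auto simp: inner_prod_def inner_axis')

lemma quot_expand:
  assumes "supported E (fst z)" "supported E (snd z)"
  shows "quot_map (lawrence_rel E a) z = (\<Sum>e\<in>E. fst z $ e *\<^sub>R \<rho>p e + snd z $ e *\<^sub>R \<rho>n e)"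
proof -
  have "z = (\<Sum>e\<in>E. fst z $ e *\<^sub>R (axis e 1, 0) + snd z $ e *\<^sub>R (0, axis e 1))"
    using supported_expand[OF assms(1)] supported_expand[OF assms(2)]
    by (simp add: prod_eq_iff fst_sum snd_sum)
  hence "quot_map (lawrence_rel E a) z = quot_map (lawrence_rel E a)
      (\<Sum>e\<in>E. fst z $ e *\<^sub>R (axis e 1, 0) + snd z $ e *\<^sub>R (0, axis e 1))" by (rule arg_cong)
  also have "\<dots> = (\<Sum>e\<in>E. fst z $ e *\<^sub>R \<rho>p e + snd z $ e *\<^sub>R \<rho>n e)"
    by (simp only: rho_pos_def rho_neg_def linear_sum[OF linear_quot_map] linear_add[OF linear_quot_map]
      linear_scale[OF linear_quot_map])
  finally show ?thesis .
qed

lemma VN_expand: "z \<in> VN \<Longrightarrow> z = (\<Sum>e\<in>E. fst z $ e *\<^sub>R \<rho>p e + snd z $ e *\<^sub>R \<rho>n e)"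
  using quot_expand[of z] quot_map_ident[OF VN_orthogonal, of z] by (auto simp: VN_def)

lemma N_subset_VN: "N \<subseteq> VN"
  unfolding lawrence_lattice_def by (auto intro!: quot_VN simp: coord_lattice_iff supported_def)

lemma span_N: "span N = VN"
proof
  show "span N \<subseteq> VN" using N_subset_VN subspace_VN by (rule span_minimal)
  show "VN \<subseteq> span N"
  proof
    fix z assume "z \<in> VN"
    hence "z = (\<Sum>e\<in>E. fst z $ e *\<^sub>R \<rho>p e + snd z $ e *\<^sub>R \<rho>n e)" by (rule VN_expand)
    moreover have "\<dots> \<in> span N" using rho_in_N by (intro span_sum span_add span_scale span_base) auto
    ultimately show "z \<in> span N" by simp
  qed
qed

lemma dual_N: "u \<in> dual_lattice N \<longleftrightarrow> u \<in> VN \<and> (\<forall>e\<in>E. fst u $ e \<in> \<int> \<and> snd u $ e \<in> \<int>)"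
proof
  assume u: "u \<in> dual_lattice N"
  hence "u \<in> VN" by (simp add: dual_lattice_def span_N)
  moreover have "\<rho>p e \<bullet> u \<in> \<int>" "\<rho>n e \<bullet> u \<in> \<int>" if "e \<in> E" for e
    using u rho_in_N[OF that] by (auto simp: dual_lattice_def)
  ultimately show "u \<in> VN \<and> (\<forall>e\<in>E. fst u $ e \<in> \<int> \<and> snd u $ e \<in> \<int>)" by (auto simp: rho_inner)
next
  assume u: "u \<in> VN \<and> (\<forall>e\<in>E. fst u $ e \<in> \<int> \<and> snd u $ e \<in> \<int>)"
  have "x \<bullet> u \<in> \<int>" if x: "x \<in> N" for x
  proof -
    obtain y z where yz: "y \<in> coord_lattice E" "z \<in> coord_lattice E" "x = quot_map (lawrence_rel E a) (y, z)"
      using x unfolding lawrence_lattice_def by blast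
    have s: "supported E y" "supported E z" using yz by (auto simp: coord_lattice_iff supported_def)
    have "x \<bullet> u = (\<Sum>e\<in>E. y $ e * fst u $ e) + (\<Sum>e\<in>E. z $ e * snd u $ e)"
      using inner_quot_map[OF VN_orthogonal, of u "(y, z)"] u yz(3)
      by (simp add: inner_prod_def supported_inner[OF s(1)] supported_inner[OF s(2)])
    also have "\<dots> \<in> \<int>" using u yz by (intro Ints_add Ints_sum Ints_mult) (auto simp: coord_lattice_iff)
    finally show ?thesis .
  qed
  thus "u \<in> dual_lattice N" using u by (simp add: dual_lattice_def span_N)
qed

lemma dual_N_VN: "u \<in> dual_lattice N \<Longrightarrow> u \<in> VN" by (simp add: dual_N)

lemma dual_N_integral: "u \<in> dual_lattice N \<Longrightarrow> fst u $ e \<in> \<int>" "u \<in> dual_lattice N \<Longrightarrow> snd u $ e \<in> \<int>"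
  using VN_supported[of u e] by (cases "e \<in> E"; simp add: dual_N)+

lemma dual_N_zero: "0 \<in> dual_lattice N"
  and dual_N_add: "x \<in> dual_lattice N \<Longrightarrow> y \<in> dual_lattice N \<Longrightarrow> x + y \<in> dual_lattice N"
  and dual_N_minus: "x \<in> dual_lattice N \<Longrightarrow> - x \<in> dual_lattice N"
  using subspace_VN by (auto simp: dual_N subspace_0 subspace_add subspace_neg)

lemma dual_N_scale: "x \<in> dual_lattice N \<Longrightarrow> of_int k *\<^sub>R x \<in> dual_lattice N"
  using subspace_VN by (auto simp: dual_N subspace_scale)

lemma unit_char_VN: "e \<in> E \<Longrightarrow> unit_char e \<in> VN"
  by (rule VN_I[of _ 0]) (auto simp: unit_char_def supported_def axis_def span_zero)

lemma unit_char_dual: "e \<in> E \<Longrightarrow> unit_char e \<in> dual_lattice N"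
  using unit_char_VN by (auto simp: dual_N unit_char_def axis_def)

lemma phi_rho: assumes "e \<in> E" shows "lawrence_phi (\<rho>p e) = axis e 1" "lawrence_phi (\<rho>n e) = axis e 1"
proof -
  have "lawrence_phi (\<rho>p e) $ f = axis e 1 $ f \<and> lawrence_phi (\<rho>n e) $ f = axis e 1 $ f" for f
  proof (cases "f \<in> E")
    case True
    thus ?thesis using rho_inner[OF unit_char_VN[OF True], of e]
      by (simp add: inner_unit_char) (simp add: unit_char_def axis_def eq_commute)
  next
    case False
    thus ?thesis using VN_supported[OF rho_VN(1)[OF assms]] VN_supported[OF rho_VN(2)[OF assms]] assms
      by (auto simp: lawrence_phi_def axis_def)
  qed
  thus "lawrence_phi (\<rho>p e) = axis e 1" "lawrence_phi (\<rho>n e) = axis e 1" by (auto simp: vec_eq_iff)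
qed

text \<open>Applying an additive map with rational values to all coordinates preserves the relations that
  define the lattice; so lattice points realise all sign patterns.\<close>

lemma sign_realised_by_character:
  assumes u: "u \<in> VN"
  shows "\<exists>u'\<in>dual_lattice N. \<forall>e. sgn (fst u' $ e) = sgn (fst u $ e) \<and> sgn (snd u' $ e) = sgn (snd u $ e)"
proof -
  let ?X = "range (\<lambda>e. fst u $ e) \<union> range (\<lambda>e. snd u $ e)"
  \<comment> \<open>The tolerance is at most every nonzero absolute coordinate, so no sign can
    change; zeros stay zero by additivity. The 1 keeps the set nonempty.\<close>
  let ?A = "insert 1 ((\<lambda>x. \<bar>x\<bar>) ` (?X - {0}))"
  have A: "finite ?A" "?A \<noteq> {}" by auto
  have "Min ?A > 0" using A by (subst Min_gr_iff) auto
  hence "finite ?X" "Min ?A > 0" by auto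
  from rational_approx_additive[OF this]
  obtain f :: "real \<Rightarrow> real" where f: "\<forall>x y. f (x + y) = f x + f y" "\<forall>x. f x \<in> \<rat>"
    "\<forall>q\<in>\<rat>. \<forall>x. f (q * x) = q * f x" "f 1 = 1" "\<forall>y\<in>?X. \<bar>f y - y\<bar> < Min ?A"
    by (elim exE conjE) (rule that)
  have f0: "f 0 = 0" using f(1)[rule_format, of 0 0] by simp
  have fsum: "f (sum h B) = (\<Sum>i\<in>B. f (h i))" for h :: "'e \<Rightarrow> real" and B
    by (induction B rule: infinite_finite_induct) (auto simp: f0 f(1))
  have fdiff: "f (x - y) = f x - f y" for x y using f(1)[rule_format, of "x - y" y] by simp
  have sg: "sgn (f x) = sgn x" if x: "x \<in> ?X" for x
  proof (cases "x = 0")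
    case False
    hence "Min ?A \<le> \<bar>x\<bar>" using x A by (intro Min_le) auto
    moreover have "\<bar>f x - x\<bar> < Min ?A" using f(5) x by blast
    ultimately have "\<bar>f x - x\<bar> < \<bar>x\<bar>" by (rule order.strict_trans2[rotated])
    thus ?thesis by (auto simp: sgn_if split: if_splits)
  qed (simp add: f0)
  define z where "z = ((\<chi> e. f (fst u $ e)), (\<chi> e. f (snd u $ e)))"
  have "z \<in> VN"
  proof (rule VN_of_relations)
    show "supported E (fst z)" "supported E (snd z)"
      using VN_supported[OF u] by (auto simp: supported_def z_def f0)
    fix k :: "'e \<Rightarrow> int" assume k: "(\<Sum>e\<in>E. of_int (k e) *\<^sub>R a e) = 0"
    obtain m where m: "\<forall>e\<in>E. fst u $ e - snd u $ e = m \<bullet> a e" using VN_functional[OF u] by auto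
    have "(\<Sum>e\<in>E. of_int (k e) * (fst z $ e - snd z $ e)) =
        f (\<Sum>e\<in>E. of_int (k e) * (fst u $ e - snd u $ e))"
      using f(3) by (simp add: z_def fsum fdiff flip: fdiff)
    also have "(\<Sum>e\<in>E. of_int (k e) * (fst u $ e - snd u $ e)) = m \<bullet> (\<Sum>e\<in>E. of_int (k e) *\<^sub>R a e)"
      using m by (simp add: inner_sum_right)
    finally show "(\<Sum>e\<in>E. of_int (k e) * (fst z $ e - snd z $ e)) = 0" using k by (simp add: f0)
  qed
  moreover obtain D1 :: int where D1: "D1 > 0" "\<forall>e\<in>E. of_int D1 * (fst z $ e) \<in> \<int>"
    using common_denominator[of E "\<lambda>e. fst z $ e"] f(2) by (auto simp: z_def)
  moreover obtain D2 :: int where D2: "D2 > 0" "\<forall>e\<in>E. of_int D2 * (snd z $ e) \<in> \<int>"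
    using common_denominator[of E "\<lambda>e. snd z $ e"] f(2) by (auto simp: z_def)
  moreover have "of_int (D1 * D2) * (fst z $ e) \<in> \<int>" "of_int (D1 * D2) * (snd z $ e) \<in> \<int>" if "e \<in> E" for e
  proof -
    have "of_int D2 * (of_int D1 * (fst z $ e)) \<in> \<int>" "of_int D1 * (of_int D2 * (snd z $ e)) \<in> \<int>"
      by (rule Ints_mult; use D1 D2 that in simp)+
    thus "of_int (D1 * D2) * (fst z $ e) \<in> \<int>" "of_int (D1 * D2) * (snd z $ e) \<in> \<int>" by (simp_all add: ac_simps)
  qed
  ultimately have "of_int (D1 * D2) *\<^sub>R z \<in> dual_lattice N"
    using subspace_VN by (auto simp: dual_N subspace_scale)
  moreover have "sgn (of_int (D1 * D2) * x) = sgn x" for x :: real using D1(1) D2(1) by (simp add: sgn_mult)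
  ultimately show ?thesis using sg by (intro bexI[of _ "of_int (D1 * D2) *\<^sub>R z"]) (auto simp: z_def)
qed

section \<open>Cones spanned by subsets of the rays\<close>

definition pcone :: "'e set \<Rightarrow> 'e set \<Rightarrow> ((real^'e) \<times> (real^'e)) set" where
  "pcone P Q = convex_cone hull (\<rho>p ` P \<union> \<rho>n ` Q)"

lemma pcone_VN: "P \<subseteq> E \<Longrightarrow> Q \<subseteq> E \<Longrightarrow> pcone P Q \<subseteq> VN"
  unfolding pcone_def using rho_VN by (intro convex_cone_hull_subset_subspace subspace_VN) auto

lemma rho_in_pcone: "e \<in> P \<Longrightarrow> \<rho>p e \<in> pcone P Q" "e \<in> Q \<Longrightarrow> \<rho>n e \<in> pcone P Q"
  unfolding pcone_def by (auto intro: hull_inc)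

lemma pcone_nonneg_iff:
  assumes "u \<in> VN"
  shows "(\<forall>x\<in>pcone P Q. 0 \<le> x \<bullet> u) \<longleftrightarrow> (\<forall>e\<in>P. 0 \<le> fst u $ e) \<and> (\<forall>e\<in>Q. 0 \<le> snd u $ e)"
proof
  assume "\<forall>x\<in>pcone P Q. 0 \<le> x \<bullet> u"
  thus "(\<forall>e\<in>P. 0 \<le> fst u $ e) \<and> (\<forall>e\<in>Q. 0 \<le> snd u $ e)"
    using rho_in_pcone by (auto simp flip: rho_inner[OF assms])
next
  assume "(\<forall>e\<in>P. 0 \<le> fst u $ e) \<and> (\<forall>e\<in>Q. 0 \<le> snd u $ e)"
  hence "0 \<le> g \<bullet> u" if "g \<in> \<rho>p ` P \<union> \<rho>n ` Q" for g using that by (auto simp: rho_inner[OF assms])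
  thus "\<forall>x\<in>pcone P Q. 0 \<le> x \<bullet> u" unfolding pcone_def using convex_cone_hull_nonneg by blast
qed

lemma pcone_orthogonal_iff:
  assumes "u \<in> VN"
  shows "(\<forall>x\<in>pcone P Q. x \<bullet> u = 0) \<longleftrightarrow> (\<forall>e\<in>P. fst u $ e = 0) \<and> (\<forall>e\<in>Q. snd u $ e = 0)"
proof
  assume "\<forall>x\<in>pcone P Q. x \<bullet> u = 0"
  thus "(\<forall>e\<in>P. fst u $ e = 0) \<and> (\<forall>e\<in>Q. snd u $ e = 0)"
    using rho_in_pcone by (auto simp flip: rho_inner[OF assms])
next
  assume "(\<forall>e\<in>P. fst u $ e = 0) \<and> (\<forall>e\<in>Q. snd u $ e = 0)"
  hence "g \<bullet> u = 0" if "g \<in> \<rho>p ` P \<union> \<rho>n ` Q" for g using that by (auto simp: rho_inner[OF assms])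
  thus "\<forall>x\<in>pcone P Q. x \<bullet> u = 0" unfolding pcone_def using convex_cone_hull_orthogonal by blast
qed

lemma pcone_exposed:
  assumes "u \<in> VN" "\<forall>e\<in>P. 0 \<le> fst u $ e" "\<forall>e\<in>Q. 0 \<le> snd u $ e"
  shows "{x\<in>pcone P Q. x \<bullet> u = 0} = pcone {e\<in>P. fst u $ e = 0} {e\<in>Q. snd u $ e = 0}"
proof -
  have "{g \<in> \<rho>p ` P \<union> \<rho>n ` Q. g \<bullet> u = 0} = \<rho>p ` {e\<in>P. fst u $ e = 0} \<union> \<rho>n ` {e\<in>Q. snd u $ e = 0}"
    by (auto simp: rho_inner[OF assms(1)])
  moreover have "0 \<le> g \<bullet> u" if "g \<in> \<rho>p ` P \<union> \<rho>n ` Q" for g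
    using that assms(2,3) by (auto simp: rho_inner[OF assms(1)])
  ultimately show ?thesis unfolding pcone_def using convex_cone_hull_exposed[of "\<rho>p ` P \<union> \<rho>n ` Q" u] by simp
qed

text \<open>The witnesses come from the functionals of \<open>- a e\<close> and \<open>a e\<close>.
  At the index \<open>e\<close> the component in question carries
  \<open>- (a e \<bullet> a e)\<close> and the other one 0; at all other indices the value is split
  into positive and negative parts, which leaves both components nonnegative.\<close>

lemma functional_negative:
  assumes e: "e \<in> E"
  shows "\<exists>u\<in>VN. fst u $ e < 0 \<and> (\<forall>f. f \<noteq> e \<longrightarrow> 0 \<le> fst u $ f) \<and> (\<forall>f. 0 \<le> snd u $ f)"
    and "\<exists>u\<in>VN. snd u $ e < 0 \<and> (\<forall>f. f \<noteq> e \<longrightarrow> 0 \<le> snd u $ f) \<and> (\<forall>f. 0 \<le> fst u $ f)"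
proof -
  have n: "a e \<bullet> a e > 0" using a_nonzero[OF e] by simp
  define x where "x = (\<chi> f. if f \<in> E then max (- (a e \<bullet> a f)) 0 else 0)"
  define y where "y = (\<chi> f. if f \<in> E then max (a e \<bullet> a f) 0 else 0)"
  define X where "X = (\<chi> f. if f = e then - (a e \<bullet> a f) else if f \<in> E then max (- (a e \<bullet> a f)) 0 else 0)"
  define Y where "Y = (\<chi> f. if f = e then 0 else if f \<in> E then max (a e \<bullet> a f) 0 else 0)"
  have s: "- a e \<in> span M" "a e \<in> span M" using a_span[OF e] by (auto simp: span_neg)
  have "(X, Y) \<in> VN" by (rule VN_I[OF _ _ s(1)]) (use e in \<open>auto simp: supported_def X_def Y_def max_def\<close>)
  thus "\<exists>u\<in>VN. fst u $ e < 0 \<and> (\<forall>f. f \<noteq> e \<longrightarrow> 0 \<le> fst u $ f) \<and> (\<forall>f. 0 \<le> snd u $ f)"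
    using n by (intro bexI[of _ "(X, Y)"]) (auto simp: X_def Y_def)
  have "(Y, X) \<in> VN" by (rule VN_I[OF _ _ s(2)]) (use e in \<open>auto simp: supported_def X_def Y_def max_def\<close>)
  thus "\<exists>u\<in>VN. snd u $ e < 0 \<and> (\<forall>f. f \<noteq> e \<longrightarrow> 0 \<le> snd u $ f) \<and> (\<forall>f. 0 \<le> fst u $ f)"
    using n by (intro bexI[of _ "(Y, X)"]) (auto simp: X_def Y_def)
qed

lemma rho_in_pcone_iff:
  assumes e: "e \<in> E"
  shows "\<rho>p e \<in> pcone P Q \<longleftrightarrow> e \<in> P" "\<rho>n e \<in> pcone P Q \<longleftrightarrow> e \<in> Q"
proof -
  obtain u where u: "u \<in> VN" "fst u $ e < 0" "\<forall>f. f \<noteq> e \<longrightarrow> 0 \<le> fst u $ f" "\<forall>f. 0 \<le> snd u $ f"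
    using functional_negative(1)[OF e] by auto
  obtain t where t: "t \<in> VN" "snd t $ e < 0" "\<forall>f. f \<noteq> e \<longrightarrow> 0 \<le> snd t $ f" "\<forall>f. 0 \<le> fst t $ f"
    using functional_negative(2)[OF e] by auto
  have "\<forall>x\<in>pcone P Q. 0 \<le> x \<bullet> u" if "e \<notin> P" using that u by (subst pcone_nonneg_iff[OF u(1)]) metis
  thus "\<rho>p e \<in> pcone P Q \<longleftrightarrow> e \<in> P" using rho_in_pcone u(2) rho_inner(1)[OF u(1), of e] by fastforce
  have "\<forall>x\<in>pcone P Q. 0 \<le> x \<bullet> t" if "e \<notin> Q" using that t by (subst pcone_nonneg_iff[OF t(1)]) metis
  thus "\<rho>n e \<in> pcone P Q \<longleftrightarrow> e \<in> Q" using rho_in_pcone t(2) rho_inner(2)[OF t(1), of e] by fastforce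
qed

text \<open>Each ray is separated from all others by \<open>functional_negative\<close>, so a cone
  remembers its generators, and inclusions of cones become inclusions of index sets.\<close>

lemma pcone_subset_iff:
  assumes "P \<subseteq> E" "Q \<subseteq> E"
  shows "pcone P Q \<subseteq> pcone P' Q' \<longleftrightarrow> P \<subseteq> P' \<and> Q \<subseteq> Q'"
proof
  assume *: "pcone P Q \<subseteq> pcone P' Q'"
  have "e \<in> P'" if "e \<in> P" for e
    using subsetD[OF * rho_in_pcone(1)[OF that]] rho_in_pcone_iff(1)[of e P' Q'] assms that by blast
  moreover have "e \<in> Q'" if "e \<in> Q" for e
    using subsetD[OF * rho_in_pcone(2)[OF that]] rho_in_pcone_iff(2)[of e P' Q'] assms that by blast
  ultimately show "P \<subseteq> P' \<and> Q \<subseteq> Q'" by blast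
next
  assume "P \<subseteq> P' \<and> Q \<subseteq> Q'" thus "pcone P Q \<subseteq> pcone P' Q'" unfolding pcone_def by (intro hull_mono) auto
qed

lemma pcone_eq_iff:
  assumes "P \<subseteq> E" "Q \<subseteq> E" "P' \<subseteq> E" "Q' \<subseteq> E"
  shows "pcone P Q = pcone P' Q' \<longleftrightarrow> P = P' \<and> Q = Q'"
  using pcone_subset_iff[OF assms(1,2), of P' Q'] pcone_subset_iff[OF assms(3,4), of P Q] by auto

lemma unit_char_orthogonal_iff:
  assumes "e \<in> E" shows "(\<forall>x\<in>pcone P Q. x \<bullet> unit_char e = 0) \<longleftrightarrow> e \<notin> P \<union> Q"
  unfolding pcone_orthogonal_iff[OF unit_char_VN[OF assms]] by (auto simp: unit_char_def axis_def)

end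

section \<open>Faces of the arrangement and cones of the Lawrence fan\<close>

context arrangement
begin

abbreviation "\<Delta> \<equiv> lawrence_fan M E a r"

definition ht :: "'e \<Rightarrow> 'm \<Rightarrow> real" where "ht e m = m \<bullet> a e + of_int (r e)"

definition face_at :: "'e set \<Rightarrow> 'm \<Rightarrow> 'm set" where
  "face_at S m0 = {m\<in>span M. \<forall>e\<in>S. sgn (ht e m) = sgn (ht e m0)}"

text \<open>In the notation of the paper, \<open>face_at S m\<close> is the face \<open>R\<close> of the localization at \<open>S\<close> that contains
  \<open>m\<close>, \<open>PP S m\<close> and \<open>QQ S m\<close> are \<open>S\<^sup>+(R)\<close> and \<open>S\<^sup>-(R)\<close>, and \<open>lcone S m\<close> is the cone of \<open>(S, R)\<close>.\<close>

definition PP :: "'e set \<Rightarrow> 'm \<Rightarrow> 'e set" where "PP S m = {e\<in>S. ht e m \<le> 0}"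
definition QQ :: "'e set \<Rightarrow> 'm \<Rightarrow> 'e set" where "QQ S m = {e\<in>S. 0 \<le> ht e m}"

abbreviation "lcone S m \<equiv> pcone (PP S m) (QQ S m)"

lemma PP_sub: "PP S m \<subseteq> S" and QQ_sub: "QQ S m \<subseteq> S" and PP_Un_QQ: "PP S m \<union> QQ S m = S"
  by (auto simp: PP_def QQ_def)

lemma ht_diff: "ht e x - ht e y = (x - y) \<bullet> a e" by (simp add: ht_def inner_diff_left)

lemma sign_vector_eq_iff:
  assumes "m \<in> span M" "m' \<in> span M"
  shows "sign_vector M a r S m = sign_vector M a r S m' \<longleftrightarrow> (\<forall>e\<in>S. sgn (ht e m) = sgn (ht e m'))"
proof -
  define g :: "real \<Rightarrow> int" where "g x = (if x < 0 then 1 else if x = 0 then 0 else -1)" for x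
  have g: "g x = g y \<longleftrightarrow> sgn x = sgn y" for x y by (auto simp: g_def sgn_if)
  have "sign_vector M a r S m = (\<lambda>e\<in>S. g (ht e m))" if "m \<in> span M" for m
    using that by (auto simp: sign_vector_def halfspace_pos_def hyperplane_def ht_def fun_eq_iff restrict_def g_def)
  moreover have "(\<lambda>e\<in>S. g (ht e m)) = (\<lambda>e\<in>S. g (ht e m')) \<longleftrightarrow> (\<forall>e\<in>S. g (ht e m) = g (ht e m'))"
    by (auto simp: fun_eq_iff restrict_def)
  ultimately show ?thesis using assms by (simp add: g)
qed

lemma arr_faces_iff: "R \<in> arr_faces M a r S \<longleftrightarrow> (\<exists>m\<in>span M. R = face_at S m)"
proof
  assume "R \<in> arr_faces M a r S"
  then obtain s where R: "R = {m \<in> span M. sign_vector M a r S m = s}" "R \<noteq> {}" by (auto simp: arr_faces_def)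
  then obtain m where m: "m \<in> span M" "s = sign_vector M a r S m" by auto
  have "R = face_at S m" unfolding R face_at_def m(2) using sign_vector_eq_iff[OF _ m(1)] by auto
  thus "\<exists>m\<in>span M. R = face_at S m" using m(1) by auto
next
  assume "\<exists>m\<in>span M. R = face_at S m"
  then obtain m where m: "m \<in> span M" "R = face_at S m" by auto
  have "R = {x \<in> span M. sign_vector M a r S x = sign_vector M a r S m}"
    unfolding m(2) face_at_def using sign_vector_eq_iff[OF _ m(1)] by auto
  moreover have "m \<in> R" using m by (auto simp: face_at_def)
  ultimately show "R \<in> arr_faces M a r S" unfolding arr_faces_def by blast
qed

lemma face_at_refl: "m \<in> span M \<Longrightarrow> m \<in> face_at S m" by (simp add: face_at_def)

lemma sgn_le_iff: "sgn x = sgn y \<Longrightarrow> x \<le> 0 \<longleftrightarrow> y \<le> (0::real)" "sgn x = sgn y \<Longrightarrow> 0 \<le> x \<longleftrightarrow> 0 \<le> (y::real)"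
  by (auto simp: sgn_if split: if_splits)

lemma pos_part_face: assumes "m \<in> span M" shows "pos_part M a r S (face_at S m) = PP S m"
  using face_at_refl[OF assms, of S] sgn_le_iff(1)
  unfolding pos_part_def PP_def halfspace_pos_def face_at_def ht_def[symmetric] by blast

lemma neg_part_face: assumes "m \<in> span M" shows "neg_part M a r S (face_at S m) = QQ S m"
  using face_at_refl[OF assms, of S] sgn_le_iff(2)
  unfolding neg_part_def QQ_def halfspace_neg_def face_at_def ht_def[symmetric] by blast

lemma lawrence_cone_face: "m \<in> span M \<Longrightarrow> lawrence_cone M E a r S (face_at S m) = lcone S m"
  by (simp add: lawrence_cone_def pcone_def pos_part_face neg_part_face)

lemma face_at_eq_iff:
  assumes "m \<in> span M" "m' \<in> span M"
  shows "face_at S m = face_at S m' \<longleftrightarrow> PP S m = PP S m' \<and> QQ S m = QQ S m'"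
proof
  assume "face_at S m = face_at S m'"
  thus "PP S m = PP S m' \<and> QQ S m = QQ S m'" using pos_part_face neg_part_face assms by metis
next
  assume *: "PP S m = PP S m' \<and> QQ S m = QQ S m'"
  have "sgn (ht e m) = sgn (ht e m')" if "e \<in> S" for e
  proof -
    have "e \<in> PP S m \<longleftrightarrow> e \<in> PP S m'" "e \<in> QQ S m \<longleftrightarrow> e \<in> QQ S m'" using * by auto
    hence "ht e m \<le> 0 \<longleftrightarrow> ht e m' \<le> 0" "0 \<le> ht e m \<longleftrightarrow> 0 \<le> ht e m'" using that by (auto simp: PP_def QQ_def)
    thus ?thesis by (auto simp: sgn_if)
  qed
  thus "face_at S m = face_at S m'" by (auto simp: face_at_def)
qed

lemma lcone_eq_iff:
  assumes "S \<subseteq> E" "S' \<subseteq> E" "m \<in> span M" "m' \<in> span M"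
  shows "lcone S m = lcone S' m' \<longleftrightarrow> S = S' \<and> face_at S m = face_at S' m'"
proof -
  have "lcone S m = lcone S' m' \<longleftrightarrow> PP S m = PP S' m' \<and> QQ S m = QQ S' m'"
    using PP_sub QQ_sub assms by (intro pcone_eq_iff) blast+
  also have "\<dots> \<longleftrightarrow> S = S' \<and> PP S m = PP S' m' \<and> QQ S m = QQ S' m'" using PP_Un_QQ by metis
  finally show ?thesis using face_at_eq_iff[OF assms(3,4)] by auto
qed

text \<open>Every point of the closed polyhedron is a limit of points on the segment towards
  \<open>m\<close>, and any positive fraction of the way to \<open>m\<close> already gives all
  heights the signs they have at \<open>m\<close>.\<close>

lemma closure_face_at:
  assumes m: "m \<in> span M"
  shows "closure (face_at S m) = {x\<in>span M. (\<forall>e\<in>PP S m. ht e x \<le> 0) \<and> (\<forall>e\<in>QQ S m. 0 \<le> ht e x)}"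
    (is "_ = ?C")
proof
  have cl: "closed ?C"
  proof -
    have "?C = span M \<inter> (\<Inter>e\<in>PP S m. {x. ht e x \<le> 0}) \<inter> (\<Inter>e\<in>QQ S m. {x. 0 \<le> ht e x})" by auto
    moreover have "closed {x. ht e x \<le> 0}" "closed {x. 0 \<le> ht e x}" for e
      unfolding ht_def by (intro closed_Collect_le continuous_intros)+
    ultimately show ?thesis by (auto intro!: closed_Int closed_INT closed_span)
  qed
  have "x \<in> ?C" if "x \<in> face_at S m" for x
  proof -
    have "ht e x \<le> 0 \<longleftrightarrow> ht e m \<le> 0" "0 \<le> ht e x \<longleftrightarrow> 0 \<le> ht e m" if "e \<in> S" for e
      using sgn_le_iff[of "ht e x" "ht e m"] \<open>x \<in> face_at S m\<close> that by (auto simp: face_at_def)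
    thus ?thesis using that by (auto simp: face_at_def PP_def QQ_def)
  qed
  hence "face_at S m \<subseteq> ?C" by blast
  thus "closure (face_at S m) \<subseteq> ?C" using cl by (rule closure_minimal)
  show "?C \<subseteq> closure (face_at S m)"
  proof
    fix x assume x: "x \<in> ?C"
    define s where "s n = x + (1 / real (Suc n)) *\<^sub>R (m - x)" for n
    have "s n \<in> face_at S m" for n
    proof -
      define t where "t = 1 / real (Suc n)"
      have t: "0 < t" "t \<le> 1" by (auto simp: t_def)
      have hts: "ht e (s n) = (1 - t) * ht e x + t * ht e m" for e
      proof -
        have sn: "s n = x + t *\<^sub>R (m - x)" by (simp only: s_def t_def)
        show ?thesis unfolding sn ht_def by (simp add: inner_simps algebra_simps)
      qed
      have "sgn (ht e (s n)) = sgn (ht e m)" if e: "e \<in> S" for e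
      proof -
        consider "ht e m < 0" | "ht e m = 0" | "ht e m > 0" by linarith
        thus ?thesis
        proof cases
          case 1
          hence "(1 - t) * ht e x \<le> 0" "t * ht e m < 0"
            using x e t by (auto simp: PP_def mult_nonneg_nonpos mult_pos_neg)
          thus ?thesis using 1 by (simp add: hts)
        next
          case 2
          hence "ht e x = 0" using x e by (force simp: PP_def QQ_def)
          thus ?thesis using 2 by (simp add: hts)
        next
          case 3
          hence "(1 - t) * ht e x \<ge> 0" "t * ht e m > 0" using x e t by (auto simp: QQ_def)
          thus ?thesis using 3 by (simp add: hts)
        qed
      qed
      moreover have "s n \<in> span M" using x m by (auto simp: s_def intro!: span_add span_scale span_diff)
      ultimately show ?thesis by (simp add: face_at_def)
    qed
    moreover have "s \<longlonglongrightarrow> x + 0 *\<^sub>R (m - x)"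
      unfolding s_def by (intro tendsto_intros LIMSEQ_Suc lim_1_over_n)
    ultimately show "x \<in> closure (face_at S m)" unfolding closure_sequential by (intro exI[of _ s]) auto
  qed
qed

text \<open>For \<open>S \<subseteq> S'\<close>, the closed conditions that cut out the closure of
  the first face hold at \<open>m'\<close> exactly if the index sets of the first cone are contained
  in those of the second. This is the source of the conditions on \<open>F\<close> and
  \<open>R\<close> in the closure relation.\<close>

lemma lcone_subset_iff:
  assumes "S \<subseteq> E" "m \<in> span M" "m' \<in> span M"
  shows "lcone S m \<subseteq> lcone S' m' \<longleftrightarrow> S \<subseteq> S' \<and> face_at S' m' \<subseteq> closure (face_at S m)"
proof -
  have 1: "lcone S m \<subseteq> lcone S' m' \<longleftrightarrow> PP S m \<subseteq> PP S' m' \<and> QQ S m \<subseteq> QQ S' m'"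
    using PP_sub QQ_sub assms by (intro pcone_subset_iff) blast+
  have "face_at S' m' \<subseteq> closure (face_at S m)" if *: "PP S m \<subseteq> PP S' m' \<and> QQ S m \<subseteq> QQ S' m'"
  proof
    fix x assume x: "x \<in> face_at S' m'"
    have "ht e x \<le> 0" if "e \<in> PP S m" for e
    proof -
      have "e \<in> S'" "ht e m' \<le> 0" using that * by (auto simp: PP_def)
      thus ?thesis using x sgn_le_iff(1)[of "ht e x" "ht e m'"] by (auto simp: face_at_def)
    qed
    moreover have "0 \<le> ht e x" if "e \<in> QQ S m" for e
    proof -
      have "e \<in> S'" "0 \<le> ht e m'" using that * by (auto simp: QQ_def)
      thus ?thesis using x sgn_le_iff(2)[of "ht e x" "ht e m'"] by (auto simp: face_at_def)
    qed
    ultimately show "x \<in> closure (face_at S m)" unfolding closure_face_at[OF assms(2)]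
      using x by (auto simp: face_at_def)
  qed
  moreover have "S \<subseteq> S'" if "PP S m \<subseteq> PP S' m' \<and> QQ S m \<subseteq> QQ S' m'" using that PP_Un_QQ by blast
  moreover have "PP S m \<subseteq> PP S' m' \<and> QQ S m \<subseteq> QQ S' m'"
    if "S \<subseteq> S'" "face_at S' m' \<subseteq> closure (face_at S m)"
  proof -
    have "m' \<in> closure (face_at S m)" using that face_at_refl[OF assms(3)] by blast
    thus ?thesis using that(1) unfolding closure_face_at[OF assms(2)] by (auto simp: PP_def QQ_def)
  qed
  ultimately show ?thesis unfolding 1 by blast
qed

text \<open>Where \<open>m\<close> and \<open>m'\<close> lie on the same hyperplane both coordinates vanish; elsewhere the direction
  from \<open>m'\<close> to \<open>m\<close> has the right sign.\<close>

lemma exposing_functional: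
  assumes S: "S \<subseteq> E" "S' \<subseteq> E" "m \<in> span M" "m' \<in> span M"
    and sub: "PP S m \<subseteq> PP S' m'" "QQ S m \<subseteq> QQ S' m'"
  shows "\<exists>u\<in>VN. (\<forall>e\<in>PP S' m'. 0 \<le> fst u $ e \<and> (fst u $ e = 0 \<longleftrightarrow> e \<in> PP S m)) \<and>
                (\<forall>e\<in>QQ S' m'. 0 \<le> snd u $ e \<and> (snd u $ e = 0 \<longleftrightarrow> e \<in> QQ S m))"
proof -
  define t where "t e = (m - m') \<bullet> a e" for e
  define x where "x = (\<chi> e. if e \<in> S then (if ht e m \<le> 0 then 0 else t e) else if e \<in> E then \<bar>t e\<bar> + 1 + t e else 0)"
  define y where "y = (\<chi> e. if e \<in> S then (if ht e m \<le> 0 then - t e else 0) else if e \<in> E then \<bar>t e\<bar> + 1 else 0)"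
  have th: "t e = ht e m - ht e m'" for e by (simp add: t_def ht_diff)
  have "(x, y) \<in> VN"
    by (rule VN_I[of _ "m - m'"]) (use S in \<open>auto simp: supported_def x_def y_def t_def span_diff\<close>)
  moreover have "0 \<le> x $ e \<and> (x $ e = 0 \<longleftrightarrow> e \<in> PP S m)" if e: "e \<in> PP S' m'" "e \<in> E" for e
  proof (cases "e \<in> S")
    case True
    show ?thesis
    proof (cases "ht e m \<le> 0")
      case True thus ?thesis using \<open>e \<in> S\<close> by (auto simp: x_def PP_def)
    next
      case False
      hence "e \<in> QQ S m" using \<open>e \<in> S\<close> by (auto simp: QQ_def)
      hence "ht e m' = 0" using sub(2) e by (force simp: QQ_def PP_def)
      thus ?thesis using False \<open>e \<in> S\<close> by (auto simp: x_def PP_def th)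
    qed
  qed (use e in \<open>auto simp: x_def PP_def\<close>)
  moreover have "0 \<le> y $ e \<and> (y $ e = 0 \<longleftrightarrow> e \<in> QQ S m)" if e: "e \<in> QQ S' m'" "e \<in> E" for e
  proof (cases "e \<in> S")
    case True
    show ?thesis
    proof (cases "ht e m \<le> 0")
      case True
      hence "e \<in> PP S m" using \<open>e \<in> S\<close> by (auto simp: PP_def)
      hence "ht e m' = 0" using sub(1) e by (force simp: QQ_def PP_def)
      thus ?thesis using True \<open>e \<in> S\<close> by (auto simp: y_def QQ_def th)
    next
      case False thus ?thesis using \<open>e \<in> S\<close> by (auto simp: y_def QQ_def)
    qed
  qed (use e in \<open>auto simp: y_def QQ_def\<close>)
  moreover have "e \<in> E" if "e \<in> PP S' m' \<or> e \<in> QQ S' m'" for e using that S PP_sub QQ_sub by blast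
  ultimately show ?thesis by (intro bexI[of _ "(x, y)"]) auto
qed

lemma pcone_face_of:
  assumes "u \<in> VN" "\<forall>e\<in>P. 0 \<le> fst u $ e" "\<forall>e\<in>Q. 0 \<le> snd u $ e"
  shows "{x\<in>pcone P Q. x \<bullet> u = 0} face_of pcone P Q"
proof -
  have "convex (pcone P Q)" unfolding pcone_def by (rule convex_convex_cone_hull)
  moreover have "0 \<le> u \<bullet> x" if "x \<in> pcone P Q" for x
    using pcone_nonneg_iff[OF assms(1), of P Q] assms(2,3) that by (auto simp: inner_commute)
  ultimately have "(pcone P Q \<inter> {x. u \<bullet> x = 0}) face_of pcone P Q"
    by (rule face_of_Int_supporting_hyperplane_ge)
  moreover have "pcone P Q \<inter> {x. u \<bullet> x = 0} = {x\<in>pcone P Q. x \<bullet> u = 0}" by (auto simp: inner_commute)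
  ultimately show ?thesis by simp
qed

text \<open>Which face is exposed depends only on the signs of the coordinates, so the real vector
  from \<open>exposing_functional\<close> can be replaced by a lattice character with the same
  signs.\<close>

lemma exposing_character:
  assumes S: "S \<subseteq> E" "S' \<subseteq> E" "m \<in> span M" "m' \<in> span M" and sub: "lcone S m \<subseteq> lcone S' m'"
  shows "\<exists>u\<in>cone_monoid N (lcone S' m'). lcone S m = {x\<in>lcone S' m'. x \<bullet> u = 0}"
proof -
  have PQ: "PP S m \<subseteq> PP S' m'" "QQ S m \<subseteq> QQ S' m'"
    using sub pcone_subset_iff[OF order_trans[OF PP_sub S(1)] order_trans[OF QQ_sub S(1)]] by simp_all
  obtain u where u: "u \<in> VN" "\<forall>e\<in>PP S' m'. 0 \<le> fst u $ e \<and> (fst u $ e = 0 \<longleftrightarrow> e \<in> PP S m)"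
    "\<forall>e\<in>QQ S' m'. 0 \<le> snd u $ e \<and> (snd u $ e = 0 \<longleftrightarrow> e \<in> QQ S m)"
    using exposing_functional[OF S PQ] by auto
  obtain w where w: "w \<in> dual_lattice N"
    "\<And>e. sgn (fst w $ e) = sgn (fst u $ e)" "\<And>e. sgn (snd w $ e) = sgn (snd u $ e)"
    using sign_realised_by_character[OF u(1)] by auto
  have sg: "0 \<le> fst w $ e \<longleftrightarrow> 0 \<le> fst u $ e" "fst w $ e = 0 \<longleftrightarrow> fst u $ e = 0"
    "0 \<le> snd w $ e \<longleftrightarrow> 0 \<le> snd u $ e" "snd w $ e = 0 \<longleftrightarrow> snd u $ e = 0" for e
    using w(2,3)[of e] by (metis sgn_le_iff(2) sgn_0_0)+
  have wV: "w \<in> VN" using w(1) by (rule dual_N_VN)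
  have nn: "\<forall>e\<in>PP S' m'. 0 \<le> fst w $ e" "\<forall>e\<in>QQ S' m'. 0 \<le> snd w $ e" using u(2,3) sg by auto
  have "{e\<in>PP S' m'. fst w $ e = 0} = PP S m" "{e\<in>QQ S' m'. snd w $ e = 0} = QQ S m"
    using u(2,3) sg PQ by auto
  hence "lcone S m = {x\<in>lcone S' m'. x \<bullet> w = 0}" using pcone_exposed[OF wV nn] by simp
  moreover have "w \<in> cone_monoid N (lcone S' m')"
    using w(1) nn pcone_nonneg_iff[OF wV] by (simp add: cone_monoid_def)
  ultimately show ?thesis by blast
qed

lemma lcone_face_of:
  assumes S: "S \<subseteq> E" "S' \<subseteq> E" "m \<in> span M" "m' \<in> span M" and sub: "lcone S m \<subseteq> lcone S' m'"
  shows "lcone S m face_of lcone S' m'"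
proof -
  obtain u where u: "u\<in>cone_monoid N (lcone S' m')" "lcone S m = {x\<in>lcone S' m'. x \<bullet> u = 0}"
    using exposing_character[OF assms] by blast
  have "u \<in> VN" using u(1) dual_N_VN by (auto simp: cone_monoid_def)
  thus ?thesis unfolding u(2) using u(1) pcone_nonneg_iff[of u]
    by (intro pcone_face_of) (auto simp: cone_monoid_def)
qed

text \<open>A point of the closed face with the maximal number of vanishing heights is a vertex: otherwise one
  can move along a direction on which these heights stay zero until another height vanishes.\<close>

lemma vertex_in_closed_face:
  assumes S: "S \<subseteq> E" and m: "m \<in> span M"
  shows "\<exists>\<xi>\<in>span M. face_at E \<xi> = {\<xi>} \<and> PP S m \<subseteq> PP E \<xi> \<and> QQ S m \<subseteq> QQ E \<xi>"
proof -
  define A where "A = {\<xi>\<in>span M. PP S m \<subseteq> PP E \<xi> \<and> QQ S m \<subseteq> QQ E \<xi>}"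
  define Z where "Z \<xi> = {e\<in>E. ht e \<xi> = 0}" for \<xi>
  have "m \<in> A" using S m by (auto simp: A_def PP_def QQ_def)
  moreover have "card (Z \<xi>) < Suc (card E)" for \<xi> unfolding Z_def less_Suc_eq_le by (intro card_mono) auto
  ultimately obtain \<xi> where \<xi>: "\<xi> \<in> A" "\<And>x. x \<in> A \<Longrightarrow> card (Z x) \<le> card (Z \<xi>)"
    using ex_has_greatest_nat[of "\<lambda>x. x \<in> A" m "\<lambda>x. card (Z x)" "Suc (card E)"] by auto
  have rigid: "x = 0" if x: "x \<in> span M" "\<forall>e\<in>Z \<xi>. x \<bullet> a e = 0" for x
  proof (rule ccontr)
    assume "x \<noteq> 0"
    then obtain e where e: "e \<in> E" "x \<bullet> a e \<noteq> 0" using orthogonal_a_zero x(1) by blast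
    hence he: "ht e \<xi> \<noteq> 0" using x(2) by (auto simp: Z_def)
    have nz: "ht e \<xi> * (x \<bullet> a e) \<noteq> 0" using he e(2) by simp
    obtain y where y: "y \<in> span M" "\<forall>e\<in>Z \<xi>. y \<bullet> a e = 0" "ht e \<xi> * (y \<bullet> a e) < 0"
    proof (cases "ht e \<xi> * (x \<bullet> a e) < 0")
      case True thus thesis using that[of x] x by blast
    next
      case False
      hence "ht e \<xi> * (- x \<bullet> a e) < 0" using nz unfolding inner_minus_left mult_minus_right by linarith
      thus thesis using that[of "- x"] x by (simp add: span_neg)
    qed
    \<comment> \<open>\<open>T\<close> collects the hyperplanes that are approached along
      \<open>y\<close>, and \<open>t\<close> is the first time one of them is reached; up to then no
      height changes sign.\<close>
    define T where "T = {f\<in>E. ht f \<xi> * (y \<bullet> a f) < 0}"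
    define t where "t = Min ((\<lambda>f. - (ht f \<xi> / (y \<bullet> a f))) ` T)"
    have T: "finite T" "T \<noteq> {}" using y(3) e by (auto simp: T_def)
    have tle: "t \<le> - (ht f \<xi> / (y \<bullet> a f))" if "f \<in> T" for f
      unfolding t_def using T that by (intro Min_le) auto
    have "t \<in> (\<lambda>f. - (ht f \<xi> / (y \<bullet> a f))) ` T" unfolding t_def using T by (intro Min_in) auto
    then obtain f0 where f0: "f0 \<in> T" "t = - (ht f0 \<xi> / (y \<bullet> a f0))" by auto
    have "t > 0" using f0 by (auto simp: T_def mult_less_0_iff divide_pos_neg divide_neg_pos)
    define \<eta> where "\<eta> = \<xi> + t *\<^sub>R y"
    have h\<eta>: "ht f \<eta> = ht f \<xi> + t * (y \<bullet> a f)" for f by (simp add: \<eta>_def ht_def inner_simps)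
    have pres: "(ht f \<xi> \<le> 0 \<longrightarrow> ht f \<eta> \<le> 0) \<and> (0 \<le> ht f \<xi> \<longrightarrow> 0 \<le> ht f \<eta>)" if f: "f \<in> E" for f
    proof (cases "f \<in> T")
      case True
      hence "t * (y \<bullet> a f) \<le> - ht f \<xi>" if "y \<bullet> a f > 0" using tle[OF True] that by (simp add: field_simps)
      moreover have "t * (y \<bullet> a f) \<ge> - ht f \<xi>" if "y \<bullet> a f < 0" using tle[OF True] that by (simp add: field_simps)
      ultimately show ?thesis using True by (auto simp: h\<eta> T_def mult_less_0_iff)
    next
      case False
      hence nn: "0 \<le> ht f \<xi> * (y \<bullet> a f)" using f by (auto simp: T_def)
      show ?thesis
      proof (cases "ht f \<xi> = 0")
        case True
        hence "y \<bullet> a f = 0" using y(2) f by (auto simp: Z_def)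
        thus ?thesis by (simp add: h\<eta>)
      next
        case False
        hence "(0 < ht f \<xi> \<and> 0 \<le> y \<bullet> a f) \<or> (ht f \<xi> < 0 \<and> y \<bullet> a f \<le> 0)"
          using nn by (auto simp: zero_le_mult_iff)
        thus ?thesis using \<open>t > 0\<close> by (auto simp: h\<eta> mult_nonneg_nonpos intro: add_nonneg_nonneg add_nonpos_nonpos)
      qed
    qed
    have "\<eta> \<in> span M" unfolding \<eta>_def using \<xi>(1) y(1) by (auto simp: A_def intro!: span_add span_scale)
    hence "\<eta> \<in> A" using \<xi>(1) pres by (auto simp: A_def PP_def QQ_def)
    moreover have "Z \<xi> \<subset> Z \<eta>"
    proof -
      have "f0 \<in> Z \<eta>" "f0 \<notin> Z \<xi>" using f0 by (auto simp: Z_def T_def h\<eta>)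
      moreover have "Z \<xi> \<subseteq> Z \<eta>" using y(2) by (auto simp: Z_def h\<eta>)
      ultimately show ?thesis by auto
    qed
    hence "card (Z \<xi>) < card (Z \<eta>)" by (intro psubset_card_mono) auto
    ultimately show False using \<xi>(2) by fastforce
  qed
  have s\<xi>: "\<xi> \<in> span M" using \<xi>(1) by (auto simp: A_def)
  have "x = \<xi>" if "x \<in> face_at E \<xi>" for x
  proof -
    have "(x - \<xi>) \<bullet> a e = 0" if "e \<in> Z \<xi>" for e
    proof -
      have "e \<in> E" "ht e \<xi> = 0" using that by (auto simp: Z_def)
      hence "ht e x = 0" using \<open>x \<in> face_at E \<xi>\<close> by (auto simp: face_at_def sgn_0_0)
      thus ?thesis using \<open>ht e \<xi> = 0\<close> ht_diff[of e x \<xi>] by simp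
    qed
    hence "x - \<xi> = 0" using that s\<xi> by (intro rigid) (auto simp: face_at_def span_diff)
    thus ?thesis by simp
  qed
  hence "face_at E \<xi> = {\<xi>}" using face_at_refl[OF s\<xi>] by blast
  thus ?thesis using \<xi>(1) by (auto simp: A_def)
qed

lemma zero_in_pcone: "0 \<in> pcone P Q" unfolding pcone_def by (rule convex_cone_hull_contains_0)

text \<open>The fan is defined through faces of vertex cones; \<open>vertex_in_closed_face\<close>
  provides a vertex whose cone contains the given one as a face.\<close>

lemma lcone_in_fan:
  assumes S: "S \<subseteq> E" and m: "m \<in> span M" shows "lcone S m \<in> \<Delta>"
proof -
  obtain \<xi> where \<xi>: "\<xi> \<in> span M" "face_at E \<xi> = {\<xi>}" "PP S m \<subseteq> PP E \<xi>" "QQ S m \<subseteq> QQ E \<xi>"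
    using vertex_in_closed_face[OF assms] by auto
  have "lcone S m \<subseteq> lcone E \<xi>" unfolding pcone_def using \<xi>(3,4) by (intro hull_mono) auto
  hence "lcone S m face_of lcone E \<xi>" using S m \<xi>(1) by (intro lcone_face_of) auto
  moreover have "lawrence_cone M E a r E {\<xi>} = lcone E \<xi>" using lawrence_cone_face[OF \<xi>(1), of E] \<xi>(2) by simp
  moreover have "{\<xi>} \<in> arr_faces M a r E" using \<xi>(1,2) by (auto simp: arr_faces_iff)
  ultimately show ?thesis using zero_in_pcone unfolding lawrence_fan_def by fastforce
qed

text \<open>A face of a vertex cone is exposed by a vector \<open>u\<close>, and the functional part
  \<open>n\<close> of \<open>u\<close> is a direction in which the vertex can be moved a little.
  \<open>S\<close> consists of the indices with a ray surviving in the face: at hyperplanes through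
  the vertex the move selects the same rays as \<open>u\<close>, and elsewhere no sign
  changes.\<close>

lemma fan_lcone:
  assumes "\<tau> \<in> \<Delta>" shows "\<exists>S m. S \<subseteq> E \<and> m \<in> span M \<and> \<tau> = lcone S m"
proof -
  obtain \<xi> where ne: "\<tau> \<noteq> {}" and "{\<xi>} \<in> arr_faces M a r E" and fc: "\<tau> face_of lawrence_cone M E a r E {\<xi>}"
    using assms by (auto simp: lawrence_fan_def)
  then obtain \<xi>' where "\<xi>' \<in> span M" "{\<xi>} = face_at E \<xi>'" by (auto simp: arr_faces_iff)
  hence \<xi>: "\<xi> \<in> span M" "face_at E \<xi> = {\<xi>}" using face_at_refl by (metis singletonD)+
  have fc': "\<tau> face_of lcone E \<xi>" using fc lawrence_cone_face[OF \<xi>(1), of E] \<xi>(2) by simp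
  have "polyhedron (lcone E \<xi>)" unfolding pcone_def by (rule polyhedron_convex_cone_hull) simp
  hence "\<tau> exposed_face_of lcone E \<xi>" using fc' exposed_face_of_polyhedron by blast
  then obtain c b where cb: "lcone E \<xi> \<subseteq> {x. c \<bullet> x \<le> b}" "\<tau> = lcone E \<xi> \<inter> {x. c \<bullet> x = b}"
    by (auto simp: exposed_face_of_def)
  have b: "b = 0"
  proof (rule antisym)
    show "0 \<le> b" using cb(1) zero_in_pcone by fastforce
    obtain x where x: "x \<in> lcone E \<xi>" "c \<bullet> x = b" using ne cb(2) by auto
    have "2 *\<^sub>R x \<in> lcone E \<xi>" using x(1) unfolding pcone_def by (rule convex_cone_hull_mul) simp
    hence "c \<bullet> (2 *\<^sub>R x) \<le> b" using cb(1) by blast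
    thus "b \<le> 0" using x(2) by simp
  qed
  \<comment> \<open>On the cone only the component of \<open>- c\<close> in the span of the lattice
    matters; the sign turns the upper bound into nonnegativity.\<close>
  obtain u z where uz: "u \<in> span VN" "\<And>w. w \<in> span VN \<Longrightarrow> orthogonal z w" "- c = u + z"
    using orthogonal_subspace_decomp_exists[of VN "- c"] by metis
  have uV: "u \<in> VN" using uz(1) subspace_VN span_eq_iff by metis
  have uc: "x \<bullet> u = - (c \<bullet> x)" if "x \<in> VN" for x
  proof -
    have "z \<bullet> x = 0" using uz(2)[OF span_base[OF that]] by (simp add: orthogonal_def)
    moreover have "- c \<bullet> x = u \<bullet> x + z \<bullet> x" by (simp add: uz(3) inner_add_left)
    ultimately show ?thesis by (simp add: inner_commute)
  qed
  have sV: "lcone E \<xi> \<subseteq> VN" using PP_sub QQ_sub by (rule pcone_VN)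
  have \<tau>: "\<tau> = {x\<in>lcone E \<xi>. x \<bullet> u = 0}" using uc sV unfolding cb(2) b by fastforce
  have "\<forall>x\<in>lcone E \<xi>. 0 \<le> x \<bullet> u" using uc sV cb(1) b by fastforce
  hence nn: "\<forall>e\<in>PP E \<xi>. 0 \<le> fst u $ e" "\<forall>e\<in>QQ E \<xi>. 0 \<le> snd u $ e" using pcone_nonneg_iff[OF uV] by auto
  have \<tau>': "\<tau> = pcone {e\<in>PP E \<xi>. fst u $ e = 0} {e\<in>QQ E \<xi>. snd u $ e = 0}"
    unfolding \<tau> by (rule pcone_exposed[OF uV nn])
  obtain n where n: "n \<in> span M" "\<forall>e\<in>E. fst u $ e - snd u $ e = n \<bullet> a e" using VN_functional[OF uV] by auto
  define S where "S = {e\<in>PP E \<xi>. fst u $ e = 0} \<union> {e\<in>QQ E \<xi>. snd u $ e = 0}"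
  \<comment> \<open>Half the minimum keeps the move from crossing a hyperplane that avoids the
    vertex. The denominators are shifted by 1 because \<open>n \<bullet> a e\<close> may vanish, and
    the inserted 1 covers the case that all hyperplanes pass through the vertex.\<close>
  define A where "A = insert 1 ((\<lambda>e. \<bar>ht e \<xi>\<bar> / (\<bar>n \<bullet> a e\<bar> + 1)) ` {e\<in>E. ht e \<xi> \<noteq> 0})"
  define \<epsilon> where "\<epsilon> = Min A / 2"
  have A: "finite A" "A \<noteq> {}" by (auto simp: A_def)
  have "Min A > 0" unfolding Min_gr_iff[OF A] by (auto simp: A_def intro!: divide_pos_pos add_nonneg_pos)
  hence \<epsilon>: "\<epsilon> > 0" "\<epsilon> < Min A" by (auto simp: \<epsilon>_def)
  define m where "m = \<xi> + \<epsilon> *\<^sub>R n"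
  have hm: "ht e m = ht e \<xi> + \<epsilon> * (n \<bullet> a e)" for e by (simp add: m_def ht_def inner_simps)
  have small: "\<epsilon> * \<bar>n \<bullet> a e\<bar> < \<bar>ht e \<xi>\<bar>" if "e \<in> E" "ht e \<xi> \<noteq> 0" for e
  proof -
    have "Min A \<le> \<bar>ht e \<xi>\<bar> / (\<bar>n \<bullet> a e\<bar> + 1)" using that A by (intro Min_le) (auto simp: A_def)
    hence "\<epsilon> < \<bar>ht e \<xi>\<bar> / (\<bar>n \<bullet> a e\<bar> + 1)" using \<epsilon> by simp
    hence "\<epsilon> * (\<bar>n \<bullet> a e\<bar> + 1) < \<bar>ht e \<xi>\<bar>" by (simp add: pos_less_divide_eq add_nonneg_pos)
    thus ?thesis using \<epsilon> by (simp add: algebra_simps)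
  qed
  have neg: "ht e m < 0" if "e \<in> E" "ht e \<xi> < 0" for e
  proof -
    have "\<bar>\<epsilon> * (n \<bullet> a e)\<bar> < \<bar>ht e \<xi>\<bar>" using small[OF that(1)] that(2) \<epsilon>(1) by (simp add: abs_mult)
    thus ?thesis using that(2) unfolding hm by linarith
  qed
  have pos: "ht e m > 0" if "e \<in> E" "ht e \<xi> > 0" for e
  proof -
    have "\<bar>\<epsilon> * (n \<bullet> a e)\<bar> < \<bar>ht e \<xi>\<bar>" using small[OF that(1)] that(2) \<epsilon>(1) by (simp add: abs_mult)
    thus ?thesis using that(2) unfolding hm by linarith
  qed
  have zero: "(ht e m \<le> 0 \<longleftrightarrow> fst u $ e = 0) \<and> (0 \<le> ht e m \<longleftrightarrow> snd u $ e = 0)"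
    if e: "e \<in> E" "ht e \<xi> = 0" "fst u $ e = 0 \<or> snd u $ e = 0" for e
  proof -
    have "e \<in> PP E \<xi>" "e \<in> QQ E \<xi>" using e by (auto simp: PP_def QQ_def)
    hence nn': "0 \<le> fst u $ e" "0 \<le> snd u $ e" using nn by auto
    have "ht e m = \<epsilon> * (fst u $ e - snd u $ e)" using n(2) e by (simp add: hm)
    thus ?thesis using nn' e(3) \<epsilon>(1) by (auto simp: mult_le_0_iff zero_le_mult_iff)
  qed
  have S: "S \<subseteq> E" by (auto simp: S_def PP_def QQ_def)
  have "PP S m = {e\<in>PP E \<xi>. fst u $ e = 0}"
  proof (intro set_eqI)
    fix e show "e \<in> PP S m \<longleftrightarrow> e \<in> {e\<in>PP E \<xi>. fst u $ e = 0}"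
      using neg[of e] pos[of e] zero[of e] unfolding S_def PP_def QQ_def
      by (cases "ht e \<xi>" "0::real" rule: linorder_cases) auto
  qed
  moreover have "QQ S m = {e\<in>QQ E \<xi>. snd u $ e = 0}"
  proof (intro set_eqI)
    fix e show "e \<in> QQ S m \<longleftrightarrow> e \<in> {e\<in>QQ E \<xi>. snd u $ e = 0}"
      using neg[of e] pos[of e] zero[of e] unfolding S_def PP_def QQ_def
      by (cases "ht e \<xi>" "0::real" rule: linorder_cases) auto
  qed
  moreover have "m \<in> span M" unfolding m_def using \<xi>(1) n(1) by (intro span_add span_scale)
  ultimately show ?thesis using S by (intro exI[of _ S] exI[of _ m]) (simp add: \<tau>')
qed

lemma fan_face:
  assumes "\<sigma> \<in> \<Delta>" "\<tau> face_of \<sigma>" "\<tau> \<noteq> {}" shows "\<tau> \<in> \<Delta>"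
proof -
  obtain \<xi> where "{\<xi>} \<in> arr_faces M a r E" "\<sigma> face_of lawrence_cone M E a r E {\<xi>}"
    using assms(1) by (auto simp: lawrence_fan_def)
  thus ?thesis using face_of_trans[OF assms(2)] assms(3) by (auto simp: lawrence_fan_def)
qed

lemma fan_pcone:
  assumes "\<sigma> \<in> \<Delta>" obtains P Q where "P \<subseteq> E" "Q \<subseteq> E" "\<sigma> = pcone P Q"
proof -
  obtain S m where "S \<subseteq> E" "\<sigma> = lcone S m" using fan_lcone[OF assms] by (elim exE conjE) (rule that)
  thus ?thesis using that[of "PP S m" "QQ S m"] PP_sub[of S m] QQ_sub[of S m] by simp
qed

lemma fan_exposing_character:
  assumes "\<sigma> \<in> \<Delta>" "\<tau> \<in> \<Delta>" "\<tau> \<subseteq> \<sigma>"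
  shows "\<exists>u\<in>cone_monoid N \<sigma>. \<tau> = {x\<in>\<sigma>. x \<bullet> u = 0}"
proof -
  obtain S m where 1: "S \<subseteq> E" "m \<in> span M" "\<tau> = lcone S m"
    using fan_lcone[OF assms(2)] by (elim exE conjE) (rule that)
  obtain S' m' where 2: "S' \<subseteq> E" "m' \<in> span M" "\<sigma> = lcone S' m'"
    using fan_lcone[OF assms(1)] by (elim exE conjE) (rule that)
  show ?thesis using exposing_character[OF 1(1) 2(1) 1(2) 2(2)] assms(3) unfolding 1(3) 2(3) by simp
qed

end

section \<open>Charts of the tropical Lawrence toric variety\<close>

context arrangement
begin

lemma cone_monoid_pcone:
  "u \<in> cone_monoid N (pcone P Q) \<longleftrightarrow>
     u \<in> dual_lattice N \<and> (\<forall>e\<in>P. 0 \<le> fst u $ e) \<and> (\<forall>e\<in>Q. 0 \<le> snd u $ e)"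
  by (cases "u \<in> dual_lattice N") (simp_all add: cone_monoid_def pcone_nonneg_iff[OF dual_N_VN])

lemma unit_char_cone_monoid: assumes "\<sigma> \<in> \<Delta>" "e \<in> E" shows "unit_char e \<in> cone_monoid N \<sigma>"
proof -
  obtain P Q where PQ: "P \<subseteq> E" "Q \<subseteq> E" "\<sigma> = pcone P Q" using fan_pcone[OF assms(1)] by blast
  show ?thesis unfolding PQ(3) cone_monoid_pcone
    using unit_char_dual[OF assms(2)] by (simp add: unit_char_def axis_def)
qed

lemma cone_monoid_zero: "0 \<in> cone_monoid N \<sigma>"
  and cone_monoid_add: "x \<in> cone_monoid N \<sigma> \<Longrightarrow> y \<in> cone_monoid N \<sigma> \<Longrightarrow> x + y \<in> cone_monoid N \<sigma>"
  by (auto simp: cone_monoid_def dual_N_zero dual_N_add inner_add_right)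

lemma cone_monoid_orthogonal_add:
  assumes "\<tau> \<subseteq> \<sigma>" "u \<in> cone_monoid N \<sigma>" "u' \<in> cone_monoid N \<sigma>"
  shows "(\<forall>x\<in>\<tau>. x \<bullet> (u + u') = 0) \<longleftrightarrow> (\<forall>x\<in>\<tau>. x \<bullet> u = 0) \<and> (\<forall>x\<in>\<tau>. x \<bullet> u' = 0)"
proof -
  have "0 \<le> x \<bullet> u" "0 \<le> x \<bullet> u'" if "x \<in> \<tau>" for x using assms that by (auto simp: cone_monoid_def)
  thus ?thesis by (auto simp: inner_add_right add_nonneg_eq_0_iff)
qed

lemma quot_fan_iff:
  assumes "P \<subseteq> E" "Q \<subseteq> E"
  shows "y \<in> quot_map (pcone P Q) ` span N \<longleftrightarrow> y \<in> VN \<and> (\<forall>x\<in>pcone P Q. x \<bullet> y = 0)"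
proof
  assume "y \<in> quot_map (pcone P Q) ` span N"
  then obtain z where z: "z \<in> VN" "y = quot_map (pcone P Q) z" by (auto simp: span_N)
  have "z - y \<in> span (pcone P Q)" unfolding z(2) by (rule quot_map(2))
  hence "z - y \<in> VN" using span_minimal[OF pcone_VN[OF assms] subspace_VN] by blast
  from subspace_diff[OF subspace_VN z(1) this] have "y \<in> VN" by simp
  moreover have "y \<in> orthogonal_comp (pcone P Q)" unfolding z(2) by (rule quot_map(1))
  ultimately show "y \<in> VN \<and> (\<forall>x\<in>pcone P Q. x \<bullet> y = 0)" by (simp add: orthogonal_comp_iff)
next
  assume y: "y \<in> VN \<and> (\<forall>x\<in>pcone P Q. x \<bullet> y = 0)"
  hence "quot_map (pcone P Q) y = y" by (intro quot_map_ident) (simp add: orthogonal_comp_iff)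
  thus "y \<in> quot_map (pcone P Q) ` span N" using y by (metis image_eqI span_N)
qed

lemma integer_ge_1: "0 \<le> x \<Longrightarrow> x \<noteq> 0 \<Longrightarrow> x \<in> \<int> \<Longrightarrow> 1 \<le> (x::real)"
  by (auto elim!: Ints_cases)

text \<open>Where \<open>u0\<close> vanishes on a ray of the cone, so does \<open>u\<close>; on the
  other rays \<open>u0\<close> takes positive integer values, hence at least 1, and a large multiple
  outweighs the negative values of \<open>u\<close>.\<close>

lemma shift_into_cone_monoid:
  assumes PQ: "P \<subseteq> E" "Q \<subseteq> E" and u0: "u0 \<in> cone_monoid N (pcone P Q)"
    and u: "u \<in> dual_lattice N" "\<forall>x\<in>{x\<in>pcone P Q. x \<bullet> u0 = 0}. x \<bullet> u = 0"
  shows "\<exists>n::nat. u + of_nat n *\<^sub>R u0 \<in> cone_monoid N (pcone P Q)"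
proof -
  have u0': "u0 \<in> dual_lattice N" "\<forall>e\<in>P. 0 \<le> fst u0 $ e" "\<forall>e\<in>Q. 0 \<le> snd u0 $ e"
    using u0 by (auto simp: cone_monoid_pcone)
  have V: "u0 \<in> VN" "u \<in> VN" using u0' u dual_N_VN by auto
  have z: "(\<forall>e\<in>{e\<in>P. fst u0 $ e = 0}. fst u $ e = 0) \<and> (\<forall>e\<in>{e\<in>Q. snd u0 $ e = 0}. snd u $ e = 0)"
    using u(2) unfolding pcone_exposed[OF V(1) u0'(2,3)] pcone_orthogonal_iff[OF V(2)] .
  define n where "n = nat \<lceil>(\<Sum>e\<in>E. \<bar>fst u $ e\<bar> + \<bar>snd u $ e\<bar>)\<rceil>"
  have nn: "0 \<le> c + of_nat n * c0" if "\<bar>c\<bar> \<le> (\<Sum>e\<in>E. \<bar>fst u $ e\<bar> + \<bar>snd u $ e\<bar>)" "0 \<le> c0" "c0 \<noteq> 0 \<or> c = 0" "c0 \<in> \<int>" for c c0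
  proof (cases "c0 = 0")
    case False
    hence "1 \<le> c0" using that by (intro integer_ge_1) auto
    moreover have "\<bar>c\<bar> \<le> of_nat n" using that(1) unfolding n_def by linarith
    ultimately have "\<bar>c\<bar> * 1 \<le> of_nat n * c0" by (intro mult_mono) auto
    thus ?thesis by linarith
  qed (use that in auto)
  have le: "\<bar>fst u $ e\<bar> \<le> (\<Sum>e\<in>E. \<bar>fst u $ e\<bar> + \<bar>snd u $ e\<bar>)" "\<bar>snd u $ e\<bar> \<le> (\<Sum>e\<in>E. \<bar>fst u $ e\<bar> + \<bar>snd u $ e\<bar>)" if "e \<in> E" for e
    using member_le_sum[of e E "\<lambda>e. \<bar>fst u $ e\<bar> + \<bar>snd u $ e\<bar>"] that by auto
  have "u + of_nat n *\<^sub>R u0 \<in> dual_lattice N" using dual_N_add[OF u(1) dual_N_scale[OF u0'(1), of "int n"]] by simp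
  moreover have "0 \<le> fst u $ e + of_nat n * fst u0 $ e" if "e \<in> P" for e
    using that PQ u0' z le dual_N_integral by (intro nn) auto
  moreover have "0 \<le> snd u $ e + of_nat n * snd u0 $ e" if "e \<in> Q" for e
    using that PQ u0' z le dual_N_integral by (intro nn) auto
  ultimately show ?thesis by (intro exI[of _ n]) (simp add: cone_monoid_pcone)
qed

lemma trop_chart_in_trop_homs:
  assumes "\<tau> \<subseteq> \<sigma>" shows "trop_chart N \<sigma> (\<tau>, y) \<in> trop_homs (cone_monoid N \<sigma>)"
  using cone_monoid_zero cone_monoid_add cone_monoid_orthogonal_add[OF assms]
  unfolding trop_homs_def trop_chart_def by (simp add: restrict_def extensional_def inner_add_right)

text \<open>The cone is recovered from the set of characters with finite value, because it is
  exposed by one of them. For the point, a character with the coordinate signs of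
  \<open>y1 - y2\<close>, shifted into the monoid, pairs equally with both; its pairing with the
  difference is a sum of nonnegative terms and vanishes termwise.\<close>

lemma trop_chart_inj:
  assumes \<sigma>: "\<sigma> \<in> \<Delta>" and p: "(\<tau>1, y1) \<in> trop_chart_points N \<Delta> \<sigma>" "(\<tau>2, y2) \<in> trop_chart_points N \<Delta> \<sigma>"
    and eq: "trop_chart N \<sigma> (\<tau>1, y1) = trop_chart N \<sigma> (\<tau>2, y2)"
  shows "\<tau>1 = \<tau>2 \<and> y1 = y2"
proof -
  have t: "\<tau>1 \<in> \<Delta>" "\<tau>2 \<in> \<Delta>" "\<tau>1 \<subseteq> \<sigma>" "\<tau>2 \<subseteq> \<sigma>"
    and y: "y1 \<in> quot_map \<tau>1 ` span N" "y2 \<in> quot_map \<tau>2 ` span N"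
    using p face_of_imp_subset by (auto simp: trop_chart_points_def)
  have e: "(if \<forall>x\<in>\<tau>1. x \<bullet> u = 0 then ereal (y1 \<bullet> u) else \<infinity>) = (if \<forall>x\<in>\<tau>2. x \<bullet> u = 0 then ereal (y2 \<bullet> u) else \<infinity>)"
    if "u \<in> cone_monoid N \<sigma>" for u
    using fun_cong[OF eq, of u] that by (simp add: trop_chart_def)
  have iff: "(\<forall>x\<in>\<tau>1. x \<bullet> u = 0) \<longleftrightarrow> (\<forall>x\<in>\<tau>2. x \<bullet> u = 0)" if "u \<in> cone_monoid N \<sigma>" for u
    using e[OF that] by (auto split: if_splits)
  obtain u1 where u1: "u1 \<in> cone_monoid N \<sigma>" "\<tau>1 = {x\<in>\<sigma>. x \<bullet> u1 = 0}"
    using fan_exposing_character[OF \<sigma> t(1,3)] by auto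
  obtain u2 where u2: "u2 \<in> cone_monoid N \<sigma>" "\<tau>2 = {x\<in>\<sigma>. x \<bullet> u2 = 0}"
    using fan_exposing_character[OF \<sigma> t(2,4)] by auto
  have "\<tau>2 \<subseteq> \<tau>1" using iff[OF u1(1)] t(4) u1(2) by blast
  moreover have "\<tau>1 \<subseteq> \<tau>2" using iff[OF u2(1)] t(3) u2(2) by blast
  ultimately have \<tau>: "\<tau>1 = \<tau>2" by simp
  obtain P Q where PQ: "P \<subseteq> E" "Q \<subseteq> E" "\<sigma> = pcone P Q" using fan_pcone[OF \<sigma>] by blast
  obtain P1 Q1 where PQ1: "P1 \<subseteq> E" "Q1 \<subseteq> E" "\<tau>1 = pcone P1 Q1" using fan_pcone[OF t(1)] by blast
  have yV: "y1 \<in> VN" "y2 \<in> VN" "\<forall>x\<in>\<tau>1. x \<bullet> y1 = 0" "\<forall>x\<in>\<tau>1. x \<bullet> y2 = 0"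
    using y quot_fan_iff[OF PQ1(1,2)] PQ1(3) \<tau> by auto
  define z where "z = y1 - y2"
  have z: "z \<in> VN" "\<forall>x\<in>\<tau>1. x \<bullet> z = 0" using yV by (auto simp: z_def subspace_diff subspace_VN inner_diff_right)
  obtain w where w: "w \<in> dual_lattice N"
    "\<And>e. sgn (fst w $ e) = sgn (fst z $ e)" "\<And>e. sgn (snd w $ e) = sgn (snd z $ e)"
    using sign_realised_by_character[OF z(1)] by auto
  have wV: "w \<in> VN" using w(1) by (rule dual_N_VN)
  have w0: "\<forall>x\<in>\<tau>1. x \<bullet> w = 0"
    using z(2) unfolding PQ1(3) pcone_orthogonal_iff[OF z(1)] pcone_orthogonal_iff[OF wV] by (metis sgn_0_0 w(2,3))
  obtain n where n: "w + of_nat n *\<^sub>R u1 \<in> cone_monoid N \<sigma>"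
    using shift_into_cone_monoid[OF PQ(1,2), of u1 w] u1 w(1) w0 PQ(3) by auto
  have u10: "\<forall>x\<in>\<tau>1. x \<bullet> u1 = 0" using u1(2) by auto
  have "y1 \<bullet> u1 = y2 \<bullet> u1" using e[OF u1(1)] u10 \<tau> by simp
  moreover have "y1 \<bullet> (w + of_nat n *\<^sub>R u1) = y2 \<bullet> (w + of_nat n *\<^sub>R u1)"
    using e[OF n] u10 w0 \<tau> by (simp add: inner_simps)
  ultimately have "z \<bullet> w = 0" by (simp add: z_def inner_simps)
  hence "(\<Sum>e\<in>UNIV. fst z $ e * fst w $ e + snd z $ e * snd w $ e) = 0"
    by (simp add: inner_prod_def inner_vec_def sum.distrib)
  moreover have ge: "0 \<le> fst z $ e * fst w $ e" "0 \<le> snd z $ e * snd w $ e" for e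
    using w(2,3)[of e] by (auto simp: zero_le_mult_iff sgn_if split: if_splits)
  ultimately have z0: "fst z $ e * fst w $ e + snd z $ e * snd w $ e = 0" for e
    by (subst (asm) sum_nonneg_eq_0_iff) auto
  have "fst z $ e * fst w $ e = 0" "snd z $ e * snd w $ e = 0" for e
    using ge[of e] z0[of e] by linarith+
  hence "fst z $ e = 0" "snd z $ e = 0" for e using w(2,3)[of e] by (metis mult_eq_0_iff sgn_0_0)+
  hence "z = 0" by (simp add: prod_eq_iff vec_eq_iff)
  thus ?thesis using \<tau> by (simp add: z_def)
qed

text \<open>The characters with finite value form the orthogonal complement of a face, exposed by one of them
  with maximal support; adding multiples of this character extends the homomorphism to a group.\<close>

lemma trop_chart_surj:
  assumes \<sigma>: "\<sigma> \<in> \<Delta>" and w: "w \<in> trop_homs (cone_monoid N \<sigma>)"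
  shows "\<exists>p\<in>trop_chart_points N \<Delta> \<sigma>. trop_chart N \<sigma> p = w"
proof -
  obtain P Q where PQ: "P \<subseteq> E" "Q \<subseteq> E" "\<sigma> = pcone P Q" using fan_pcone[OF \<sigma>] by blast
  let ?S = "cone_monoid N \<sigma>"
  have wx: "w \<in> extensional ?S" "\<And>u. u \<in> ?S \<Longrightarrow> w u \<noteq> -\<infinity>" "w 0 = 0"
    "\<And>u u'. u \<in> ?S \<Longrightarrow> u' \<in> ?S \<Longrightarrow> w (u + u') = w u + w u'" using w by (auto simp: trop_homs_def)
  define Fin where "Fin = {u\<in>?S. w u \<noteq> \<infinity>}"
  have Fin_real: "\<exists>c. w u = ereal c" if "u \<in> Fin" for u
    using that wx(2)[of u] by (cases "w u") (auto simp: Fin_def)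
  have Fin_add: "x + y \<in> Fin" if "x \<in> Fin" "y \<in> Fin" for x y
    using that wx(4)[of x y] cone_monoid_add by (auto simp: Fin_def)
  have Fin_split: "x \<in> Fin" if "x \<in> ?S" "y \<in> ?S" "x + y \<in> Fin" for x y
    using that wx(4)[of x y] wx(2)[of y] by (auto simp: Fin_def)
  \<comment> \<open>\<open>sup u\<close> is the set of rays of \<open>\<sigma>\<close> on which
    \<open>u\<close> is nonzero; the sum type keeps \<open>rho_pos\<close> and
    \<open>rho_neg\<close> apart.\<close>
  define sup where "sup u = Inl ` {e\<in>P. fst u $ e \<noteq> 0} \<union> Inr ` {e\<in>Q. snd u $ e \<noteq> 0}" for u :: "(real^'e) \<times> (real^'e)"
  have supadd: "sup (x + y) = sup x \<union> sup y" if "x \<in> ?S" "y \<in> ?S" for x y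
  proof -
    have "\<forall>e\<in>P. 0 \<le> fst x $ e" "\<forall>e\<in>Q. 0 \<le> snd x $ e" "\<forall>e\<in>P. 0 \<le> fst y $ e" "\<forall>e\<in>Q. 0 \<le> snd y $ e"
      using that by (auto simp: PQ(3) cone_monoid_pcone)
    hence "{e\<in>P. fst (x + y) $ e \<noteq> 0} = {e\<in>P. fst x $ e \<noteq> 0} \<union> {e\<in>P. fst y $ e \<noteq> 0}"
      "{e\<in>Q. snd (x + y) $ e \<noteq> 0} = {e\<in>Q. snd x $ e \<noteq> 0} \<union> {e\<in>Q. snd y $ e \<noteq> 0}"
      by (auto simp: add_nonneg_eq_0_iff)
    thus ?thesis by (auto simp: sup_def)
  qed
  have "0 \<in> Fin" using cone_monoid_zero wx(3) by (simp add: Fin_def)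
  moreover have "card (sup u) < Suc (CARD('e + 'e))" for u unfolding less_Suc_eq_le by (intro card_mono) auto
  ultimately obtain u0 where u0: "u0 \<in> Fin" "\<And>u. u \<in> Fin \<Longrightarrow> card (sup u) \<le> card (sup u0)"
    using ex_has_greatest_nat[of "\<lambda>u. u \<in> Fin" 0 "\<lambda>u. card (sup u)" "Suc (CARD('e + 'e))"] by auto
  have u0S: "u0 \<in> ?S" using u0 by (simp add: Fin_def)
  have supmax: "sup u \<subseteq> sup u0" if "u \<in> Fin" for u
  proof -
    have "sup (u + u0) = sup u \<union> sup u0" using supadd that u0S by (simp add: Fin_def)
    moreover have "card (sup (u + u0)) \<le> card (sup u0)" using u0 Fin_add that by blast
    ultimately have "sup u0 = sup u \<union> sup u0" by (intro card_seteq) auto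
    thus ?thesis by blast
  qed
  define \<tau> where "\<tau> = {x\<in>\<sigma>. x \<bullet> u0 = 0}"
  have u0V: "u0 \<in> VN" and nn: "\<forall>e\<in>P. 0 \<le> fst u0 $ e" "\<forall>e\<in>Q. 0 \<le> snd u0 $ e"
    using u0S dual_N_VN by (auto simp: PQ(3) cone_monoid_pcone)
  have \<tau>: "\<tau> = pcone {e\<in>P. fst u0 $ e = 0} {e\<in>Q. snd u0 $ e = 0}"
    unfolding \<tau>_def PQ(3) by (rule pcone_exposed[OF u0V nn])
  have face: "\<tau> face_of \<sigma>" unfolding \<tau>_def PQ(3) by (rule pcone_face_of[OF u0V nn])
  have \<tau>\<Delta>: "\<tau> \<in> \<Delta>" using fan_face[OF \<sigma> face] zero_in_pcone \<tau> by blast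
  have orth: "(\<forall>x\<in>\<tau>. x \<bullet> u = 0) \<longleftrightarrow> sup u \<subseteq> sup u0" if "u \<in> VN" for u
    unfolding \<tau> pcone_orthogonal_iff[OF that] by (auto simp: sup_def)
  have SV: "u \<in> VN" if "u \<in> ?S" for u using that dual_N_VN by (auto simp: cone_monoid_def)
  have shift: "\<exists>n::nat. u + of_nat n *\<^sub>R u0 \<in> ?S" if "u \<in> dual_lattice N" "\<forall>x\<in>\<tau>. x \<bullet> u = 0" for u
    using shift_into_cone_monoid[OF PQ(1,2), of u0 u] that u0S unfolding \<tau>_def PQ(3) by blast
  have nFin: "of_nat n *\<^sub>R u0 \<in> Fin" for n
    by (induction n) (auto simp: \<open>0 \<in> Fin\<close> Fin_add u0(1) algebra_simps)
  have Fin_iff: "u \<in> Fin \<longleftrightarrow> (\<forall>x\<in>\<tau>. x \<bullet> u = 0)" if u: "u \<in> ?S" for u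
  proof
    assume "u \<in> Fin" thus "\<forall>x\<in>\<tau>. x \<bullet> u = 0" using supmax orth[OF SV[OF u]] by blast
  next
    assume o: "\<forall>x\<in>\<tau>. x \<bullet> u = 0"
    have "- u \<in> dual_lattice N" using u dual_N_minus by (auto simp: cone_monoid_def)
    then obtain n :: nat where "- u + of_nat n *\<^sub>R u0 \<in> ?S" using shift[of "- u"] o by auto
    moreover have "u + (- u + of_nat n *\<^sub>R u0) \<in> Fin" using nFin by simp
    ultimately show "u \<in> Fin" using Fin_split[OF u] by blast
  qed
  define G where "G = {u\<in>dual_lattice N. \<forall>x\<in>\<tau>. x \<bullet> u = 0}"
  define wr where "wr u = real_of_ereal (w u)" for u
  have wr: "w u = ereal (wr u)" if "u \<in> Fin" for u using Fin_real[OF that] by (auto simp: wr_def)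
  have wradd: "wr (x + y) = wr x + wr y" if "x \<in> Fin" "y \<in> Fin" for x y
  proof -
    have "w (x + y) = w x + w y" using that wx(4) by (simp add: Fin_def)
    also have "\<dots> = ereal (wr x + wr y)" using wr[OF that(1)] wr[OF that(2)] by simp
    finally have "real_of_ereal (w (x + y)) = wr x + wr y" by simp
    thus ?thesis by (simp only: wr_def)
  qed
  have u0o: "\<forall>x\<in>\<tau>. x \<bullet> u0 = 0" by (simp add: \<tau>_def)
  have GFin: "g + of_nat n *\<^sub>R u0 \<in> Fin" if "g \<in> G" "g + of_nat n *\<^sub>R u0 \<in> ?S" for g and n :: nat
    using Fin_iff[OF that(2)] that(1) u0o by (simp add: G_def inner_simps)
  define k where "k g = (SOME n::nat. g + of_nat n *\<^sub>R u0 \<in> ?S)" for g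
  have k: "g + of_nat (k g) *\<^sub>R u0 \<in> ?S" if "g \<in> G" for g
  proof -
    have "\<exists>n::nat. g + of_nat n *\<^sub>R u0 \<in> ?S" using shift[of g] that by (simp add: G_def)
    thus ?thesis unfolding k_def by (rule someI_ex)
  qed
  \<comment> \<open>The value on the group is a difference of two values on the monoid. By
    \<open>w'eq\<close> it is the same for every admissible multiple of \<open>u0\<close>, which
    gives additivity.\<close>
  define w' where "w' g = wr (g + of_nat (k g) *\<^sub>R u0) - wr (of_nat (k g) *\<^sub>R u0)" for g
  have w'eq: "w' g = wr (g + of_nat n *\<^sub>R u0) - wr (of_nat n *\<^sub>R u0)"
    if g: "g \<in> G" "g + of_nat n *\<^sub>R u0 \<in> ?S" for g and n :: nat
  proof -
    have c: "(g + of_nat (k g) *\<^sub>R u0) + of_nat n *\<^sub>R u0 = (g + of_nat n *\<^sub>R u0) + of_nat (k g) *\<^sub>R u0" by simp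
    have "wr (g + of_nat (k g) *\<^sub>R u0) + wr (of_nat n *\<^sub>R u0) = wr (g + of_nat n *\<^sub>R u0) + wr (of_nat (k g) *\<^sub>R u0)"
      using wradd[OF GFin[OF g(1) k[OF g(1)]] nFin[of n]] wradd[OF GFin[OF g] nFin[of "k g"]] arg_cong[OF c, of wr] by simp
    thus ?thesis by (simp add: w'_def)
  qed
  have w'add: "w' (x + y) = w' x + w' y" if xy: "x \<in> G" "y \<in> G" for x y
  proof -
    have c1: "(x + y) + of_nat (k x + k y) *\<^sub>R u0 = (x + of_nat (k x) *\<^sub>R u0) + (y + of_nat (k y) *\<^sub>R u0)"
      by (simp add: algebra_simps)
    have c2: "of_nat (k x + k y) *\<^sub>R u0 = of_nat (k x) *\<^sub>R u0 + of_nat (k y) *\<^sub>R u0" by (simp add: algebra_simps)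
    have "x + y \<in> G" using xy by (auto simp: G_def dual_N_add inner_add_right)
    moreover have "(x + y) + of_nat (k x + k y) *\<^sub>R u0 \<in> ?S"
      unfolding c1 by (rule cone_monoid_add[OF k[OF xy(1)] k[OF xy(2)]])
    ultimately have "w' (x + y) = wr ((x + y) + of_nat (k x + k y) *\<^sub>R u0) - wr (of_nat (k x + k y) *\<^sub>R u0)"
      by (rule w'eq)
    also have "\<dots> = (wr (x + of_nat (k x) *\<^sub>R u0) + wr (y + of_nat (k y) *\<^sub>R u0)) -
        (wr (of_nat (k x) *\<^sub>R u0) + wr (of_nat (k y) *\<^sub>R u0))"
      unfolding c1 unfolding c2 wradd[OF nFin nFin] wradd[OF GFin[OF xy(1) k[OF xy(1)]] GFin[OF xy(2) k[OF xy(2)]]] ..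
    finally show ?thesis by (simp add: w'_def)
  qed
  have "\<exists>y\<in>span G. \<forall>u\<in>G. w' u = y \<bullet> u"
  proof (rule additive_on_integral_group)
    show "u \<bullet> b \<in> \<int>" if "u \<in> G" "b \<in> Basis" for u b
      using that dual_N_integral[of u] by (auto simp: G_def Basis_prod_def Basis_vec_def inner_prod_def inner_axis)
    show "0 \<in> G" "\<And>x. x \<in> G \<Longrightarrow> - x \<in> G" "\<And>x y. x \<in> G \<Longrightarrow> y \<in> G \<Longrightarrow> x + y \<in> G"
      by (auto simp: G_def dual_N_zero dual_N_minus dual_N_add inner_add_right)
  qed (use w'add in auto)
  then obtain y where y: "y \<in> span G" "\<And>u. u \<in> G \<Longrightarrow> w' u = y \<bullet> u" by auto
  have "y \<in> VN"
  proof -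
    have "G \<subseteq> VN" using dual_N_VN by (auto simp: G_def)
    thus ?thesis using span_minimal[OF _ subspace_VN] y(1) by blast
  qed
  moreover have "x \<bullet> y = 0" if "x \<in> \<tau>" for x
  proof -
    have "y \<bullet> x = 0" using y(1) by (rule inner_span_eq_0) (use that in \<open>auto simp: G_def inner_commute\<close>)
    thus ?thesis by (simp add: inner_commute)
  qed
  ultimately have "y \<in> quot_map \<tau> ` span N"
    unfolding \<tau> using PQ(1,2) by (subst quot_fan_iff) auto
  hence p: "(\<tau>, y) \<in> trop_chart_points N \<Delta> \<sigma>" using \<tau>\<Delta> face by (simp add: trop_chart_points_def)
  have "trop_chart N \<sigma> (\<tau>, y) u = w u" for u
  proof (cases "u \<in> ?S")
    case False thus ?thesis using extensional_arb[OF wx(1) False] by (simp add: trop_chart_def)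
  next
    case True
    show ?thesis
    proof (cases "\<forall>x\<in>\<tau>. x \<bullet> u = 0")
      case o: True
      have "u \<in> G" using True o by (simp add: G_def cone_monoid_def)
      hence "y \<bullet> u = wr u - wr 0" using y(2)[of u] w'eq[of u 0] True by simp
      moreover have "wr 0 = 0" using wx(3) by (simp add: wr_def)
      moreover have "w u = ereal (wr u)" using wr Fin_iff[OF True] o by blast
      ultimately show ?thesis using True o by (simp add: trop_chart_def)
    next
      case False
      hence "u \<notin> Fin" using Fin_iff[OF True] by blast
      hence "w u = \<infinity>" using True by (simp add: Fin_def)
      thus ?thesis using True False by (simp add: trop_chart_def)
    qed
  qed
  thus ?thesis using p by (intro bexI[of _ "(\<tau>, y)"]) auto
qed

lemma trop_glue_chart:
  assumes "\<sigma> \<in> \<Delta>" "p \<in> trop_chart_points N \<Delta> \<sigma>"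
  shows "trop_glue N \<Delta> \<sigma> (trop_chart N \<sigma> p) = p"
  unfolding trop_glue_def
proof (rule the_equality)
  fix p' assume p': "p' \<in> trop_chart_points N \<Delta> \<sigma> \<and> trop_chart N \<sigma> p' = trop_chart N \<sigma> p"
  obtain \<tau>1 y1 \<tau>2 y2 where [simp]: "p = (\<tau>1, y1)" "p' = (\<tau>2, y2)" by (cases p, cases p') auto
  show "p' = p" using trop_chart_inj[OF assms(1), of \<tau>2 y2 \<tau>1 y1] assms(2) p' by simp
qed (use assms in auto)

lemma trop_glue:
  assumes "\<sigma> \<in> \<Delta>" "w \<in> trop_homs (cone_monoid N \<sigma>)"
  shows "trop_glue N \<Delta> \<sigma> w \<in> trop_chart_points N \<Delta> \<sigma>" "trop_chart N \<sigma> (trop_glue N \<Delta> \<sigma> w) = w"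
proof -
  obtain p where p: "p \<in> trop_chart_points N \<Delta> \<sigma>" "trop_chart N \<sigma> p = w" using trop_chart_surj[OF assms] by blast
  show "trop_glue N \<Delta> \<sigma> w \<in> trop_chart_points N \<Delta> \<sigma>" "trop_chart N \<sigma> (trop_glue N \<Delta> \<sigma> w) = w"
    using trop_glue_chart[OF assms(1) p(1)] p by simp_all
qed

end

section \<open>Level sets and flags\<close>

text \<open>Thresholds range over the extended reals: -\<infinity> yields \<open>E\<close> and
  \<infinity> yields the set where \<open>w\<close> is infinite, so both ends of a flag occur among
  the superlevel sets.\<close>

definition levels :: "'e set \<Rightarrow> ('e \<Rightarrow> ereal) \<Rightarrow> 'e set set" where
  "levels E w = {{e\<in>E. t \<le> w e} | t. True}"

lemma levels_self: "E \<in> levels E w" "{e\<in>E. w e = \<infinity>} \<in> levels E w"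
proof -
  have "E = {e\<in>E. -\<infinity> \<le> w e}" "{e\<in>E. w e = \<infinity>} = {e\<in>E. \<infinity> \<le> w e}" by auto
  thus "E \<in> levels E w" "{e\<in>E. w e = \<infinity>} \<in> levels E w" unfolding levels_def by blast+
qed

lemma chain_levels: "chain_subset (levels E w)"
proof -
  have "{e\<in>E. t \<le> w e} \<subseteq> {e\<in>E. s \<le> w e} \<or> {e\<in>E. s \<le> w e} \<subseteq> {e\<in>E. t \<le> w e}" for s t
    by (cases "t \<le> s") (auto intro: order_trans)
  thus ?thesis unfolding chain_subset_def levels_def by blast
qed

lemma levels_sub: "G \<in> levels E w \<Longrightarrow> G \<subseteq> E" "G \<in> levels E w \<Longrightarrow> {e\<in>E. w e = \<infinity>} \<subseteq> G"
  by (auto simp: levels_def)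

lemma levels_cong: assumes "\<And>e. e \<in> E \<Longrightarrow> w e = w' e" shows "levels E w = levels E w'"
proof -
  have "{e\<in>E. t \<le> w e} = {e\<in>E. t \<le> w' e}" for t using assms by auto
  thus ?thesis by (simp add: levels_def)
qed

text \<open>For a chain this is a total preorder in which elements of smaller members come first.
  Vectors in the cone of a flag are those whose values weakly decrease along it.\<close>

definition fle :: "'e set set \<Rightarrow> 'e \<Rightarrow> 'e \<Rightarrow> bool" where
  "fle \<F> e f \<longleftrightarrow> (\<forall>G\<in>\<F>. f \<in> G \<longrightarrow> e \<in> G)"

lemma fle_total: "chain_subset \<F> \<Longrightarrow> fle \<F> e f \<or> fle \<F> f e"
  unfolding chain_subset_def fle_def by blast

lemma not_fle: "\<not> fle \<F> f e \<longleftrightarrow> (\<exists>G\<in>\<F>. e \<in> G \<and> f \<notin> G)"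
  by (auto simp: fle_def)

lemma finite_chain_Union: "finite \<B> \<Longrightarrow> \<B> \<noteq> {} \<Longrightarrow> chain_subset \<B> \<Longrightarrow> \<Union>\<B> \<in> \<B>"
proof (induction \<B> rule: finite_ne_induct)
  case (insert B \<B>)
  hence "\<Union>\<B> \<in> \<B>" by (auto simp: chain_subset_def)
  hence "B \<subseteq> \<Union>\<B> \<or> \<Union>\<B> \<subseteq> B" using insert.prems by (auto simp: chain_subset_def)
  thus ?case using \<open>\<Union>\<B> \<in> \<B>\<close> by (auto simp: Un_absorb1 Un_absorb2)
qed simp

lemma finite_chain_Inter: "finite \<B> \<Longrightarrow> \<B> \<noteq> {} \<Longrightarrow> chain_subset \<B> \<Longrightarrow> \<Inter>\<B> \<in> \<B>"
proof (induction \<B> rule: finite_ne_induct)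
  case (insert B \<B>)
  hence "\<Inter>\<B> \<in> \<B>" by (auto simp: chain_subset_def)
  hence "B \<subseteq> \<Inter>\<B> \<or> \<Inter>\<B> \<subseteq> B" using insert.prems by (auto simp: chain_subset_def)
  thus ?case using \<open>\<Inter>\<B> \<in> \<B>\<close> by (auto simp: Int_absorb1 Int_absorb2)
qed simp

section \<open>Superlevel sets that belong to a flag\<close>

locale set_flag =
  fixes E :: "'e::finite set" and F :: "'e set" and \<F> :: "'e set set"
  assumes F_in: "F \<in> \<F>" and E_in: "E \<in> \<F>" and chain: "chain_subset \<F>"
    and sub: "\<And>G. G \<in> \<F> \<Longrightarrow> F \<subseteq> G \<and> G \<subseteq> E"
begin

lemma F_sub: "F \<subseteq> E" using sub[OF E_in] by simp

text \<open>This rewrites membership of all superlevel sets as finitely many inequalities, a form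
  that is visibly closed. For the converse, a set closed under the preorder is the union of the
  smallest members containing its elements, and the union of a finite chain is one of its
  terms.\<close>

lemma levels_subset_iff:
  assumes w: "\<And>e. e \<in> F \<Longrightarrow> w e = \<infinity>"
  shows "levels E w \<subseteq> \<F> \<longleftrightarrow> (\<forall>e\<in>E. \<forall>f\<in>E. fle \<F> e f \<longrightarrow> w f \<le> w e)"
proof
  assume l: "levels E w \<subseteq> \<F>"
  show "\<forall>e\<in>E. \<forall>f\<in>E. fle \<F> e f \<longrightarrow> w f \<le> w e"
  proof (intro ballI impI)
    fix e f assume ef: "e \<in> E" "f \<in> E" "fle \<F> e f"
    have "{x\<in>E. w f \<le> w x} \<in> \<F>" using l by (auto simp: levels_def)
    thus "w f \<le> w e" using ef by (auto simp: fle_def)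
  qed
next
  assume mono: "\<forall>e\<in>E. \<forall>f\<in>E. fle \<F> e f \<longrightarrow> w f \<le> w e"
  show "levels E w \<subseteq> \<F>"
  proof
    fix U assume "U \<in> levels E w"
    then obtain t where U: "U = {e\<in>E. t \<le> w e}" by (auto simp: levels_def)
    define g where "g e = \<Inter>{G\<in>\<F>. e \<in> G}" for e
    have g: "g e \<in> \<F>" "e \<in> g e" if "e \<in> E" for e
    proof -
      have "\<Inter>{G\<in>\<F>. e \<in> G} \<in> {G\<in>\<F>. e \<in> G}"
        using that E_in chain by (intro finite_chain_Inter) (auto simp: chain_subset_def)
      thus "g e \<in> \<F>" "e \<in> g e" by (auto simp: g_def)
    qed
    have "g e \<subseteq> U" if "e \<in> U" for e
    proof
      fix x assume x: "x \<in> g e"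
      have "x \<in> E" using x g(1)[of e] that sub U by blast
      moreover have "fle \<F> x e" using x by (auto simp: fle_def g_def)
      ultimately show "x \<in> U" using mono that unfolding U by (auto intro: order_trans)
    qed
    moreover have "F \<subseteq> U" using w F_sub unfolding U by auto
    \<comment> \<open>Inserting \<open>F\<close> keeps the chain nonempty when \<open>U\<close> is
      empty.\<close>
    ultimately have "U = \<Union>(insert F (g ` U))" using g(2) U by auto
    moreover have "\<Union>(insert F (g ` U)) \<in> insert F (g ` U)"
      using F_in g(1) U chain by (intro finite_chain_Union) (auto simp: chain_subset_def)
    ultimately show "U \<in> \<F>" using F_in g(1) U by auto
  qed
qed

text \<open>A member other than \<open>F\<close> is the superlevel set at the least value taken on
  its part outside \<open>F\<close>, since strictness keeps everything outside the member below that
  value; \<open>F\<close> itself is the level \<infinity>.\<close>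

lemma levels_eq_iff:
  assumes w: "\<And>e. e \<in> F \<Longrightarrow> w e = \<infinity>" "\<And>e. e \<in> E - F \<Longrightarrow> w e \<noteq> \<infinity>"
  shows "levels E w = \<F> \<longleftrightarrow> levels E w \<subseteq> \<F> \<and> (\<forall>e\<in>E - F. \<forall>f\<in>E - F. \<not> fle \<F> f e \<longrightarrow> w f < w e)"
proof
  assume l: "levels E w = \<F>"
  have "w f < w e" if ef: "e \<in> E - F" "f \<in> E - F" "\<not> fle \<F> f e" for e f
  proof -
    obtain G where G: "G \<in> levels E w" "e \<in> G" "f \<notin> G" using ef(3) l by (auto simp: not_fle)
    then obtain t where "G = {e\<in>E. t \<le> w e}" by (auto simp: levels_def)
    hence "t \<le> w e" "\<not> t \<le> w f" using G ef by auto
    thus ?thesis by simp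
  qed
  thus "levels E w \<subseteq> \<F> \<and> (\<forall>e\<in>E - F. \<forall>f\<in>E - F. \<not> fle \<F> f e \<longrightarrow> w f < w e)" using l by auto
next
  assume *: "levels E w \<subseteq> \<F> \<and> (\<forall>e\<in>E - F. \<forall>f\<in>E - F. \<not> fle \<F> f e \<longrightarrow> w f < w e)"
  have "G \<in> levels E w" if G: "G \<in> \<F>" for G
  proof (cases "G = F")
    case True
    hence "G = {e\<in>E. w e = \<infinity>}" using w F_sub by auto
    thus ?thesis using levels_self by simp
  next
    case False
    hence ne: "w ` (G - F) \<noteq> {}" using sub[OF G] by auto
    define t where "t = Min (w ` (G - F))"
    have "t \<in> w ` (G - F)" unfolding t_def using ne by (intro Min_in) auto
    then obtain f where f: "f \<in> G - F" "t = w f" by auto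
    have tle: "t \<le> w e" if "e \<in> G - F" for e unfolding t_def using that by (intro Min_le) auto
    have "G = {e\<in>E. t \<le> w e}"
    proof (intro equalityI subsetI)
      fix e assume "e \<in> G" thus "e \<in> {e\<in>E. t \<le> w e}" using tle[of e] w(1)[of e] sub[OF G] by (cases "e \<in> F") auto
    next
      fix e assume e: "e \<in> {e\<in>E. t \<le> w e}"
      show "e \<in> G"
      proof (rule ccontr)
        assume n: "e \<notin> G"
        hence "e \<in> E - F" "\<not> fle \<F> e f" using e sub[OF G] G f(1) by (auto simp: not_fle)
        hence "w e < w f" using * f(1) sub[OF G] by auto
        thus False using e f(2) by auto
      qed
    qed
    thus ?thesis by (auto simp: levels_def)
  qed
  thus "levels E w = \<F>" using * by auto
qed

end

definition wv :: "'e set \<Rightarrow> real^'e::finite \<Rightarrow> 'e \<Rightarrow> ereal" where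
  "wv F z e = (if e \<in> F then \<infinity> else ereal (z $ e))"

lemma wv_PInf: "F \<subseteq> E \<Longrightarrow> {e\<in>E. wv F z e = \<infinity>} = F" by (auto simp: wv_def)

lemma indicator_vec_component: "indicator_vec S $ e = (if e \<in> S then 1 else 0)"
proof -
  have "indicator_vec S $ e = (\<Sum>i\<in>S. if i = e then 1 else 0)"
    unfolding indicator_vec_def sum_component by (intro sum.cong) (auto simp: axis_def)
  thus ?thesis by simp
qed

text \<open>Induction on the number of distinct values: lowering the largest value to the second
  largest removes a nonnegative multiple of the indicator of the top superlevel set, and with it one
  value. In the end a constant vector remains, a multiple of \<open>indicator_vec X\<close> of
  either sign.\<close>

lemma level_set_decomposition:
  fixes z :: "real^'e::finite"
  assumes "supported X z"
  shows "z \<in> convex_cone hull ((\<lambda>t. indicator_vec {e\<in>X. t \<le> z $ e}) ` ((\<lambda>e. z $ e) ` X) \<union> {- indicator_vec X})"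
  using assms
proof (induction "card ((\<lambda>e. z $ e) ` X)" arbitrary: z rule: less_induct)
  case (less z)
  let ?v = "\<lambda>e. z $ e"
  let ?H = "convex_cone hull ((\<lambda>t. indicator_vec {e\<in>X. t \<le> z $ e}) ` (?v ` X) \<union> {- indicator_vec X})"
  show ?case
  proof (cases "X = {}")
    case True
    hence "z = 0" using less.prems by (auto simp: supported_def vec_eq_iff)
    thus ?thesis by (simp add: convex_cone_hull_contains_0)
  next
    case ne: False
    define t where "t = Max (?v ` X)"
    have tX: "t \<in> ?v ` X" unfolding t_def using ne by (intro Max_in) auto
    have tmax: "z $ e \<le> t" if "e \<in> X" for e unfolding t_def using that by (intro Max_ge) auto
    show ?thesis
    proof (cases "?v ` X = {t}")
      case True
      hence zt: "z $ e = t" if "e \<in> X" for e using that by auto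
      have z: "z = t *\<^sub>R indicator_vec X"
        using zt less.prems by (auto simp: vec_eq_iff indicator_vec_component supported_def)
      have X: "{e\<in>X. t \<le> z $ e} = X" using zt by auto
      have "indicator_vec {e\<in>X. t \<le> z $ e} \<in> ?H" "- indicator_vec X \<in> ?H" using tX by (auto intro!: hull_inc)
      hence g: "indicator_vec X \<in> ?H" "- indicator_vec X \<in> ?H" unfolding X .
      have "t *\<^sub>R indicator_vec X \<in> ?H"
      proof (cases "0 \<le> t")
        case True thus ?thesis using g(1) by (intro convex_cone_hull_mul)
      next
        case False
        hence "(- t) *\<^sub>R (- indicator_vec X) \<in> ?H" using g(2) by (intro convex_cone_hull_mul) auto
        thus ?thesis by simp
      qed
      thus ?thesis using z by simp
    next
      case False
      hence ne': "?v ` X - {t} \<noteq> {}" using tX by auto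
      define s where "s = Max (?v ` X - {t})"
      have sX: "s \<in> ?v ` X - {t}" unfolding s_def using ne' by (intro Max_in) auto
      have smax: "z $ e \<le> s" if "e \<in> X" "z $ e \<noteq> t" for e
        unfolding s_def using that by (intro Max_ge) auto
      have st: "s < t" using sX tmax by force
      define T where "T = {e\<in>X. t \<le> z $ e}"
      define y where "y = z - (t - s) *\<^sub>R indicator_vec T"
      have yc: "y $ e = (if z $ e = t then s else z $ e)" if "e \<in> X" for e
        using that tmax[OF that] by (auto simp: y_def indicator_vec_component T_def)
      have ysup: "supported X y" using less.prems by (auto simp: supported_def y_def indicator_vec_component T_def)
      have yv: "(\<lambda>e. y $ e) ` X = ?v ` X - {t}"
      proof (intro equalityI subsetI)
        fix c assume "c \<in> (\<lambda>e. y $ e) ` X"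
        then obtain e where "e \<in> X" "c = y $ e" by auto
        thus "c \<in> ?v ` X - {t}" using yc sX by auto
      next
        fix c assume "c \<in> ?v ` X - {t}"
        then obtain e where "e \<in> X" "c = z $ e" "z $ e \<noteq> t" by auto
        thus "c \<in> (\<lambda>e. y $ e) ` X" using yc by (intro image_eqI[of _ _ e]) auto
      qed
      have lev: "{e\<in>X. c \<le> y $ e} = {e\<in>X. c \<le> z $ e}" if c: "c \<in> (\<lambda>e. y $ e) ` X" for c
      proof -
        have "c \<le> s" using c yv smax by auto
        thus ?thesis using yc st by (auto split: if_splits)
      qed
      have "card ((\<lambda>e. y $ e) ` X) < card (?v ` X)" unfolding yv using tX by (intro psubset_card_mono) auto
      hence "y \<in> convex_cone hull ((\<lambda>t. indicator_vec {e\<in>X. t \<le> y $ e}) ` ((\<lambda>e. y $ e) ` X) \<union> {- indicator_vec X})"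
        using less.hyps ysup by blast
      also have "\<dots> \<subseteq> ?H"
      proof (rule hull_mono)
        have "(\<lambda>t. indicator_vec {e\<in>X. t \<le> y $ e}) ` ((\<lambda>e. y $ e) ` X) =
          (\<lambda>t. indicator_vec {e\<in>X. t \<le> z $ e}) ` ((\<lambda>e. y $ e) ` X)" using lev by (intro image_cong) auto
        also have "\<dots> \<subseteq> (\<lambda>t. indicator_vec {e\<in>X. t \<le> z $ e}) ` (?v ` X)" unfolding yv by (intro image_mono) auto
        finally show "(\<lambda>t. indicator_vec {e\<in>X. t \<le> y $ e}) ` ((\<lambda>e. y $ e) ` X) \<union> {- indicator_vec X} \<subseteq>
          (\<lambda>t. indicator_vec {e\<in>X. t \<le> z $ e}) ` (?v ` X) \<union> {- indicator_vec X}" by blast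
      qed
      finally have "y \<in> ?H" .
      moreover have "(t - s) *\<^sub>R indicator_vec T \<in> ?H"
        using tX st unfolding T_def by (intro convex_cone_hull_mul hull_inc) auto
      ultimately have "y + (t - s) *\<^sub>R indicator_vec T \<in> ?H" by (rule convex_cone_hull_add)
      thus ?thesis by (simp add: y_def)
    qed
  qed
qed

context set_flag
begin

lemma fle_mono_iff:
  "levels E (wv F z) \<subseteq> \<F> \<longleftrightarrow> (\<forall>e\<in>E - F. \<forall>f\<in>E - F. fle \<F> e f \<longrightarrow> z $ f \<le> z $ e)"
proof -
  have "levels E (wv F z) \<subseteq> \<F> \<longleftrightarrow> (\<forall>e\<in>E. \<forall>f\<in>E. fle \<F> e f \<longrightarrow> wv F z f \<le> wv F z e)"
    by (rule levels_subset_iff) (simp add: wv_def)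
  moreover have "\<not> fle \<F> e f" if "e \<in> E - F" "f \<in> F" for e f using that F_in by (auto simp: fle_def)
  ultimately show ?thesis by (auto simp: wv_def)
qed

lemma strict_iff:
  "levels E (wv F z) = \<F> \<longleftrightarrow> levels E (wv F z) \<subseteq> \<F> \<and> (\<forall>e\<in>E - F. \<forall>f\<in>E - F. \<not> fle \<F> f e \<longrightarrow> z $ f < z $ e)"
proof -
  have "levels E (wv F z) = \<F> \<longleftrightarrow> levels E (wv F z) \<subseteq> \<F> \<and>
      (\<forall>e\<in>E - F. \<forall>f\<in>E - F. \<not> fle \<F> f e \<longrightarrow> wv F z f < wv F z e)"
    by (rule levels_eq_iff) (auto simp: wv_def)
  thus ?thesis by (auto simp: wv_def)
qed

text \<open>Counting the members that contain an element orders the elements by depth, and strictly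
  so whenever some member separates them.\<close>

lemma strict_vector: "levels E (wv F (\<chi> e. real (card {G\<in>\<F>. e \<in> G}))) = \<F>"
  unfolding strict_iff fle_mono_iff
proof (intro conjI ballI impI)
  fix e f assume "fle \<F> e f"
  thus "(\<chi> e. real (card {G\<in>\<F>. e \<in> G})) $ f \<le> (\<chi> e. real (card {G\<in>\<F>. e \<in> G})) $ e"
    by (auto simp: fle_def intro!: card_mono)
next
  fix e f assume n: "\<not> fle \<F> f e"
  hence "fle \<F> e f" using fle_total[OF chain] by blast
  hence "{G\<in>\<F>. f \<in> G} \<subset> {G\<in>\<F>. e \<in> G}" using n by (auto simp: fle_def)
  thus "(\<chi> e. real (card {G\<in>\<F>. e \<in> G})) $ f < (\<chi> e. real (card {G\<in>\<F>. e \<in> G})) $ e"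
    by (simp add: psubset_card_mono)
qed

text \<open>Inequalities pass from the generators to the cone. Conversely, the decomposition into
  superlevel sets uses only members of the flag, and the level \<open>E\<close> is one of the two
  lineality generators.\<close>

lemma bergman_cone_iff:
  assumes z: "supported (E - F) z"
  shows "z \<in> bergman_cone E F \<F> \<longleftrightarrow> levels E (wv F z) \<subseteq> \<F>"
proof
  assume "z \<in> bergman_cone E F \<F>"
  hence "\<forall>e\<in>E - F. \<forall>f\<in>E - F. fle \<F> e f \<longrightarrow> z $ f \<le> z $ e"
    unfolding bergman_cone_def
  proof (induction rule: convex_cone_hull_induct)
    case (base g)
    then consider G where "G \<in> \<F>" "g = indicator_vec (G - F)" | "g = indicator_vec (E - F)" | "g = - indicator_vec (E - F)"
      by auto
    thus ?case by cases (auto simp: indicator_vec_component fle_def)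
  next
    case (add x y) thus ?case by (auto intro: add_mono)
  next
    case (scale c x) thus ?case by (auto intro: mult_left_mono)
  qed auto
  thus "levels E (wv F z) \<subseteq> \<F>" by (simp add: fle_mono_iff)
next
  assume l: "levels E (wv F z) \<subseteq> \<F>"
  have "(\<lambda>t. indicator_vec {e\<in>E - F. t \<le> z $ e}) ` ((\<lambda>e. z $ e) ` (E - F)) \<union> {- indicator_vec (E - F)} \<subseteq>
     (\<lambda>G. indicator_vec (G - F)) ` (\<F> - {F, E}) \<union> {indicator_vec (E - F), - indicator_vec (E - F)}"
  proof (intro Un_least subsetI)
    fix x assume "x \<in> (\<lambda>t. indicator_vec {e\<in>E - F. t \<le> z $ e}) ` ((\<lambda>e. z $ e) ` (E - F))"
    then obtain f where f: "f \<in> E - F" "x = indicator_vec {e\<in>E - F. z $ f \<le> z $ e}" by auto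
    define G where "G = {e\<in>E. ereal (z $ f) \<le> wv F z e}"
    have "G \<in> \<F>" using l by (auto simp: G_def levels_def)
    moreover have "G - F = {e\<in>E - F. z $ f \<le> z $ e}" by (auto simp: G_def wv_def)
    moreover have "f \<in> G" using f by (auto simp: G_def wv_def)
    ultimately have "G \<in> \<F>" "x = indicator_vec (G - F)" "G \<noteq> F" using f by auto
    thus "x \<in> (\<lambda>G. indicator_vec (G - F)) ` (\<F> - {F, E}) \<union> {indicator_vec (E - F), - indicator_vec (E - F)}"
      by (cases "G = E") simp_all
  qed auto
  thus "z \<in> bergman_cone E F \<F>" unfolding bergman_cone_def
    using subsetD[OF hull_mono level_set_decomposition[OF z]] by blast
qed

end

section \<open>Flats\<close>

context arrangement
begin

abbreviation "flat \<equiv> is_flat M E a"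

lemma arr_rank_eq: assumes S: "S \<subseteq> E" shows "arr_rank M a S = dim (a ` S)"
proof -
  have sub: "span (a ` S) \<subseteq> span M" using a_span S by (intro span_minimal) auto
  have "{m \<in> span M. \<forall>e\<in>S. m \<in> hyperplane M a (\<lambda>_. 0) e} = {y\<in>span M. \<forall>x\<in>span (a ` S). orthogonal x y}"
  proof (intro equalityI subsetI)
    fix m assume m: "m \<in> {m \<in> span M. \<forall>e\<in>S. m \<in> hyperplane M a (\<lambda>_. 0) e}"
    have "x \<bullet> m = 0" if "x \<in> span (a ` S)" for x
      using that by (rule inner_span_eq_0) (use m in \<open>auto simp: hyperplane_def inner_commute\<close>)
    thus "m \<in> {y\<in>span M. \<forall>x\<in>span (a ` S). orthogonal x y}" using m by (auto simp: orthogonal_def)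
  next
    fix m assume m: "m \<in> {y\<in>span M. \<forall>x\<in>span (a ` S). orthogonal x y}"
    hence "m \<bullet> a e = 0" if "e \<in> S" for e using that by (auto simp: orthogonal_def inner_commute span_base)
    thus "m \<in> {m \<in> span M. \<forall>e\<in>S. m \<in> hyperplane M a (\<lambda>_. 0) e}" using m by (auto simp: hyperplane_def)
  qed
  moreover have "dim {y\<in>span M. \<forall>x\<in>span (a ` S). orthogonal x y} + dim (span (a ` S)) = dim (span M)"
    by (rule dim_subspace_orthogonal_to_vectors[OF subspace_span subspace_span sub])
  ultimately show ?thesis unfolding arr_rank_def by simp
qed

lemma flat_iff: "flat F \<longleftrightarrow> F \<subseteq> E \<and> (\<forall>e\<in>E. a e \<in> span (a ` F) \<longrightarrow> e \<in> F)"
proof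
  assume f: "flat F"
  hence FE: "F \<subseteq> E" by (simp add: is_flat_def)
  have "e \<in> F" if e: "e \<in> E" "a e \<in> span (a ` F)" for e
  proof (rule ccontr)
    assume "e \<notin> F"
    hence "arr_rank M a (insert e F) \<noteq> arr_rank M a F" using f e(1) FE unfolding is_flat_def by auto
    moreover have "dim (a ` insert e F) = dim (a ` F)" using e(2) by (simp add: dim_insert)
    ultimately show False using FE e(1) by (simp add: arr_rank_eq)
  qed
  thus "F \<subseteq> E \<and> (\<forall>e\<in>E. a e \<in> span (a ` F) \<longrightarrow> e \<in> F)" using FE by auto
next
  assume F: "F \<subseteq> E \<and> (\<forall>e\<in>E. a e \<in> span (a ` F) \<longrightarrow> e \<in> F)"
  have "arr_rank M a S \<noteq> arr_rank M a F" if S: "F \<subset> S" "S \<subseteq> E" for S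
  proof -
    obtain e where e: "e \<in> S" "e \<notin> F" using S by auto
    hence "a e \<notin> span (a ` F)" using F S by auto
    hence "dim (insert (a e) (a ` F)) = dim (a ` F) + 1" by (simp add: dim_insert)
    moreover have "dim (insert (a e) (a ` F)) \<le> dim (a ` S)" using S e by (intro dim_subset) auto
    ultimately show ?thesis using F S by (simp add: arr_rank_eq)
  qed
  thus "flat F" using F by (auto simp: is_flat_def)
qed

lemma flat_sub: "flat F \<Longrightarrow> F \<subseteq> E" by (simp add: is_flat_def)

lemma flag_set_flag: "is_flag M E a F \<F> \<Longrightarrow> set_flag E F \<F>"
  unfolding is_flag_def by unfold_locales (auto dest: flat_sub)

lemma levels_flag:
  assumes "\<forall>G\<in>levels E w. flat G" "{e\<in>E. w e = \<infinity>} = F"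
  shows "is_flag M E a F (levels E w)"
  using assms levels_self[of E w] chain_levels[of E w] levels_sub(2)[of _ E w] by (auto simp: is_flag_def)

definition cl :: "'e set \<Rightarrow> 'e set" where "cl S = {e\<in>E. a e \<in> span (a ` S)}"

lemma cl_sub: "S \<subseteq> E \<Longrightarrow> S \<subseteq> cl S" "cl S \<subseteq> E"
  by (auto simp: cl_def span_base)

lemma span_cl: "S \<subseteq> E \<Longrightarrow> span (a ` cl S) = span (a ` S)"
proof (rule subset_antisym)
  show "span (a ` cl S) \<subseteq> span (a ` S)" by (rule span_minimal) (auto simp: cl_def)
  show "S \<subseteq> E \<Longrightarrow> span (a ` S) \<subseteq> span (a ` cl S)" by (intro span_mono image_mono cl_sub)
qed

lemma flat_cl: "S \<subseteq> E \<Longrightarrow> flat (cl S)"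
  unfolding flat_iff using span_cl cl_sub(2) by (auto simp: cl_def)

lemma cl_subset_flat: "flat G \<Longrightarrow> S \<subseteq> G \<Longrightarrow> cl S \<subseteq> G"
  unfolding flat_iff cl_def using span_mono[of "a ` S" "a ` G"] by blast

abbreviation "rk S \<equiv> dim (a ` S)"

lemma rk_cl: "S \<subseteq> E \<Longrightarrow> rk (cl S) = rk S" using span_cl dim_span by metis

lemma rk_mono: "S \<subseteq> T \<Longrightarrow> rk S \<le> rk T" by (intro dim_subset image_mono)

lemma rk_insert: "flat F \<Longrightarrow> e \<in> E \<Longrightarrow> e \<notin> F \<Longrightarrow> rk (insert e F) = rk F + 1"
  by (auto simp: flat_iff dim_insert)

lemma flat_eq_of_rk: assumes "flat F" "flat G" "F \<subseteq> G" "rk G \<le> rk F" shows "F = G"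
proof (rule ccontr)
  assume "F \<noteq> G"
  then obtain e where e: "e \<in> G" "e \<notin> F" using assms(3) by auto
  hence "rk (insert e F) = rk F + 1" using rk_insert assms flat_sub by blast
  moreover have "rk (insert e F) \<le> rk G" using e assms(3) by (intro rk_mono) auto
  ultimately show False using assms(4) by simp
qed

end

section \<open>Blocks of a flag and the dimension count\<close>

context set_flag
begin

text \<open>For a member \<open>G \<noteq> F\<close> this is the difference between \<open>G\<close>
  and the member just before it, as the union of the smaller members of a finite chain is the
  largest of them.\<close>

definition blk :: "'e set \<Rightarrow> 'e set" where "blk G = G - \<Union>{G'\<in>\<F>. G' \<subset> G}"

definition BC :: "(real^'e) set" where
  "BC = {s. supported (E - F) s \<and> (\<forall>e\<in>E - F. \<forall>f\<in>E - F. fle \<F> e f \<and> fle \<F> f e \<longrightarrow> s $ e = s $ f)}"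

lemma subspace_BC: "subspace BC"
proof (rule subspaceI)
  show "0 \<in> BC" by (simp add: BC_def supported_def)
next
  fix x y assume xy: "x \<in> BC" "y \<in> BC"
  have "(x + y) $ e = (x + y) $ f" if ef: "e \<in> E - F" "f \<in> E - F" "fle \<F> e f \<and> fle \<F> f e" for e f
  proof -
    have "x $ e = x $ f" "y $ e = y $ f" using xy ef unfolding BC_def by blast+
    thus ?thesis by simp
  qed
  moreover have "supported (E - F) (x + y)" using xy unfolding BC_def supported_def by auto
  ultimately show "x + y \<in> BC" unfolding BC_def by blast
next
  fix c x assume x: "x \<in> BC"
  have "(c *\<^sub>R x) $ e = (c *\<^sub>R x) $ f" if ef: "e \<in> E - F" "f \<in> E - F" "fle \<F> e f \<and> fle \<F> f e" for e f
  proof -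
    have "x $ e = x $ f" using x ef unfolding BC_def by blast
    thus ?thesis by simp
  qed
  moreover have "supported (E - F) (c *\<^sub>R x)" using x unfolding BC_def supported_def by auto
  ultimately show "c *\<^sub>R x \<in> BC" unfolding BC_def by blast
qed

lemma blk_fle: assumes "fle \<F> e f" "fle \<F> f e" "G \<in> \<F>" shows "e \<in> blk G \<longleftrightarrow> f \<in> blk G"
proof -
  have "e \<in> H \<longleftrightarrow> f \<in> H" if "H \<in> \<F>" for H
    using assms(1)[unfolded fle_def, rule_format, OF that] assms(2)[unfolded fle_def, rule_format, OF that] by argo
  thus ?thesis using assms(3) by (auto simp: blk_def)
qed

lemma blk_ne: assumes "G \<in> \<F>" "G \<noteq> F" shows "blk G \<noteq> {}"
proof -
  have "\<Union>{G'\<in>\<F>. G' \<subset> G} \<in> {G'\<in>\<F>. G' \<subset> G}"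
    using assms F_in sub[OF assms(1)] chain by (intro finite_chain_Union) (auto simp: chain_subset_def)
  thus ?thesis by (auto simp: blk_def)
qed

lemma blk_sub: "G \<in> \<F> \<Longrightarrow> G \<noteq> F \<Longrightarrow> blk G \<subseteq> E - F"
  unfolding blk_def using sub[of G] F_in by blast

lemma blk_disjoint: assumes "G \<in> \<F>" "G' \<in> \<F>" "e \<in> blk G" "e \<in> blk G'" shows "G = G'"
proof -
  have "G \<subseteq> G' \<or> G' \<subseteq> G" using chain assms(1,2) by (auto simp: chain_subset_def)
  thus ?thesis using assms by (auto simp: blk_def)
qed

lemma blk_cover: assumes "e \<in> E - F" shows "\<exists>G\<in>\<F> - {F}. e \<in> blk G"
proof -
  let ?g = "\<Inter>{G\<in>\<F>. e \<in> G}"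
  have "?g \<in> {G\<in>\<F>. e \<in> G}"
    using assms E_in chain by (intro finite_chain_Inter) (auto simp: chain_subset_def)
  moreover have "e \<in> blk ?g" using calculation by (auto simp: blk_def)
  ultimately show ?thesis using assms by (intro bexI[of _ ?g]) auto
qed

lemma blk_equiv: assumes "G \<in> \<F>" "e \<in> blk G" "f \<in> blk G" shows "fle \<F> e f"
  unfolding fle_def
proof (intro ballI impI)
  fix G' assume G': "G' \<in> \<F>" "f \<in> G'"
  have "G \<subseteq> G' \<or> G' \<subseteq> G" using chain assms(1) G'(1) unfolding chain_subset_def by blast
  moreover have "\<not> G' \<subset> G" using assms(3) G' by (auto simp: blk_def)
  ultimately have "G \<subseteq> G'" by blast
  thus "e \<in> G'" using assms(2) by (auto simp: blk_def)
qed

text \<open>The indicators of the blocks of the members other than \<open>F\<close> are nonzero and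
  pairwise orthogonal, hence independent; they span because a vector constant on blocks is
  determined by one value per block.\<close>

lemma dim_BC: "dim BC = card (\<F> - {F})"
proof -
  let ?v = "\<lambda>G. indicator_vec (blk G)"
  let ?B = "?v ` (\<F> - {F})"
  have ind: "?v G \<bullet> ?v G' = 0" if "G \<in> \<F> - {F}" "G' \<in> \<F> - {F}" "G \<noteq> G'" for G G'
  proof -
    have "?v G $ e * ?v G' $ e = 0" for e
      using blk_disjoint[of G G' e] that by (auto simp: indicator_vec_component)
    thus ?thesis by (simp only: inner_vec_def inner_real_def sum.neutral_const)
  qed
  have nz: "?v G \<noteq> 0" if G: "G \<in> \<F> - {F}" for G
  proof -
    obtain e where "e \<in> blk G" using blk_ne[of G] G by auto
    hence "?v G $ e = 1" by (simp add: indicator_vec_component)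
    thus ?thesis by auto
  qed
  have inj: "inj_on ?v (\<F> - {F})"
  proof (rule inj_onI, rule ccontr)
    fix G G' assume G: "G \<in> \<F> - {F}" "G' \<in> \<F> - {F}" "?v G = ?v G'" "G \<noteq> G'"
    hence "?v G \<bullet> ?v G = 0" using ind[OF G(1,2,4)] by simp
    thus False using nz[OF G(1)] by simp
  qed
  have "pairwise orthogonal ?B" using ind by (auto simp: pairwise_def orthogonal_def)
  moreover have "0 \<notin> ?B" using nz by (metis (no_types, lifting) imageE)
  ultimately have indep: "independent ?B" by (rule pairwise_orthogonal_independent)
  have "span ?B = BC"
  proof
    have "?v G \<in> BC" if "G \<in> \<F> - {F}" for G
      using that blk_sub[of G] blk_fle[of _ _ G] unfolding BC_def supported_def
      by (auto simp: indicator_vec_component)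
    thus "span ?B \<subseteq> BC" by (intro span_minimal subspace_BC) auto
    show "BC \<subseteq> span ?B"
    proof
      fix s assume s: "s \<in> BC"
      define c where "c G = s $ (SOME e. e \<in> blk G)" for G
      have cs: "c G = s $ e" if G: "G \<in> \<F> - {F}" "e \<in> blk G" for G e
      proof -
        let ?e = "SOME e. e \<in> blk G"
        have e': "?e \<in> blk G" using G(2) by (rule someI)
        have "fle \<F> ?e e" "fle \<F> e ?e" using blk_equiv G e' by auto
        moreover have "?e \<in> E - F" "e \<in> E - F" using blk_sub[of G] G e' by auto
        ultimately show ?thesis using s unfolding c_def BC_def by blast
      qed
      have "s = (\<Sum>G\<in>\<F> - {F}. c G *\<^sub>R ?v G)"
      proof (rule vec_eq_iff[THEN iffD2], rule allI)
        fix e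
        show "s $ e = (\<Sum>G\<in>\<F> - {F}. c G *\<^sub>R ?v G) $ e"
        proof (cases "e \<in> E - F")
          case True
          then obtain G0 where G0: "G0 \<in> \<F> - {F}" "e \<in> blk G0" using blk_cover by blast
          have "(\<Sum>G\<in>\<F> - {F}. c G *\<^sub>R ?v G) $ e = (\<Sum>G\<in>\<F> - {F}. if G = G0 then c G else 0)"
            unfolding sum_component using blk_disjoint G0
            by (intro sum.cong) (auto simp: indicator_vec_component)
          also have "\<dots> = s $ e" using G0 cs by simp
          finally show ?thesis by simp
        next
          case False
          have "(\<Sum>G\<in>\<F> - {F}. c G *\<^sub>R ?v G) $ e = 0"
            unfolding sum_component using blk_sub False
            by (intro sum.neutral) (auto simp: indicator_vec_component)
          thus ?thesis using s False by (simp add: BC_def supported_def)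
        qed
      qed
      also have "\<dots> \<in> span ?B" by (intro span_sum span_scale span_base) auto
      finally show "s \<in> span ?B" .
    qed
  qed
  hence "dim BC = dim ?B" by (metis dim_span)
  also have "\<dots> = card ?B" using indep by (rule dim_eq_card_independent)
  also have "\<dots> = card (\<F> - {F})" by (rule card_image[OF inj])
  finally show ?thesis .
qed

lemma flag_length_eq: "flag_length \<F> = card (\<F> - {F})"
  using F_in by (simp add: flag_length_def)

end

section \<open>The cones in a stratum\<close>

context arrangement
begin

text \<open>The stratum of the cone of \<open>(S, m)\<close>, realised as the orthogonal complement
  of the cone (\<open>W_quot\<close>); the pairing with the rays turns this into vanishing
  coordinates.\<close>

definition W :: "'e set \<Rightarrow> 'm \<Rightarrow> ((real^'e) \<times> (real^'e)) set" where
  "W S m = {y\<in>VN. (\<forall>e\<in>PP S m. fst y $ e = 0) \<and> (\<forall>e\<in>QQ S m. snd y $ e = 0)}"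

lemma W_orthogonal: "y \<in> W S m \<longleftrightarrow> y \<in> VN \<and> (\<forall>x\<in>lcone S m. x \<bullet> y = 0)"
  by (cases "y \<in> VN") (simp_all add: W_def pcone_orthogonal_iff)

lemma W_quot: assumes "S \<subseteq> E" shows "quot_map (lcone S m) ` span N = W S m"
proof (rule set_eqI)
  fix y show "y \<in> quot_map (lcone S m) ` span N \<longleftrightarrow> y \<in> W S m"
    using quot_fan_iff[OF order_trans[OF PP_sub assms] order_trans[OF QQ_sub assms]] W_orthogonal by simp
qed

lemma subspace_W: "subspace (W S m)"
  using subspace_VN unfolding W_def subspace_def by simp

text \<open>The indices in both \<open>PP S m\<close> and \<open>QQ S m\<close> are the hyperplanes
  that contain the face, so this is the direction space of its affine hull.\<close>

definition KK :: "'e set \<Rightarrow> 'm \<Rightarrow> 'm set" where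
  "KK S m = {n\<in>span M. \<forall>e\<in>PP S m \<inter> QQ S m. n \<bullet> a e = 0}"

lemma subspace_KK: "subspace (KK S m)"
  unfolding KK_def subspace_def by (auto simp: span_zero span_add span_scale inner_simps)

text \<open>A stratum is the product of the lineality space of the face with the space of the values of the
  coordinates outside \<open>S\<close>.\<close>

definition Psi :: "'e set \<Rightarrow> 'm \<Rightarrow> 'm \<times> (real^'e) \<Rightarrow> (real^'e) \<times> (real^'e)" where
  "Psi S m x = ((\<chi> e. if e \<in> S then (if e \<in> PP S m then 0 else fst x \<bullet> a e)
                       else if e \<in> E then (snd x $ e + fst x \<bullet> a e) / 2 else 0),
                (\<chi> e. if e \<in> S then (if e \<in> PP S m then - (fst x \<bullet> a e) else 0)
                       else if e \<in> E then (snd x $ e - fst x \<bullet> a e) / 2 else 0))"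

lemma linear_Psi: "linear (Psi S m)"
  by (rule linearI) (auto simp: Psi_def vec_eq_iff inner_simps field_simps)

lemma Psi_W:
  assumes "S \<subseteq> E" "n \<in> KK S m" shows "Psi S m (n, s) \<in> W S m"
proof -
  have "Psi S m (n, s) \<in> VN"
    by (rule VN_I[of _ n]) (use assms in \<open>auto simp: supported_def Psi_def KK_def field_simps\<close>)
  moreover have "fst (Psi S m (n, s)) $ e = 0" if "e \<in> PP S m" for e
    using that PP_sub[of S m] by (auto simp: Psi_def)
  moreover have "snd (Psi S m (n, s)) $ e = 0" if "e \<in> QQ S m" for e
    using that QQ_sub[of S m] assms(2) by (auto simp: Psi_def KK_def)
  ultimately show ?thesis by (simp add: W_def)
qed

lemma Psi_phi: "e \<in> E - S \<Longrightarrow> lawrence_phi (Psi S m x) $ e = snd x $ e"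
  by (auto simp: Psi_def lawrence_phi_component field_simps)

definition proj_off :: "'e set \<Rightarrow> real^'e \<Rightarrow> real^'e" where
  "proj_off S z = (\<chi> e. if e \<in> E - S then z $ e else 0)"

lemma supported_proj_off: "supported (E - S) (proj_off S z)" by (simp add: supported_def proj_off_def)

lemma Psi_surj:
  assumes S: "S \<subseteq> E" and y: "y \<in> W S m"
  shows "\<exists>n\<in>KK S m. y = Psi S m (n, proj_off S (lawrence_phi y))"
proof -
  have yV: "y \<in> VN" and y0: "\<forall>e\<in>PP S m. fst y $ e = 0" "\<forall>e\<in>QQ S m. snd y $ e = 0" using y by (auto simp: W_def)
  obtain n where n: "n \<in> span M" "\<forall>e\<in>E. fst y $ e - snd y $ e = n \<bullet> a e" using VN_functional[OF yV] by blast
  have "n \<bullet> a e = 0" if "e \<in> PP S m \<inter> QQ S m" for e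
    using that y0 n(2) S PP_sub[of S m] by force
  hence "n \<in> KK S m" using n(1) by (simp add: KK_def)
  moreover have "fst y $ e = fst (Psi S m (n, proj_off S (lawrence_phi y))) $ e \<and>
      snd y $ e = snd (Psi S m (n, proj_off S (lawrence_phi y))) $ e" for e
  proof (cases "e \<in> S")
    case True
    hence eE: "e \<in> E" using S by auto
    show ?thesis
    proof (cases "e \<in> PP S m")
      case t: True thus ?thesis using True y0(1) n(2) eE by (auto simp: Psi_def)
    next
      case False
      hence "e \<in> QQ S m" using True PP_Un_QQ[of S m] by auto
      hence "snd y $ e = 0" "fst y $ e = n \<bullet> a e" using y0(2) n(2) eE by force+
      thus ?thesis using True False by (simp add: Psi_def)
    qed
  next
    case False
    show ?thesis
    proof (cases "e \<in> E")
      case True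
      hence "fst y $ e - snd y $ e = n \<bullet> a e" using n(2) by blast
      thus ?thesis using False True by (simp add: Psi_def proj_off_def lawrence_phi_component)
    next
      case f: False
      thus ?thesis using False VN_supported[OF yV, of e] by (simp add: Psi_def)
    qed
  qed
  hence "y = Psi S m (n, proj_off S (lawrence_phi y))" by (simp add: prod_eq_iff vec_eq_iff)
  ultimately show ?thesis by blast
qed

lemma Psi_kernel:
  assumes "S \<subseteq> E" "n \<in> KK S m" "supported (E - S) s" "Psi S m (n, s) = 0"
  shows "n = 0 \<and> s = 0"
proof -
  have z: "fst (Psi S m (n, s)) $ e = 0" "snd (Psi S m (n, s)) $ e = 0" for e by (simp_all add: assms(4))
  have "n \<bullet> a e = 0" if "e \<in> E" for e
    using z[of e] that assms(1) by (auto simp: Psi_def split: if_splits)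
  hence "n = 0" using assms(2) by (intro orthogonal_a_zero) (auto simp: KK_def)
  moreover have "s $ e = 0" for e
    using Psi_phi[of e S m "(n, s)"] assms(3,4) by (cases "e \<in> E - S") (simp_all add: lawrence_phi_def supported_def)
  ultimately show ?thesis by (simp add: vec_eq_iff)
qed

lemma dim_Psi_image:
  assumes S: "S \<subseteq> E" and T: "subspace T" "\<And>s. s \<in> T \<Longrightarrow> supported (E - S) s"
  shows "dim {y\<in>W S m. proj_off S (lawrence_phi y) \<in> T} = dim (KK S m) + dim T"
proof -
  have sub: "subspace (KK S m \<times> T)" using subspace_KK T(1) by (rule subspace_Times)
  have "{y\<in>W S m. proj_off S (lawrence_phi y) \<in> T} = Psi S m ` (KK S m \<times> T)"
  proof (intro equalityI subsetI)
    fix y assume y: "y \<in> {y\<in>W S m. proj_off S (lawrence_phi y) \<in> T}"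
    then obtain n where n: "n \<in> KK S m" "y = Psi S m (n, proj_off S (lawrence_phi y))" using Psi_surj[OF S] by blast
    have "(n, proj_off S (lawrence_phi y)) \<in> KK S m \<times> T" using n(1) y by simp
    thus "y \<in> Psi S m ` (KK S m \<times> T)" using n(2) by (rule rev_image_eqI)
  next
    fix y assume "y \<in> Psi S m ` (KK S m \<times> T)"
    then obtain n s where ns: "n \<in> KK S m" "s \<in> T" "y = Psi S m (n, s)" by blast
    have "proj_off S (lawrence_phi y) = s"
      using T(2)[OF ns(2)] Psi_phi[of _ S m "(n, s)"] unfolding ns(3) proj_off_def supported_def vec_eq_iff by simp
    thus "y \<in> {y\<in>W S m. proj_off S (lawrence_phi y) \<in> T}" using ns Psi_W[OF S ns(1)] by simp
  qed
  moreover have "inj_on (Psi S m) (span (KK S m \<times> T))"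
    unfolding span_eq_iff[THEN iffD2, OF sub] linear_inj_on_iff_eq_0[OF linear_Psi sub]
    using Psi_kernel[OF S] T(2) by (auto simp: zero_prod_def)
  ultimately have "dim {y\<in>W S m. proj_off S (lawrence_phi y) \<in> T} = dim (KK S m \<times> T)"
    using dim_image_eq[OF linear_Psi] by metis
  also have "\<dots> = dim (KK S m) + dim T" using subspace_KK T(1) by (rule dim_Times)
  finally show ?thesis .
qed

text \<open>The strict inequalities are open conditions, so the face is a nonempty relatively open
  part of the affine space \<open>L\<close>, a translate of \<open>KK S m\<close>.\<close>

lemma aff_dim_face_at:
  assumes m: "m \<in> span M" shows "aff_dim (face_at S m) = int (dim (KK S m))"
proof -
  define L where "L = {x\<in>span M. \<forall>e\<in>PP S m \<inter> QQ S m. ht e x = 0}"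
  define U where "U = (\<Inter>e\<in>{e\<in>S. ht e m < 0}. {x. ht e x < 0}) \<inter> (\<Inter>e\<in>{e\<in>S. 0 < ht e m}. {x. 0 < ht e x})"
  have "open {x. ht e x < 0}" "open {x. 0 < ht e x}" for e
    unfolding ht_def by (intro open_Collect_less continuous_intros)+
  hence U: "open U" unfolding U_def by (intro open_Int open_INT ballI) auto
  have htm: "ht e m = 0" if "e \<in> PP S m \<inter> QQ S m" for e using that by (auto simp: PP_def QQ_def)
  have L: "L = (+) m ` KK S m"
  proof (intro equalityI subsetI)
    fix x assume x: "x \<in> L"
    have "(x - m) \<bullet> a e = 0" if "e \<in> PP S m \<inter> QQ S m" for e
      using htm[OF that] x that by (auto simp: L_def simp flip: ht_diff)
    hence "x - m \<in> KK S m" using x m by (auto simp: KK_def L_def span_diff)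
    thus "x \<in> (+) m ` KK S m" by (intro image_eqI[of _ _ "x - m"]) auto
  next
    fix x assume "x \<in> (+) m ` KK S m"
    then obtain n where n: "n \<in> KK S m" "x = m + n" by auto
    thus "x \<in> L" using htm m by (auto simp: L_def KK_def ht_def span_add inner_simps)
  qed
  have face: "face_at S m = L \<inter> U"
  proof (intro equalityI subsetI)
    fix x assume x: "x \<in> face_at S m"
    hence sg: "sgn (ht e x) = sgn (ht e m)" if "e \<in> S" for e using that by (auto simp: face_at_def)
    have "ht e x = 0" if "e \<in> PP S m \<inter> QQ S m" for e
      using sg[of e] that htm[OF that] by (auto simp: PP_def sgn_0_0)
    moreover have "ht e x < 0 \<longleftrightarrow> ht e m < 0" "0 < ht e x \<longleftrightarrow> 0 < ht e m" if "e \<in> S" for e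
      using sg[OF that] by (auto simp: sgn_if split: if_splits)
    ultimately show "x \<in> L \<inter> U" using x by (auto simp: L_def U_def face_at_def)
  next
    fix x assume x: "x \<in> L \<inter> U"
    have "sgn (ht e x) = sgn (ht e m)" if e: "e \<in> S" for e
    proof -
      consider "ht e m < 0" | "ht e m = 0" | "0 < ht e m" by linarith
      thus ?thesis
      proof cases
        case 1 hence "ht e x < 0" using x e by (auto simp: U_def)
        thus ?thesis using 1 by simp
      next
        case 2 hence "e \<in> PP S m \<inter> QQ S m" using e by (auto simp: PP_def QQ_def)
        thus ?thesis using 2 x by (auto simp: L_def)
      next
        case 3 hence "0 < ht e x" using x e by (auto simp: U_def)
        thus ?thesis using 3 by simp
      qed
    qed
    thus "x \<in> face_at S m" using x by (auto simp: face_at_def L_def)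
  qed
  have "convex L" unfolding L by (intro convex_translation subspace_imp_convex subspace_KK)
  moreover have "L \<inter> U \<noteq> {}" using face face_at_refl[OF m] by blast
  ultimately have "affine hull (face_at S m) = affine hull L"
    unfolding face using U by (intro affine_hull_convex_Int_open)
  hence "aff_dim (face_at S m) = aff_dim L" by (rule aff_dim_affine_hull2)
  also have "\<dots> = int (dim (KK S m))" unfolding L aff_dim_translation_eq by (rule aff_dim_subspace[OF subspace_KK])
  finally show ?thesis .
qed

text \<open>The cone of \<open>(F, R, \<F>)\<close> in the paper, for the face \<open>R\<close> of the localization at \<open>F\<close> that contains \<open>m\<close>, is
  \<open>HC F m \<F>\<close>.\<close>

definition HC :: "'e set \<Rightarrow> 'm \<Rightarrow> 'e set set \<Rightarrow> ((real^'e) \<times> (real^'e)) set" where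
  "HC S m \<F> = {y\<in>W S m. levels E (wv S (lawrence_phi y)) \<subseteq> \<F>}"

text \<open>The linear hull of \<open>HC S m \<F>\<close> for a flag (\<open>span_HC\<close>): of
  the order inequalities only those that hold in both directions survive, as equations.\<close>

definition VF :: "'e set \<Rightarrow> 'm \<Rightarrow> 'e set set \<Rightarrow> ((real^'e) \<times> (real^'e)) set" where
  "VF S m \<F> = {y\<in>W S m. \<forall>e\<in>E - S. \<forall>f\<in>E - S. fle \<F> e f \<and> fle \<F> f e \<longrightarrow> lawrence_phi y $ e = lawrence_phi y $ f}"

lemma HC_iff:
  assumes "set_flag E S \<F>"
  shows "y \<in> HC S m \<F> \<longleftrightarrow> y \<in> W S m \<and>
    (\<forall>e\<in>E - S. \<forall>f\<in>E - S. fle \<F> e f \<longrightarrow> lawrence_phi y $ f \<le> lawrence_phi y $ e)"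
  unfolding HC_def by (simp add: set_flag.fle_mono_iff[OF assms])

lemma phi_add: "lawrence_phi (x + y) $ e = lawrence_phi x $ e + lawrence_phi y $ e"
  and phi_scale: "lawrence_phi (c *\<^sub>R x) $ e = c * lawrence_phi x $ e"
  and phi_diff: "lawrence_phi (x - y) $ e = lawrence_phi x $ e - lawrence_phi y $ e"
  and phi_zero: "lawrence_phi 0 $ e = 0"
  by (simp_all add: lawrence_phi_component algebra_simps)

lemma HC_zero: assumes "set_flag E S \<F>" shows "0 \<in> HC S m \<F>"
  unfolding HC_iff[OF assms] by (simp add: subspace_0[OF subspace_W] phi_zero)

lemma HC_add: assumes "set_flag E S \<F>" "x \<in> HC S m \<F>" "y \<in> HC S m \<F>" shows "x + y \<in> HC S m \<F>"
  using assms(2,3) unfolding HC_iff[OF assms(1)] by (simp add: subspace_add[OF subspace_W] phi_add add_mono)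

lemma HC_scale: assumes "set_flag E S \<F>" "x \<in> HC S m \<F>" "0 \<le> c" shows "c *\<^sub>R x \<in> HC S m \<F>"
  using assms(2,3) unfolding HC_iff[OF assms(1)] by (simp add: subspace_scale[OF subspace_W] phi_scale mult_left_mono)

lemma convex_HC: assumes "set_flag E S \<F>" shows "convex (HC S m \<F>)"
  using HC_add[OF assms] HC_scale[OF assms] unfolding convex_def by simp

lemma convex_cone_HC: assumes "set_flag E S \<F>" shows "convex_cone (HC S m \<F>)"
  unfolding convex_cone_def conic_def using convex_HC[OF assms] HC_zero[OF assms] HC_scale[OF assms] by blast

lemma W_with_phi:
  assumes "S \<subseteq> E" shows "\<exists>y\<in>W S m. \<forall>e\<in>E - S. lawrence_phi y $ e = s $ e"
proof -
  have "0 \<in> KK S m" by (rule subspace_0[OF subspace_KK])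
  thus ?thesis using Psi_W[OF assms, of 0 m s] Psi_phi[of _ S m "(0, s)"] by (intro bexI[of _ "Psi S m (0, s)"]) auto
qed

lemma wv_cong: "(\<And>e. e \<in> E - S \<Longrightarrow> z $ e = z' $ e) \<Longrightarrow> levels E (wv S z) = levels E (wv S z')"
  by (rule levels_cong) (auto simp: wv_def)

lemma HC_strict_ex:
  assumes "set_flag E S \<F>" shows "\<exists>y\<in>W S m. levels E (wv S (lawrence_phi y)) = \<F>"
proof -
  interpret set_flag E S \<F> by fact
  obtain y where y: "y \<in> W S m" "\<forall>e\<in>E - S. lawrence_phi y $ e = (\<chi> e. real (card {G\<in>\<F>. e \<in> G})) $ e"
    using W_with_phi[OF F_sub, of m "\<chi> e. real (card {G\<in>\<F>. e \<in> G})"] by blast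
  have "levels E (wv S (lawrence_phi y)) = levels E (wv S (\<chi> e. real (card {G\<in>\<F>. e \<in> G})))"
    by (rule wv_cong) (use y(2) in blast)
  thus ?thesis using y(1) strict_vector by auto
qed

lemma subspace_VF: "subspace (VF S m \<F>)"
proof (rule subspaceI)
  show "0 \<in> VF S m \<F>" by (simp add: VF_def subspace_0[OF subspace_W] phi_zero)
next
  fix x y assume xy: "x \<in> VF S m \<F>" "y \<in> VF S m \<F>"
  have "lawrence_phi (x + y) $ e = lawrence_phi (x + y) $ f"
    if ef: "e \<in> E - S" "f \<in> E - S" "fle \<F> e f \<and> fle \<F> f e" for e f
  proof -
    have "lawrence_phi x $ e = lawrence_phi x $ f" "lawrence_phi y $ e = lawrence_phi y $ f"
      using xy ef unfolding VF_def by blast+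
    thus ?thesis by (simp add: phi_add)
  qed
  moreover have "x + y \<in> W S m" using xy by (intro subspace_add[OF subspace_W]) (simp_all add: VF_def)
  ultimately show "x + y \<in> VF S m \<F>" unfolding VF_def by blast
next
  fix c x assume x: "x \<in> VF S m \<F>"
  have "lawrence_phi (c *\<^sub>R x) $ e = lawrence_phi (c *\<^sub>R x) $ f"
    if ef: "e \<in> E - S" "f \<in> E - S" "fle \<F> e f \<and> fle \<F> f e" for e f
  proof -
    have "lawrence_phi x $ e = lawrence_phi x $ f" using x ef unfolding VF_def by blast
    thus ?thesis by (simp add: phi_scale)
  qed
  moreover have "c *\<^sub>R x \<in> W S m" using x by (intro subspace_scale[OF subspace_W]) (simp add: VF_def)
  ultimately show "c *\<^sub>R x \<in> VF S m \<F>" unfolding VF_def by blast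
qed

lemma HC_subset_VF: assumes "set_flag E S \<F>" shows "HC S m \<F> \<subseteq> VF S m \<F>"
proof
  fix y assume y: "y \<in> HC S m \<F>"
  have "lawrence_phi y $ e = lawrence_phi y $ f" if "e \<in> E - S" "f \<in> E - S" "fle \<F> e f \<and> fle \<F> f e" for e f
    using y that unfolding HC_iff[OF assms] by (meson antisym)
  thus "y \<in> VF S m \<F>" using y unfolding VF_def HC_def by blast
qed

lemma HC_of_VF:
  assumes "set_flag E S \<F>" "y \<in> VF S m \<F>"
    "\<And>e f. e \<in> E - S \<Longrightarrow> f \<in> E - S \<Longrightarrow> \<not> fle \<F> f e \<Longrightarrow> lawrence_phi y $ f \<le> lawrence_phi y $ e"
  shows "y \<in> HC S m \<F>"
  unfolding HC_iff[OF assms(1)]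
proof (intro conjI ballI impI)
  show "y \<in> W S m" using assms(2) by (simp add: VF_def)
  fix e f assume ef: "e \<in> E - S" "f \<in> E - S" "fle \<F> e f"
  show "lawrence_phi y $ f \<le> lawrence_phi y $ e"
  proof (cases "fle \<F> f e")
    case True
    hence "lawrence_phi y $ e = lawrence_phi y $ f" using ef assms(2) unfolding VF_def by blast
    thus ?thesis by simp
  qed (use assms(3) ef in blast)
qed

lemma HC_strict:
  assumes "set_flag E S \<F>" "y \<in> W S m" "levels E (wv S (lawrence_phi y)) = \<F>"
  shows "y \<in> HC S m \<F>" "e \<in> E - S \<Longrightarrow> f \<in> E - S \<Longrightarrow> \<not> fle \<F> f e \<Longrightarrow> lawrence_phi y $ f < lawrence_phi y $ e"
  using assms(2,3) set_flag.strict_iff[OF assms(1)] unfolding HC_def by auto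

text \<open>Adding a large multiple of a vector with strict inequalities moves any vector of
  \<open>VF S m \<F>\<close> into the cone, so it is a difference of two cone vectors.
  \<open>K\<close> bounds the ratios between the gaps of \<open>y\<close> and those of
  \<open>y0\<close>.\<close>

lemma span_HC: assumes "set_flag E S \<F>" shows "span (HC S m \<F>) = VF S m \<F>"
proof
  show "span (HC S m \<F>) \<subseteq> VF S m \<F>" using HC_subset_VF[OF assms] subspace_VF by (rule span_minimal)
  show "VF S m \<F> \<subseteq> span (HC S m \<F>)"
  proof
    fix y assume y: "y \<in> VF S m \<F>"
    obtain y0 where y0: "y0 \<in> W S m" "levels E (wv S (lawrence_phi y0)) = \<F>" using HC_strict_ex[OF assms] by blast
    have y0H: "y0 \<in> HC S m \<F>" by (rule HC_strict(1)[OF assms y0])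
    define I where "I = {(e, f). e \<in> E - S \<and> f \<in> E - S \<and> \<not> fle \<F> f e}"
    define D where "D z p = lawrence_phi z $ fst p - lawrence_phi z $ snd p" for z and p :: "'e \<times> 'e"
    define K where "K = (\<Sum>p\<in>I. \<bar>D y p\<bar> / D y0 p)"
    have pos: "0 < D y0 p" if "p \<in> I" for p
      using that HC_strict(2)[OF assms y0, of "fst p" "snd p"] by (auto simp: I_def D_def)
    have K: "\<bar>D y p\<bar> \<le> K * D y0 p" if p: "p \<in> I" for p
    proof -
      have "\<bar>D y p\<bar> / D y0 p \<le> K" unfolding K_def
        using p by (intro member_le_sum[of p I "\<lambda>p. \<bar>D y p\<bar> / D y0 p"]) (auto intro!: divide_nonneg_pos pos)
      thus ?thesis using pos[OF p] by (simp add: pos_divide_le_eq)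
    qed
    have K0: "0 \<le> K" unfolding K_def by (intro sum_nonneg divide_nonneg_pos pos) auto
    have "K *\<^sub>R y0 + y \<in> HC S m \<F>"
    proof (rule HC_of_VF[OF assms])
      show "K *\<^sub>R y0 + y \<in> VF S m \<F>" using y y0H HC_subset_VF[OF assms]
        by (intro subspace_add subspace_scale subspace_VF) blast+
      fix e f assume "e \<in> E - S" "f \<in> E - S" "\<not> fle \<F> f e"
      hence "\<bar>D y (e, f)\<bar> \<le> K * D y0 (e, f)" by (intro K) (simp add: I_def)
      thus "lawrence_phi (K *\<^sub>R y0 + y) $ f \<le> lawrence_phi (K *\<^sub>R y0 + y) $ e"
        unfolding D_def phi_add phi_scale by (auto simp: algebra_simps)
    qed
    hence "(K *\<^sub>R y0 + y) - K *\<^sub>R y0 \<in> span (HC S m \<F>)"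
      using y0H by (intro span_diff span_scale span_base)
    thus "y \<in> span (HC S m \<F>)" by simp
  qed
qed

lemma dim_HC:
  assumes "set_flag E S \<F>" shows "dim (HC S m \<F>) = dim (KK S m) + flag_length \<F>"
proof -
  interpret set_flag E S \<F> by fact
  have "VF S m \<F> = {y\<in>W S m. proj_off S (lawrence_phi y) \<in> BC}"
  proof (rule set_eqI)
    fix y
    have "proj_off S (lawrence_phi y) $ e = lawrence_phi y $ e" if "e \<in> E - S" for e
      using that by (simp add: proj_off_def)
    hence "(\<forall>e\<in>E - S. \<forall>f\<in>E - S. fle \<F> e f \<and> fle \<F> f e \<longrightarrow> proj_off S (lawrence_phi y) $ e = proj_off S (lawrence_phi y) $ f) \<longleftrightarrow>
      (\<forall>e\<in>E - S. \<forall>f\<in>E - S. fle \<F> e f \<and> fle \<F> f e \<longrightarrow> lawrence_phi y $ e = lawrence_phi y $ f)"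
      by metis
    thus "y \<in> VF S m \<F> \<longleftrightarrow> y \<in> {y\<in>W S m. proj_off S (lawrence_phi y) \<in> BC}"
      unfolding VF_def BC_def mem_Collect_eq using supported_proj_off by blast
  qed
  moreover have "dim {y\<in>W S m. proj_off S (lawrence_phi y) \<in> BC} = dim (KK S m) + dim BC"
    by (rule dim_Psi_image[OF F_sub subspace_BC]) (simp add: BC_def)
  ultimately show ?thesis using span_HC[OF assms, of m] dim_BC flag_length_eq dim_span by metis
qed

lemma aff_dim_HC: assumes "set_flag E S \<F>" shows "aff_dim (HC S m \<F>) = int (dim (HC S m \<F>))"
  using HC_zero[OF assms] by (intro aff_dim_zero hull_inc)

text \<open>At a relative interior point the segment coming from a strict point \<open>y0\<close>
  can be prolonged inside the cone, which bounds the gaps at \<open>y\<close> below by positive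
  multiples of those at \<open>y0\<close>. Conversely, strict inequalities are open, and the
  remaining conditions are equations that hold on the affine hull.\<close>

lemma rel_interior_HC:
  assumes fl: "set_flag E S \<F>"
  shows "rel_interior (HC S m \<F>) = {y\<in>W S m. levels E (wv S (lawrence_phi y)) = \<F>}"
proof (intro equalityI subsetI)
  fix y assume y: "y \<in> rel_interior (HC S m \<F>)"
  hence yH: "y \<in> HC S m \<F>" using rel_interior_subset by blast
  obtain y0 where y0: "y0 \<in> W S m" "levels E (wv S (lawrence_phi y0)) = \<F>" using HC_strict_ex[OF fl] by blast
  have "y0 \<in> affine hull HC S m \<F>" by (rule hull_inc[OF HC_strict(1)[OF fl y0]])
  then obtain c where c: "c > 1" "(1 - c) *\<^sub>R y0 + c *\<^sub>R y \<in> HC S m \<F>"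
    using convex_rel_interior_if[OF convex_HC[OF fl] y] by (metis order_refl)
  have "lawrence_phi y $ f < lawrence_phi y $ e" if ef: "e \<in> E - S" "f \<in> E - S" "\<not> fle \<F> f e" for e f
  proof -
    have "fle \<F> e f" using fle_total[OF set_flag.chain[OF fl]] ef(3) by blast
    hence "lawrence_phi ((1 - c) *\<^sub>R y0 + c *\<^sub>R y) $ f \<le> lawrence_phi ((1 - c) *\<^sub>R y0 + c *\<^sub>R y) $ e"
      using c(2) ef unfolding HC_iff[OF fl] by blast
    hence "(c - 1) * (lawrence_phi y0 $ e - lawrence_phi y0 $ f) \<le> c * (lawrence_phi y $ e - lawrence_phi y $ f)"
      unfolding phi_add phi_scale by (simp add: algebra_simps)
    moreover have "0 < (c - 1) * (lawrence_phi y0 $ e - lawrence_phi y0 $ f)"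
      using c(1) HC_strict(2)[OF fl y0 ef] by (intro mult_pos_pos) auto
    ultimately have "0 < c * (lawrence_phi y $ e - lawrence_phi y $ f)" by linarith
    thus ?thesis using c(1) by (simp add: zero_less_mult_iff)
  qed
  thus "y \<in> {y\<in>W S m. levels E (wv S (lawrence_phi y)) = \<F>}"
    using yH set_flag.strict_iff[OF fl] unfolding HC_def by simp
next
  fix y assume "y \<in> {y\<in>W S m. levels E (wv S (lawrence_phi y)) = \<F>}"
  hence y: "y \<in> W S m" "levels E (wv S (lawrence_phi y)) = \<F>" by auto
  define I where "I = {(e, f). e \<in> E - S \<and> f \<in> E - S \<and> \<not> fle \<F> f e}"
  define T where "T = (\<Inter>p\<in>I. {z. lawrence_phi z $ snd p < lawrence_phi z $ fst p})"
  have "open {z. lawrence_phi z $ f < lawrence_phi z $ e}" for e f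
    unfolding lawrence_phi_def by (intro open_Collect_less continuous_intros)
  hence "open T" unfolding T_def by (intro open_INT ballI) auto
  moreover have "y \<in> T" using HC_strict(2)[OF fl y] by (auto simp: T_def I_def)
  moreover have "T \<inter> affine hull HC S m \<F> \<subseteq> HC S m \<F>"
  proof
    fix z assume z: "z \<in> T \<inter> affine hull HC S m \<F>"
    have "affine hull HC S m \<F> \<subseteq> VF S m \<F>"
      using HC_subset_VF[OF fl] subspace_imp_affine[OF subspace_VF] by (intro hull_minimal)
    hence "z \<in> VF S m \<F>" using z by blast
    moreover have "lawrence_phi z $ f \<le> lawrence_phi z $ e" if "e \<in> E - S" "f \<in> E - S" "\<not> fle \<F> f e" for e f
      using z that by (force simp: T_def I_def)
    ultimately show "z \<in> HC S m \<F>" by (intro HC_of_VF[OF fl])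
  qed
  ultimately show "y \<in> rel_interior (HC S m \<F>)" using HC_strict(1)[OF fl y] unfolding mem_rel_interior by blast
qed

lemma HC_mono: "\<F>' \<subseteq> \<F> \<Longrightarrow> HC S m \<F>' \<subseteq> HC S m \<F>" by (auto simp: HC_def)

lemma HC_Int: "HC S m \<F> \<inter> HC S m \<F>' = HC S m (\<F> \<inter> \<F>')" by (auto simp: HC_def)

lemma HC_subset_iff:
  assumes "set_flag E S \<F>'" shows "HC S m \<F>' \<subseteq> HC S m \<F> \<longleftrightarrow> \<F>' \<subseteq> \<F>"
proof
  assume *: "HC S m \<F>' \<subseteq> HC S m \<F>"
  obtain y0 where y0: "y0 \<in> W S m" "levels E (wv S (lawrence_phi y0)) = \<F>'" using HC_strict_ex[OF assms] by blast
  hence "y0 \<in> HC S m \<F>" using * HC_strict(1)[OF assms y0] by blast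
  thus "\<F>' \<subseteq> \<F>" using y0 by (simp add: HC_def)
qed (rule HC_mono)

text \<open>The supporting functional adds up the differences over all pairs that
  \<open>\<F>\<close> orders and \<open>\<F>'\<close> orders the other way round as well. Each
  difference is nonnegative on the larger cone, so the sum vanishes exactly if all these pairs have
  equal values.\<close>

lemma HC_face_of:
  assumes fl: "set_flag E S \<F>" "set_flag E S \<F>'" and sub: "\<F>' \<subseteq> \<F>"
  shows "HC S m \<F>' face_of HC S m \<F>"
proof -
  define I where "I = {(e, f). e \<in> E - S \<and> f \<in> E - S \<and> fle \<F> e f \<and> fle \<F>' f e}"
  define u where "u = (\<Sum>p\<in>I. unit_char (fst p) - unit_char (snd p))"
  have uy: "u \<bullet> y = (\<Sum>p\<in>I. lawrence_phi y $ fst p - lawrence_phi y $ snd p)" for y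
  proof -
    have "u \<bullet> y = y \<bullet> u" by (rule inner_commute)
    thus ?thesis by (simp add: u_def inner_sum_right inner_diff_right inner_unit_char)
  qed
  have term_nonneg: "0 \<le> lawrence_phi y $ fst p - lawrence_phi y $ snd p" if "y \<in> HC S m \<F>" "p \<in> I" for y p
    using that unfolding HC_iff[OF fl(1)] by (auto simp: I_def)
  have "0 \<le> u \<bullet> y" if "y \<in> HC S m \<F>" for y unfolding uy using term_nonneg[OF that] by (intro sum_nonneg)
  hence "(HC S m \<F> \<inter> {y. u \<bullet> y = 0}) face_of HC S m \<F>"
    by (intro face_of_Int_supporting_hyperplane_ge convex_HC[OF fl(1)])
  moreover have "HC S m \<F> \<inter> {y. u \<bullet> y = 0} = HC S m \<F>'"
  proof (intro equalityI subsetI)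
    fix y assume y: "y \<in> HC S m \<F> \<inter> {y. u \<bullet> y = 0}"
    hence yH: "y \<in> HC S m \<F>" and s0: "(\<Sum>p\<in>I. lawrence_phi y $ fst p - lawrence_phi y $ snd p) = 0" using uy by auto
    have z: "lawrence_phi y $ fst p - lawrence_phi y $ snd p = 0" if "p \<in> I" for p
    proof -
      have "\<forall>p\<in>I. lawrence_phi y $ fst p - lawrence_phi y $ snd p = 0"
        using s0 by (subst (asm) sum_nonneg_eq_0_iff) (use term_nonneg[OF yH] in auto)
      thus ?thesis using that by blast
    qed
    show "y \<in> HC S m \<F>'" unfolding HC_iff[OF fl(2)]
    proof (intro conjI ballI impI)
      show "y \<in> W S m" using yH by (simp add: HC_def)
      fix e f assume ef: "e \<in> E - S" "f \<in> E - S" "fle \<F>' e f"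
      show "lawrence_phi y $ f \<le> lawrence_phi y $ e"
      proof (cases "fle \<F> e f")
        case True thus ?thesis using yH ef unfolding HC_iff[OF fl(1)] by blast
      next
        case False
        hence "(f, e) \<in> I" using fle_total[OF set_flag.chain[OF fl(1)], of e f] ef by (auto simp: I_def)
        thus ?thesis using z[of "(f, e)"] by simp
      qed
    qed
  next
    fix y assume y: "y \<in> HC S m \<F>'"
    have "lawrence_phi y $ fst p - lawrence_phi y $ snd p = 0" if p: "p \<in> I" for p
    proof -
      have ef: "fst p \<in> E - S" "snd p \<in> E - S" "fle \<F> (fst p) (snd p)" "fle \<F>' (snd p) (fst p)"
        using p by (auto simp: I_def)
      have "fle \<F>' (fst p) (snd p)" using ef(3) sub by (auto simp: fle_def)
      thus ?thesis using y ef unfolding HC_iff[OF fl(2)] by (simp add: antisym)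
    qed
    hence "u \<bullet> y = 0" unfolding uy by (intro sum.neutral) blast
    thus "y \<in> HC S m \<F> \<inter> {y. u \<bullet> y = 0}" using y HC_mono[OF sub] by blast
  qed
  ultimately show ?thesis by simp
qed

lemma levels_set_flag: "S \<subseteq> E \<Longrightarrow> set_flag E S (levels E (wv S z))"
  using levels_self[of E "wv S z"] levels_sub[of _ E "wv S z"] chain_levels wv_PInf[of S E z]
  by unfold_locales auto

text \<open>A relative interior point \<open>y\<close> of the face lies in the relative interior of
  the cone of its own superlevel sets, which is a face too; two faces whose relative interiors meet
  coincide.\<close>

lemma HC_face:
  assumes fl: "set_flag E S \<F>" and D: "D face_of HC S m \<F>" "D \<noteq> {}"
  shows "\<exists>\<F>'. set_flag E S \<F>' \<and> \<F>' \<subseteq> \<F> \<and> D = HC S m \<F>'"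
proof -
  have "convex D" using D(1) by (rule face_of_imp_convex)
  then obtain y where y: "y \<in> rel_interior D" using rel_interior_eq_empty D(2) by blast
  have yH: "y \<in> HC S m \<F>" using y rel_interior_subset face_of_imp_subset[OF D(1)] by blast
  define \<F>' where "\<F>' = levels E (wv S (lawrence_phi y))"
  have fl': "set_flag E S \<F>'" unfolding \<F>'_def by (rule levels_set_flag[OF set_flag.F_sub[OF fl]])
  have sub: "\<F>' \<subseteq> \<F>" using yH by (simp add: HC_def \<F>'_def)
  have "y \<in> rel_interior (HC S m \<F>')" unfolding rel_interior_HC[OF fl'] using yH by (simp add: HC_def \<F>'_def)
  hence "D = HC S m \<F>'" using face_of_eq[OF D(1) HC_face_of[OF fl fl' sub]] y by blast
  thus ?thesis using fl' sub by blast
qed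

end

section \<open>Rational generators and balancing\<close>

context arrangement
begin

lemma N_diff: assumes "x \<in> N" "y \<in> N" shows "x - y \<in> N"
proof -
  obtain c d where cd: "c \<in> coord_lattice E" "d \<in> coord_lattice E" "x = quot_map (lawrence_rel E a) (c, d)"
    using assms(1) unfolding lawrence_lattice_def by blast
  obtain c' d' where cd': "c' \<in> coord_lattice E" "d' \<in> coord_lattice E" "y = quot_map (lawrence_rel E a) (c', d')"
    using assms(2) unfolding lawrence_lattice_def by blast
  have "x - y = quot_map (lawrence_rel E a) (c - c', d - d')"
    unfolding cd cd' using linear_diff[OF linear_quot_map, of "lawrence_rel E a" "(c, d)" "(c', d')"] by simp
  moreover have "c - c' \<in> coord_lattice E" "d - d' \<in> coord_lattice E" using cd cd' by (auto simp: coord_lattice_iff)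
  ultimately show ?thesis unfolding lawrence_lattice_def by blast
qed

lemma N_zero: "0 \<in> N"
proof (cases "N = {}")
  case True
  have "(0, 0) \<in> coord_lattice E \<times> coord_lattice E" by (simp add: coord_lattice_iff)
  thus ?thesis using True unfolding lawrence_lattice_def by blast
next
  case False thus ?thesis using N_diff by (metis diff_self ex_in_conv)
qed

lemma N_uminus: "x \<in> N \<Longrightarrow> - x \<in> N" using N_diff[OF N_zero] by fastforce

lemma N_add: "x \<in> N \<Longrightarrow> y \<in> N \<Longrightarrow> x + y \<in> N" using N_diff[OF _ N_uminus, of x y] by simp

lemma N_sum: "(\<And>i. i \<in> A \<Longrightarrow> f i \<in> N) \<Longrightarrow> sum f A \<in> N"
  by (induction A rule: infinite_finite_induct) (auto simp: N_zero N_add)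

lemma N_scale: assumes "x \<in> N" shows "of_int k *\<^sub>R x \<in> N"
proof -
  have nat: "of_nat n *\<^sub>R x \<in> N" for n by (induction n) (auto simp: N_zero N_add assms algebra_simps)
  show ?thesis
  proof (cases k rule: int_cases2)
    case (nonneg n) thus ?thesis using nat[of n] by simp
  next
    case (nonpos n) thus ?thesis using N_uminus[OF nat[of n]] by simp
  qed
qed

lemma N_phi_integral: assumes "x \<in> N" "e \<in> E" shows "lawrence_phi x $ e \<in> \<int>"
  using unit_char_dual[OF assms(2)] assms(1) unfolding dual_lattice_def inner_unit_char[symmetric] by blast

lemma phi_quot:
  assumes "e \<in> E - S" shows "lawrence_phi (quot_map (lcone S m) x) $ e = lawrence_phi x $ e"
proof -
  have "unit_char e \<in> orthogonal_comp (lcone S m)"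
    unfolding orthogonal_comp_iff using unit_char_orthogonal_iff[of e "PP S m" "QQ S m"] assms PP_Un_QQ by simp
  thus ?thesis unfolding inner_unit_char[symmetric] by (rule inner_quot_map)
qed

lemma quot_W: assumes "S \<subseteq> E" "x \<in> VN" shows "quot_map (lcone S m) x \<in> W S m"
  using W_quot[OF assms(1), of m] assms(2) span_N by blast

text \<open>A lattice point over the indicator vector of \<open>G - S\<close>, for
  \<open>G \<subseteq> E\<close>. Both rays over \<open>e\<close> have the same image under
  \<open>lawrence_phi\<close>, so \<open>rho_pos\<close> is a choice.\<close>

definition bvec :: "'e set \<Rightarrow> 'e set \<Rightarrow> (real^'e) \<times> (real^'e)" where
  "bvec S G = (\<Sum>e\<in>G - S. \<rho>p e)"

lemma bvec_N: "G \<subseteq> E \<Longrightarrow> bvec S G \<in> N"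
  unfolding bvec_def using rho_in_N by (intro N_sum) auto

lemma phi_bvec: assumes "G \<subseteq> E" shows "lawrence_phi (bvec S G) = indicator_vec (G - S)"
proof -
  have "lawrence_phi (bvec S G) = (\<Sum>e\<in>G - S. lawrence_phi (\<rho>p e))"
    unfolding bvec_def by (rule linear_sum[OF linear_lawrence_phi])
  also have "\<dots> = indicator_vec (G - S)"
    unfolding indicator_vec_def using assms phi_rho by (intro sum.cong) auto
  finally show ?thesis .
qed

lemma phi_quot_bvec:
  assumes "G \<subseteq> E" "e \<in> E - S"
  shows "lawrence_phi (quot_map (lcone S m) (bvec S G)) $ e = (if e \<in> G then 1 else 0)"
  using phi_quot[OF assms(2)] phi_bvec[OF assms(1)] assms(2) by (simp add: indicator_vec_component)

text \<open>Expand \<open>y\<close> in the rays. For \<open>e \<in> S\<close> one of the two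
  projected rays vanishes, and so does the coordinate of \<open>y\<close> belonging to it; for
  \<open>e\<close> outside \<open>S\<close> the two coordinates are opposite. Either way only the
  difference of the two rays enters.\<close>

lemma stratum_kernel:
  assumes S: "S \<subseteq> E" and y: "y \<in> W S m" and z: "\<And>e. e \<in> E - S \<Longrightarrow> lawrence_phi y $ e = 0"
  shows "\<exists>c. y = (\<Sum>e\<in>E. c e *\<^sub>R quot_map (lcone S m) (\<rho>p e - \<rho>n e))"
proof -
  let ?q = "quot_map (lcone S m)"
  have yV: "y \<in> VN" and y0: "\<forall>e\<in>PP S m. fst y $ e = 0" "\<forall>e\<in>QQ S m. snd y $ e = 0" using y by (auto simp: W_def)
  have qp: "?q (\<rho>p e) = 0" if "e \<in> PP S m" for e
    by (rule quot_map_eq_0[OF span_base[OF rho_in_pcone(1)[OF that]]])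
  have qn: "?q (\<rho>n e) = 0" if "e \<in> QQ S m" for e
    by (rule quot_map_eq_0[OF span_base[OF rho_in_pcone(2)[OF that]]])
  have "?q y = y" using y unfolding W_orthogonal by (intro quot_map_ident) (simp add: orthogonal_comp_iff)
  hence "y = ?q (\<Sum>e\<in>E. fst y $ e *\<^sub>R \<rho>p e + snd y $ e *\<^sub>R \<rho>n e)" using VN_expand[OF yV] by metis
  also have "\<dots> = (\<Sum>e\<in>E. fst y $ e *\<^sub>R ?q (\<rho>p e) + snd y $ e *\<^sub>R ?q (\<rho>n e))"
    by (simp only: linear_sum[OF linear_quot_map] linear_add[OF linear_quot_map] linear_scale[OF linear_quot_map])
  also have "\<dots> = (\<Sum>e\<in>E. (if e \<in> PP S m then - snd y $ e else fst y $ e) *\<^sub>R ?q (\<rho>p e - \<rho>n e))"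
  proof (rule sum.cong[OF refl])
    fix e assume e: "e \<in> E"
    have d: "?q (\<rho>p e - \<rho>n e) = ?q (\<rho>p e) - ?q (\<rho>n e)" by (rule linear_diff[OF linear_quot_map])
    show "fst y $ e *\<^sub>R ?q (\<rho>p e) + snd y $ e *\<^sub>R ?q (\<rho>n e) =
        (if e \<in> PP S m then - snd y $ e else fst y $ e) *\<^sub>R ?q (\<rho>p e - \<rho>n e)"
    proof (cases "e \<in> PP S m")
      case True thus ?thesis using y0(1) qp by (simp add: d)
    next
      case nP: False
      show ?thesis
      proof (cases "e \<in> S")
        case True
        hence "e \<in> QQ S m" using nP PP_Un_QQ[of S m] by blast
        thus ?thesis using y0(2) qn nP by (simp add: d)
      next
        case False
        hence "snd y $ e = - fst y $ e" using z[of e] e by (simp add: lawrence_phi_component)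
        thus ?thesis using nP by (simp add: d algebra_simps)
      qed
    qed
  qed
  finally show ?thesis by (rule exI[where x = "\<lambda>e. if e \<in> PP S m then - snd y $ e else fst y $ e"])
qed

text \<open>The cone is the preimage of a Bergman cone under a linear map, so it is generated by
  lattice lifts of the Bergman generators together with generators of the kernel in both signs; the
  latter come from \<open>stratum_kernel\<close>.\<close>

lemma rational_cone_HC:
  assumes fl: "set_flag E S \<F>" shows "rational_cone (quot_map (lcone S m) ` N) (HC S m \<F>)"
proof -
  interpret set_flag E S \<F> by fact
  let ?q = "quot_map (lcone S m)"
  define b where "b G = ?q (bvec S G)" for G
  define k where "k e = ?q (\<rho>p e - \<rho>n e)" for e
  define B where "B = b ` (\<F> - {S, E}) \<union> {b E, - b E}"
  define K where "K = k ` E \<union> (\<lambda>e. - k e) ` E"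
  define L where "L y = proj_off S (lawrence_phi y)" for y
  have linL: "linear L"
    by (rule linearI) (simp_all add: L_def proj_off_def vec_eq_iff lawrence_phi_component algebra_simps)
  have bW: "b G \<in> W S m" if "G \<subseteq> E" for G
    unfolding b_def by (rule quot_W[OF F_sub]) (use bvec_N[OF that] N_subset_VN in blast)
  have kW: "k e \<in> W S m" if "e \<in> E" for e
    unfolding k_def by (rule quot_W[OF F_sub]) (use rho_VN[OF that] subspace_VN in \<open>simp add: subspace_diff\<close>)
  have bphi: "lawrence_phi (b G) $ e = (if e \<in> G then 1 else 0)" if "G \<subseteq> E" "e \<in> E - S" for G e
    unfolding b_def by (rule phi_quot_bvec[OF that])
  have kphi: "lawrence_phi (k e) $ f = 0" if "e \<in> E" "f \<in> E - S" for e f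
    unfolding k_def phi_quot[OF that(2)] phi_diff using phi_rho[OF that(1)] by simp
  have Lb: "L (b G) = indicator_vec (G - S)" if "G \<subseteq> E" for G
    using bphi[OF that] that by (auto simp: L_def proj_off_def vec_eq_iff indicator_vec_component)
  have LB: "L ` B = (\<lambda>G. indicator_vec (G - S)) ` (\<F> - {S, E}) \<union> {indicator_vec (E - S), - indicator_vec (E - S)}"
  proof -
    have "L ` b ` (\<F> - {S, E}) = (\<lambda>G. indicator_vec (G - S)) ` (\<F> - {S, E})"
      unfolding image_image using Lb sub by (intro image_cong) auto
    moreover have "L (- b E) = - indicator_vec (E - S)" using Lb[of E] linear_neg[OF linL] by simp
    ultimately show ?thesis using Lb[of E] by (simp add: B_def image_Un)
  qed
  have berg: "bergman_cone E S \<F> = L ` (convex_cone hull B)"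
    unfolding bergman_cone_def LB[symmetric] by (rule convex_cone_hull_linear_image[OF linL])
  have "B \<union> K \<subseteq> HC S m \<F>"
  proof
    fix y assume "y \<in> B \<union> K"
    then consider G where "G \<in> \<F>" "y = b G" | "y = - b E" | e where "e \<in> E" "y = k e" | e where "e \<in> E" "y = - k e"
      using E_in unfolding B_def K_def by blast
    thus "y \<in> HC S m \<F>"
    proof cases
      case 1
      have "e \<in> G" if "fle \<F> e f" "f \<in> G" for e f using that 1(1) by (simp add: fle_def)
      hence "lawrence_phi (b G) $ f \<le> lawrence_phi (b G) $ e" if "e \<in> E - S" "f \<in> E - S" "fle \<F> e f" for e f
        using bphi[of G e] bphi[of G f] sub[OF 1(1)] that by simp
      thus ?thesis using bW[of G] sub[OF 1(1)] unfolding HC_iff[OF fl] 1(2) by blast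
    next
      case 2
      have "lawrence_phi (- b E) $ e = - 1" if "e \<in> E - S" for e
        using bphi[of E e] that phi_scale[of "-1" "b E" e] by simp
      thus ?thesis using bW[of E] subspace_neg[OF subspace_W] unfolding HC_iff[OF fl] 2 by simp
    next
      case 3 thus ?thesis using kW[of e] kphi[of e] unfolding HC_iff[OF fl] by simp
    next
      case 4
      have "lawrence_phi (- k e) $ f = 0" if "f \<in> E - S" for f
        using kphi[OF 4(1) that] phi_scale[of "-1" "k e" f] by simp
      thus ?thesis using kW[OF 4(1)] subspace_neg[OF subspace_W] unfolding HC_iff[OF fl] 4 by simp
    qed
  qed
  hence "convex_cone hull (B \<union> K) \<subseteq> HC S m \<F>" using convex_cone_HC[OF fl] by (rule hull_minimal)
  moreover have "HC S m \<F> \<subseteq> convex_cone hull (B \<union> K)"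
  proof
    fix y assume y: "y \<in> HC S m \<F>"
    hence yW: "y \<in> W S m" by (simp add: HC_def)
    have "levels E (wv S (L y)) = levels E (wv S (lawrence_phi y))"
      by (rule wv_cong) (simp add: L_def proj_off_def)
    hence "L y \<in> bergman_cone E S \<F>"
      using bergman_cone_iff[of "L y"] supported_proj_off y by (simp add: HC_def L_def)
    then obtain x where x: "x \<in> convex_cone hull B" "L y = L x" unfolding berg by blast
    have xH: "x \<in> convex_cone hull (B \<union> K)" using x(1) hull_mono[of B "B \<union> K"] by blast
    have "x \<in> W S m" using xH \<open>convex_cone hull (B \<union> K) \<subseteq> HC S m \<F>\<close> by (auto simp: HC_def)
    hence dW: "y - x \<in> W S m" using yW by (intro subspace_diff subspace_W)
    have "lawrence_phi (y - x) $ e = 0" if "e \<in> E - S" for e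
      using arg_cong[OF x(2), of "\<lambda>v. v $ e"] that by (simp add: L_def proj_off_def phi_diff)
    then obtain c where c: "y - x = (\<Sum>e\<in>E. c e *\<^sub>R k e)"
      using stratum_kernel[OF F_sub dW] unfolding k_def by blast
    have "c e *\<^sub>R k e \<in> convex_cone hull (B \<union> K)" if e: "e \<in> E" for e
    proof (cases "0 \<le> c e")
      case True thus ?thesis using e by (intro convex_cone_hull_mul hull_inc) (auto simp: K_def)
    next
      case False
      hence "(- c e) *\<^sub>R (- k e) \<in> convex_cone hull (B \<union> K)"
        using e by (intro convex_cone_hull_mul hull_inc) (auto simp: K_def)
      thus ?thesis by simp
    qed
    hence "y - x \<in> convex_cone hull (B \<union> K)" unfolding c by (rule convex_cone_hull_sum)
    hence "x + (y - x) \<in> convex_cone hull (B \<union> K)" by (rule convex_cone_hull_add[OF xH])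
    thus "y \<in> convex_cone hull (B \<union> K)" by simp
  qed
  ultimately have eq: "HC S m \<F> = convex_cone hull (B \<union> K)" by blast
  have bN: "b G \<in> ?q ` N" "- b G \<in> ?q ` N" if "G \<subseteq> E" for G
    using bvec_N[OF that] N_uminus linear_neg[OF linear_quot_map] unfolding b_def by (metis image_eqI)+
  have kN: "k e \<in> ?q ` N" "- k e \<in> ?q ` N" if "e \<in> E" for e
    using N_diff[OF rho_in_N[OF that]] N_uminus linear_neg[OF linear_quot_map] unfolding k_def by (metis image_eqI)+
  have "B \<union> K \<subseteq> ?q ` N"
  proof
    fix y assume "y \<in> B \<union> K"
    then consider G where "G \<in> \<F>" "y = b G" | "y = - b E" | e where "e \<in> E" "y = k e" | e where "e \<in> E" "y = - k e"
      using E_in unfolding B_def K_def by blast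
    thus "y \<in> ?q ` N"
    proof cases
      case 1 thus ?thesis using bN(1)[of G] sub[of G] by simp
    next
      case 2 thus ?thesis using bN(2)[of E] by simp
    next
      case 3 thus ?thesis using kN(1)[of e] by simp
    next
      case 4 thus ?thesis using kN(2)[of e] by simp
    qed
  qed
  moreover have "finite (B \<union> K)" unfolding B_def K_def by simp
  ultimately show ?thesis unfolding rational_cone_def eq by blast
qed

section \<open>Gaps in a flag of flats and completion of flags\<close>

lemma flag_sub: "is_flag M E a F \<F> \<Longrightarrow> G \<in> \<F> \<Longrightarrow> flat G \<and> F \<subseteq> G \<and> G \<subseteq> E"
  unfolding is_flag_def using flat_sub by blast

lemma flag_comparable: "is_flag M E a F \<F> \<Longrightarrow> G \<in> \<F> \<Longrightarrow> H \<in> \<F> \<Longrightarrow> G \<subseteq> H \<or> H \<subseteq> G"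
  unfolding is_flag_def chain_subset_def by blast

lemma flag_rk_inj: assumes fl: "is_flag M E a F \<F>" shows "inj_on rk \<F>"
proof (rule inj_onI)
  fix G H assume "G \<in> \<F>" "H \<in> \<F>" "rk G = rk H"
  thus "G = H" using flag_comparable[OF fl] flag_sub[OF fl] flat_eq_of_rk[of G H] flat_eq_of_rk[of H G] by auto
qed

lemma flag_rk_range: assumes fl: "is_flag M E a F \<F>" shows "rk ` \<F> \<subseteq> {rk F..rk E}"
  using flag_sub[OF fl] rk_mono by (auto intro: rk_mono)

lemma flag_card_le: assumes fl: "is_flag M E a F \<F>" shows "card \<F> \<le> rk E - rk F + 1"
proof -
  have "card \<F> = card (rk ` \<F>)" using card_image[OF flag_rk_inj[OF fl]] by simp
  also have "\<dots> \<le> card {rk F..rk E}" using flag_rk_range[OF fl] by (intro card_mono) auto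
  also have "\<dots> \<le> rk E - rk F + 1" by simp
  finally show ?thesis .
qed

text \<open>Every member has rank below or above \<open>j\<close>, so the gap is bounded by the
  union of the former members and the intersection of the latter, which are members
  themselves.\<close>

lemma flag_gap:
  assumes fl: "is_flag M E a F \<F>" and j: "j \<in> {rk F..rk E}" "j \<notin> rk ` \<F>"
  shows "\<exists>G1 G2. G1 \<in> \<F> \<and> G2 \<in> \<F> \<and> G1 \<subset> G2 \<and> rk G1 < j \<and> j < rk G2 \<and> (\<forall>G\<in>\<F>. G \<subseteq> G1 \<or> G2 \<subseteq> G) \<and>
     (\<forall>G\<in>\<F>. rk G < j \<longrightarrow> G \<subseteq> G1) \<and> (\<forall>G\<in>\<F>. j < rk G \<longrightarrow> G2 \<subseteq> G)"
proof -
  have FE: "F \<in> \<F>" "E \<in> \<F>" "chain_subset \<F>" using fl by (auto simp: is_flag_def)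
  have ne: "rk G \<noteq> j" if "G \<in> \<F>" for G using that j(2) by auto
  let ?A = "{G\<in>\<F>. rk G < j}" and ?B = "{G\<in>\<F>. j < rk G}"
  have "F \<in> ?A" "E \<in> ?B" using FE j(1) ne[of F] ne[of E] by auto
  hence A: "\<Union>?A \<in> ?A" and B: "\<Inter>?B \<in> ?B"
    using FE(3) by (intro finite_chain_Union finite_chain_Inter; force simp: chain_subset_def)+
  define G1 where "G1 = \<Union>?A"
  define G2 where "G2 = \<Inter>?B"
  have G: "G1 \<in> \<F>" "rk G1 < j" "G2 \<in> \<F>" "j < rk G2" using A B unfolding G1_def G2_def by blast+
  have "\<not> G2 \<subseteq> G1" using rk_mono[of G2 G1] G by auto
  hence G12: "G1 \<subset> G2" using flag_comparable[OF fl G(1,3)] by blast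
  have lt: "G \<subseteq> G1" if "G \<in> \<F>" "rk G < j" for G using that unfolding G1_def by blast
  have gt: "G2 \<subseteq> G" if "G \<in> \<F>" "j < rk G" for G using that unfolding G2_def by blast
  have "G \<subseteq> G1 \<or> G2 \<subseteq> G" if "G \<in> \<F>" for G
    using lt[OF that] gt[OF that] ne[OF that] by (cases "rk G < j") auto
  thus ?thesis using G G12 lt gt by (intro exI[of _ G1] exI[of _ G2]) simp
qed

lemma flag_insert:
  assumes fl: "is_flag M E a F \<F>" and G: "flat G" "G1 \<subseteq> G" "G \<subseteq> G2" "G1 \<in> \<F>" "G2 \<in> \<F>" "\<forall>H\<in>\<F>. H \<subseteq> G1 \<or> G2 \<subseteq> H"
  shows "is_flag M E a F (insert G \<F>)"
proof -
  have "F \<subseteq> G" using flag_sub[OF fl G(4)] G(2) by blast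
  have cmp: "G \<subseteq> H \<or> H \<subseteq> G" if "H \<in> \<F>" for H using bspec[OF G(6) that] G(2,3) by auto
  have "A \<subseteq> B \<or> B \<subseteq> A" if "A \<in> insert G \<F>" "B \<in> insert G \<F>" for A B
    using that cmp[of A] cmp[of B] flag_comparable[OF fl, of A B] by (cases "A = G"; cases "B = G") auto
  hence "chain_subset (insert G \<F>)" by (simp add: chain_subset_def)
  thus ?thesis using fl G(1) \<open>F \<subseteq> G\<close> by (simp add: is_flag_def)
qed

text \<open>If a rank \<open>j\<close> is missing, the closure of the lower end of the gap and one
  more element of the upper end has rank only one more than the lower end, hence at most
  \<open>j\<close>, and fits strictly into the gap.\<close>

lemma flag_extend:
  assumes fl: "is_flag M E a F \<F>" and c: "card \<F> < rk E - rk F + 1"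
  shows "\<exists>G. G \<notin> \<F> \<and> is_flag M E a F (insert G \<F>)"
proof -
  have "rk F \<le> rk E" using fl flag_rk_range[OF fl] by (auto simp: is_flag_def)
  hence "card (rk ` \<F>) < card {rk F..rk E}" using c card_image[OF flag_rk_inj[OF fl]] by simp
  hence "rk ` \<F> \<noteq> {rk F..rk E}" by auto
  then obtain j where j: "j \<in> {rk F..rk E}" "j \<notin> rk ` \<F>" using flag_rk_range[OF fl] by blast
  obtain G1 G2 where G: "G1 \<in> \<F>" "G2 \<in> \<F>" "G1 \<subset> G2" "rk G1 < j" "j < rk G2" "\<forall>G\<in>\<F>. G \<subseteq> G1 \<or> G2 \<subseteq> G"
    using flag_gap[OF fl j] by blast
  obtain e where e: "e \<in> G2" "e \<notin> G1" using G(3) by blast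
  have f1: "flat G1" "flat G2" "G1 \<subseteq> E" "G2 \<subseteq> E" using flag_sub[OF fl] G by auto
  define H where "H = cl (insert e G1)"
  have sE: "insert e G1 \<subseteq> E" using e f1 by auto
  have "rk H = rk G1 + 1" unfolding H_def rk_cl[OF sE] using rk_insert[OF f1(1)] e f1 by blast
  hence rkH: "rk H \<noteq> rk G2" "rk H \<le> j" using G by auto
  have "insert e G1 \<subseteq> H" unfolding H_def by (rule cl_sub(1)[OF sE])
  moreover have "H \<subseteq> G2" unfolding H_def using e G(3) by (intro cl_subset_flat f1) auto
  moreover have "flat H" unfolding H_def by (rule flat_cl[OF sE])
  ultimately have "is_flag M E a F (insert H \<F>)" using G by (intro flag_insert[OF fl, of H G1 G2]) auto
  moreover have "H \<notin> \<F>"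
  proof
    assume "H \<in> \<F>"
    hence "H \<subseteq> G1 \<or> G2 \<subseteq> H" using G(6) by blast
    thus False using \<open>insert e G1 \<subseteq> H\<close> \<open>H \<subseteq> G2\<close> e(2) rkH(1) by auto
  qed
  ultimately show ?thesis by blast
qed

lemma flag_complete:
  assumes "is_flag M E a F \<F>"
  shows "\<exists>\<F>'. \<F> \<subseteq> \<F>' \<and> is_flag M E a F \<F>' \<and> card \<F>' = rk E - rk F + 1"
  using assms
proof (induction "rk E - rk F + 1 - card \<F>" arbitrary: \<F>)
  case 0
  hence "card \<F> = rk E - rk F + 1" using flag_card_le[OF 0(2)] by simp
  thus ?case using 0 by blast
next
  case (Suc n)
  then obtain G where G: "G \<notin> \<F>" "is_flag M E a F (insert G \<F>)" using flag_extend[of F \<F>] by fastforce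
  have "card (insert G \<F>) = Suc (card \<F>)" using G(1) by simp
  hence "n = rk E - rk F + 1 - card (insert G \<F>)" using Suc(2) by simp
  thus ?case using Suc(1)[OF _ G(2)] by blast
qed

text \<open>With \<open>rk E - rk F\<close> members exactly one of the
  \<open>rk E - rk F + 1\<close> possible ranks is missing. The neighbouring ranks are attained and
  bound the gap, and a flat that can be inserted must have the missing rank.\<close>

lemma flag_gap_codim_one:
  assumes fl: "is_flag M E a F \<F>" and c: "card \<F> = rk E - rk F" "rk F < rk E"
  shows "\<exists>G1 G2. G1 \<in> \<F> \<and> G2 \<in> \<F> \<and> G1 \<subset> G2 \<and> rk G2 = rk G1 + 2 \<and> (\<forall>G\<in>\<F>. G \<subseteq> G1 \<or> G2 \<subseteq> G) \<and>
    (\<forall>G. is_flag M E a F (insert G \<F>) \<and> G \<notin> \<F> \<longrightarrow> G1 \<subset> G \<and> G \<subset> G2)"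
proof -
  have FE: "F \<in> \<F>" "E \<in> \<F>" using fl by (auto simp: is_flag_def)
  have "card (rk ` \<F>) = rk E - rk F" using c card_image[OF flag_rk_inj[OF fl]] by simp
  moreover have "card {rk F..rk E} = rk E - rk F + 1" using c(2) by simp
  ultimately have "card ({rk F..rk E} - rk ` \<F>) = 1"
    using flag_rk_range[OF fl] by (simp add: card_Diff_subset)
  then obtain j where j: "{rk F..rk E} - rk ` \<F> = {j}" by (auto simp: card_1_singleton_iff)
  have j1: "j \<in> {rk F..rk E}" "j \<notin> rk ` \<F>" using j by blast+
  have others: "i \<in> rk ` \<F>" if "i \<in> {rk F..rk E}" "i \<noteq> j" for i using that j by blast
  obtain G1 G2 where G: "G1 \<in> \<F>" "G2 \<in> \<F>" "G1 \<subset> G2" "rk G1 < j" "j < rk G2" "\<forall>G\<in>\<F>. G \<subseteq> G1 \<or> G2 \<subseteq> G"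
    "\<forall>G\<in>\<F>. rk G < j \<longrightarrow> G \<subseteq> G1" "\<forall>G\<in>\<F>. j < rk G \<longrightarrow> G2 \<subseteq> G"
    using flag_gap[OF fl j1] by blast
  have r12: "rk F \<le> rk G1" "rk G2 \<le> rk E" using flag_rk_range[OF fl] G(1,2) by auto
  have "j - 1 \<in> rk ` \<F>" using G(4,5) r12 by (intro others) auto
  then obtain A where A: "A \<in> \<F>" "rk A = j - 1" by auto
  have "A \<subseteq> G1" using G(4,7) A by auto
  hence "j - 1 \<le> rk G1" using rk_mono[of A G1] A by simp
  have "j + 1 \<in> rk ` \<F>" using G(4,5) r12 by (intro others) auto
  then obtain B where B: "B \<in> \<F>" "rk B = j + 1" by auto
  have "G2 \<subseteq> B" using G(8) B by auto
  hence "rk G2 \<le> j + 1" using rk_mono[of G2 B] B by simp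
  have rr: "rk G1 = j - 1" "rk G2 = j + 1" "0 < j" using \<open>j - 1 \<le> rk G1\<close> \<open>rk G2 \<le> j + 1\<close> G(4,5) by auto
  have "G1 \<subset> G \<and> G \<subset> G2" if g: "is_flag M E a F (insert G \<F>)" "G \<notin> \<F>" for G
  proof -
    have "rk G \<in> {rk F..rk E}" using flag_rk_range[OF g(1)] by blast
    moreover have "rk G \<notin> rk ` \<F>" using flag_rk_inj[OF g(1)] g(2) unfolding inj_on_def by auto
    ultimately have "rk G = j" using j by blast
    hence "\<not> G \<subseteq> G1" "\<not> G2 \<subseteq> G" using rk_mono[of G G1] rk_mono[of G2 G] rr by auto
    thus ?thesis using flag_comparable[OF g(1), of G G1] flag_comparable[OF g(1), of G G2] G(1,2) by blast
  qed
  thus ?thesis using G rr by (intro exI[of _ G1] exI[of _ G2]) simp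
qed

text \<open>Inserting \<open>G\<close> splits the block \<open>G2 - G1\<close> into
  \<open>G - G1\<close> and \<open>G2 - G\<close>. A lattice point in the span of the larger cone
  has one integer value on each; subtracting their difference times the normal vector makes them
  equal and leaves a point in the span of the facet.\<close>

lemma normal_vector_HC:
  assumes fl: "is_flag M E a F \<F>" and G: "G1 \<in> \<F>" "G2 \<in> \<F>" "G1 \<subset> G" "G \<subset> G2" "\<forall>H\<in>\<F>. H \<subseteq> G1 \<or> G2 \<subseteq> H"
    and flG: "is_flag M E a F (insert G \<F>)"
  shows "normal_vector (quot_map (lcone F m) ` N) (HC F m \<F>) (HC F m (insert G \<F>)) (quot_map (lcone F m) (bvec F G))"
proof -
  let ?q = "quot_map (lcone F m)" and ?G = "insert G \<F>"
  have sf: "set_flag E F \<F>" "set_flag E F ?G" using flag_set_flag fl flG by auto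
  have FE: "F \<subseteq> E" by (rule set_flag.F_sub[OF sf(1)])
  have GE: "G \<subseteq> E" using flag_sub[OF flG, of G] by blast
  define u where "u = ?q (bvec F G)"
  have uphi: "lawrence_phi u $ e = (if e \<in> G then 1 else 0)" if "e \<in> E - F" for e
    unfolding u_def by (rule phi_quot_bvec[OF GE that])
  have uN: "u \<in> ?q ` N" unfolding u_def using bvec_N[OF GE] by blast
  have uW: "u \<in> W F m" unfolding u_def by (rule quot_W[OF FE]) (use bvec_N[OF GE] N_subset_VN in blast)
  have uC: "u \<in> HC F m ?G"
  proof -
    have "e \<in> G" if "fle ?G e f" "f \<in> G" for e f using that by (simp add: fle_def)
    hence "lawrence_phi u $ f \<le> lawrence_phi u $ e" if "e \<in> E - F" "f \<in> E - F" "fle ?G e f" for e f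
      using uphi that by simp
    thus ?thesis using uW unfolding HC_iff[OF sf(2)] by blast
  qed
  have qN_diff: "x - of_int k *\<^sub>R u \<in> ?q ` N" if x: "x \<in> ?q ` N" for x and k :: int
  proof -
    obtain x' where x': "x' \<in> N" "x = ?q x'" using x by blast
    have "x - of_int k *\<^sub>R u = ?q (x' - of_int k *\<^sub>R bvec F G)"
      unfolding x'(2) u_def by (simp only: linear_diff[OF linear_quot_map] linear_scale[OF linear_quot_map])
    thus ?thesis using N_diff[OF x'(1) N_scale[OF bvec_N[OF GE]]] by blast
  qed
  obtain e1 where e1: "e1 \<in> G" "e1 \<notin> G1" using G(3) by blast
  obtain e2 where e2: "e2 \<in> G2" "e2 \<notin> G" using G(4) by blast
  have cls1: "fle ?G e e'" if "e \<in> G" "e \<notin> G1" "e' \<in> G" "e' \<notin> G1" for e e'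
    unfolding fle_def
  proof (intro ballI impI)
    fix H assume H: "H \<in> ?G" "e' \<in> H"
    show "e \<in> H"
    proof (cases "H = G")
      case False
      hence "G2 \<subseteq> H" using H G(5) that by blast
      thus ?thesis using that G(4) by blast
    qed (use that in simp)
  qed
  have cls2: "fle ?G e e'" if "e \<in> G2" "e \<notin> G" "e' \<in> G2" "e' \<notin> G" for e e'
    unfolding fle_def
  proof (intro ballI impI)
    fix H assume H: "H \<in> ?G" "e' \<in> H"
    hence "H \<in> \<F>" "\<not> H \<subseteq> G1" using that G(3) by blast+
    thus "e \<in> H" using G(5) that by blast
  qed
  have F1: "F \<subseteq> G1" "G2 \<subseteq> E" using flag_sub[OF fl] G(1,2) by blast+
  have "(?q ` N) \<inter> VF F m ?G = {x + of_int k *\<^sub>R u | x (k::int). x \<in> (?q ` N) \<inter> VF F m \<F>}"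
  proof (intro equalityI subsetI)
    fix y assume y: "y \<in> (?q ` N) \<inter> VF F m ?G"
    obtain y' where y': "y' \<in> N" "y = ?q y'" using y by blast
    have int: "lawrence_phi y $ e \<in> \<int>" if "e \<in> E - F" for e
      unfolding y'(2) phi_quot[OF that] using N_phi_integral[OF y'(1)] that by blast
    have eEF: "e1 \<in> E - F" "e2 \<in> E - F" using e1 e2 F1 GE G(3) by blast+
    obtain k :: int where k: "of_int k = lawrence_phi y $ e1 - lawrence_phi y $ e2"
      using Ints_diff[OF int[OF eEF(1)] int[OF eEF(2)]] by (metis Ints_cases)
    define x where "x = y - of_int k *\<^sub>R u"
    have yW: "y \<in> W F m" using y by (simp add: VF_def)
    have xW: "x \<in> W F m" unfolding x_def using yW uW by (intro subspace_diff subspace_scale subspace_W)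
    have xphi: "lawrence_phi x $ e = lawrence_phi y $ e - of_int k * (if e \<in> G then 1 else 0)" if "e \<in> E - F" for e
      unfolding x_def phi_diff phi_scale using uphi[OF that] by simp
    have yeq: "lawrence_phi y $ e = lawrence_phi y $ f" if "e \<in> E - F" "f \<in> E - F" "fle ?G e f" "fle ?G f e" for e f
      using y that unfolding VF_def by blast
    have main: "lawrence_phi x $ e = lawrence_phi x $ f"
      if ef: "e \<in> E - F" "f \<in> E - F" "fle \<F> e f" "fle \<F> f e" "e \<in> G" "f \<notin> G" for e f
    proof -
      have "f \<notin> G1" using ef(6) G(3) by blast
      hence "e \<notin> G1" using ef(4) G(1) unfolding fle_def by blast
      moreover have "f \<in> G2" using ef(4,5) G(2,4) unfolding fle_def by blast
      ultimately have "lawrence_phi y $ e = lawrence_phi y $ e1" "lawrence_phi y $ f = lawrence_phi y $ e2"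
        using yeq ef eEF cls1 cls2 e1 e2 by blast+
      thus ?thesis using xphi ef k by simp
    qed
    have "lawrence_phi x $ e = lawrence_phi x $ f" if ef: "e \<in> E - F" "f \<in> E - F" "fle \<F> e f \<and> fle \<F> f e" for e f
    proof (cases "e \<in> G \<longleftrightarrow> f \<in> G")
      case True
      hence "fle ?G e f" "fle ?G f e" using ef(3) by (simp_all add: fle_def)
      hence "lawrence_phi y $ e = lawrence_phi y $ f" by (rule yeq[OF ef(1,2)])
      thus ?thesis using xphi[OF ef(1)] xphi[OF ef(2)] True by simp
    next
      case False
      thus ?thesis using main[of e f] main[of f e] ef by (cases "e \<in> G") auto
    qed
    hence "x \<in> VF F m \<F>" using xW unfolding VF_def by blast
    moreover have "x \<in> ?q ` N" unfolding x_def using y by (intro qN_diff) blast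
    moreover have "y = x + of_int k *\<^sub>R u" by (simp add: x_def)
    ultimately show "y \<in> {x + of_int k *\<^sub>R u | x (k::int). x \<in> (?q ` N) \<inter> VF F m \<F>}" by blast
  next
    fix y assume "y \<in> {x + of_int k *\<^sub>R u | x (k::int). x \<in> (?q ` N) \<inter> VF F m \<F>}"
    then obtain x and k :: int where x: "y = x + of_int k *\<^sub>R u" "x \<in> ?q ` N" "x \<in> VF F m \<F>" by blast
    have "VF F m \<F> \<subseteq> VF F m ?G" unfolding span_HC[OF sf(1), symmetric] span_HC[OF sf(2), symmetric]
      by (intro span_mono HC_mono) blast
    moreover have "u \<in> VF F m ?G" using uC HC_subset_VF[OF sf(2)] by blast
    ultimately have "y \<in> VF F m ?G" unfolding x(1) using x(3)
      by (intro subspace_add[OF subspace_VF] subspace_scale[OF subspace_VF]) blast+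
    moreover have "y \<in> ?q ` N" using qN_diff[OF x(2), of "- k"] unfolding x(1) by simp
    ultimately show "y \<in> (?q ` N) \<inter> VF F m ?G" by blast
  qed
  thus ?thesis unfolding normal_vector_def span_HC[OF sf(1)] span_HC[OF sf(2)] u_def[symmetric]
    using uN uC by blast
qed

text \<open>The maximal cones around a flag with one missing rank correspond to the flats strictly
  between the ends of the gap. Outside \<open>F\<close>, the sum of their normal vectors has the
  value \<open>card GG\<close> on \<open>G1\<close>, 1 on the gap and 0 beyond \<open>G2\<close>, so
  it is constant on the blocks of the flag.\<close>

lemma balanced_HC:
  assumes "flat F"
  shows "balanced_fan (quot_map (lcone F m) ` N) {HC F m \<F> | \<F>. is_flag M E a F \<F>} (\<lambda>_. 1)"
proof -
  let ?q = "quot_map (lcone F m)" and ?\<Sigma> = "{HC F m \<F> | \<F>. is_flag M E a F \<F>}"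
  have FE: "F \<subseteq> E" using assms by (rule flat_sub)
  have rkFE: "rk F \<le> rk E" using FE by (rule rk_mono)
  define n where "n = dim (KK F m) + (rk E - rk F)"
  have dim: "dim (HC F m \<F>) = dim (KK F m) + (card \<F> - 1)" if "is_flag M E a F \<F>" for \<F>
    using dim_HC[OF flag_set_flag[OF that], of m] by (simp add: flag_length_def)
  have cpos: "0 < card \<F>" if "is_flag M E a F \<F>" for \<F>
    using that unfolding is_flag_def by (auto simp: card_gt_0_iff)
  have b1: "\<exists>D\<in>?\<Sigma>. C \<subseteq> D \<and> dim D = n" if "C \<in> ?\<Sigma>" for C
  proof -
    obtain \<F> where fl: "is_flag M E a F \<F>" "C = HC F m \<F>" using \<open>C \<in> ?\<Sigma>\<close> by blast
    obtain \<F>' where fl': "\<F> \<subseteq> \<F>'" "is_flag M E a F \<F>'" "card \<F>' = rk E - rk F + 1"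
      using flag_complete[OF fl(1)] by blast
    have "C \<subseteq> HC F m \<F>'" unfolding fl(2) by (rule HC_mono[OF fl'(1)])
    moreover have "dim (HC F m \<F>') = n" using dim[OF fl'(2)] fl'(3) by (simp add: n_def)
    ultimately show ?thesis using fl'(2) by blast
  qed
  have b2: "dim C \<le> n" if "C \<in> ?\<Sigma>" for C
  proof -
    obtain \<F> where fl: "is_flag M E a F \<F>" "C = HC F m \<F>" using \<open>C \<in> ?\<Sigma>\<close> by blast
    show ?thesis using dim[OF fl(1)] flag_card_le[OF fl(1)] unfolding fl(2) n_def by simp
  qed
  have b3: "\<exists>u. (\<forall>C\<in>?\<Sigma>. dim C = n \<and> \<tau> \<subseteq> C \<longrightarrow> normal_vector (?q ` N) \<tau> C (u C)) \<and>
      (\<Sum>C\<in>{C\<in>?\<Sigma>. dim C = n \<and> \<tau> \<subseteq> C}. of_int 1 *\<^sub>R u C) \<in> span \<tau>"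
    if \<tau>: "\<tau> \<in> ?\<Sigma>" "Suc (dim \<tau>) = n" for \<tau>
  proof -
    obtain \<F> where fl: "is_flag M E a F \<F>" "\<tau> = HC F m \<F>" using \<tau>(1) by blast
    have sf: "set_flag E F \<F>" using flag_set_flag[OF fl(1)] .
    have "card \<F> = rk E - rk F" "rk F < rk E" using \<tau>(2) dim[OF fl(1)] cpos[OF fl(1)] unfolding fl(2) n_def by auto
    from flag_gap_codim_one[OF fl(1) this]
    obtain G1 G2 where G: "G1 \<in> \<F>" "G2 \<in> \<F>" "G1 \<subset> G2" "rk G2 = rk G1 + 2" "\<forall>G\<in>\<F>. G \<subseteq> G1 \<or> G2 \<subseteq> G"
      "\<forall>G. is_flag M E a F (insert G \<F>) \<and> G \<notin> \<F> \<longrightarrow> G1 \<subset> G \<and> G \<subset> G2" by (elim exE conjE) (rule that)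
    have fG: "flat G1" "flat G2" "G2 \<subseteq> E" "G1 \<subseteq> E" "F \<subseteq> G1" using flag_sub[OF fl(1)] G(1,2) by blast+
    define GG where "GG = {H. flat H \<and> G1 \<subset> H \<and> H \<subset> G2}"
    define h where "h H = HC F m (insert H \<F>)" for H
    have ins: "is_flag M E a F (insert H \<F>)" "H \<notin> \<F>" if "H \<in> GG" for H
    proof -
      show "is_flag M E a F (insert H \<F>)"
        by (rule flag_insert[OF fl(1), of H G1 G2]) (use \<open>H \<in> GG\<close> G in \<open>auto simp: GG_def\<close>)
      show "H \<notin> \<F>" using \<open>H \<in> GG\<close> G(5) unfolding GG_def by blast
    qed
    have inj: "inj_on h GG"
    proof (rule inj_onI)
      fix H H' assume H: "H \<in> GG" "H' \<in> GG" "h H = h H'"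
      have "insert H \<F> \<subseteq> insert H' \<F>"
        using HC_subset_iff[OF flag_set_flag[OF ins(1)[OF H(1)]], of m "insert H' \<F>"] H(3) by (simp add: h_def)
      thus "H = H'" using ins(2)[OF H(1)] by blast
    qed
    have max: "{C\<in>?\<Sigma>. dim C = n \<and> \<tau> \<subseteq> C} = h ` GG"
    proof (intro equalityI subsetI)
      fix C assume C: "C \<in> {C\<in>?\<Sigma>. dim C = n \<and> \<tau> \<subseteq> C}"
      then obtain \<F>' where fl': "is_flag M E a F \<F>'" "C = HC F m \<F>'" by blast
      have sub: "\<F> \<subseteq> \<F>'" using C HC_subset_iff[OF sf] unfolding fl(2) fl'(2) by blast
      have "card \<F>' = Suc (card \<F>)"
        using C dim[OF fl'(1)] dim[OF fl(1)] \<tau>(2) cpos[OF fl'(1)] cpos[OF fl(1)] unfolding fl(2) fl'(2) by auto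
      hence "card (\<F>' - \<F>) = 1" using sub by (simp add: card_Diff_subset)
      then obtain H where H: "\<F>' - \<F> = {H}" by (auto simp: card_1_singleton_iff)
      hence ins': "\<F>' = insert H \<F>" "H \<notin> \<F>" using sub by blast+
      have "G1 \<subset> H \<and> H \<subset> G2" using G(6) fl'(1) ins' by blast
      moreover have "flat H" using flag_sub[OF fl'(1), of H] ins' by blast
      ultimately show "C \<in> h ` GG" unfolding fl'(2) ins'(1) h_def GG_def by blast
    next
      fix C assume "C \<in> h ` GG"
      then obtain H where H: "H \<in> GG" "C = HC F m (insert H \<F>)" unfolding h_def by blast
      have "dim C = n" using dim[OF ins(1)[OF H(1)]] ins(2)[OF H(1)] \<tau>(2) dim[OF fl(1)] cpos[OF fl(1)]
        unfolding H(2) fl(2) by simp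
      moreover have "\<tau> \<subseteq> C" unfolding fl(2) H(2) by (rule HC_mono) blast
      ultimately show "C \<in> {C\<in>?\<Sigma>. dim C = n \<and> \<tau> \<subseteq> C}" using ins(1)[OF H(1)] H(2) by blast
    qed
    \<comment> \<open>\<open>balanced_fan\<close> indexes normal vectors by cones, so the inserted
      flat is recovered from its cone through the injectivity of \<open>h\<close>.\<close>
    define u where "u C = ?q (bvec F (the_inv_into GG h C))" for C
    have uh: "u (h H) = ?q (bvec F H)" if "H \<in> GG" for H
      unfolding u_def by (simp add: the_inv_into_f_f[OF inj that])
    have "normal_vector (?q ` N) \<tau> C (u C)" if C: "C \<in> ?\<Sigma>" "dim C = n \<and> \<tau> \<subseteq> C" for C
    proof -
      have "C \<in> h ` GG" using C max by blast
      then obtain H where H: "H \<in> GG" "C = h H" by blast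
      have "normal_vector (?q ` N) (HC F m \<F>) (HC F m (insert H \<F>)) (?q (bvec F H))"
        by (rule normal_vector_HC[OF fl(1) G(1,2) _ _ G(5) ins(1)[OF H(1)]]) (use H(1) in \<open>auto simp: GG_def\<close>)
      thus ?thesis unfolding H(2) uh[OF H(1)] unfolding h_def fl(2) .
    qed
    moreover have "(\<Sum>C\<in>{C\<in>?\<Sigma>. dim C = n \<and> \<tau> \<subseteq> C}. of_int 1 *\<^sub>R u C) \<in> span \<tau>"
    proof -
      define s where "s = (\<Sum>H\<in>GG. ?q (bvec F H))"
      have "(\<Sum>C\<in>{C\<in>?\<Sigma>. dim C = n \<and> \<tau> \<subseteq> C}. of_int 1 *\<^sub>R u C) = (\<Sum>H\<in>GG. u (h H))"
        unfolding max by (simp add: sum.reindex[OF inj])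
      also have "\<dots> = s" unfolding s_def using uh by (intro sum.cong) auto
      finally have eq: "(\<Sum>C\<in>{C\<in>?\<Sigma>. dim C = n \<and> \<tau> \<subseteq> C}. of_int 1 *\<^sub>R u C) = s" .
      have GGE: "H \<subseteq> E" if "H \<in> GG" for H using that fG(3) unfolding GG_def by blast
      have sW: "s \<in> W F m"
        unfolding s_def by (intro subspace_sum[OF subspace_W] quot_W[OF FE]) (use bvec_N GGE N_subset_VN in blast)
      have sphi: "lawrence_phi s $ e = real (card {H\<in>GG. e \<in> H})" if "e \<in> E - F" for e
      proof -
        have "lawrence_phi s $ e = (\<Sum>H\<in>GG. lawrence_phi (?q (bvec F H)) $ e)"
          unfolding s_def by (simp add: linear_sum[OF linear_lawrence_phi])
        also have "\<dots> = (\<Sum>H\<in>GG. if e \<in> H then 1 else 0)"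
          using phi_quot_bvec[OF GGE that] by (intro sum.cong) auto
        finally show ?thesis by (simp add: sum.If_cases Int_def)
      qed
      \<comment> \<open>The closure of \<open>G1\<close> and \<open>e\<close> is such a flat. Any
        flat of \<open>GG\<close> through \<open>e\<close> contains it and has at most the same
        rank, so the two coincide.\<close>
      have one: "card {H\<in>GG. e \<in> H} = 1" if e: "e \<in> G2" "e \<notin> G1" for e
      proof -
        have sE: "insert e G1 \<subseteq> E" using e fG by blast
        define K where "K = cl (insert e G1)"
        have fK: "flat K" unfolding K_def by (rule flat_cl[OF sE])
        have iK: "insert e G1 \<subseteq> K" unfolding K_def by (rule cl_sub(1)[OF sE])
        have rK: "rk K = rk G1 + 1" unfolding K_def rk_cl[OF sE] using rk_insert[OF fG(1)] e fG by blast
        have "K \<subseteq> G2" unfolding K_def by (rule cl_subset_flat[OF fG(2)]) (use e G(3) in blast)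
        moreover have "K \<noteq> G2" using rK G(4) by auto
        moreover have "G1 \<noteq> K" using iK e(2) by blast
        ultimately have KG: "K \<in> GG" using fK iK unfolding GG_def by blast
        have "H = K" if H: "H \<in> GG" "e \<in> H" for H
        proof -
          have fH: "flat H" "G1 \<subseteq> H" "H \<subseteq> G2" "H \<noteq> G2" using H unfolding GG_def by blast+
          have "K \<subseteq> H" unfolding K_def by (rule cl_subset_flat[OF fH(1)]) (use H fH in blast)
          moreover have "rk H < rk G2" using flat_eq_of_rk[OF fH(1) fG(2) fH(3)] fH(4) by fastforce
          hence "rk H \<le> rk K" using rK G(4) by simp
          ultimately show ?thesis using flat_eq_of_rk[OF fK fH(1)] by blast
        qed
        hence "{H\<in>GG. e \<in> H} = {K}" using KG iK by blast
        thus ?thesis by simp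
      qed
      have "lawrence_phi s $ e = lawrence_phi s $ f" if ef: "e \<in> E - F" "f \<in> E - F" "fle \<F> e f \<and> fle \<F> f e" for e f
      proof -
        have i1: "e \<in> G1 \<longleftrightarrow> f \<in> G1" and i2: "e \<in> G2 \<longleftrightarrow> f \<in> G2"
          using ef(3)[unfolded fle_def, THEN conjunct1, rule_format] ef(3)[unfolded fle_def, THEN conjunct2, rule_format]
            G(1,2) by metis+
        consider "e \<in> G1" "f \<in> G1" | "e \<notin> G2" "f \<notin> G2" | "e \<in> G2" "e \<notin> G1" "f \<in> G2" "f \<notin> G1"
          using i1 i2 by blast
        hence "card {H\<in>GG. e \<in> H} = card {H\<in>GG. f \<in> H}"
        proof cases
          case 1
          hence "{H\<in>GG. e \<in> H} = GG" "{H\<in>GG. f \<in> H} = GG" unfolding GG_def by blast+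
          thus ?thesis by simp
        next
          case 2
          hence "{H\<in>GG. e \<in> H} = {}" "{H\<in>GG. f \<in> H} = {}" unfolding GG_def by blast+
          thus ?thesis by (simp only:)
        next
          case 3 thus ?thesis using one by simp
        qed
        thus ?thesis using sphi ef by simp
      qed
      hence "s \<in> VF F m \<F>" using sW unfolding VF_def by blast
      hence "s \<in> span \<tau>" unfolding fl(2) span_HC[OF sf] .
      thus ?thesis unfolding eq .
    qed
    ultimately show ?thesis by (intro exI[of _ u] conjI ballI impI)
  qed
  show ?thesis unfolding balanced_fan_def
  proof (intro exI[of _ n] conjI ballI impI)
    fix C assume "C \<in> ?\<Sigma>" thus "\<exists>D\<in>?\<Sigma>. C \<subseteq> D \<and> dim D = n" by (rule b1)
  next
    fix C assume "C \<in> ?\<Sigma>" thus "dim C \<le> n" by (rule b2)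
  qed (rule b3)
qed

end

section \<open>Integral relations with unit coefficients\<close>

locale hypertoric = arrangement M E a r d + valued_field v
  for M :: "'m::euclidean_space set" and E :: "'e::finite set" and a :: "'e \<Rightarrow> 'm"
    and r :: "'e \<Rightarrow> int" and d :: nat and v :: "'k::field \<Rightarrow> ereal" +
  assumes residual: "residually_independent v M E a"
begin

text \<open>Independence of the set of vectors would overlook repetitions, and \<open>a\<close> need
  not be injective; so the condition is put on the indexed family, as in
  \<open>residually_independent\<close>.\<close>

definition findep :: "'e set \<Rightarrow> bool" where
  "findep S \<longleftrightarrow> (\<forall>c :: 'e \<Rightarrow> real. (\<Sum>e\<in>S. c e *\<^sub>R a e) = 0 \<longrightarrow> (\<forall>e\<in>S. c e = 0))"

lemma findepD: "findep S \<Longrightarrow> (\<Sum>e\<in>S. c e *\<^sub>R a e) = 0 \<Longrightarrow> e \<in> S \<Longrightarrow> c e = (0::real)"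
  unfolding findep_def by blast

lemma findep_subset: assumes "findep S" "T \<subseteq> S" shows "findep T"
  unfolding findep_def
proof (intro allI impI ballI)
  fix c :: "'e \<Rightarrow> real" and e assume c: "(\<Sum>e\<in>T. c e *\<^sub>R a e) = 0" and e: "e \<in> T"
  have "(\<Sum>e\<in>S. (if e \<in> T then c e else 0) *\<^sub>R a e) = (\<Sum>e\<in>T. c e *\<^sub>R a e)"
    using assms(2) by (intro sum.mono_neutral_cong_right) auto
  thus "c e = 0" using findepD[OF assms(1), of "\<lambda>e. if e \<in> T then c e else 0" e] c e assms(2) by auto
qed

lemma in_span_image: assumes "x \<in> span (a ` U)" shows "\<exists>q. x = (\<Sum>f\<in>U. q f *\<^sub>R a f)"
proof -
  let ?T = "{x. \<exists>q. x = (\<Sum>f\<in>U. q f *\<^sub>R a f)}"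
  have "subspace ?T"
  proof (rule subspaceI)
    have "0 = (\<Sum>f\<in>U. 0 *\<^sub>R a f)" by simp
    thus "0 \<in> ?T" by (intro CollectI exI[of _ "\<lambda>_. 0"])
  next
    fix x y assume "x \<in> ?T" "y \<in> ?T"
    then obtain q q' where "x = (\<Sum>f\<in>U. q f *\<^sub>R a f)" "y = (\<Sum>f\<in>U. q' f *\<^sub>R a f)" by blast
    hence "x + y = (\<Sum>f\<in>U. (q f + q' f) *\<^sub>R a f)" by (simp add: scaleR_add_left sum.distrib)
    thus "x + y \<in> ?T" by (intro CollectI exI[of _ "\<lambda>f. q f + q' f"])
  next
    fix c x assume "x \<in> ?T"
    then obtain q where "x = (\<Sum>f\<in>U. q f *\<^sub>R a f)" by blast
    hence "c *\<^sub>R x = (\<Sum>f\<in>U. (c * q f) *\<^sub>R a f)" by (simp add: scaleR_sum_right)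
    thus "c *\<^sub>R x \<in> ?T" by (intro CollectI exI[of _ "\<lambda>f. c * q f"])
  qed
  moreover have "a f \<in> ?T" if f: "f \<in> U" for f
  proof -
    have "(\<Sum>g\<in>U. (if g = f then 1 else 0) *\<^sub>R a g) = (\<Sum>g\<in>U. if g = f then a g else 0)"
      by (intro sum.cong) auto
    also have "\<dots> = a f" using f by simp
    finally show ?thesis by (intro CollectI exI[of _ "\<lambda>g. if g = f then 1 else 0"]) (rule sym)
  qed
  ultimately have "span (a ` U) \<subseteq> ?T" by (intro span_minimal) auto
  thus ?thesis using assms by blast
qed

lemma span_image_sum: "(\<Sum>f\<in>U. q f *\<^sub>R a f) \<in> span (a ` U)"
  by (intro span_sum span_scale span_base) auto

lemma residual_dvd:
  assumes "prime p" "0 < v (of_nat p)" "S \<subseteq> E" "findep S" "n \<in> dual_lattice M"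
    "(\<Sum>e\<in>S. of_int (c e) *\<^sub>R a e) = of_nat p *\<^sub>R n" "e \<in> S"
  shows "int p dvd c e"
  using residual assms unfolding residually_independent_def findep_def by blast

lemma dual_M_combination: "S \<subseteq> E \<Longrightarrow> (\<Sum>e\<in>S. of_int (c e) *\<^sub>R a e) \<in> dual_lattice M"
proof -
  assume S: "S \<subseteq> E"
  have "x \<bullet> (\<Sum>e\<in>S. of_int (c e) *\<^sub>R a e) \<in> \<int>" if "x \<in> M" for x
  proof -
    have "x \<bullet> (\<Sum>e\<in>S. of_int (c e) *\<^sub>R a e) = (\<Sum>e\<in>S. of_int (c e) * (x \<bullet> a e))" by (simp add: inner_sum_right)
    also have "\<dots> \<in> \<int>" using S that a_integral by (intro Ints_sum Ints_mult) auto
    finally show ?thesis .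
  qed
  thus ?thesis using sum_a_span[OF S] by (simp add: dual_lattice_def)
qed

text \<open>The coefficients are rational, and the least denominator works: if a prime
  \<open>p\<close> of positive valuation divided it, residual independence would make
  \<open>p\<close> divide all coefficients too, and cancelling \<open>p\<close> would give a smaller
  denominator.\<close>

lemma integral_expression:
  assumes U: "U \<subseteq> E" "findep U" and e: "e \<in> E" "a e \<in> span (a ` U)"
  shows "\<exists>D Q. D > 0 \<and> of_int D *\<^sub>R a e = (\<Sum>f\<in>U. of_int (Q f) *\<^sub>R a f) \<and> v (of_int D) = 0"
proof -
  obtain q where q: "a e = (\<Sum>f\<in>U. q f *\<^sub>R a f)" using in_span_image[OF e(2)] by blast
  from rational_approx_additive[of "{}" 1]
  obtain \<phi> :: "real \<Rightarrow> real" where \<phi>: "\<forall>x y. \<phi> (x + y) = \<phi> x + \<phi> y" "\<forall>x. \<phi> x \<in> \<rat>"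
    "\<forall>q\<in>\<rat>. \<forall>x. \<phi> (q * x) = q * \<phi> x" "\<phi> 1 = 1" by auto
  have \<phi>0: "\<phi> 0 = 0" using \<phi>(1)[rule_format, of 0 0] by simp
  have \<phi>d: "\<phi> (x - y) = \<phi> x - \<phi> y" for x y using \<phi>(1)[rule_format, of "x - y" y] by simp
  define c where "c f = (if f \<in> U then q f else 0) - (if f = e then 1 else 0)" for f
  have ee: "(\<Sum>f\<in>E. (if f = e then 1 else 0) *\<^sub>R a f) = a e"
  proof -
    have "(\<Sum>f\<in>E. (if f = e then 1 else 0) *\<^sub>R a f) = (\<Sum>f\<in>E. if f = e then a f else 0)" by (intro sum.cong) auto
    thus ?thesis using e(1) by simp
  qed
  have qq: "(\<Sum>f\<in>E. (if f \<in> U then g f else 0) *\<^sub>R a f) = (\<Sum>f\<in>U. g f *\<^sub>R a f)" for g :: "'e \<Rightarrow> real"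
    using U(1) by (intro sum.mono_neutral_cong_right) auto
  have "(\<Sum>f\<in>E. c f *\<^sub>R a f) = 0"
    unfolding c_def scaleR_diff_left sum_subtractf ee qq using q by simp
  hence "(\<Sum>f\<in>E. \<phi> (c f) *\<^sub>R a f) = 0" using additive_relation[of \<phi> E c] \<phi>(1,3) by blast
  moreover have "\<phi> (c f) = (if f \<in> U then \<phi> (q f) else 0) - (if f = e then 1 else 0)" for f
    by (simp add: c_def \<phi>d \<phi>0 \<phi>(4))
  ultimately have "(\<Sum>f\<in>U. \<phi> (q f) *\<^sub>R a f) = a e"
    by (simp only: scaleR_diff_left sum_subtractf ee qq) simp
  \<comment> \<open>Applying \<open>\<phi>\<close> to the coefficients gives a second expression of
    \<open>a e\<close>; independence identifies the two, so the coefficients are fixed by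
    \<open>\<phi>\<close> and therefore rational.\<close>
  hence "(\<Sum>f\<in>U. (\<phi> (q f) - q f) *\<^sub>R a f) = 0" using q by (simp add: scaleR_diff_left sum_subtractf)
  hence "\<phi> (q f) = q f" if "f \<in> U" for f using findepD[OF U(2), of "\<lambda>f. \<phi> (q f) - q f"] that by simp
  hence "q f \<in> \<rat>" if "f \<in> U" for f using \<phi>(2) that by metis
  then obtain D :: int where D: "D > 0" "\<forall>f\<in>U. of_int D * q f \<in> \<int>"
    using common_denominator[of U q] by auto
  define good where "good n \<longleftrightarrow> n > 0 \<and> (\<exists>Q. of_nat n *\<^sub>R a e = (\<Sum>f\<in>U. of_int (Q f) *\<^sub>R a f))" for n :: nat
  have k: "of_int \<lfloor>of_int D * q f\<rfloor> = of_int D * q f" if "f \<in> U" for f using D(2) that by (metis Ints_cases floor_of_int)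
  have "of_nat (nat D) *\<^sub>R a e = (\<Sum>f\<in>U. of_int \<lfloor>of_int D * q f\<rfloor> *\<^sub>R a f)"
    using D(1) by (subst q) (simp add: scaleR_sum_right k)
  hence "good (nat D)" unfolding good_def using D(1) by (intro conjI exI[of _ "\<lambda>f. \<lfloor>of_int D * q f\<rfloor>"]) auto
  define n where "n = (LEAST n. good n)"
  have n: "good n" unfolding n_def using \<open>good (nat D)\<close> by (rule LeastI)
  have nle: "n \<le> k" if "good k" for k unfolding n_def using that by (rule Least_le)
  obtain Q where Q: "of_nat n *\<^sub>R a e = (\<Sum>f\<in>U. of_int (Q f) *\<^sub>R a f)" using n unfolding good_def by blast
  have n0: "n > 0" using n by (simp add: good_def)
  have "v (of_int (int n)) = 0"
  proof (rule v_of_int_zero_iff)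
    show "int n \<noteq> 0" using n0 by simp
    fix p assume p: "prime p" "0 < v (of_nat p)"
    show "\<not> int p dvd int n"
    proof
      assume "int p dvd int n"
      then obtain l where l: "n = p * l" using int_dvd_int_iff by (metis dvdE)
      have "(\<Sum>f\<in>U. of_int (Q f) *\<^sub>R a f) = of_nat p *\<^sub>R (of_nat l *\<^sub>R a e)" by (simp add: l flip: Q)
      moreover have "of_nat l *\<^sub>R a e \<in> dual_lattice M"
        using dual_M_combination[of "{e}" "\<lambda>_. int l"] e(1) by simp
      ultimately have dv: "int p dvd Q f" if "f \<in> U" for f using residual_dvd[OF p U] that by blast
      have "of_nat p *\<^sub>R (of_nat l *\<^sub>R a e) = of_nat p *\<^sub>R (\<Sum>f\<in>U. of_int (Q f div int p) *\<^sub>R a f)"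
      proof -
        have "of_int (Q f) = of_nat p * (of_int (Q f div int p) :: real)" if "f \<in> U" for f
          using dv[OF that] by (metis dvd_mult_div_cancel of_int_mult of_int_of_nat_eq)
        hence "(\<Sum>f\<in>U. of_int (Q f) *\<^sub>R a f) = (\<Sum>f\<in>U. of_nat p *\<^sub>R (of_int (Q f div int p) *\<^sub>R a f))"
          by (intro sum.cong) simp_all
        thus ?thesis using Q by (simp add: l scaleR_sum_right)
      qed
      hence "of_nat l *\<^sub>R a e = (\<Sum>f\<in>U. of_int (Q f div int p) *\<^sub>R a f)" 
        using prime_gt_0_nat[OF p(1)] by (simp only: scaleR_cancel_left) simp
      hence "good l" using n0 l unfolding good_def by (intro conjI exI[of _ "\<lambda>f. Q f div int p"]) auto
      hence "n \<le> l" by (rule nle)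
      thus False using l n0 prime_gt_1_nat[OF p(1)] by auto
    qed
  qed
  thus ?thesis using Q n0 by (intro exI[of _ "int n"] exI[of _ Q]) simp
qed

lemma findep_spanning_subset:
  assumes "x \<in> span (a ` U)" shows "\<exists>U'\<subseteq>U. findep U' \<and> x \<in> span (a ` U')"
proof -
  define A where "A = {U'. U' \<subseteq> U \<and> x \<in> span (a ` U')}"
  have "finite A" "A \<noteq> {}" using assms by (auto simp: A_def)
  then obtain U' where U': "U' \<in> A" "\<And>V. V \<in> A \<Longrightarrow> card U' \<le> card V"
    using ex_is_arg_min_if_finite[of A card] by (auto simp: is_arg_min_linorder)
  have "findep U'"
    unfolding findep_def
  proof (intro allI impI ballI, rule ccontr)
    fix c :: "'e \<Rightarrow> real" and f assume c: "(\<Sum>e\<in>U'. c e *\<^sub>R a e) = 0" and f: "f \<in> U'" "c f \<noteq> 0"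
    have "(\<Sum>e\<in>U'. c e *\<^sub>R a e) = c f *\<^sub>R a f + (\<Sum>e\<in>U' - {f}. c e *\<^sub>R a e)" using f(1) by (simp add: sum.remove)
    hence "c f *\<^sub>R a f = - (\<Sum>e\<in>U' - {f}. c e *\<^sub>R a e)" using c by (simp add: eq_neg_iff_add_eq_0)
    also have "\<dots> \<in> span (a ` (U' - {f}))" by (rule span_neg[OF span_image_sum])
    finally have "(1 / c f) *\<^sub>R (c f *\<^sub>R a f) \<in> span (a ` (U' - {f}))" by (rule span_scale)
    hence "a f \<in> span (a ` (U' - {f}))" using f(2) by simp
    hence "a ` U' \<subseteq> span (a ` (U' - {f}))" by (auto intro: span_base)
    hence "span (a ` U') \<subseteq> span (a ` (U' - {f}))" by (rule span_minimal) simp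
    hence "U' - {f} \<in> A" using U'(1) unfolding A_def by blast
    hence "card U' \<le> card (U' - {f})" by (rule U'(2))
    moreover have "card (U' - {f}) < card U'" using f(1) by (intro psubset_card_mono) auto
    ultimately show False by simp
  qed
  thus ?thesis using U'(1) unfolding A_def by blast
qed

text \<open>The denominator from \<open>integral_expression\<close> becomes the coefficient of
  \<open>e\<close>. With a unit there, the term of \<open>e\<close> stands alone as soon as all
  terms over \<open>U\<close> have larger value.\<close>

lemma unit_relation:
  assumes U: "U \<subseteq> E" "e \<notin> U" and e: "e \<in> E" "a e \<in> span (a ` U)"
  shows "\<exists>c :: 'e \<Rightarrow> int. (\<forall>f. f \<notin> insert e U \<longrightarrow> c f = 0) \<and> (\<Sum>f\<in>E. of_int (c f) *\<^sub>R a f) = 0 \<and> v (of_int (c e)) = 0"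
proof -
  obtain U' where U': "U' \<subseteq> U" "findep U'" "a e \<in> span (a ` U')" using findep_spanning_subset[OF e(2)] by blast
  obtain D Q where DQ: "of_int D *\<^sub>R a e = (\<Sum>f\<in>U'. of_int (Q f) *\<^sub>R a f)" "v (of_int D) = 0"
    using integral_expression[OF _ U'(2) e(1) U'(3)] U'(1) U(1) by blast
  define c where "c f = (if f = e then D else if f \<in> U' then - Q f else 0)" for f
  have "(\<Sum>f\<in>E. of_int (c f) *\<^sub>R a f) = (\<Sum>f\<in>insert e U'. of_int (c f) *\<^sub>R a f)"
    using U U' e by (intro sum.mono_neutral_right) (auto simp: c_def)
  also have "\<dots> = of_int D *\<^sub>R a e + (\<Sum>f\<in>U'. of_int (c f) *\<^sub>R a f)"
    using U(2) U'(1) by (subst sum.insert) (auto simp: c_def)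
  also have "(\<Sum>f\<in>U'. of_int (c f) *\<^sub>R a f) = - (\<Sum>f\<in>U'. of_int (Q f) *\<^sub>R a f)"
    unfolding sum_negf[symmetric] using U(2) U'(1) by (intro sum.cong) (auto simp: c_def)
  finally have "(\<Sum>f\<in>E. of_int (c f) *\<^sub>R a f) = 0" using DQ(1) by simp
  moreover have "\<forall>f. f \<notin> insert e U \<longrightarrow> c f = 0" using U' by (auto simp: c_def)
  moreover have "c e = D" by (simp add: c_def)
  ultimately show ?thesis using DQ(2) by (intro exI[of _ c]) simp
qed

text \<open>The basis is chosen greedily along an order by decreasing values of \<open>w\<close>.\<close>

lemma adapted_basis:
  fixes w :: "'e \<Rightarrow> ereal"
  shows "\<exists>B q D. B \<subseteq> E \<and> findep B \<and> D \<noteq> 0 \<and> v (of_int D) = 0 \<and>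
    (\<forall>e\<in>E. of_int D *\<^sub>R a e = (\<Sum>b\<in>B. of_int (q e b) *\<^sub>R a b)) \<and> (\<forall>e\<in>E. \<forall>b\<in>B. q e b \<noteq> 0 \<longrightarrow> w e \<le> w b)"
proof -
  obtain g :: "'e \<Rightarrow> nat" where g: "inj_on g E"
    using ex_bij_betw_finite_nat[of E] by (auto simp: bij_betw_def)
  \<comment> \<open>Ties between equal values are broken by an injective numbering, which makes the
    order strict and total on \<open>E\<close>.\<close>
  define lt where "lt f e \<longleftrightarrow> w e < w f \<or> (w e = w f \<and> g f < g e)" for f e
  have trans: "lt x y \<Longrightarrow> lt y z \<Longrightarrow> lt x z" for x y z unfolding lt_def by auto
  have irr: "\<not> lt x x" for x by (simp add: lt_def)
  have total: "x = y \<or> lt x y \<or> lt y x" if "x \<in> E" "y \<in> E" for x y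
    using that g unfolding lt_def inj_on_def by (metis linorder_less_linear)
  define pred where "pred e = {f\<in>E. lt f e}" for e
  have predlt: "card (pred f) < card (pred e)" if "lt f e" "f \<in> E" for e f
  proof (rule psubset_card_mono)
    have "pred f \<subseteq> pred e" using trans[OF _ that(1)] by (auto simp: pred_def)
    moreover have "f \<in> pred e" "f \<notin> pred f" using that irr by (auto simp: pred_def)
    ultimately show "pred f \<subset> pred e" by blast
  qed simp
  define B where "B = {e\<in>E. a e \<notin> span (a ` pred e)}"
  define Bl where "Bl e = {b\<in>B. b = e \<or> lt b e}" for e
  have gen: "a e \<in> span (a ` Bl e)" if "e \<in> E" for e
    using that
  proof (induction "card (pred e)" arbitrary: e rule: less_induct)
    case less
    show ?case
    proof (cases "e \<in> B")
      case True thus ?thesis by (intro span_base) (auto simp: Bl_def)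
    next
      case False
      hence "a e \<in> span (a ` pred e)" using less.prems by (simp add: B_def)
      moreover have "a f \<in> span (a ` Bl e)" if f: "f \<in> pred e" for f
      proof -
        have f': "f \<in> E" "lt f e" using f by (auto simp: pred_def)
        have "a f \<in> span (a ` Bl f)" using less.hyps predlt f' by blast
        moreover have "Bl f \<subseteq> Bl e" using f'(2) trans unfolding Bl_def by blast
        ultimately show ?thesis using span_mono[OF image_mono] by blast
      qed
      ultimately show ?thesis using span_minimal[of "a ` pred e" "span (a ` Bl e)"] by auto
    qed
  qed
  have "findep B"
    unfolding findep_def
  proof (intro allI impI ballI, rule ccontr)
    fix c :: "'e \<Rightarrow> real" and f assume c: "(\<Sum>e\<in>B. c e *\<^sub>R a e) = 0" and f: "f \<in> B" "c f \<noteq> 0"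
    define A where "A = {b\<in>B. c b \<noteq> 0}"
    have "finite A" "A \<noteq> {}" using f by (auto simp: A_def)
    then obtain b where b: "b \<in> A" "\<And>b'. b' \<in> A \<Longrightarrow> card (pred b') \<le> card (pred b)"
      using ex_is_arg_min_if_finite[of A "\<lambda>b. - int (card (pred b))"] by (auto simp: is_arg_min_linorder)
    have b': "b \<in> B" "c b \<noteq> 0" "b \<in> E" using b(1) by (auto simp: A_def B_def)
    have "e \<in> pred b" if e: "e \<in> A - {b}" for e
    proof -
      have "e \<in> E" using e by (auto simp: A_def B_def)
      moreover have "\<not> lt b e" using predlt[of b e] b(2)[of e] e b'(3) by fastforce
      ultimately show ?thesis using total[of e b] e b'(3) by (auto simp: pred_def)
    qed
    hence sub: "a ` (A - {b}) \<subseteq> a ` pred b" by blast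
    have "(\<Sum>e\<in>B. c e *\<^sub>R a e) = (\<Sum>e\<in>A. c e *\<^sub>R a e)" by (rule sum.mono_neutral_right) (auto simp: A_def)
    also have "\<dots> = c b *\<^sub>R a b + (\<Sum>e\<in>A - {b}. c e *\<^sub>R a e)" using b(1) by (simp add: sum.remove)
    finally have "c b *\<^sub>R a b = - (\<Sum>e\<in>A - {b}. c e *\<^sub>R a e)" using c by (simp add: eq_neg_iff_add_eq_0)
    also have "\<dots> \<in> span (a ` pred b)" using span_mono[OF sub] by (intro span_neg) (use span_image_sum in blast)
    finally have "(1 / c b) *\<^sub>R (c b *\<^sub>R a b) \<in> span (a ` pred b)" by (rule span_scale)
    hence "a b \<in> span (a ` pred b)" using b'(2) by simp
    thus False using b'(1) by (simp add: B_def)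
  qed
  have BE: "B \<subseteq> E" by (auto simp: B_def)
  have "\<exists>D Q. D > 0 \<and> of_int D *\<^sub>R a e = (\<Sum>f\<in>Bl e. of_int (Q f) *\<^sub>R a f) \<and> v (of_int D) = 0" if "e \<in> E" for e
  proof (rule integral_expression[OF _ _ that gen[OF that]])
    show "Bl e \<subseteq> E" using BE by (auto simp: Bl_def)
    show "findep (Bl e)" by (rule findep_subset[OF \<open>findep B\<close>]) (auto simp: Bl_def)
  qed
  hence "\<forall>e. \<exists>D Q. e \<in> E \<longrightarrow> D > 0 \<and> of_int D *\<^sub>R a e = (\<Sum>f\<in>Bl e. of_int (Q f) *\<^sub>R a f) \<and> v (of_int D) = 0" by blast
  then obtain De where "\<forall>e. \<exists>Q. e \<in> E \<longrightarrow> De e > 0 \<and> of_int (De e) *\<^sub>R a e = (\<Sum>f\<in>Bl e. of_int (Q f) *\<^sub>R a f) \<and> v (of_int (De e)) = 0"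
    by (rule choice[THEN exE])
  then obtain Qe where DQ: "\<And>e. e \<in> E \<Longrightarrow> De e > 0 \<and> of_int (De e) *\<^sub>R a e = (\<Sum>f\<in>Bl e. of_int (Qe e f) *\<^sub>R a f) \<and> v (of_int (De e)) = 0"
    using choice[of "\<lambda>e Q. e \<in> E \<longrightarrow> De e > 0 \<and> of_int (De e) *\<^sub>R a e = (\<Sum>f\<in>Bl e. of_int (Q f) *\<^sub>R a f) \<and> v (of_int (De e)) = 0"]
    by blast
  \<comment> \<open>One denominator serves for all \<open>e\<close>: the product stays nonzero and
    of valuation 0, and the extra factors are moved into the coefficients \<open>q\<close>.\<close>
  define D where "D = (\<Prod>e\<in>E. De e)"
  define q where "q e b = (if b \<in> Bl e then (\<Prod>f\<in>E - {e}. De f) * Qe e b else 0)" for e b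
  have vD: "v (of_int (\<Prod>e\<in>A. De e)) = 0" if "A \<subseteq> E" for A
    using that
  proof (induction A rule: infinite_finite_induct)
    case (insert x A) thus ?case using DQ[of x] by (simp add: v_mult)
  qed auto
  have "De e \<noteq> 0" if "e \<in> E" for e using DQ[OF that] by simp
  hence D0: "D \<noteq> 0" unfolding D_def by simp
  have "of_int D *\<^sub>R a e = (\<Sum>b\<in>B. of_int (q e b) *\<^sub>R a b)" if e: "e \<in> E" for e
  proof -
    have "(\<Sum>b\<in>B. of_int (q e b) *\<^sub>R a b) = (\<Sum>b\<in>Bl e. of_int (q e b) *\<^sub>R a b)"
      by (rule sum.mono_neutral_right) (auto simp: Bl_def q_def)
    also have "\<dots> = (\<Sum>b\<in>Bl e. of_int (\<Prod>f\<in>E - {e}. De f) *\<^sub>R (of_int (Qe e b) *\<^sub>R a b))"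
      by (intro sum.cong) (simp_all add: q_def)
    also have "\<dots> = of_int (\<Prod>f\<in>E - {e}. De f) *\<^sub>R (of_int (De e) *\<^sub>R a e)"
      using DQ[OF e] by (simp add: scaleR_sum_right)
    also have "\<dots> = of_int (De e * (\<Prod>f\<in>E - {e}. De f)) *\<^sub>R a e" by (simp add: mult.commute)
    also have "De e * (\<Prod>f\<in>E - {e}. De f) = D" unfolding D_def using e by (simp add: prod.remove)
    finally show ?thesis by simp
  qed
  moreover have "w e \<le> w b" if "e \<in> E" "b \<in> B" "q e b \<noteq> 0" for e b
  proof -
    have "b = e \<or> lt b e" using that(3) unfolding q_def Bl_def by (auto split: if_splits)
    thus ?thesis unfolding lt_def by auto
  qed
  ultimately show ?thesis using BE \<open>findep B\<close> D0 vD[OF order_refl]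
    by (intro exI[of _ B] exI[of _ q] exI[of _ D]) (simp add: D_def)
qed

text \<open>Without a unit coefficient at the level of \<open>e\<close>,
  \<open>D *\<^sub>R a e\<close> would be, modulo a prime \<open>p\<close> of positive valuation, a
  combination of basis elements of larger value. These lie in the flat \<open>G\<close>, whose span
  misses \<open>a e\<close>, so together with \<open>e\<close> they are independent; residual
  independence then forces \<open>p\<close> to divide \<open>D\<close>, against
  \<open>v (of_int D) = 0\<close>.\<close>

lemma adapted_unit_coefficient:
  fixes w :: "'e \<Rightarrow> ereal"
  assumes B: "B \<subseteq> E" "findep B" "D \<noteq> 0" "v (of_int D) = 0"
    "\<forall>e\<in>E. of_int D *\<^sub>R a e = (\<Sum>b\<in>B. of_int (q e b) *\<^sub>R a b)" "\<forall>e\<in>E. \<forall>b\<in>B. q e b \<noteq> 0 \<longrightarrow> w e \<le> w b"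
    and flats: "\<forall>G\<in>levels E w. flat G" and e: "e \<in> E" "w e \<noteq> \<infinity>"
  shows "\<exists>b\<in>B. w b = w e \<and> v (of_int (q e b)) = 0"
proof (rule ccontr)
  assume neg: "\<not> (\<exists>b\<in>B. w b = w e \<and> v (of_int (q e b)) = 0)"
  define G where "G = {f\<in>E. w e < w f}"
  \<comment> \<open>Including \<infinity> covers the case that \<open>G\<close> is empty; in all
    cases \<open>t\<close> exceeds \<open>w e\<close>, and \<open>G\<close> is the superlevel set at
    \<open>t\<close>.\<close>
  define t where "t = Min (insert \<infinity> (w ` G))"
  have "t \<in> insert \<infinity> (w ` G)" unfolding t_def by (intro Min_in) auto
  hence "w e < t" using e(2) by (auto simp: G_def)
  have "G = {f\<in>E. t \<le> w f}"
  proof (intro equalityI subsetI)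
    fix f assume f: "f \<in> G"
    hence "t \<le> w f" unfolding t_def by (intro Min_le) auto
    thus "f \<in> {f\<in>E. t \<le> w f}" using f by (simp add: G_def)
  next
    fix f assume "f \<in> {f\<in>E. t \<le> w f}" thus "f \<in> G" using \<open>w e < t\<close> by (auto simp: G_def)
  qed
  hence "G \<in> levels E w" unfolding levels_def by blast
  hence fG: "flat G" using flats by blast
  have ns: "a e \<notin> span (a ` G)" using fG e(1) unfolding flat_iff by (auto simp: G_def)
  have Bsplit: "of_int D *\<^sub>R a e = (\<Sum>b\<in>B \<inter> G. of_int (q e b) *\<^sub>R a b) + (\<Sum>b\<in>B - G. of_int (q e b) *\<^sub>R a b)"
    using B(5) e(1) sum.Int_Diff[of B "\<lambda>b. of_int (q e b) *\<^sub>R a b" G] by simp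
  have inG: "(\<Sum>b\<in>B \<inter> G. of_int (q e b) *\<^sub>R a b) \<in> span (a ` G)"
    by (intro span_sum span_scale span_base) auto
  have pos: "0 < v (of_int (q e b))" if b: "b \<in> B - G" for b
  proof (cases "q e b = 0")
    case False
    hence "w e \<le> w b" using B(6) e(1) b by blast
    moreover have "\<not> w e < w b" using b B(1) by (auto simp: G_def)
    ultimately have "w b = w e" by simp
    hence "v (of_int (q e b)) \<noteq> 0" using neg b by blast
    thus ?thesis using v_of_int_nonneg[of "q e b"] by (simp add: order_less_le)
  qed simp
  have "\<exists>b\<in>B - G. q e b \<noteq> 0"
  proof (rule ccontr)
    assume "\<not> (\<exists>b\<in>B - G. q e b \<noteq> 0)"
    hence "(\<Sum>b\<in>B - G. of_int (q e b) *\<^sub>R a b) = 0" by (intro sum.neutral) auto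
    hence "of_int D *\<^sub>R a e \<in> span (a ` G)" using Bsplit inG by simp
    hence "(1 / of_int D) *\<^sub>R (of_int D *\<^sub>R a e) \<in> span (a ` G)" by (rule span_scale)
    thus False using ns B(3) by simp
  qed
  then obtain b0 where b0: "b0 \<in> B - G" "q e b0 \<noteq> 0" by blast
  obtain p where p: "prime p" "0 < v (of_nat p)" using v_of_int_zero_iff[of "q e b0"] pos[OF b0(1)] b0(2) by force
  have dv: "int p dvd q e b" if "b \<in> B - G" for b by (rule v_of_int_pos_dvd[OF p pos[OF that]])
  define n where "n = (\<Sum>b\<in>B - G. of_int (q e b div int p) *\<^sub>R a b)"
  have nd: "n \<in> dual_lattice M" unfolding n_def using B(1) by (intro dual_M_combination) auto
  have pn: "(\<Sum>b\<in>B - G. of_int (q e b) *\<^sub>R a b) = of_nat p *\<^sub>R n"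
  proof -
    have "of_int (q e b) = of_nat p * (of_int (q e b div int p) :: real)" if "b \<in> B - G" for b
      using dv[OF that] by (metis dvd_mult_div_cancel of_int_mult of_int_of_nat_eq)
    thus ?thesis unfolding n_def scaleR_sum_right by (intro sum.cong) simp_all
  qed
  define S where "S = insert e (B \<inter> G)"
  have eS: "e \<notin> B \<inter> G" by (simp add: G_def)
  have SE: "S \<subseteq> E" using B(1) e(1) by (auto simp: S_def)
  have "findep S"
    unfolding findep_def
  proof (intro allI impI ballI)
    fix c :: "'e \<Rightarrow> real" and f assume c: "(\<Sum>e\<in>S. c e *\<^sub>R a e) = 0" and f: "f \<in> S"
    have s: "c e *\<^sub>R a e + (\<Sum>b\<in>B \<inter> G. c b *\<^sub>R a b) = 0" using c eS by (simp add: S_def)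
    have "c e = 0"
    proof (rule ccontr)
      assume ce: "c e \<noteq> 0"
      have "c e *\<^sub>R a e = - (\<Sum>b\<in>B \<inter> G. c b *\<^sub>R a b)" using s by (simp add: eq_neg_iff_add_eq_0)
      also have "\<dots> \<in> span (a ` G)" by (intro span_neg span_sum span_scale span_base) auto
      finally have "(1 / c e) *\<^sub>R (c e *\<^sub>R a e) \<in> span (a ` G)" by (rule span_scale)
      thus False using ns ce by simp
    qed
    moreover have "(\<Sum>b\<in>B \<inter> G. c b *\<^sub>R a b) = 0" using s \<open>c e = 0\<close> by simp
    hence "c b = 0" if "b \<in> B \<inter> G" for b using findepD[OF findep_subset[OF B(2), of "B \<inter> G"]] that by blast
    ultimately show "c f = 0" using f by (auto simp: S_def)
  qed
  moreover have "(\<Sum>f\<in>S. of_int (if f = e then D else - q e f) *\<^sub>R a f) = of_nat p *\<^sub>R n"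
  proof -
    have "(\<Sum>f\<in>S. of_int (if f = e then D else - q e f) *\<^sub>R a f) =
        of_int D *\<^sub>R a e + (\<Sum>f\<in>B \<inter> G. of_int (if f = e then D else - q e f) *\<^sub>R a f)"
      unfolding S_def using eS by (subst sum.insert) auto
    also have "(\<Sum>f\<in>B \<inter> G. of_int (if f = e then D else - q e f) *\<^sub>R a f) = - (\<Sum>f\<in>B \<inter> G. of_int (q e f) *\<^sub>R a f)"
      unfolding sum_negf[symmetric] using eS by (intro sum.cong) auto
    finally show ?thesis using Bsplit pn by simp
  qed
  ultimately have "int p dvd (if e = e then D else - q e e)"
    using residual_dvd[OF p SE _ nd, of "\<lambda>f. if f = e then D else - q e f" e] by (simp add: S_def)
  then obtain k where "D = int p * k" by (auto simp: dvd_def)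
  hence "v (of_int D) = v (of_nat p) + v (of_int k)" by (simp add: v_mult)
  hence "0 < v (of_int D)" using p(2) v_of_int_nonneg[of k] by (simp add: add_pos_nonneg)
  thus False using B(4) by simp
qed

end

section \<open>Valuations on the strata\<close>

lemma unit_char_inj: "unit_char e = unit_char f \<longleftrightarrow> e = f"
  by (auto simp: unit_char_def axis_eq_axis)

lemma snd_unit_char: "snd (unit_char e) $ f = (if e = f then 1 else 0)"
  by (simp add: unit_char_def axis_def)

text \<open>The coordinate \<open>x\<^sub>e\<close> is replaced by the linear form \<open>ell e\<close> in the coordinates of a basis adapted to
  the values of the coordinates at \<open>y\<close>; the relations become zero and the Gauss valuation at \<open>y\<close> still has
  the right values on characters. The substitution only makes sense for characters with
  nonnegative exponents outside \<open>F\<close>, so general ones are first multiplied by a power of the product of the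
  coordinates outside \<open>F\<close>.\<close>

locale stratum_valuation = hypertoric M E a r d v
  for M :: "'m::euclidean_space set" and E :: "'e::finite set" and a :: "'e \<Rightarrow> 'm"
    and r :: "'e \<Rightarrow> int" and d :: nat and v :: "'k::field \<Rightarrow> ereal" +
  fixes F :: "'e set" and m :: 'm and y :: "(real^'e) \<times> (real^'e)"
    and B :: "'e set" and q :: "'e \<Rightarrow> 'e \<Rightarrow> int" and D :: int
  assumes flatF: "flat F" and yW: "y \<in> W F m"
    and flats: "\<forall>G\<in>levels E (wv F (lawrence_phi y)). flat G"
    and B: "B \<subseteq> E" "findep B" "D \<noteq> 0" "v (of_int D) = 0"
      "\<forall>e\<in>E. of_int D *\<^sub>R a e = (\<Sum>b\<in>B. of_int (q e b) *\<^sub>R a b)"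
      "\<forall>e\<in>E. \<forall>b\<in>B. q e b \<noteq> 0 \<longrightarrow> wv F (lawrence_phi y) e \<le> wv F (lawrence_phi y) b"
begin

lemma FE: "F \<subseteq> E" using flatF by (rule flat_sub)

text \<open>The linear form for \<open>D\<close> times \<open>x_e\<close> in the basis coordinates;
  the factor has valuation 0 and does not affect values. Basis elements in \<open>F\<close> are left
  out because their coordinates vanish on the stratum.\<close>

definition ell :: "'e \<Rightarrow> ((real^'e) \<times> (real^'e)) \<Rightarrow>\<^sub>0 'k" where
  "ell e = (\<Sum>b\<in>B - F. Poly_Mapping.single (unit_char b) (of_int (q e b)))"

lemma lookup_ell: "b \<in> B - F \<Longrightarrow> Poly_Mapping.lookup (ell e) (unit_char b) = of_int (q e b)"
  unfolding ell_def by (simp add: lookup_sum lookup_single when_def unit_char_inj)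

text \<open>All terms have at least the value of \<open>x_e\<close> because the basis is adapted,
  and the unit coefficient at a basis element of the same level attains it.\<close>

lemma gauss_ell: assumes e: "e \<in> E - F" shows "gauss v y (ell e) = ereal (lawrence_phi y $ e)"
proof (rule antisym)
  obtain b where b: "b \<in> B" "wv F (lawrence_phi y) b = wv F (lawrence_phi y) e" "v (of_int (q e b)) = 0"
    using adapted_unit_coefficient[OF B flats, of e] e by (auto simp: wv_def)
  hence bF: "b \<in> B - F" "lawrence_phi y $ b = lawrence_phi y $ e" using e by (auto simp: wv_def split: if_splits)
  have "gauss v y (ell e) \<le> v (Poly_Mapping.lookup (ell e) (unit_char b)) + ereal (y \<bullet> unit_char b)" by (rule gauss_le)
  thus "gauss v y (ell e) \<le> ereal (lawrence_phi y $ e)" using b(3) bF by (simp add: lookup_ell inner_unit_char)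
  show "ereal (lawrence_phi y $ e) \<le> gauss v y (ell e)"
    unfolding ell_def
  proof (rule gauss_sum_ge)
    fix b assume b: "b \<in> B - F"
    show "ereal (lawrence_phi y $ e) \<le> gauss v y (Poly_Mapping.single (unit_char b) (of_int (q e b)))"
    proof (cases "q e b = 0")
      case False
      hence "wv F (lawrence_phi y) e \<le> wv F (lawrence_phi y) b" using B(6) e b by blast
      hence "lawrence_phi y $ e \<le> lawrence_phi y $ b" using e b by (simp add: wv_def)
      hence "0 + ereal (lawrence_phi y $ e) \<le> v (of_int (q e b)) + ereal (lawrence_phi y $ b)"
        using v_of_int_nonneg[of "q e b"] by (intro add_mono) auto
      thus ?thesis by (simp add: gauss_single inner_unit_char)
    qed simp
  qed
qed

text \<open>Independence of the basis annihilates the combined coefficient at every basis element.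
  An index \<open>e \<in> F\<close> contributes nothing at a basis element outside \<open>F\<close>,
  because \<open>q e b \<noteq> 0\<close> would require \<infinity> to be at most a finite
  value.\<close>

lemma ell_relation:
  assumes c: "(\<Sum>e\<in>E. of_int (c e) *\<^sub>R a e) = 0"
  shows "(\<Sum>e\<in>E - F. Poly_Mapping.single 0 (of_int (c e)) * ell e) = 0"
proof -
  have z: "(\<Sum>e\<in>E - F. c e * q e b) = 0" if b: "b \<in> B - F" for b
  proof -
    have "(\<Sum>b\<in>B. of_int (\<Sum>e\<in>E. c e * q e b) *\<^sub>R a b) = (\<Sum>b\<in>B. \<Sum>e\<in>E. of_int (c e) *\<^sub>R (of_int (q e b) *\<^sub>R a b))"
      by (simp add: scaleR_sum_left)
    also have "\<dots> = (\<Sum>e\<in>E. of_int (c e) *\<^sub>R (of_int D *\<^sub>R a e))"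
      using B(5) by (subst sum.swap) (simp add: scaleR_sum_right)
    also have "\<dots> = of_int D *\<^sub>R (\<Sum>e\<in>E. of_int (c e) *\<^sub>R a e)" by (simp add: scaleR_sum_right mult.commute)
    finally have "(\<Sum>b\<in>B. of_int (\<Sum>e\<in>E. c e * q e b) *\<^sub>R a b) = 0" using c by simp
    hence "real_of_int (\<Sum>e\<in>E. c e * q e b) = 0"
      using findepD[OF B(2), of "\<lambda>b. of_int (\<Sum>e\<in>E. c e * q e b)" b] b by blast
    hence "(\<Sum>e\<in>E. c e * q e b) = 0" by linarith
    moreover have "(\<Sum>e\<in>E. c e * q e b) = (\<Sum>e\<in>E - F. c e * q e b)"
    proof (rule sum.mono_neutral_right)
      show "\<forall>e\<in>E - (E - F). c e * q e b = 0"
      proof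
        fix e assume e: "e \<in> E - (E - F)"
        have "\<not> wv F (lawrence_phi y) e \<le> wv F (lawrence_phi y) b" using e b by (simp add: wv_def)
        hence "q e b = 0" using B(6) e b by blast
        thus "c e * q e b = 0" by simp
      qed
    qed auto
    ultimately show ?thesis by simp
  qed
  have "(\<Sum>e\<in>E - F. Poly_Mapping.single 0 (of_int (c e)) * ell e) =
      (\<Sum>e\<in>E - F. \<Sum>b\<in>B - F. Poly_Mapping.single (unit_char b) (of_int (c e * q e b)))"
    unfolding ell_def sum_distrib_left by (simp only: mult_single add_0_left of_int_mult)
  also have "\<dots> = (\<Sum>b\<in>B - F. \<Sum>e\<in>E - F. Poly_Mapping.single (unit_char b) (of_int (c e * q e b)))"
    by (rule sum.swap)
  also have "\<dots> = (\<Sum>b\<in>B - F. Poly_Mapping.single (unit_char b) (of_int (\<Sum>e\<in>E - F. c e * q e b)))"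
  proof (rule sum.cong[OF refl])
    fix b
    have "(\<Sum>e\<in>A. Poly_Mapping.single (unit_char b) (of_int (c e * q e b) :: 'k)) =
        Poly_Mapping.single (unit_char b) (of_int (\<Sum>e\<in>A. c e * q e b))" for A
      by (induction A rule: infinite_finite_induct) (auto simp: single_add)
    thus "(\<Sum>e\<in>E - F. Poly_Mapping.single (unit_char b) (of_int (c e * q e b) :: 'k)) =
        Poly_Mapping.single (unit_char b) (of_int (\<Sum>e\<in>E - F. c e * q e b))" .
  qed
  also have "\<dots> = 0" using z by simp
  finally show ?thesis .
qed

definition Tm :: "((real^'e) \<times> (real^'e)) set" where
  "Tm = {u\<in>dual_lattice N. \<forall>x\<in>lcone F m. x \<bullet> u = 0}"

definition Pm :: "((real^'e) \<times> (real^'e)) set" where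
  "Pm = {u\<in>Tm. \<forall>e\<in>E - F. 0 \<le> snd u $ e}"

text \<open>The part of a character complementary to the coordinates outside \<open>F\<close>: after
  the subtraction its second component vanishes there, so no power of such a coordinate is left to
  substitute.\<close>

definition sh :: "(real^'e) \<times> (real^'e) \<Rightarrow> (real^'e) \<times> (real^'e)" where
  "sh u = u - (\<Sum>e\<in>E - F. snd u $ e *\<^sub>R unit_char e)"

text \<open>The image of the character \<open>u\<close> under the substitution. \<open>nat\<close>
  of the floor is the true exponent as soon as \<open>u \<in> Pm\<close>, where the second component
  is a nonnegative integer outside \<open>F\<close>.\<close>

definition hh :: "(real^'e) \<times> (real^'e) \<Rightarrow> ((real^'e) \<times> (real^'e)) \<Rightarrow>\<^sub>0 'k" where
  "hh u = Poly_Mapping.single (sh u) 1 * (\<Prod>e\<in>E - F. ell e ^ nat \<lfloor>snd u $ e\<rfloor>)"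

lemma Tm_add: "x \<in> Tm \<Longrightarrow> t \<in> Tm \<Longrightarrow> x + t \<in> Tm"
  by (simp add: Tm_def dual_N_add inner_add_right)

lemma Pm_add: "x \<in> Pm \<Longrightarrow> t \<in> Pm \<Longrightarrow> x + t \<in> Pm"
  by (simp add: Pm_def Tm_add)

lemma zero_Pm: "0 \<in> Pm" by (simp add: Pm_def Tm_def dual_N_zero)

lemma unit_char_Pm: assumes "e \<in> E - F" shows "unit_char e \<in> Pm"
proof -
  have "\<forall>x\<in>lcone F m. x \<bullet> unit_char e = 0"
    using unit_char_orthogonal_iff[of e "PP F m" "QQ F m"] assms PP_Un_QQ by simp
  thus ?thesis using unit_char_dual[of e] assms by (simp add: Pm_def Tm_def snd_unit_char)
qed

lemma Tm_integral: "u \<in> Tm \<Longrightarrow> snd u $ e \<in> \<int>" using dual_N_integral(2) by (simp add: Tm_def)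

lemma sh_add: "sh (x + t) = sh x + sh t"
  by (simp add: sh_def scaleR_add_left sum.distrib)

lemma nat_floor_add:
  assumes "x \<in> \<int>" "t \<in> \<int>" "0 \<le> x" "0 \<le> (t::real)" shows "nat \<lfloor>x + t\<rfloor> = nat \<lfloor>x\<rfloor> + nat \<lfloor>t\<rfloor>"
  using assms by (auto elim!: Ints_cases simp: nat_add_distrib)

lemma hh_add: assumes "x \<in> Pm" "t \<in> Pm" shows "hh (x + t) = hh x * hh t"
proof -
  have "nat \<lfloor>snd (x + t) $ e\<rfloor> = nat \<lfloor>snd x $ e\<rfloor> + nat \<lfloor>snd t $ e\<rfloor>" if "e \<in> E - F" for e
    using assms that Tm_integral nat_floor_add[of "snd x $ e" "snd t $ e"] by (simp add: Pm_def)
  hence "(\<Prod>e\<in>E - F. ell e ^ nat \<lfloor>snd (x + t) $ e\<rfloor>) =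
      (\<Prod>e\<in>E - F. ell e ^ nat \<lfloor>snd x $ e\<rfloor>) * (\<Prod>e\<in>E - F. ell e ^ nat \<lfloor>snd t $ e\<rfloor>)"
    by (simp add: power_add prod.distrib)
  moreover have "Poly_Mapping.single (sh (x + t)) (1::'k) = Poly_Mapping.single (sh x) 1 * Poly_Mapping.single (sh t) 1"
    by (simp add: mult_single sh_add)
  ultimately show ?thesis unfolding hh_def by (simp only: ac_simps)
qed

lemma hh_zero: "hh 0 = 1" by (simp add: hh_def sh_def)

lemma hh_unit_char: assumes e: "e \<in> E - F" shows "hh (unit_char e) = ell e"
proof -
  have "(\<Sum>f\<in>E - F. snd (unit_char e) $ f *\<^sub>R unit_char f) = (\<Sum>f\<in>E - F. if f = e then unit_char f else 0)"
    by (intro sum.cong) (auto simp: snd_unit_char)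
  hence "sh (unit_char e) = 0" using e by (simp add: sh_def)
  moreover have "(\<Prod>f\<in>E - F. ell f ^ nat \<lfloor>snd (unit_char e) $ f\<rfloor>) = (\<Prod>f\<in>E - F. if f = e then ell f else 1)"
    by (intro prod.cong) (auto simp: snd_unit_char)
  ultimately show ?thesis using e by (simp add: hh_def)
qed

lemma gauss_hh: assumes u: "u \<in> Pm" shows "gauss v y (hh u) = ereal (y \<bullet> u)"
proof -
  have "gauss v y (ell e ^ nat \<lfloor>snd u $ e\<rfloor>) = ereal (snd u $ e * lawrence_phi y $ e)" if e: "e \<in> E - F" for e
  proof -
    have "snd u $ e \<in> \<int>" "0 \<le> snd u $ e" using u e Tm_integral by (auto simp: Pm_def)
    hence "of_nat (nat \<lfloor>snd u $ e\<rfloor>) = snd u $ e" by (auto elim!: Ints_cases)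
    thus ?thesis using gauss_power[OF gauss_ell[OF e], of "nat \<lfloor>snd u $ e\<rfloor>"] by simp
  qed
  hence "gauss v y (\<Prod>e\<in>E - F. ell e ^ nat \<lfloor>snd u $ e\<rfloor>) = ereal (\<Sum>e\<in>E - F. snd u $ e * lawrence_phi y $ e)"
    by (rule gauss_prod)
  hence "gauss v y (hh u) = ereal (y \<bullet> sh u + (\<Sum>e\<in>E - F. snd u $ e * lawrence_phi y $ e))"
    by (simp add: hh_def gauss_mult gauss_single)
  also have "y \<bullet> sh u + (\<Sum>e\<in>E - F. snd u $ e * lawrence_phi y $ e) = y \<bullet> u"
    by (simp add: sh_def inner_diff_right inner_sum_right inner_unit_char)
  finally show ?thesis .
qed

definition UX :: "(real^'e) \<times> (real^'e)" where "UX = (\<Sum>e\<in>E - F. unit_char e)"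

lemma snd_UX: "e \<in> E - F \<Longrightarrow> snd UX $ e = 1"
proof -
  assume e: "e \<in> E - F"
  have "snd UX $ e = (\<Sum>f\<in>E - F. snd (unit_char f) $ e)" by (simp add: UX_def snd_sum)
  also have "\<dots> = 1" using e by (simp add: snd_unit_char)
  finally show ?thesis .
qed

lemma UX_Pm: "of_nat n *\<^sub>R UX \<in> Pm"
proof -
  have "(\<Sum>e\<in>A. unit_char e) \<in> Pm" if "A \<subseteq> E - F" for A
    using that by (induction A rule: infinite_finite_induct) (auto simp: zero_Pm intro!: Pm_add unit_char_Pm)
  hence "UX \<in> Pm" unfolding UX_def by blast
  thus ?thesis by (induction n) (auto simp: zero_Pm Pm_add algebra_simps)
qed

abbreviation shift :: "nat \<Rightarrow> ((real^'e) \<times> (real^'e)) \<Rightarrow>\<^sub>0 'k" where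
  "shift n \<equiv> Poly_Mapping.single (of_nat n *\<^sub>R UX) 1"

lemma shift_add: "shift (n + k) = shift n * shift k"
  by (simp add: mult_single scaleR_add_left)

text \<open>The factor is the \<open>n\<close>-th power of the product of all coordinates outside
  \<open>F\<close>; it has to clear the negative exponents of \<open>f\<close>.\<close>

definition ok :: "nat \<Rightarrow> (((real^'e) \<times> (real^'e)) \<Rightarrow>\<^sub>0 'k) \<Rightarrow> bool" where
  "ok n f \<longleftrightarrow> shift n * f \<in> semigroup_algebra Pm"

lemma shift_alg: "shift n \<in> semigroup_algebra Pm" by (rule semigroup_algebra_single[OF UX_Pm])

lemma Pm_alg_mult:
  assumes "f \<in> semigroup_algebra Pm" "g \<in> semigroup_algebra Pm"
  shows "f * g \<in> semigroup_algebra Pm"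
  by (rule semigroup_algebra_mult[OF assms]) (rule Pm_add)

lemma alg_ext_hh_mult:
  assumes "f \<in> semigroup_algebra Pm" "g \<in> semigroup_algebra Pm"
  shows "alg_ext hh (f * g) = alg_ext hh f * alg_ext hh g"
  by (rule alg_ext_mult[OF assms]) (rule hh_add)

lemma ok_mono: assumes "ok n f" shows "ok (n + k) f" "ok (k + n) f"
proof -
  have "shift k * (shift n * f) \<in> semigroup_algebra Pm"
    using assms unfolding ok_def by (rule Pm_alg_mult[OF shift_alg])
  thus "ok (n + k) f" "ok (k + n) f" unfolding ok_def shift_add by (simp_all add: ac_simps)
qed

lemma ok_ex: assumes f: "f \<in> semigroup_algebra Tm" shows "\<exists>n. ok n f"
proof -
  define c where "c = (\<Sum>u\<in>Poly_Mapping.keys f. \<Sum>e\<in>E - F. \<bar>snd u $ e\<bar>)"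
  define n where "n = nat \<lceil>c\<rceil>"
  have "x \<in> Pm" if x: "x \<in> Poly_Mapping.keys (shift n * f)" for x
  proof -
    obtain w u where wu: "x = w + u" "w \<in> Poly_Mapping.keys (shift n)" "u \<in> Poly_Mapping.keys f"
      using subsetD[OF keys_mult x] by blast
    hence u: "u \<in> Poly_Mapping.keys f" "x = of_nat n *\<^sub>R UX + u" by simp_all
    have uT: "u \<in> Tm" using u(1) f by (auto simp: semigroup_algebra_def)
    have "0 \<le> snd x $ e" if e: "e \<in> E - F" for e
    proof -
      have "\<bar>snd u $ e\<bar> \<le> (\<Sum>e\<in>E - F. \<bar>snd u $ e\<bar>)" using e by (intro member_le_sum) auto
      also have "\<dots> \<le> c" unfolding c_def using u(1)
        by (intro member_le_sum[of u _ "\<lambda>u. \<Sum>e\<in>E - F. \<bar>snd u $ e\<bar>"]) (auto intro: sum_nonneg)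
      also have "c \<le> of_nat n" unfolding n_def by linarith
      finally show ?thesis unfolding u(2) using snd_UX[OF e] by simp
    qed
    moreover have "x \<in> Tm" unfolding u(2) using uT UX_Pm by (intro Tm_add) (auto simp: Pm_def)
    ultimately show ?thesis by (simp add: Pm_def)
  qed
  thus ?thesis unfolding ok_def semigroup_algebra_def by blast
qed

definition Vn :: "nat \<Rightarrow> (((real^'e) \<times> (real^'e)) \<Rightarrow>\<^sub>0 'k) \<Rightarrow> ereal" where
  "Vn n f = gauss v y (alg_ext hh (shift n * f)) - ereal (of_nat n * (y \<bullet> UX))"

lemma gauss_shift: "gauss v y (alg_ext hh (shift n)) = ereal (of_nat n * (y \<bullet> UX))"
  by (simp add: alg_ext_single gauss_mult gauss_hh[OF UX_Pm])

lemma Vn_shift: assumes "ok n f" shows "Vn (n + k) f = Vn n f" "Vn (k + n) f = Vn n f"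
proof -
  have "alg_ext hh (shift k * (shift n * f)) = alg_ext hh (shift k) * alg_ext hh (shift n * f)"
    using alg_ext_hh_mult[OF shift_alg assms[unfolded ok_def]] .
  moreover have "shift (n + k) * f = shift k * (shift n * f)" by (simp only: shift_add ac_simps)
  ultimately have "gauss v y (alg_ext hh (shift (n + k) * f)) =
      ereal (of_nat k * (y \<bullet> UX)) + gauss v y (alg_ext hh (shift n * f))"
    by (simp only: gauss_mult gauss_shift)
  thus "Vn (n + k) f = Vn n f"
    unfolding Vn_def by (cases "gauss v y (alg_ext hh (shift n * f))") (auto simp: algebra_simps)
  thus "Vn (k + n) f = Vn n f" by (simp add: add.commute)
qed

text \<open>By \<open>Vn_shift\<close> every \<open>n\<close> that clears the negative exponents
  gives the same value, so the choice is harmless.\<close>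

definition val0 :: "(((real^'e) \<times> (real^'e)) \<Rightarrow>\<^sub>0 'k) \<Rightarrow> ereal" where
  "val0 f = Vn (SOME n. ok n f) f"

lemma val0_eq: assumes "ok n f" shows "val0 f = Vn n f"
proof -
  have k: "ok (SOME n. ok n f) f" using assms by (rule someI)
  show ?thesis unfolding val0_def using Vn_shift(1)[OF k, of n] Vn_shift(2)[OF assms, of "SOME n. ok n f"] by simp
qed

lemma val0_not_MInf: "f \<in> semigroup_algebra Tm \<Longrightarrow> val0 f \<noteq> -\<infinity>"
proof -
  assume "f \<in> semigroup_algebra Tm"
  then obtain n where n: "ok n f" using ok_ex by blast
  show ?thesis unfolding val0_eq[OF n] Vn_def using gauss_not_MInf[of y "alg_ext hh (shift n * f)"]
    by (cases "gauss v y (alg_ext hh (shift n * f))") auto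
qed

lemma val0_mult:
  assumes "f \<in> semigroup_algebra Tm" "g \<in> semigroup_algebra Tm" shows "val0 (f * g) = val0 f + val0 g"
proof -
  obtain n k where nk: "ok n f" "ok k g" using ok_ex assms by blast
  have eq: "shift (n + k) * (f * g) = (shift n * f) * (shift k * g)" by (simp only: shift_add ac_simps)
  have "ok (n + k) (f * g)" unfolding ok_def eq using nk unfolding ok_def by (rule Pm_alg_mult)
  hence "val0 (f * g) = Vn (n + k) (f * g)" by (rule val0_eq)
  also have "\<dots> = gauss v y (alg_ext hh (shift n * f) * alg_ext hh (shift k * g)) - ereal (of_nat (n + k) * (y \<bullet> UX))"
    unfolding Vn_def eq alg_ext_hh_mult[OF nk[unfolded ok_def]] ..
  also have "\<dots> = Vn n f + Vn k g"
    unfolding Vn_def gauss_mult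
    using gauss_not_MInf[of y "alg_ext hh (shift n * f)"] gauss_not_MInf[of y "alg_ext hh (shift k * g)"]
    by (cases "gauss v y (alg_ext hh (shift n * f))"; cases "gauss v y (alg_ext hh (shift k * g))")
      (auto simp: algebra_simps)
  finally show ?thesis using val0_eq nk by simp
qed

lemma val0_add:
  assumes "f \<in> semigroup_algebra Tm" "g \<in> semigroup_algebra Tm" shows "min (val0 f) (val0 g) \<le> val0 (f + g)"
proof -
  obtain n k where nk: "ok n f" "ok k g" using ok_ex assms by blast
  let ?n = "n + k"
  have o: "ok ?n f" "ok ?n g" using ok_mono nk by blast+
  have eq: "shift ?n * (f + g) = shift ?n * f + shift ?n * g" by (rule distrib_left)
  have "ok ?n (f + g)" unfolding ok_def eq using o unfolding ok_def by (intro semigroup_algebra_add)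
  hence "val0 (f + g) = Vn ?n (f + g)" by (rule val0_eq)
  moreover have "min (Vn ?n f) (Vn ?n g) \<le> Vn ?n (f + g)"
    unfolding Vn_def eq alg_ext_add
    using gauss_add[of y "alg_ext hh (shift ?n * f)" "alg_ext hh (shift ?n * g)"]
    by (auto simp: min_def split: if_splits intro: ereal_minus_mono order_trans)
  ultimately show ?thesis using val0_eq o by simp
qed

lemma val0_const: "val0 (Poly_Mapping.single 0 c) = v c"
proof -
  have "ok 0 (Poly_Mapping.single 0 c)" unfolding ok_def
    using semigroup_algebra_single[OF zero_Pm, of c] by simp
  hence "val0 (Poly_Mapping.single 0 c) = Vn 0 (Poly_Mapping.single 0 c)" by (rule val0_eq)
  also have "\<dots> = v c" by (simp add: Vn_def alg_ext_single hh_zero gauss_single)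
  finally show ?thesis .
qed

lemma val0_char: assumes u: "u \<in> Tm" shows "val0 (Poly_Mapping.single u 1) = ereal (y \<bullet> u)"
proof -
  obtain n where n: "ok n (Poly_Mapping.single u 1)" using ok_ex semigroup_algebra_single[OF u] by blast
  have eq: "shift n * Poly_Mapping.single u 1 = Poly_Mapping.single (of_nat n *\<^sub>R UX + u) 1" by (simp add: mult_single)
  have P: "of_nat n *\<^sub>R UX + u \<in> Pm" using n unfolding ok_def eq semigroup_algebra_def by simp
  have "val0 (Poly_Mapping.single u 1) = Vn n (Poly_Mapping.single u 1)" using n by (rule val0_eq)
  also have "\<dots> = ereal (y \<bullet> (of_nat n *\<^sub>R UX + u)) - ereal (of_nat n * (y \<bullet> UX))"
    unfolding Vn_def eq by (simp add: alg_ext_single gauss_hh[OF P])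
  also have "\<dots> = ereal (y \<bullet> u)" by (simp add: inner_simps)
  finally show ?thesis .
qed

lemma val0_relation:
  assumes g: "g \<in> semigroup_algebra Tm" and c: "(\<Sum>e\<in>E. of_int (c e) *\<^sub>R a e) = 0"
  shows "val0 (g * (\<Sum>e\<in>E - F. Poly_Mapping.single (unit_char e) (of_int (c e)))) = \<infinity>"
proof -
  let ?L = "\<Sum>e\<in>E - F. Poly_Mapping.single (unit_char e) (of_int (c e) :: 'k)"
  have LP: "?L \<in> semigroup_algebra Pm" using unit_char_Pm by (intro semigroup_algebra_sum semigroup_algebra_single)
  have "alg_ext hh ?L = (\<Sum>e\<in>E - F. Poly_Mapping.single 0 (of_int (c e)) * ell e)"
    by (simp add: alg_ext_sum alg_ext_single hh_unit_char)
  hence L0: "alg_ext hh ?L = 0" using ell_relation[OF c] by simp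
  obtain n where n: "ok n g" using ok_ex[OF g] by blast
  have eq: "shift n * (g * ?L) = (shift n * g) * ?L" by (rule mult.assoc[symmetric])
  have "ok n (g * ?L)" unfolding ok_def eq using n LP unfolding ok_def by (rule Pm_alg_mult)
  hence "val0 (g * ?L) = Vn n (g * ?L)" by (rule val0_eq)
  also have "alg_ext hh (shift n * (g * ?L)) = 0"
    unfolding eq alg_ext_hh_mult[OF n[unfolded ok_def] LP] L0 by simp
  hence "Vn n (g * ?L) = \<infinity>" by (simp add: Vn_def)
  finally show ?thesis .
qed

end

context hypertoric
begin

text \<open>The characters of the orbit torus (\<open>dual_quot_N\<close>).\<close>

definition Tchar :: "'e set \<Rightarrow> 'm \<Rightarrow> ((real^'e) \<times> (real^'e)) set" where
  "Tchar F m = {u\<in>dual_lattice N. \<forall>x\<in>lcone F m. x \<bullet> u = 0}"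

lemma stratum_valuation_exists:
  assumes "flat F" "y \<in> W F m" "\<forall>G\<in>levels E (wv F (lawrence_phi y)). flat G"
  shows "\<exists>val :: (((real^'e) \<times> (real^'e)) \<Rightarrow>\<^sub>0 'k) \<Rightarrow> ereal.
    (\<forall>f\<in>semigroup_algebra (Tchar F m). val f \<noteq> -\<infinity>) \<and>
    (\<forall>f\<in>semigroup_algebra (Tchar F m). \<forall>g\<in>semigroup_algebra (Tchar F m).
       val (f * g) = val f + val g \<and> min (val f) (val g) \<le> val (f + g)) \<and>
    (\<forall>c. val (Poly_Mapping.single 0 c) = v c) \<and>
    (\<forall>u\<in>Tchar F m. val (Poly_Mapping.single u 1) = ereal (y \<bullet> u)) \<and>
    (\<forall>g\<in>semigroup_algebra (Tchar F m). \<forall>c. (\<Sum>e\<in>E. of_int (c e) *\<^sub>R a e) = 0 \<longrightarrow>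
       val (g * (\<Sum>e\<in>E - F. Poly_Mapping.single (unit_char e) (of_int (c e)))) = \<infinity>)"
proof -
  obtain B q D where B: "B \<subseteq> E" "findep B" "D \<noteq> 0" "v (of_int D) = 0"
      "\<forall>e\<in>E. of_int D *\<^sub>R a e = (\<Sum>b\<in>B. of_int (q e b) *\<^sub>R a b)"
      "\<forall>e\<in>E. \<forall>b\<in>B. q e b \<noteq> 0 \<longrightarrow> wv F (lawrence_phi y) e \<le> wv F (lawrence_phi y) b"
    using adapted_basis[of "wv F (lawrence_phi y)"] by (elim exE conjE) (rule that)
  interpret stratum_valuation M E a r d v F m y B q D
    by unfold_locales (fact assms B)+
  have T: "Tchar F m = Tm" by (simp add: Tchar_def Tm_def)
  show ?thesis unfolding T using val0_not_MInf val0_mult val0_add val0_const val0_char val0_relation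
    by (intro exI[of _ val0] conjI ballI allI impI)
qed

end

section \<open>Tropicalization of the hypertoric variety\<close>

lemma adjoint_lawrence_phi: "adjoint (lawrence_phi :: (real^'e::finite) \<times> (real^'e) \<Rightarrow> real^'e) = (\<lambda>u. (u, u))"
  by (rule adjoint_unique) (simp add: lawrence_phi_def inner_add_left inner_prod_def)

lemma char_pullback_linear_form:
  "char_pullback lawrence_phi (\<Sum>e\<in>A. Poly_Mapping.single (axis e 1) (f e)) =
     (\<Sum>e\<in>A. Poly_Mapping.single (unit_char e) (f e :: 'k::field))"
  by (simp add: char_pullback_alg_ext alg_ext_sum alg_ext_single adjoint_lawrence_phi mult_single unit_char_def)

lemma orbit_restrict_sum: "orbit_restrict \<tau> (sum f A) = (\<Sum>i\<in>A. orbit_restrict \<tau> (f i))"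
  and orbit_restrict_add: "orbit_restrict \<tau> (p + q) = orbit_restrict \<tau> p + orbit_restrict \<tau> q"
  and orbit_restrict_single: "orbit_restrict \<tau> (Poly_Mapping.single u c) =
    (if \<forall>x\<in>\<tau>. x \<bullet> u = 0 then Poly_Mapping.single u c else 0)"
  by (simp_all add: orbit_restrict_alg_ext alg_ext_sum alg_ext_add alg_ext_single mult_single)

lemma one_in_semigroup_algebra: "0 \<in> S \<Longrightarrow> 1 \<in> semigroup_algebra S"
  using semigroup_algebra_single[of 0 S 1] by simp

context hypertoric
begin

text \<open>The exponent monoid \<open>S\<close> and the index set \<open>X\<close> are left open
  because the argument is needed twice: on an orbit torus with the coordinates outside
  \<open>F\<close>, and on an affine chart with all coordinates. Indices outside \<open>X\<close>
  count as infinite.\<close>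

lemma levels_flat_of_valuation:
  fixes val :: "(((real^'e) \<times> (real^'e)) \<Rightarrow>\<^sub>0 'k) \<Rightarrow> ereal"
  assumes S0: "0 \<in> S"
    and mult: "\<And>f g. f \<in> semigroup_algebra S \<Longrightarrow> g \<in> semigroup_algebra S \<Longrightarrow> val (f * g) = val f + val g"
    and add: "\<And>f g. f \<in> semigroup_algebra S \<Longrightarrow> g \<in> semigroup_algebra S \<Longrightarrow> min (val f) (val g) \<le> val (f + g)"
    and const: "\<And>c. val (Poly_Mapping.single 0 c) = v c"
    and X: "X \<subseteq> E" "\<And>e. e \<in> X \<Longrightarrow> unit_char e \<in> S"
    and rel: "\<And>c. (\<Sum>e\<in>E. of_int (c e) *\<^sub>R a e) = 0 \<Longrightarrow>
      val (\<Sum>e\<in>X. Poly_Mapping.single (unit_char e) (of_int (c e))) = \<infinity>"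
    and G: "G \<in> levels E (\<lambda>e. if e \<in> X then val (Poly_Mapping.single (unit_char e) 1) else \<infinity>)"
  shows "flat G"
proof -
  let ?w = "\<lambda>e. if e \<in> X then val (Poly_Mapping.single (unit_char e) 1) else \<infinity>"
  obtain t where t: "G = {e\<in>E. t \<le> ?w e}" using G unfolding levels_def by blast
  have val0: "val 0 = \<infinity>" using const[of 0] by simp
  have val_term: "val (Poly_Mapping.single (unit_char e) c) = v c + val (Poly_Mapping.single (unit_char e) 1)"
    if "e \<in> X" for e c
    using mult[of "Poly_Mapping.single 0 c" "Poly_Mapping.single (unit_char e) 1"] S0 X(2)[OF that]
    by (simp add: semigroup_algebra_single mult_single const)
  have "e \<in> G" if e: "e \<in> E" "a e \<in> span (a ` G)" for e
  proof (rule ccontr)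
    assume eG: "e \<notin> G"
    have "G \<subseteq> E" using t by blast
    then obtain c :: "'e \<Rightarrow> int" where c: "\<forall>f. f \<notin> insert e G \<longrightarrow> c f = 0"
        "(\<Sum>f\<in>E. of_int (c f) *\<^sub>R a f) = 0" "v (of_int (c e)) = 0"
      using unit_relation[of G e] eG e by blast
    have we: "?w e < t" using eG e(1) t by (simp add: not_le)
    hence eX: "e \<in> X" by (auto split: if_splits)
    define s :: "'e \<Rightarrow> ((real^'e) \<times> (real^'e)) \<Rightarrow>\<^sub>0 'k"
      where "s = (\<lambda>f. Poly_Mapping.single (unit_char f) (of_int (c f)))"
    have s_alg: "s f \<in> semigroup_algebra S" if "f \<in> X" for f
      unfolding s_def using X(2)[OF that] by (rule semigroup_algebra_single)
    have ge: "t \<le> val (s f)" if f: "f \<in> X - {e}" for f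
    proof (cases "f \<in> G")
      case True
      hence "t \<le> val (Poly_Mapping.single (unit_char f) 1)" using f t by auto
      also have "\<dots> \<le> v (of_int (c f)) + val (Poly_Mapping.single (unit_char f) 1)"
        using add_right_mono[OF v_of_int_nonneg[of "c f"], of "val (Poly_Mapping.single (unit_char f) 1)"] by simp
      finally show ?thesis using val_term[of f "of_int (c f)"] f by (simp add: s_def)
    next
      case False
      hence "c f = 0" using c(1) f by blast
      thus ?thesis by (simp add: s_def val0)
    qed
    have "sum s A \<in> semigroup_algebra S \<and> t \<le> val (sum s A)" if "A \<subseteq> X - {e}" for A
      using that
    proof (induction A rule: infinite_finite_induct)
      case (insert f A)
      hence "sum s A \<in> semigroup_algebra S" "t \<le> val (sum s A)" "s f \<in> semigroup_algebra S" "t \<le> val (s f)"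
        using s_alg ge by blast+
      thus ?case using insert(1,2) add[of "s f" "sum s A"] semigroup_algebra_add[of "s f" S "sum s A"]
        by (simp add: min_le_iff_disj) (meson min.boundedI order_trans)
    qed (auto simp: val0 semigroup_algebra_def)
    hence R: "sum s (X - {e}) \<in> semigroup_algebra S" "t \<le> val (sum s (X - {e}))" by blast+
    \<comment> \<open>The term of \<open>e\<close> is the whole relation minus the remaining terms.
      Subtraction is written with the constant -1, whose value is 0, so multiplicativity leaves the
      value of the remainder unchanged.\<close>
    define n :: "((real^'e) \<times> (real^'e)) \<Rightarrow>\<^sub>0 'k" where "n = Poly_Mapping.single 0 (- 1)"
    have n: "n \<in> semigroup_algebra S" "val n = 0"
      using semigroup_algebra_single[OF S0] const[of "-1"] v_minus[of 1] by (simp_all add: n_def)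
    have nR: "n * sum s (X - {e}) = - sum s (X - {e})"
      by (simp add: n_def single_uminus)
    have nRval: "val (n * sum s (X - {e})) = val (sum s (X - {e}))"
      using mult[OF n(1) R(1)] n(2) by simp
    have "n * sum s (X - {e}) \<in> semigroup_algebra S"
      unfolding nR using R(1) by (simp add: semigroup_algebra_def)
    moreover have "sum s X \<in> semigroup_algebra S" using s_alg by (rule semigroup_algebra_sum)
    ultimately have "min (val (sum s X)) (val (n * sum s (X - {e}))) \<le> val (sum s X + n * sum s (X - {e}))"
      by (intro add)
    moreover have "sum s X + n * sum s (X - {e}) = s e"
      unfolding nR using sum.remove[of X e s] eX by simp
    moreover have "val (sum s X) = \<infinity>" unfolding s_def by (rule rel[OF c(2)])
    ultimately have "t \<le> val (s e)" using R(2) nRval by simp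
    moreover have "val (s e) = val (Poly_Mapping.single (unit_char e) 1)"
      unfolding s_def val_term[OF eX, of "of_int (c e)"] c(3) by (rule add_0)
    ultimately have "t \<le> ?w e" using eX by simp
    from leD[OF this] we show False by (rule notE)
  qed
  moreover have "G \<subseteq> E" using t by blast
  ultimately show ?thesis unfolding flat_iff by blast
qed

abbreviation linform :: "('e \<Rightarrow> int) \<Rightarrow> 'e set \<Rightarrow> ((real^'e) \<times> (real^'e)) \<Rightarrow>\<^sub>0 'k" where
  "linform c X \<equiv> \<Sum>e\<in>X. Poly_Mapping.single (unit_char e) (of_int (c e))"

lemma linform_in_ideal:
  assumes "(\<Sum>e\<in>E. of_int (c e) *\<^sub>R a e) = 0"
  shows "linform c E \<in> hypertoric_ideal E a \<sigma>"
proof -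
  have "(\<Sum>e\<in>E. Poly_Mapping.single (axis e 1) (of_int (c e) :: 'k)) \<in> linear_forms E a"
    unfolding linear_forms_def using assms by blast
  hence "linform c E \<in> char_pullback lawrence_phi ` linear_forms E a"
    using char_pullback_linear_form[symmetric] by (rule rev_image_eqI)
  thus ?thesis unfolding hypertoric_ideal_def ideal_gen_def
    using one_in_semigroup_algebra[OF cone_monoid_zero, of \<sigma>]
    by (intro CollectI exI[of _ "{linform c E}"] exI[of _ "\<lambda>_. 1"]) simp
qed

lemma hypertoric_ideal_expand:
  assumes "f \<in> hypertoric_ideal E a \<sigma>"
  shows "\<exists>(A :: (((real^'e) \<times> (real^'e)) \<Rightarrow>\<^sub>0 'k) set) h c. finite A \<and> f = (\<Sum>g\<in>A. h g * linform (c g) E) \<and>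
    (\<forall>g\<in>A. h g \<in> semigroup_algebra (cone_monoid N \<sigma>) \<and> (\<Sum>e\<in>E. of_int (c g e) *\<^sub>R a e) = 0)"
proof -
  obtain A h where A: "f = (\<Sum>g\<in>A. h g * g)" "finite A" "A \<subseteq> char_pullback lawrence_phi ` linear_forms E a"
      "\<forall>g\<in>A. h g \<in> semigroup_algebra (cone_monoid N \<sigma>)"
    using assms unfolding hypertoric_ideal_def ideal_gen_def by blast
  have "\<exists>c. g = linform c E \<and> (\<Sum>e\<in>E. of_int (c e) *\<^sub>R a e) = 0" if gA: "g \<in> A" for g
  proof -
    obtain c where "g = char_pullback lawrence_phi (\<Sum>e\<in>E. Poly_Mapping.single (axis e 1) (of_int (c e)))"
        "(\<Sum>e\<in>E. of_int (c e) *\<^sub>R a e) = 0"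
      using subsetD[OF A(3) gA] unfolding linear_forms_def by blast
    thus ?thesis unfolding char_pullback_linear_form by blast
  qed
  then obtain c where c: "\<forall>g\<in>A. g = linform (c g) E \<and> (\<Sum>e\<in>E. of_int (c g e) *\<^sub>R a e) = 0" by metis
  have "f = (\<Sum>g\<in>A. h g * linform (c g) E)"
    unfolding A(1) using c by (intro sum.cong refl arg_cong2[where f = times]) blast+
  moreover have "\<forall>g\<in>A. h g \<in> semigroup_algebra (cone_monoid N \<sigma>) \<and> (\<Sum>e\<in>E. of_int (c g e) *\<^sub>R a e) = 0"
    using A(4) c by blast
  ultimately show ?thesis using A(2) by (intro exI[of _ A] exI[of _ h] exI[of _ c] conjI)
qed

lemma orbit_restrict_linform:
  assumes "F \<subseteq> E" shows "orbit_restrict (lcone F m) (linform c E) = linform c (E - F)"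
proof -
  have "orbit_restrict (lcone F m) (linform c E) =
      (\<Sum>e\<in>E. if e \<in> E - F then Poly_Mapping.single (unit_char e) (of_int (c e)) else 0)"
    unfolding orbit_restrict_sum orbit_restrict_single
    by (intro sum.cong refl) (simp add: unit_char_orthogonal_iff PP_Un_QQ)
  also have "\<dots> = linform c (E - F)" by (intro sum.mono_neutral_cong_right) auto
  finally show ?thesis .
qed

text \<open>Characters in the cone monoid are nonnegative on the cone, so a sum is orthogonal to it
  only if both summands are; products with discarded terms are discarded as well.\<close>

lemma orbit_restrict_mult:
  assumes "f \<in> semigroup_algebra (cone_monoid N \<tau>)" "g \<in> semigroup_algebra (cone_monoid N \<tau>)"
  shows "orbit_restrict \<tau> (f * g) = orbit_restrict \<tau> f * orbit_restrict \<tau> g"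
  unfolding orbit_restrict_alg_ext
  by (rule alg_ext_mult[OF assms])
    (use cone_monoid_orthogonal_add[OF order_refl, of _ \<tau>] in \<open>auto simp: mult_single\<close>)

lemma orbit_restrict_alg:
  assumes "f \<in> semigroup_algebra (cone_monoid N (lcone F m))"
  shows "orbit_restrict (lcone F m) f \<in> semigroup_algebra (Tchar F m)"
  unfolding orbit_restrict_def using assms
  by (intro semigroup_algebra_sum semigroup_algebra_single)
    (auto simp: Tchar_def semigroup_algebra_def cone_monoid_def)

lemma unit_char_Tchar: assumes "e \<in> E - F" shows "unit_char e \<in> Tchar F m"
  using unit_char_orthogonal_iff[of e "PP F m" "QQ F m"] assms PP_Un_QQ[of F m] unit_char_dual[of e]
  by (simp add: Tchar_def)

lemma Tchar_zero: "0 \<in> Tchar F m" by (simp add: Tchar_def dual_N_zero)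

text \<open>Restriction turns an element of the chart ideal into a combination of truncated linear
  forms, in which the coordinates in \<open>F\<close> are zero. Each summand has value \<infinity>,
  and the sum follows term by term.\<close>

lemma restricted_ideal_PInf:
  fixes val :: "(((real^'e) \<times> (real^'e)) \<Rightarrow>\<^sub>0 'k) \<Rightarrow> ereal"
  assumes F: "F \<subseteq> E"
    and add: "\<forall>f\<in>semigroup_algebra (Tchar F m). \<forall>g\<in>semigroup_algebra (Tchar F m). min (val f) (val g) \<le> val (f + g)"
    and const: "\<forall>c. val (Poly_Mapping.single 0 c) = v c"
    and rel: "\<forall>g\<in>semigroup_algebra (Tchar F m). \<forall>c. (\<Sum>e\<in>E. of_int (c e) *\<^sub>R a e) = 0 \<longrightarrow>
       val (g * linform c (E - F)) = \<infinity>"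
    and f: "f \<in> hypertoric_ideal E a (lcone F m)"
  shows "val (orbit_restrict (lcone F m) f) = \<infinity>"
proof -
  obtain A :: "(((real^'e) \<times> (real^'e)) \<Rightarrow>\<^sub>0 'k) set" and h c where A: "finite A" "f = (\<Sum>g\<in>A. h g * linform (c g) E)"
    "\<forall>g\<in>A. h g \<in> semigroup_algebra (cone_monoid N (lcone F m)) \<and> (\<Sum>e\<in>E. of_int (c g e) *\<^sub>R a e) = 0"
    using hypertoric_ideal_expand[OF f] by (elim exE conjE) (rule that)
  have uc: "unit_char e \<in> cone_monoid N (lcone F m)" if "e \<in> E" for e
    unfolding cone_monoid_pcone using unit_char_dual[OF that] by (simp add: unit_char_def axis_def)
  define s where "s = (\<lambda>g. orbit_restrict (lcone F m) (h g) * linform (c g) (E - F))"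
  have eq: "orbit_restrict (lcone F m) f = sum s A"
    unfolding A(2) orbit_restrict_sum s_def
  proof (intro sum.cong refl)
    fix g assume g: "g \<in> A"
    have "linform (c g) E \<in> semigroup_algebra (cone_monoid N (lcone F m))"
      using uc by (intro semigroup_algebra_sum semigroup_algebra_single)
    thus "orbit_restrict (lcone F m) (h g * linform (c g) E) = orbit_restrict (lcone F m) (h g) * linform (c g) (E - F)"
      using A(3) g orbit_restrict_linform[OF F, of m "c g"] by (simp only: orbit_restrict_mult)
  qed
  have "sum s A' \<in> semigroup_algebra (Tchar F m) \<and> val (sum s A') = \<infinity>" if "A' \<subseteq> A" for A'
    using that
  proof (induction A' rule: infinite_finite_induct)
    case (insert g A')
    have L: "linform (c g) (E - F) \<in> semigroup_algebra (Tchar F m)"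
      using unit_char_Tchar by (intro semigroup_algebra_sum semigroup_algebra_single)
    have H: "orbit_restrict (lcone F m) (h g) \<in> semigroup_algebra (Tchar F m)"
      using A(3) insert.prems by (intro orbit_restrict_alg) blast
    have "s g \<in> semigroup_algebra (Tchar F m)" unfolding s_def
      by (rule semigroup_algebra_mult[OF H L]) (auto simp: Tchar_def dual_N_add inner_add_right)
    moreover have "val (s g) = \<infinity>" unfolding s_def using rel H A(3) insert.prems by blast
    moreover have "sum s A' \<in> semigroup_algebra (Tchar F m)" "val (sum s A') = \<infinity>" using insert by blast+
    ultimately show ?case using insert(1,2) add[rule_format, of "s g" "sum s A'"]
      by (simp add: semigroup_algebra_add)
  qed (use const[rule_format, of 0] in \<open>auto simp: semigroup_algebra_def\<close>)
  thus ?thesis unfolding eq by blast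
qed

lemma span_quot_N: assumes "F \<subseteq> E" shows "span (quot_map (lcone F m) ` N) = W F m"
  using W_quot[OF assms, of m] linear_span_image[OF linear_quot_map, of "lcone F m" N] by metis

lemma dual_quot_N: assumes "F \<subseteq> E" shows "dual_lattice (quot_map (lcone F m) ` N) = Tchar F m"
proof -
  have "quot_map (lcone F m) x \<bullet> u = x \<bullet> u" if "\<forall>z\<in>lcone F m. z \<bullet> u = 0" for x u
    using inner_quot_map[of u "lcone F m" x] that by (simp add: orthogonal_comp_iff)
  hence "(\<forall>x\<in>quot_map (lcone F m) ` N. x \<bullet> u \<in> \<int>) \<longleftrightarrow> (\<forall>x\<in>N. x \<bullet> u \<in> \<int>)"
    if "\<forall>z\<in>lcone F m. z \<bullet> u = 0" for u
    using that by (simp only: ball_simps)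
  thus ?thesis unfolding dual_lattice_def span_quot_N[OF assms] Tchar_def W_orthogonal span_N
    by blast
qed

definition tstratum :: "'e set \<Rightarrow> 'm \<Rightarrow> ((real^'e) \<times> (real^'e)) set" where
  "tstratum F m = {y\<in>W F m. \<forall>G\<in>levels E (wv F (lawrence_phi y)). flat G}"

lemma Trop_hypertoric_orbit_eq:
  assumes F: "flat F" and m: "m \<in> span M"
  shows "Trop_hypertoric_orbit v M E a r F (face_at F m) = tstratum F m"
proof -
  have FE: "F \<subseteq> E" using F by (rule flat_sub)
  let ?J = "orbit_restrict (lcone F m) ` hypertoric_ideal E a (lcone F m)
    :: (((real^'e) \<times> (real^'e)) \<Rightarrow>\<^sub>0 'k) set"
  have eq: "Trop_hypertoric_orbit v M E a r F (face_at F m) =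
      {y\<in>W F m. \<exists>val\<in>berkovich v (Tchar F m) ?J. \<forall>u\<in>Tchar F m. val (Poly_Mapping.single u 1) = ereal (y \<bullet> u)}"
    unfolding Trop_hypertoric_orbit_def Trop_orbit_def Trop_torus_def lawrence_cone_face[OF m]
      span_quot_N[OF FE] dual_quot_N[OF FE] ..
  have "flat G" if y: "y \<in> W F m" and val: "val \<in> berkovich v (Tchar F m) ?J"
      "\<forall>u\<in>Tchar F m. val (Poly_Mapping.single u 1) = ereal (y \<bullet> u)"
      and G: "G \<in> levels E (wv F (lawrence_phi y))" for y val G
  proof (rule levels_flat_of_valuation[where X = "E - F" and S = "Tchar F m" and val = val])
    fix c :: "'e \<Rightarrow> int" assume c: "(\<Sum>e\<in>E. of_int (c e) *\<^sub>R a e) = 0"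
    have "linform c (E - F) \<in> ?J"
      using linform_in_ideal[OF c] orbit_restrict_linform[OF FE, symmetric] by (rule rev_image_eqI)
    thus "val (linform c (E - F)) = \<infinity>" using val(1) unfolding berkovich_def by blast
  next
    have "levels E (wv F (lawrence_phi y)) =
        levels E (\<lambda>e. if e \<in> E - F then val (Poly_Mapping.single (unit_char e) 1) else \<infinity>)"
      using val(2)[rule_format, OF unit_char_Tchar]
      by (intro levels_cong) (simp add: wv_def inner_unit_char)
    thus "G \<in> levels E (\<lambda>e. if e \<in> E - F then val (Poly_Mapping.single (unit_char e) 1) else \<infinity>)"
      using G by blast
  qed (use val(1) unit_char_Tchar Tchar_zero in \<open>auto simp: berkovich_def\<close>)
  moreover have "\<exists>val\<in>berkovich v (Tchar F m) ?J. \<forall>u\<in>Tchar F m. val (Poly_Mapping.single u 1) = ereal (y \<bullet> u)"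
    if y: "y \<in> W F m" "\<forall>G\<in>levels E (wv F (lawrence_phi y)). flat G" for y
  proof -
    obtain val :: "(((real^'e) \<times> (real^'e)) \<Rightarrow>\<^sub>0 'k) \<Rightarrow> ereal" where val:
      "\<forall>f\<in>semigroup_algebra (Tchar F m). val f \<noteq> -\<infinity>"
      "\<forall>f\<in>semigroup_algebra (Tchar F m). \<forall>g\<in>semigroup_algebra (Tchar F m).
         val (f * g) = val f + val g \<and> min (val f) (val g) \<le> val (f + g)"
      "\<forall>c. val (Poly_Mapping.single 0 c) = v c"
      "\<forall>u\<in>Tchar F m. val (Poly_Mapping.single u 1) = ereal (y \<bullet> u)"
      "\<forall>g\<in>semigroup_algebra (Tchar F m). \<forall>c. (\<Sum>e\<in>E. of_int (c e) *\<^sub>R a e) = 0 \<longrightarrow> val (g * linform c (E - F)) = \<infinity>"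
      using stratum_valuation_exists[OF F y] by (elim exE conjE) (rule that)
    have "val (orbit_restrict (lcone F m) f) = \<infinity>" if "f \<in> hypertoric_ideal E a (lcone F m)" for f
      by (rule restricted_ideal_PInf[OF FE _ val(3,5) that]) (use val(2) in blast)
    hence "val \<in> berkovich v (Tchar F m) ?J" using val(1-3) unfolding berkovich_def by blast
    thus ?thesis using val(4) by blast
  qed
  ultimately show ?thesis unfolding eq tstratum_def by blast
qed

lemma stratum_phi_proj_off: assumes "y \<in> W F m" shows "stratum_phi F y = proj_off F (lawrence_phi y)"
proof -
  have "lawrence_phi y $ e = 0" if "e \<notin> E" for e
    using assms VN_supported[of y e] that by (simp add: W_def lawrence_phi_component)
  thus ?thesis by (simp add: stratum_phi_def proj_off_def vec_eq_iff)
qed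

lemma hyp_cone_eq_HC:
  assumes F: "flat F" and m: "m \<in> span M" and fl: "is_flag M E a F \<F>"
  shows "hyp_cone v M E a r F (face_at F m) \<F> = HC F m \<F>"
proof -
  interpret set_flag E F \<F> using fl by (rule flag_set_flag)
  have "stratum_phi F y \<in> bergman_cone E F \<F> \<longleftrightarrow> levels E (wv F (lawrence_phi y)) \<subseteq> \<F>" if y: "y \<in> W F m" for y
  proof -
    have "levels E (wv F (proj_off F (lawrence_phi y))) = levels E (wv F (lawrence_phi y))"
      by (rule wv_cong) (simp add: proj_off_def)
    thus ?thesis unfolding stratum_phi_proj_off[OF y] bergman_cone_iff[OF supported_proj_off] by simp
  qed
  moreover have "flat G" if "levels E (wv F (lawrence_phi y)) \<subseteq> \<F>" "G \<in> levels E (wv F (lawrence_phi y))" for y G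
    using flag_sub[OF fl] that by blast
  ultimately show ?thesis
    unfolding hyp_cone_def Trop_hypertoric_orbit_eq[OF F m] tstratum_def HC_def by blast
qed

text \<open>A point of the analytification is taken in an affine chart, where the values of all
  coordinates, infinite ones included, come from one valuation. Conversely, a point of a stratum is
  already reached in the chart of its own cone.\<close>

lemma Trop_hypertoric_eq:
  "Trop_hypertoric v M E a r = {(lcone F m, y) | F m y. flat F \<and> m \<in> span M \<and> y \<in> tstratum F m}"
  (is "_ = ?T")
proof (intro set_eqI iffI)
  fix p assume "p \<in> Trop_hypertoric v M E a r"
  then obtain \<sigma> val where \<sigma>: "\<sigma> \<in> \<Delta>" and val: "val \<in> berkovich v (cone_monoid N \<sigma>) (hypertoric_ideal E a \<sigma>)"
    and p: "p = trop_glue N \<Delta> \<sigma> (\<lambda>u\<in>cone_monoid N \<sigma>. val (Poly_Mapping.single u 1))"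
    unfolding Trop_hypertoric_def Trop_def by blast
  let ?S = "cone_monoid N \<sigma>"
  define w where "w = (\<lambda>u\<in>?S. val (Poly_Mapping.single u 1))"
  have mult: "val (f * g) = val f + val g" and add: "min (val f) (val g) \<le> val (f + g)"
    if "f \<in> semigroup_algebra ?S" "g \<in> semigroup_algebra ?S" for f g
    using val that unfolding berkovich_def by blast+
  have const: "val (Poly_Mapping.single 0 c) = v c" for c using val unfolding berkovich_def by blast
  have nM: "val f \<noteq> -\<infinity>" if "f \<in> semigroup_algebra ?S" for f using val that unfolding berkovich_def by blast
  have w: "w \<in> trop_homs ?S"
    unfolding trop_homs_def
  proof (intro CollectI conjI ballI)
    show "w \<in> extensional ?S" by (simp add: w_def)
    show "w 0 = 0" using const[of 1] cone_monoid_zero by (simp add: w_def)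
    fix u assume u: "u \<in> ?S"
    show "w u \<noteq> -\<infinity>" using nM[OF semigroup_algebra_single[OF u]] u by (simp add: w_def)
    fix u' assume u': "u' \<in> ?S"
    show "w (u + u') = w u + w u'"
      using mult[OF semigroup_algebra_single[OF u, of 1] semigroup_algebra_single[OF u', of 1]] u u' cone_monoid_add
      by (simp add: w_def mult_single)
  qed
  obtain \<tau> y where py: "p = (\<tau>, y)" by (cases p)
  have pt: "(\<tau>, y) \<in> trop_chart_points N \<Delta> \<sigma>" "trop_chart N \<sigma> (\<tau>, y) = w"
    using trop_glue[OF \<sigma> w] p unfolding w_def[symmetric] py by simp_all
  obtain F m where Fm: "F \<subseteq> E" "m \<in> span M" "\<tau> = lcone F m"
    using fan_lcone[of \<tau>] pt(1) unfolding trop_chart_points_def by blast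
  have y: "y \<in> W F m" using pt(1) W_quot[OF Fm(1), of m] Fm(3) unfolding trop_chart_points_def by blast
  have lev: "flat G" if G: "G \<in> levels E (wv F (lawrence_phi y))" for G
  proof (rule levels_flat_of_valuation[where X = E and S = ?S and val = val])
    fix c :: "'e \<Rightarrow> int" assume "(\<Sum>e\<in>E. of_int (c e) *\<^sub>R a e) = 0"
    from linform_in_ideal[OF this] show "val (linform c E) = \<infinity>" using val unfolding berkovich_def by blast
  next
    have "wv F (lawrence_phi y) e = val (Poly_Mapping.single (unit_char e) 1)" if e: "e \<in> E" for e
    proof -
      have "val (Poly_Mapping.single (unit_char e) 1) = trop_chart N \<sigma> (\<tau>, y) (unit_char e)"
        unfolding pt(2) using unit_char_cone_monoid[OF \<sigma> e] by (simp add: w_def)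
      also have "\<dots> = wv F (lawrence_phi y) e"
        using unit_char_cone_monoid[OF \<sigma> e] unit_char_orthogonal_iff[OF e, of "PP F m" "QQ F m"]
        by (simp add: trop_chart_def Fm(3) PP_Un_QQ wv_def inner_unit_char)
      finally show ?thesis by simp
    qed
    hence "levels E (wv F (lawrence_phi y)) =
        levels E (\<lambda>e. if e \<in> E then val (Poly_Mapping.single (unit_char e) 1) else \<infinity>)"
      by (intro levels_cong) simp
    thus "G \<in> levels E (\<lambda>e. if e \<in> E then val (Poly_Mapping.single (unit_char e) 1) else \<infinity>)" using G by blast
  qed (use mult add const unit_char_cone_monoid[OF \<sigma>] cone_monoid_zero in blast)+
  \<comment> \<open>\<open>F\<close> is the superlevel set at \<infinity>, so only strata indexed by
    flats meet the tropicalization.\<close>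
  have "flat F" using lev[OF levels_self(2)] wv_PInf[OF Fm(1)] by simp
  thus "p \<in> ?T" using py Fm y lev unfolding tstratum_def by blast
next
  fix p assume "p \<in> ?T"
  then obtain F m y where p: "p = (lcone F m, y)" and F: "flat F" and m: "m \<in> span M" and y: "y \<in> tstratum F m" by blast
  let ?\<tau> = "lcone F m"
  let ?S = "cone_monoid N ?\<tau>"
  have FE: "F \<subseteq> E" using F by (rule flat_sub)
  have y': "y \<in> W F m" "\<forall>G\<in>levels E (wv F (lawrence_phi y)). flat G" using y unfolding tstratum_def by blast+
  obtain val :: "(((real^'e) \<times> (real^'e)) \<Rightarrow>\<^sub>0 'k) \<Rightarrow> ereal" where val:
    "\<forall>f\<in>semigroup_algebra (Tchar F m). val f \<noteq> -\<infinity>"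
    "\<forall>f\<in>semigroup_algebra (Tchar F m). \<forall>g\<in>semigroup_algebra (Tchar F m).
       val (f * g) = val f + val g \<and> min (val f) (val g) \<le> val (f + g)"
    "\<forall>c. val (Poly_Mapping.single 0 c) = v c"
    "\<forall>u\<in>Tchar F m. val (Poly_Mapping.single u 1) = ereal (y \<bullet> u)"
    "\<forall>g\<in>semigroup_algebra (Tchar F m). \<forall>c. (\<Sum>e\<in>E. of_int (c e) *\<^sub>R a e) = 0 \<longrightarrow> val (g * linform c (E - F)) = \<infinity>"
    using stratum_valuation_exists[OF F y'] by (elim exE conjE) (rule that)
  \<comment> \<open>The valuation on the orbit is extended to its chart by composition with
    restriction to the orbit, which is closed in the chart; characters that vanish on the orbit get
    \<infinity>.\<close>
  define val' :: "(((real^'e) \<times> (real^'e)) \<Rightarrow>\<^sub>0 'k) \<Rightarrow> ereal" where "val' = (\<lambda>f. val (orbit_restrict ?\<tau> f))"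
  have ideal: "val' f = \<infinity>" if "f \<in> hypertoric_ideal E a ?\<tau>" for f
    unfolding val'_def by (rule restricted_ideal_PInf[OF FE _ val(3,5) that]) (use val(2) in blast)
  have "val' \<in> berkovich v ?S (hypertoric_ideal E a ?\<tau>)"
    unfolding berkovich_def
  proof (intro CollectI conjI ballI allI)
    fix f g :: "((real^'e) \<times> (real^'e)) \<Rightarrow>\<^sub>0 'k"
    assume fg: "f \<in> semigroup_algebra ?S" "g \<in> semigroup_algebra ?S"
    note fg' = orbit_restrict_alg[OF fg(1)] orbit_restrict_alg[OF fg(2)]
    show "val' f \<noteq> -\<infinity>" unfolding val'_def using val(1) fg'(1) by blast
    show "val' (f * g) = val' f + val' g" unfolding val'_def orbit_restrict_mult[OF fg] using val(2) fg' by blast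
    show "min (val' f) (val' g) \<le> val' (f + g)" unfolding val'_def orbit_restrict_add using val(2) fg' by blast
  qed (use ideal val(1,3) orbit_restrict_alg in \<open>auto simp: val'_def orbit_restrict_single\<close>)
  moreover have "(\<lambda>u\<in>?S. val' (Poly_Mapping.single u 1)) = trop_chart N ?\<tau> (?\<tau>, y)"
  proof
    fix u
    show "(\<lambda>u\<in>?S. val' (Poly_Mapping.single u 1)) u = trop_chart N ?\<tau> (?\<tau>, y) u"
    proof (cases "u \<in> ?S \<and> (\<forall>x\<in>?\<tau>. x \<bullet> u = 0)")
      case True
      hence "u \<in> Tchar F m" by (simp add: Tchar_def cone_monoid_def)
      thus ?thesis using True val(4) by (simp add: val'_def trop_chart_def orbit_restrict_single)
    next
      case False
      thus ?thesis using val(3)[rule_format, of 0]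
        by (auto simp: val'_def trop_chart_def orbit_restrict_single restrict_def)
    qed
  qed
  moreover have fan: "?\<tau> \<in> \<Delta>" by (rule lcone_in_fan[OF FE m])
  moreover have "(?\<tau>, y) \<in> trop_chart_points N \<Delta> ?\<tau>"
    using fan y'(1) W_quot[OF FE, of m] lcone_face_of[OF FE FE m m order_refl]
    unfolding trop_chart_points_def by blast
  ultimately have "(?\<tau>, y) \<in> (\<lambda>val. trop_glue N \<Delta> ?\<tau> (\<lambda>u\<in>?S. val (Poly_Mapping.single u 1))) `
      berkovich v ?S (hypertoric_ideal E a ?\<tau>)"
    using trop_glue_chart by (intro image_eqI[of _ _ val']) simp_all
  thus "p \<in> Trop_hypertoric v M E a r"
    unfolding Trop_hypertoric_def Trop_def p using fan by blast
qed

end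

section \<open>Closures of the cells\<close>

lemma topspace_trop_homs: "topspace (trop_homs_topology S) = trop_homs S"
  unfolding trop_homs_topology_def by (auto simp: trop_homs_def PiE_def)

lemma continuous_map_trop_homs:
  assumes "u \<in> S" shows "continuous_map (trop_homs_topology S) euclidean (\<lambda>w. w u)"
  unfolding trop_homs_topology_def
  by (intro continuous_map_from_subtopology continuous_map_product_projection assms)

lemma closedin_trop_homs_PInf:
  assumes "u \<in> S" shows "closedin (trop_homs_topology S) {w\<in>trop_homs S. w u = \<infinity>}"
  using closedin_continuous_map_preimage[OF continuous_map_trop_homs[OF assms], of "{\<infinity>}"]
  by (simp add: topspace_trop_homs)

lemma closedin_trop_homs_le:
  assumes "u \<in> S" "u' \<in> S" shows "closedin (trop_homs_topology S) {w\<in>trop_homs S. w u \<le> w u'}"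
proof -
  have "continuous_map (trop_homs_topology S) (prod_topology euclidean euclidean) (\<lambda>w. (w u, w u'))"
    by (intro continuous_map_pairedI continuous_map_trop_homs assms)
  moreover have "closed {p :: ereal \<times> ereal. fst p \<le> snd p}"
    by (intro closed_Collect_le continuous_intros)
  hence "closedin (prod_topology euclidean euclidean) {p :: ereal \<times> ereal. fst p \<le> snd p}" by simp
  ultimately have "closedin (trop_homs_topology S)
      {w\<in>topspace (trop_homs_topology S). (w u, w u') \<in> {p. fst p \<le> snd p}}"
    by (rule closedin_continuous_map_preimage)
  thus ?thesis by (simp add: topspace_trop_homs)
qed

lemma closedin_Collect_ball:
  assumes "\<And>i. i \<in> I \<Longrightarrow> closedin X {x\<in>T. P i x}" "closedin X T"
  shows "closedin X {x\<in>T. \<forall>i\<in>I. P i x}"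
proof (cases "I = {}")
  case False
  have "closedin X (\<Inter>i\<in>I. {x\<in>T. P i x})" using assms False by (intro closedin_INT)
  moreover have "(\<Inter>i\<in>I. {x\<in>T. P i x}) = {x\<in>T. \<forall>i\<in>I. P i x}" using False by blast
  ultimately show ?thesis by simp
qed (use assms in simp)

lemma closedin_trop_homs_self: "closedin (trop_homs_topology S) (trop_homs S)"
  using closedin_topspace[of "trop_homs_topology S"] by (simp only: topspace_trop_homs)

context arrangement
begin

abbreviation "TT \<equiv> trop_toric N \<Delta>"

lemma chart_points_iff:
  assumes \<sigma>: "\<sigma> \<in> \<Delta>"
  shows "p \<in> trop_chart_points N \<Delta> \<sigma> \<longleftrightarrow>
    (\<exists>S m y. p = (lcone S m, y) \<and> S \<subseteq> E \<and> m \<in> span M \<and> y \<in> W S m \<and> lcone S m \<subseteq> \<sigma>)"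
proof
  assume "p \<in> trop_chart_points N \<Delta> \<sigma>"
  then obtain \<tau> y where p: "p = (\<tau>, y)" "\<tau> \<in> \<Delta>" "\<tau> face_of \<sigma>" "y \<in> quot_map \<tau> ` span N"
    unfolding trop_chart_points_def by blast
  obtain S m where S: "S \<subseteq> E" "m \<in> span M" "\<tau> = lcone S m" using fan_lcone[OF p(2)] by blast
  have "lcone S m \<subseteq> \<sigma>" using face_of_imp_subset[OF p(3)] S(3) by simp
  moreover have "y \<in> W S m" using p(4) W_quot[OF S(1), of m] S(3) by simp
  ultimately show "\<exists>S m y. p = (lcone S m, y) \<and> S \<subseteq> E \<and> m \<in> span M \<and> y \<in> W S m \<and> lcone S m \<subseteq> \<sigma>"
    using p(1) S by blast
next
  assume "\<exists>S m y. p = (lcone S m, y) \<and> S \<subseteq> E \<and> m \<in> span M \<and> y \<in> W S m \<and> lcone S m \<subseteq> \<sigma>"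
  then obtain S m y where p: "p = (lcone S m, y)" "S \<subseteq> E" "m \<in> span M" "y \<in> W S m" "lcone S m \<subseteq> \<sigma>" by blast
  obtain S' m' where S': "S' \<subseteq> E" "m' \<in> span M" "\<sigma> = lcone S' m'" using fan_lcone[OF \<sigma>] by blast
  have "lcone S m face_of \<sigma>" using lcone_face_of[OF p(2) S'(1) p(3) S'(2)] p(5) S'(3) by simp
  thus "p \<in> trop_chart_points N \<Delta> \<sigma>"
    unfolding trop_chart_points_def p(1) using lcone_in_fan[OF p(2,3)] W_quot[OF p(2), of m] p(4) by blast
qed

lemma topspace_TT_eq: "topspace TT = (\<Union>\<sigma>\<in>\<Delta>. trop_chart_points N \<Delta> \<sigma>)"
proof
  have "trop_toric_openin N \<Delta> (topspace TT)"
    using openin_topspace[of TT] unfolding openin_trop_toric .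
  thus "topspace TT \<subseteq> (\<Union>\<sigma>\<in>\<Delta>. trop_chart_points N \<Delta> \<sigma>)" unfolding trop_toric_openin_def by blast
  have "{w \<in> trop_homs (cone_monoid N \<sigma>). trop_glue N \<Delta> \<sigma> w \<in> (\<Union>\<sigma>\<in>\<Delta>. trop_chart_points N \<Delta> \<sigma>)} =
      topspace (trop_homs_topology (cone_monoid N \<sigma>))" if "\<sigma> \<in> \<Delta>" for \<sigma>
    unfolding topspace_trop_homs using trop_glue(1)[OF that] that by blast
  hence "openin TT (\<Union>\<sigma>\<in>\<Delta>. trop_chart_points N \<Delta> \<sigma>)"
    unfolding openin_trop_toric trop_toric_openin_def by (intro conjI order_refl ballI) (simp only: openin_topspace)
  thus "(\<Union>\<sigma>\<in>\<Delta>. trop_chart_points N \<Delta> \<sigma>) \<subseteq> topspace TT" by (rule openin_subset)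
qed

lemma topspace_TT:
  "p \<in> topspace TT \<longleftrightarrow> (\<exists>S m y. p = (lcone S m, y) \<and> S \<subseteq> E \<and> m \<in> span M \<and> y \<in> W S m)"
proof
  assume "p \<in> topspace TT"
  then obtain \<sigma> where "\<sigma> \<in> \<Delta>" "p \<in> trop_chart_points N \<Delta> \<sigma>" unfolding topspace_TT_eq by blast
  thus "\<exists>S m y. p = (lcone S m, y) \<and> S \<subseteq> E \<and> m \<in> span M \<and> y \<in> W S m"
    using chart_points_iff[of \<sigma> p] by blast
next
  assume "\<exists>S m y. p = (lcone S m, y) \<and> S \<subseteq> E \<and> m \<in> span M \<and> y \<in> W S m"
  then obtain S m y where p: "p = (lcone S m, y)" "S \<subseteq> E" "m \<in> span M" "y \<in> W S m" by blast
  have f: "lcone S m \<in> \<Delta>" by (rule lcone_in_fan[OF p(2,3)])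
  have "p \<in> trop_chart_points N \<Delta> (lcone S m)"
    unfolding chart_points_iff[OF f] by (intro exI[of _ S] exI[of _ m] exI[of _ y] conjI p order_refl)
  thus "p \<in> topspace TT" unfolding topspace_TT_eq using f by blast
qed

lemma closedin_TT:
  assumes "C \<subseteq> topspace TT"
    "\<And>\<sigma>. \<sigma> \<in> \<Delta> \<Longrightarrow> closedin (trop_homs_topology (cone_monoid N \<sigma>))
      {w \<in> trop_homs (cone_monoid N \<sigma>). trop_glue N \<Delta> \<sigma> w \<in> C}"
  shows "closedin TT C"
proof -
  have "openin (trop_homs_topology (cone_monoid N \<sigma>))
      {w \<in> trop_homs (cone_monoid N \<sigma>). trop_glue N \<Delta> \<sigma> w \<in> topspace TT - C}" if \<sigma>: "\<sigma> \<in> \<Delta>" for \<sigma>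
  proof -
    have "{w \<in> trop_homs (cone_monoid N \<sigma>). trop_glue N \<Delta> \<sigma> w \<in> topspace TT - C} =
      topspace (trop_homs_topology (cone_monoid N \<sigma>)) -
      {w \<in> trop_homs (cone_monoid N \<sigma>). trop_glue N \<Delta> \<sigma> w \<in> C}"
      unfolding topspace_trop_homs topspace_TT_eq using trop_glue(1)[OF \<sigma>] \<sigma> by blast
    thus ?thesis using assms(2)[OF \<sigma>] by (simp add: openin_diff)
  qed
  moreover have "topspace TT - C \<subseteq> (\<Union>\<sigma>\<in>\<Delta>. trop_chart_points N \<Delta> \<sigma>)" unfolding topspace_TT_eq by blast
  ultimately have "openin TT (topspace TT - C)" unfolding openin_trop_toric trop_toric_openin_def by blast
  thus ?thesis using assms(1) by (simp add: closedin_def)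
qed

text \<open>The value of the coordinate \<open>x_e\<close> at the point \<open>(\<tau>, y)\<close>,
  expressed through the cone alone so that it makes sense without a chosen pair
  \<open>(S, m)\<close>.\<close>

definition tphi :: "((real^'e) \<times> (real^'e)) set \<Rightarrow> (real^'e) \<times> (real^'e) \<Rightarrow> 'e \<Rightarrow> ereal" where
  "tphi \<tau> y e = (if \<forall>x\<in>\<tau>. x \<bullet> unit_char e = 0 then ereal (lawrence_phi y $ e) else \<infinity>)"

lemma tphi_lcone: assumes "e \<in> E" shows "tphi (lcone S m) y e = wv S (lawrence_phi y) e"
  using unit_char_orthogonal_iff[OF assms, of "PP S m" "QQ S m"]
  by (simp add: tphi_def wv_def PP_Un_QQ)

lemma chart_unit_char:
  assumes "\<sigma> \<in> \<Delta>" "e \<in> E" shows "trop_chart N \<sigma> (\<tau>, y) (unit_char e) = tphi \<tau> y e"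
  using unit_char_cone_monoid[OF assms] by (simp add: trop_chart_def tphi_def inner_unit_char)

definition cell_closure :: "'e set \<Rightarrow> 'm \<Rightarrow> 'e set set \<Rightarrow> (((real^'e) \<times> (real^'e)) set \<times> (real^'e) \<times> (real^'e)) set" where
  "cell_closure F m \<F> = {p\<in>topspace TT. lcone F m \<subseteq> fst p \<and>
     (\<forall>e\<in>E. \<forall>f\<in>E. fle \<F> e f \<longrightarrow> tphi (fst p) (snd p) f \<le> tphi (fst p) (snd p) e)}"

lemma cell_closure_iff:
  assumes fl: "set_flag E F \<F>" and m: "m \<in> span M" and S: "S' \<subseteq> E" "m' \<in> span M" "y' \<in> W S' m'"
  shows "(lcone S' m', y') \<in> cell_closure F m \<F> \<longleftrightarrow>
    lcone F m \<subseteq> lcone S' m' \<and> levels E (wv S' (lawrence_phi y')) \<subseteq> \<F>"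
proof -
  interpret set_flag E F \<F> by (rule fl)
  have "(lcone S' m', y') \<in> topspace TT" unfolding topspace_TT using S by blast
  moreover have "(\<forall>e\<in>E. \<forall>f\<in>E. fle \<F> e f \<longrightarrow> tphi (lcone S' m') y' f \<le> tphi (lcone S' m') y' e) \<longleftrightarrow>
      levels E (wv S' (lawrence_phi y')) \<subseteq> \<F>" if sub: "lcone F m \<subseteq> lcone S' m'"
  proof -
    have "F \<subseteq> S'" using lcone_subset_iff[OF F_sub m S(2)] sub by blast
    hence "wv S' (lawrence_phi y') e = \<infinity>" if "e \<in> F" for e using that by (auto simp: wv_def)
    from levels_subset_iff[OF this] show ?thesis by (simp add: tphi_lcone)
  qed
  ultimately show ?thesis unfolding cell_closure_def by (simp only: mem_Collect_eq fst_conv snd_conv) blast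
qed

text \<open>If the cone of a chart contains \<open>lcone F m\<close>, then inclusion of
  \<open>lcone F m\<close> in the cone of a point means that all characters not orthogonal to
  \<open>lcone F m\<close> are infinite there; the character exposing the cone of the point is
  finite and so detects the inclusion. Other charts do not meet the set.\<close>

lemma closedin_cell_closure:
  assumes F: "F \<subseteq> E" and m: "m \<in> span M"
  shows "closedin TT (cell_closure F m \<F>)"
proof (rule closedin_TT)
  show "cell_closure F m \<F> \<subseteq> topspace TT" unfolding cell_closure_def by blast
  fix \<sigma> assume \<sigma>: "\<sigma> \<in> \<Delta>"
  let ?S = "cone_monoid N \<sigma>"
  let ?H = "trop_homs ?S"
  let ?U = "{u\<in>?S. \<exists>x\<in>lcone F m. x \<bullet> u \<noteq> 0}"
  have glue: "\<exists>\<tau> y. trop_glue N \<Delta> \<sigma> w = (\<tau>, y) \<and> \<tau> \<in> \<Delta> \<and> \<tau> \<subseteq> \<sigma> \<and> w = trop_chart N \<sigma> (\<tau>, y) \<and> (\<tau>, y) \<in> topspace TT"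
    if w: "w \<in> ?H" for w
  proof -
    obtain \<tau> y where ty: "trop_glue N \<Delta> \<sigma> w = (\<tau>, y)" by (cases "trop_glue N \<Delta> \<sigma> w")
    have c: "(\<tau>, y) \<in> trop_chart_points N \<Delta> \<sigma>" "trop_chart N \<sigma> (\<tau>, y) = w"
      using trop_glue[OF \<sigma> w] ty by simp_all
    have "\<tau> \<in> \<Delta>" "\<tau> \<subseteq> \<sigma>" using c(1) face_of_imp_subset unfolding trop_chart_points_def by blast+
    moreover have "(\<tau>, y) \<in> topspace TT" unfolding topspace_TT_eq using c(1) \<sigma> by blast
    ultimately show ?thesis using ty c(2) by blast
  qed
  show "closedin (trop_homs_topology ?S) {w\<in>?H. trop_glue N \<Delta> \<sigma> w \<in> cell_closure F m \<F>}"
  proof (cases "lcone F m \<subseteq> \<sigma>")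
    case False
    have "{w\<in>?H. trop_glue N \<Delta> \<sigma> w \<in> cell_closure F m \<F>} = {}"
    proof (rule ccontr)
      assume "{w\<in>?H. trop_glue N \<Delta> \<sigma> w \<in> cell_closure F m \<F>} \<noteq> {}"
      then obtain w where w: "w \<in> ?H" "trop_glue N \<Delta> \<sigma> w \<in> cell_closure F m \<F>" by blast
      obtain \<tau> y where "trop_glue N \<Delta> \<sigma> w = (\<tau>, y)" "\<tau> \<subseteq> \<sigma>" using glue[OF w(1)] by blast
      moreover from this w(2) have "lcone F m \<subseteq> \<tau>" unfolding cell_closure_def by simp
      ultimately show False using False by blast
    qed
    thus ?thesis by (simp only: closedin_empty)
  next
    case True
    have "trop_glue N \<Delta> \<sigma> w \<in> cell_closure F m \<F> \<longleftrightarrow>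
        (\<forall>u\<in>?U. w u = \<infinity>) \<and> (\<forall>e\<in>E. \<forall>f\<in>{f\<in>E. fle \<F> e f}. w (unit_char f) \<le> w (unit_char e))" if w: "w \<in> ?H" for w
    proof -
      obtain \<tau> y where t: "trop_glue N \<Delta> \<sigma> w = (\<tau>, y)" "\<tau> \<in> \<Delta>" "\<tau> \<subseteq> \<sigma>" "w = trop_chart N \<sigma> (\<tau>, y)" "(\<tau>, y) \<in> topspace TT"
        using glue[OF w] by blast
      have wu: "w u = (if \<forall>x\<in>\<tau>. x \<bullet> u = 0 then ereal (y \<bullet> u) else \<infinity>)" if "u \<in> ?S" for u
        unfolding t(4) using that by (simp add: trop_chart_def)
      have we: "w (unit_char e) = tphi \<tau> y e" if "e \<in> E" for e
        unfolding t(4) by (rule chart_unit_char[OF \<sigma> that])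
      have "lcone F m \<subseteq> \<tau> \<longleftrightarrow> (\<forall>u\<in>?U. w u = \<infinity>)"
      proof
        assume "lcone F m \<subseteq> \<tau>"
        hence "\<not> (\<forall>x\<in>\<tau>. x \<bullet> u = 0)" if "u \<in> ?U" for u using that by blast
        hence "w u = \<infinity>" if "u \<in> ?U" for u using wu[of u] that by (simp only: mem_Collect_eq if_False)
        thus "\<forall>u\<in>?U. w u = \<infinity>" by blast
      next
        assume inf: "\<forall>u\<in>?U. w u = \<infinity>"
        obtain u where u: "u \<in> ?S" "\<tau> = {x\<in>\<sigma>. x \<bullet> u = 0}" using fan_exposing_character[OF \<sigma> t(2,3)] by blast
        have "\<forall>x\<in>\<tau>. x \<bullet> u = 0" using u(2) by blast
        hence "w u \<noteq> \<infinity>" using wu[OF u(1)] by simp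
        hence "\<forall>x\<in>lcone F m. x \<bullet> u = 0" using inf u(1) by blast
        thus "lcone F m \<subseteq> \<tau>" using True u(2) by blast
      qed
      moreover have "(\<forall>e\<in>E. \<forall>f\<in>E. fle \<F> e f \<longrightarrow> tphi \<tau> y f \<le> tphi \<tau> y e) \<longleftrightarrow>
          (\<forall>e\<in>E. \<forall>f\<in>{f\<in>E. fle \<F> e f}. w (unit_char f) \<le> w (unit_char e))"
        using we by (simp, blast)
      ultimately show ?thesis unfolding cell_closure_def t(1) using t(5)
        by (simp only: mem_Collect_eq fst_conv snd_conv simp_thms)
    qed
    hence "{w\<in>?H. trop_glue N \<Delta> \<sigma> w \<in> cell_closure F m \<F>} =
        {w\<in>?H. \<forall>u\<in>?U. w u = \<infinity>} \<inter> {w\<in>?H. \<forall>e\<in>E. \<forall>f\<in>{f\<in>E. fle \<F> e f}. w (unit_char f) \<le> w (unit_char e)}"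
      by blast
    moreover have "closedin (trop_homs_topology ?S) {w\<in>?H. \<forall>u\<in>?U. w u = \<infinity>}"
      by (intro closedin_Collect_ball closedin_trop_homs_self closedin_trop_homs_PInf) blast
    moreover have "closedin (trop_homs_topology ?S)
        {w\<in>?H. \<forall>e\<in>E. \<forall>f\<in>{f\<in>E. fle \<F> e f}. w (unit_char f) \<le> w (unit_char e)}"
      using unit_char_cone_monoid[OF \<sigma>]
      by (intro closedin_Collect_ball closedin_trop_homs_self closedin_trop_homs_le) blast+
    ultimately show ?thesis by (simp only: closedin_Int)
  qed
qed

text \<open>A generator of the cone of \<open>(S, m)\<close> over the coordinate vector of \<open>e\<close>, chosen so that the
  generators for \<open>e \<in> S\<close> add up to a point in the relative interior of the cone.\<close>

definition mid_gen :: "'e set \<Rightarrow> 'm \<Rightarrow> 'e \<Rightarrow> (real^'e) \<times> (real^'e)" where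
  "mid_gen S m e = (if e \<in> PP S m \<and> e \<in> QQ S m then (1/2) *\<^sub>R (\<rho>p e + \<rho>n e)
     else if e \<in> PP S m then \<rho>p e else \<rho>n e)"

lemma mid_gen:
  assumes S: "S \<subseteq> E" and e: "e \<in> S"
  shows "mid_gen S m e \<in> span (lcone S m)" "mid_gen S m e \<in> VN" "lawrence_phi (mid_gen S m e) = axis e 1"
    "u \<in> VN \<Longrightarrow> mid_gen S m e \<bullet> u = (if e \<in> PP S m \<and> e \<in> QQ S m then (fst u $ e + snd u $ e) / 2
       else if e \<in> PP S m then fst u $ e else snd u $ e)"
proof -
  have eE: "e \<in> E" using assms by blast
  have PQ: "e \<in> PP S m \<or> e \<in> QQ S m" using PP_Un_QQ[of S m] e by blast
  have g: "\<rho>p e \<in> span (lcone S m)" if "e \<in> PP S m" using rho_in_pcone(1)[OF that] by (rule span_base)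
  have g': "\<rho>n e \<in> span (lcone S m)" if "e \<in> QQ S m" using rho_in_pcone(2)[OF that] by (rule span_base)
  show "mid_gen S m e \<in> span (lcone S m)"
    unfolding mid_gen_def using PQ g g' by (auto intro: span_scale span_add)
  show "mid_gen S m e \<in> VN"
    unfolding mid_gen_def using rho_VN[OF eE] subspace_VN by (auto intro: subspace_scale subspace_add)
  have "lawrence_phi ((1/2) *\<^sub>R (\<rho>p e + \<rho>n e)) = axis e 1"
    unfolding linear_scale[OF linear_lawrence_phi] linear_add[OF linear_lawrence_phi] phi_rho[OF eE]
    by (simp add: scaleR_add_right scaleR_half_double)
  thus "lawrence_phi (mid_gen S m e) = axis e 1"
    unfolding mid_gen_def using phi_rho[OF eE] by simp
  show "mid_gen S m e \<bullet> u = (if e \<in> PP S m \<and> e \<in> QQ S m then (fst u $ e + snd u $ e) / 2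
       else if e \<in> PP S m then fst u $ e else snd u $ e)" if "u \<in> VN"
    unfolding mid_gen_def by (simp add: rho_inner[OF that] inner_add_left add_divide_distrib)
qed

lemma mid_gen_nonneg:
  assumes S: "S \<subseteq> E" and e: "e \<in> S" and u: "u \<in> cone_monoid N (lcone S m)"
  shows "0 \<le> mid_gen S m e \<bullet> u"
proof -
  have uV: "u \<in> VN" and nn: "e \<in> PP S m \<Longrightarrow> 0 \<le> fst u $ e" "e \<in> QQ S m \<Longrightarrow> 0 \<le> snd u $ e"
    using u unfolding cone_monoid_pcone by (auto dest: dual_N_VN)
  show ?thesis unfolding mid_gen(4)[OF S e uV] using nn PP_Un_QQ[of S m] e by auto
qed

lemma mid_gen_pos:
  assumes S: "S \<subseteq> E" and u: "u \<in> cone_monoid N (lcone S m)" "\<not> (\<forall>x\<in>lcone S m. x \<bullet> u = 0)"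
  shows "0 < (\<Sum>e\<in>S. mid_gen S m e \<bullet> u)"
proof -
  have uV: "u \<in> VN" and nn: "\<And>e. e \<in> PP S m \<Longrightarrow> 0 \<le> fst u $ e" "\<And>e. e \<in> QQ S m \<Longrightarrow> 0 \<le> snd u $ e"
    using u(1) unfolding cone_monoid_pcone by (auto dest: dual_N_VN)
  obtain e where e: "e \<in> PP S m \<and> fst u $ e \<noteq> 0 \<or> e \<in> QQ S m \<and> snd u $ e \<noteq> 0"
    using u(2) pcone_orthogonal_iff[OF uV] by blast
  hence eS: "e \<in> S" using PP_sub QQ_sub by blast
  have "0 < mid_gen S m e \<bullet> u"
    unfolding mid_gen(4)[OF S eS uV] using nn[of e] e by fastforce
  moreover have "mid_gen S m e \<bullet> u \<le> (\<Sum>e\<in>S. mid_gen S m e \<bullet> u)"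
    using mid_gen_nonneg[OF S _ u(1)] eS by (intro member_le_sum) auto
  ultimately show ?thesis by linarith
qed

lemma trop_chart_orthogonal:
    "u \<in> cone_monoid N \<sigma> \<Longrightarrow> \<forall>x\<in>\<tau>. x \<bullet> u = 0 \<Longrightarrow> trop_chart N \<sigma> (\<tau>, y) u = ereal (y \<bullet> u)"
  and trop_chart_PInf:
    "u \<in> cone_monoid N \<sigma> \<Longrightarrow> \<not> (\<forall>x\<in>\<tau>. x \<bullet> u = 0) \<Longrightarrow> trop_chart N \<sigma> (\<tau>, y) u = \<infinity>"
  by (simp_all add: trop_chart_def)

text \<open>\<open>x n\<close> moves \<open>y\<close> along the span of the cone of
  \<open>(S, m')\<close> so that every coordinate with index in \<open>S\<close> has the value
  \<open>n\<close>. For large \<open>n\<close> these dominate the coordinates outside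
  \<open>S\<close>, which keep their values, so the projections to the stratum of \<open>F\<close>
  lie in the cell.\<close>

lemma cell_closure_limit:
  assumes fl: "set_flag E F \<F>" and m: "m \<in> span M" and S: "S \<subseteq> E" and m': "m' \<in> span M" and y: "y \<in> W S m'"
    and cl: "(lcone S m', y) \<in> cell_closure F m \<F>"
  shows "\<exists>z. (\<forall>\<^sub>F n in sequentially. z n \<in> HC F m \<F>) \<and> (\<forall>n. z n \<in> W F m) \<and>
    (\<forall>u\<in>cone_monoid N (lcone S m').
       ((\<lambda>n. trop_chart N (lcone S m') (lcone F m, z n) u) \<longlongrightarrow> trop_chart N (lcone S m') (lcone S m', y) u) sequentially)"
proof -
  interpret set_flag E F \<F> by (rule fl)
  define \<phi> where "\<phi> = (\<lambda>e. lawrence_phi y $ e)"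
  define x where "x = (\<lambda>n::nat. y + (\<Sum>e\<in>S. (of_nat n - \<phi> e) *\<^sub>R mid_gen S m' e))"
  define z where "z = (\<lambda>n. quot_map (lcone F m) (x n))"
  have sub: "lcone F m \<subseteq> lcone S m'" using cl unfolding cell_closure_def by simp
  have mono: "wv S (lawrence_phi y) f \<le> wv S (lawrence_phi y) e" if "e \<in> E" "f \<in> E" "fle \<F> e f" for e f
  proof -
    have "tphi (lcone S m') y f \<le> tphi (lcone S m') y e"
      using cl that unfolding cell_closure_def mem_Collect_eq fst_conv snd_conv by blast
    thus ?thesis unfolding tphi_lcone[OF that(1)] tphi_lcone[OF that(2)] .
  qed
  have FS: "F \<subseteq> S" using lcone_subset_iff[OF F_sub m m'] sub by blast
  have "(\<Sum>e\<in>S. (of_nat n - \<phi> e) *\<^sub>R mid_gen S m' e) \<in> VN" for n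
    using mid_gen(2)[OF S] subspace_VN by (intro subspace_sum subspace_scale)
  moreover have "y \<in> VN" using y by (simp add: W_def)
  ultimately have xV: "x n \<in> VN" for n unfolding x_def by (intro subspace_add[OF subspace_VN])
  hence zW: "z n \<in> W F m" for n unfolding z_def by (intro quot_W F_sub)
  have phix: "lawrence_phi (x n) $ e = (if e \<in> S then of_nat n else \<phi> e)" for n e
  proof -
    have "lawrence_phi (x n) = lawrence_phi y + (\<Sum>e\<in>S. (of_nat n - \<phi> e) *\<^sub>R axis e 1)"
      unfolding x_def linear_add[OF linear_lawrence_phi] linear_sum[OF linear_lawrence_phi] linear_scale[OF linear_lawrence_phi]
      by (intro arg_cong2[where f = plus] refl sum.cong) (simp add: mid_gen(3)[OF S])
    hence "lawrence_phi (x n) $ e = \<phi> e + (\<Sum>f\<in>S. if f = e then of_nat n - \<phi> e else 0)"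
      by (simp add: \<phi>_def sum_component axis_def if_distrib cong: if_cong)
    thus ?thesis by simp
  qed
  have inHC: "z n \<in> HC F m \<F>" if n: "\<forall>e\<in>E. \<phi> e \<le> of_nat n" for n
    unfolding HC_iff[OF fl]
  proof (intro conjI ballI impI zW)
    fix e f assume ef: "e \<in> E - F" "f \<in> E - F" "fle \<F> e f"
    have eq: "lawrence_phi (z n) $ f = (if f \<in> S then of_nat n else \<phi> f)" "lawrence_phi (z n) $ e = (if e \<in> S then of_nat n else \<phi> e)"
      unfolding z_def phi_quot[OF ef(1)] phi_quot[OF ef(2)] by (rule phix)+
    show "lawrence_phi (z n) $ f \<le> lawrence_phi (z n) $ e"
      unfolding eq using n mono[of e f] ef by (auto simp: wv_def \<phi>_def split: if_splits)
  qed
  obtain n0 :: nat where n0: "\<forall>e\<in>E. \<phi> e \<le> of_nat n0"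
  proof -
    have "\<phi> e \<le> of_nat (nat \<lceil>\<Sum>e\<in>E. \<bar>\<phi> e\<bar>\<rceil>)" if "e \<in> E" for e
    proof -
      have "\<phi> e \<le> \<bar>\<phi> e\<bar>" by simp
      also have "\<dots> \<le> (\<Sum>e\<in>E. \<bar>\<phi> e\<bar>)" using that by (intro member_le_sum) auto
      finally show ?thesis by linarith
    qed
    thus ?thesis using that by blast
  qed
  have ev: "\<forall>\<^sub>F n in sequentially. z n \<in> HC F m \<F>"
    using n0 by (intro eventually_sequentiallyI[of n0] inHC) force
  have lim: "((\<lambda>n. trop_chart N (lcone S m') (lcone F m, z n) u) \<longlongrightarrow> trop_chart N (lcone S m') (lcone S m', y) u) sequentially"
    if u: "u \<in> cone_monoid N (lcone S m')" for u
  proof (cases "\<forall>t\<in>lcone F m. t \<bullet> u = 0")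
    case False
    hence F': "\<not> (\<forall>t\<in>lcone S m'. t \<bullet> u = 0)" using sub by blast
    show ?thesis unfolding trop_chart_PInf[OF u False] trop_chart_PInf[OF u F'] by (rule tendsto_const)
  next
    case True
    \<comment> \<open>The slope in \<open>n\<close> is the pairing with the sum of the generators.
      It is zero if \<open>u\<close> is orthogonal to the larger cone and positive otherwise, by
      \<open>mid_gen_pos\<close>.\<close>
    have zu: "z n \<bullet> u = y \<bullet> u - (\<Sum>e\<in>S. \<phi> e * (mid_gen S m' e \<bullet> u)) + of_nat n * (\<Sum>e\<in>S. mid_gen S m' e \<bullet> u)" for n
    proof -
      have "z n \<bullet> u = x n \<bullet> u" unfolding z_def using True by (intro inner_quot_map) (simp add: orthogonal_comp_iff)
      also have "\<dots> = y \<bullet> u + (\<Sum>e\<in>S. (of_nat n - \<phi> e) * (mid_gen S m' e \<bullet> u))"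
        by (simp add: x_def inner_add_left inner_sum_left)
      finally show ?thesis by (simp add: left_diff_distrib sum_subtractf sum_distrib_left)
    qed
    show ?thesis
    proof (cases "\<forall>t\<in>lcone S m'. t \<bullet> u = 0")
      case orth: True
      have "mid_gen S m' e \<bullet> u = 0" if "e \<in> S" for e
        using inner_span_eq_0[OF mid_gen(1)[OF S that]] orth by blast
      hence "z n \<bullet> u = y \<bullet> u" for n unfolding zu by simp
      thus ?thesis unfolding trop_chart_orthogonal[OF u True] trop_chart_orthogonal[OF u orth] by simp
    next
      case False
      define A where "A = y \<bullet> u - (\<Sum>e\<in>S. \<phi> e * (mid_gen S m' e \<bullet> u))"
      define B where "B = (\<Sum>e\<in>S. mid_gen S m' e \<bullet> u)"
      have B: "0 < B" unfolding B_def by (rule mid_gen_pos[OF S u False])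
      have "filterlim (\<lambda>n::nat. A + of_nat n * B) at_top sequentially"
        using B by (intro filterlim_tendsto_add_at_top[OF tendsto_const]
            filterlim_at_top_mult_tendsto_pos[OF tendsto_const B filterlim_real_sequentially])
      hence "((\<lambda>n::nat. ereal (A + of_nat n * B)) \<longlongrightarrow> \<infinity>) sequentially"
        by (simp add: tendsto_PInfty_eq_at_top)
      moreover have "trop_chart N (lcone S m') (lcone F m, z n) u = ereal (A + of_nat n * B)" for n
        unfolding trop_chart_orthogonal[OF u True] zu A_def B_def ..
      ultimately show ?thesis unfolding trop_chart_PInf[OF u False] by (simp only:)
    qed
  qed
  show ?thesis using ev zW lim by blast
qed

lemma closure_of_cell:
  assumes fl: "set_flag E F \<F>" and m: "m \<in> span M"
  shows "TT closure_of ({lcone F m} \<times> HC F m \<F>) = cell_closure F m \<F>"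
proof
  interpret set_flag E F \<F> by (rule fl)
  have "(lcone F m, y) \<in> cell_closure F m \<F>" if "y \<in> HC F m \<F>" for y
    using that unfolding HC_def by (subst cell_closure_iff[OF fl m F_sub m]) auto
  thus "TT closure_of ({lcone F m} \<times> HC F m \<F>) \<subseteq> cell_closure F m \<F>"
    using closedin_cell_closure[OF F_sub m] by (intro closure_of_minimal) blast+
  show "cell_closure F m \<F> \<subseteq> TT closure_of ({lcone F m} \<times> HC F m \<F>)"
  proof
    fix p assume p: "p \<in> cell_closure F m \<F>"
    hence pT: "p \<in> topspace TT" unfolding cell_closure_def by blast
    then obtain S m' y where S: "p = (lcone S m', y)" "S \<subseteq> E" "m' \<in> span M" "y \<in> W S m'"
      unfolding topspace_TT by blast
    let ?\<sigma> = "lcone S m'"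
    let ?S = "cone_monoid N ?\<sigma>"
    have \<sigma>: "?\<sigma> \<in> \<Delta>" by (rule lcone_in_fan[OF S(2,3)])
    have sub: "lcone F m \<subseteq> ?\<sigma>" using p unfolding cell_closure_def S(1) by simp
    obtain z where z: "\<forall>\<^sub>F n in sequentially. z n \<in> HC F m \<F>" "\<forall>n. z n \<in> W F m"
        "\<forall>u\<in>?S. ((\<lambda>n. trop_chart N ?\<sigma> (lcone F m, z n) u) \<longlongrightarrow> trop_chart N ?\<sigma> (?\<sigma>, y) u) sequentially"
      using cell_closure_limit[OF fl m S(2-4) p[unfolded S(1)]] by (elim exE conjE) (rule that)
    have ext: "trop_chart N ?\<sigma> (\<tau>, t) \<in> extensional ?S" for \<tau> t by (simp add: trop_chart_def)
    have "limitin (trop_homs_topology ?S) (\<lambda>n. trop_chart N ?\<sigma> (lcone F m, z n)) (trop_chart N ?\<sigma> (?\<sigma>, y)) sequentially"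
      unfolding trop_homs_topology_def limitin_subtopology limitin_componentwise limitin_canonical_iff
      using z(3) ext trop_chart_in_trop_homs[OF sub] trop_chart_in_trop_homs[OF order_refl, of ?\<sigma>]
      by (simp add: PiE_def)
    hence lim: "\<forall>\<^sub>F n in sequentially. trop_chart N ?\<sigma> (lcone F m, z n) \<in> U"
      if "openin (trop_homs_topology ?S) U" "trop_chart N ?\<sigma> (?\<sigma>, y) \<in> U" for U
      using that unfolding limitin_def by blast
    show "p \<in> TT closure_of ({lcone F m} \<times> HC F m \<F>)"
      unfolding in_closure_of
    proof (intro conjI allI impI pT)
      fix T assume T: "p \<in> T \<and> openin TT T"
      let ?U = "{w \<in> trop_homs ?S. trop_glue N \<Delta> ?\<sigma> w \<in> T}"
      have "openin (trop_homs_topology ?S) ?U" using T \<sigma> unfolding openin_trop_toric trop_toric_openin_def by blast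
      moreover have "p \<in> trop_chart_points N \<Delta> ?\<sigma>" unfolding chart_points_iff[OF \<sigma>] using S by blast
      hence "trop_chart N ?\<sigma> (?\<sigma>, y) \<in> ?U"
        using trop_glue_chart[OF \<sigma>, of p] T trop_chart_in_trop_homs[OF order_refl, of ?\<sigma> y] S(1) by simp
      ultimately have "\<forall>\<^sub>F n in sequentially. trop_chart N ?\<sigma> (lcone F m, z n) \<in> ?U" by (rule lim)
      from eventually_happens'[OF sequentially_bot eventually_conj[OF this z(1)]]
      obtain n where n: "trop_chart N ?\<sigma> (lcone F m, z n) \<in> ?U" "z n \<in> HC F m \<F>" by blast
      have "(lcone F m, z n) \<in> trop_chart_points N \<Delta> ?\<sigma>"
        unfolding chart_points_iff[OF \<sigma>] using F_sub m z(2) sub by blast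
      hence "(lcone F m, z n) \<in> T" using n(1) trop_glue_chart[OF \<sigma>, of "(lcone F m, z n)"] by simp
      thus "\<exists>y. y \<in> {lcone F m} \<times> HC F m \<F> \<and> y \<in> T" using n(2) by blast
    qed
  qed
qed

lemma in_closure_of_cell:
  assumes "set_flag E F \<F>" "m \<in> span M" "S' \<subseteq> E" "m' \<in> span M" "y' \<in> W S' m'"
  shows "(lcone S' m', y') \<in> TT closure_of ({lcone F m} \<times> HC F m \<F>) \<longleftrightarrow>
    lcone F m \<subseteq> lcone S' m' \<and> levels E (wv S' (lawrence_phi y')) \<subseteq> \<F>"
  unfolding closure_of_cell[OF assms(1,2)] by (rule cell_closure_iff[OF assms])

text \<open>One point of the first cell with superlevel sets exactly \<open>\<F>'\<close> suffices
  to read off both conditions; the other points of that cell have all their superlevel sets in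
  \<open>\<F>'\<close>.\<close>

lemma cell_subset_closure:
  assumes fl: "set_flag E F \<F>" "set_flag E F' \<F>'" and m: "m \<in> span M" "m' \<in> span M"
  shows "{lcone F' m'} \<times> HC F' m' \<F>' \<subseteq> TT closure_of ({lcone F m} \<times> HC F m \<F>) \<longleftrightarrow>
    lcone F m \<subseteq> lcone F' m' \<and> \<F>' \<subseteq> \<F>"
proof
  interpret f': set_flag E F' \<F>' by (rule fl(2))
  note iff = in_closure_of_cell[OF fl(1) m(1) f'.F_sub m(2)]
  { assume sub: "{lcone F' m'} \<times> HC F' m' \<F>' \<subseteq> TT closure_of ({lcone F m} \<times> HC F m \<F>)"
    obtain y where y: "y \<in> W F' m'" "levels E (wv F' (lawrence_phi y)) = \<F>'"
      using HC_strict_ex[OF fl(2)] by blast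
    hence "(lcone F' m', y) \<in> {lcone F' m'} \<times> HC F' m' \<F>'" by (simp add: HC_def)
    hence "(lcone F' m', y) \<in> TT closure_of ({lcone F m} \<times> HC F m \<F>)" using sub by blast
    thus "lcone F m \<subseteq> lcone F' m' \<and> \<F>' \<subseteq> \<F>" using iff[OF y(1)] y(2) by simp }
  assume sub: "lcone F m \<subseteq> lcone F' m' \<and> \<F>' \<subseteq> \<F>"
  have "(lcone F' m', y) \<in> TT closure_of ({lcone F m} \<times> HC F m \<F>)" if "y \<in> HC F' m' \<F>'" for y
    using that sub iff[of y] unfolding HC_def by blast
  thus "{lcone F' m'} \<times> HC F' m' \<F>' \<subseteq> TT closure_of ({lcone F m} \<times> HC F m \<F>)" by blast
qed

end

section \<open>The polyhedral structure\<close>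

context arrangement
begin

lemma cone_index_iff:
  "(F, R, \<F>) \<in> cone_index M E a r \<longleftrightarrow> flat F \<and> (\<exists>m\<in>span M. R = face_at F m) \<and> is_flag M E a F \<F>"
  by (simp add: cone_index_def arr_faces_iff)

lemma ball_cone_index:
  "(\<forall>(F, R, \<F>)\<in>cone_index M E a r. P F R \<F>) \<longleftrightarrow>
    (\<forall>F m \<F>. flat F \<and> m \<in> span M \<and> is_flag M E a F \<F> \<longrightarrow> P F (face_at F m) \<F>)"
  unfolding cone_index_def arr_faces_iff by blast

lemma Union_cone_index:
  "(\<Union>(F, R, \<F>)\<in>cone_index M E a r. g F R \<F>) =
    {p. \<exists>F m \<F>. flat F \<and> m \<in> span M \<and> is_flag M E a F \<F> \<and> p \<in> g F (face_at F m) \<F>}"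
  unfolding cone_index_def arr_faces_iff by blast

lemma cone_indexE:
  assumes "j \<in> cone_index M E a r"
  obtains F m \<F> where "j = (F, face_at F m, \<F>)" "flat F" "m \<in> span M" "is_flag M E a F \<F>"
  using assms unfolding cone_index_def arr_faces_iff by blast

lemma finite_arr_faces: "finite (arr_faces M a r S)"
proof (rule finite_imageD)
  show "inj_on (\<lambda>R. (pos_part M a r S R, neg_part M a r S R)) (arr_faces M a r S)"
  proof (rule inj_onI)
    fix R R' assume "R \<in> arr_faces M a r S" "R' \<in> arr_faces M a r S"
      and eq: "(pos_part M a r S R, neg_part M a r S R) = (pos_part M a r S R', neg_part M a r S R')"
    then obtain m m' where m: "m \<in> span M" "R = face_at S m" "m' \<in> span M" "R' = face_at S m'"
      unfolding arr_faces_iff by blast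
    show "R = R'" using eq face_at_eq_iff[OF m(1,3), of S] m
      by (simp add: pos_part_face neg_part_face)
  qed
qed simp

lemma finite_cone_index: "finite (cone_index M E a r)"
proof (rule finite_subset)
  show "cone_index M E a r \<subseteq> UNIV \<times> (\<Union>S. arr_faces M a r S) \<times> UNIV" unfolding cone_index_def by blast
  show "finite ((UNIV :: 'e set set) \<times> (\<Union>S. arr_faces M a r S) \<times> (UNIV :: 'e set set set))"
    using finite_arr_faces by (intro finite_cartesian_product finite_UN_I) auto
qed

lemma sub_flag:
  assumes "is_flag M E a F \<F>" "set_flag E F \<F>'" "\<F>' \<subseteq> \<F>" shows "is_flag M E a F \<F>'"
proof -
  interpret set_flag E F \<F>' by (rule assms)
  show ?thesis unfolding is_flag_def using F_in E_in chain flag_sub[OF assms(1)] assms(3) by blast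
qed

lemma flag_Int:
  assumes "is_flag M E a F \<F>" "is_flag M E a F \<F>'" shows "is_flag M E a F (\<F> \<inter> \<F>')"
proof -
  have "chain_subset (\<F> \<inter> \<F>')" using assms(1) unfolding is_flag_def chain_subset_def by simp
  thus ?thesis using assms unfolding is_flag_def by simp
qed

lemma polyhedral_fan_HC:
  assumes "flat F"
  shows "polyhedral_fan (quot_map (lcone F m) ` N) {HC F m \<F> | \<F>. is_flag M E a F \<F>}"
  unfolding polyhedral_fan_def
proof (intro conjI ballI allI impI)
  have "{HC F m \<F> | \<F>. is_flag M E a F \<F>} = HC F m ` {\<F>. is_flag M E a F \<F>}" by blast
  thus "finite {HC F m \<F> | \<F>. is_flag M E a F \<F>}" by simp
next
  fix C assume "C \<in> {HC F m \<F> | \<F>. is_flag M E a F \<F>}"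
  then obtain \<F> where C: "C = HC F m \<F>" "is_flag M E a F \<F>" by blast
  show "rational_cone (quot_map (lcone F m) ` N) C" unfolding C(1) by (rule rational_cone_HC[OF flag_set_flag[OF C(2)]])
  { fix D assume D: "D face_of C \<and> D \<noteq> {}"
    obtain \<F>' where "set_flag E F \<F>'" "\<F>' \<subseteq> \<F>" "D = HC F m \<F>'"
      using HC_face[OF flag_set_flag[OF C(2)], of D m] D C(1) by blast
    thus "D \<in> {HC F m \<F> | \<F>. is_flag M E a F \<F>}" using sub_flag[OF C(2)] by blast }
  fix D assume "D \<in> {HC F m \<F> | \<F>. is_flag M E a F \<F>}"
  then obtain \<F>' where D: "D = HC F m \<F>'" "is_flag M E a F \<F>'" by blast
  note fl = flag_set_flag[OF C(2)] flag_set_flag[OF D(2)] flag_set_flag[OF flag_Int[OF C(2) D(2)]]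
  show "C \<inter> D face_of C" "C \<inter> D face_of D"
    unfolding C(1) D(1) HC_Int by (rule HC_face_of[OF _ fl(3)]; use fl in blast)+
qed

lemma aff_dim_HC_codim:
  assumes "set_flag E F \<F>" "m \<in> span M"
  shows "aff_dim (HC F m \<F>) = int d + int (flag_length \<F>) - codim_face M (face_at F m)"
  unfolding aff_dim_HC[OF assms(1)] dim_HC[OF assms(1)] codim_face_def aff_dim_face_at[OF assms(2)] dim_M by simp

text \<open>The superlevel sets of \<open>p\<close> itself form a flag whose cell passes through
  \<open>p\<close>. Membership in either closure depends only on the cone and on the superlevel
  sets, so this whole cell lies in both closures.\<close>

lemma closures_Int_cells:
  assumes fl: "is_flag M E a F1 \<F>1" "is_flag M E a F2 \<F>2" and m: "m1 \<in> span M" "m2 \<in> span M"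
    and p: "p \<in> TT closure_of ({lcone F1 m1} \<times> HC F1 m1 \<F>1) \<inter> TT closure_of ({lcone F2 m2} \<times> HC F2 m2 \<F>2)"
  shows "\<exists>F m \<F>. flat F \<and> m \<in> span M \<and> is_flag M E a F \<F> \<and> p \<in> {lcone F m} \<times> HC F m \<F> \<and>
    {lcone F m} \<times> HC F m \<F> \<subseteq>
      TT closure_of ({lcone F1 m1} \<times> HC F1 m1 \<F>1) \<inter> TT closure_of ({lcone F2 m2} \<times> HC F2 m2 \<F>2)"
proof -
  note sf = flag_set_flag[OF fl(1)] flag_set_flag[OF fl(2)]
  have "p \<in> topspace TT" by (rule subsetD[OF closure_of_subset_topspace IntD1[OF p]])
  then obtain S m y where S: "p = (lcone S m, y)" "S \<subseteq> E" "m \<in> span M" "y \<in> W S m" unfolding topspace_TT by blast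
  let ?L = "levels E (wv S (lawrence_phi y))"
  have sub: "lcone F1 m1 \<subseteq> lcone S m" "?L \<subseteq> \<F>1" "lcone F2 m2 \<subseteq> lcone S m" "?L \<subseteq> \<F>2"
    using p unfolding S(1) Int_iff in_closure_of_cell[OF sf(1) m(1) S(2-4)] in_closure_of_cell[OF sf(2) m(2) S(2-4)]
    by blast+
  have L: "is_flag M E a S ?L"
    using flag_sub[OF fl(1)] sub(2) wv_PInf[OF S(2)] by (intro levels_flag) blast+
  have "flat S" using L unfolding is_flag_def by blast
  moreover have "p \<in> {lcone S m} \<times> HC S m ?L" using S(1,4) by (simp add: HC_def)
  moreover have "{lcone S m} \<times> HC S m ?L \<subseteq>
      TT closure_of ({lcone F1 m1} \<times> HC F1 m1 \<F>1) \<inter> TT closure_of ({lcone F2 m2} \<times> HC F2 m2 \<F>2)"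
    using cell_subset_closure[OF sf(1) flag_set_flag[OF L] m(1) S(3)]
      cell_subset_closure[OF sf(2) flag_set_flag[OF L] m(2) S(3)] sub by blast
  ultimately show ?thesis using S(3) L by blast
qed

end

context hypertoric
begin

lemma tstratum_HC: assumes "is_flag M E a F \<F>" shows "HC F m \<F> \<subseteq> tstratum F m"
  using flag_sub[OF assms] unfolding HC_def tstratum_def by blast

lemma tstratum_flag:
  assumes "F \<subseteq> E" "y \<in> tstratum F m" shows "is_flag M E a F (levels E (wv F (lawrence_phi y)))"
  using assms(2) wv_PInf[OF assms(1), of "lawrence_phi y"] unfolding tstratum_def by (intro levels_flag) blast+

lemma tstratum_in_rel_interior:
  assumes "F \<subseteq> E" "y \<in> tstratum F m" shows "y \<in> rel_interior (HC F m (levels E (wv F (lawrence_phi y))))"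
  using assms(2) unfolding rel_interior_HC[OF levels_set_flag[OF assms(1)]] tstratum_def by blast

lemma tstratum_iff_HC:
  assumes "F \<subseteq> E"
  shows "y \<in> tstratum F m \<longleftrightarrow> (\<exists>\<F>. is_flag M E a F \<F> \<and> y \<in> HC F m \<F>)"
    "y \<in> tstratum F m \<longleftrightarrow> (\<exists>\<F>. is_flag M E a F \<F> \<and> y \<in> rel_interior (HC F m \<F>))"
proof -
  have 1: "\<exists>\<F>. is_flag M E a F \<F> \<and> y \<in> rel_interior (HC F m \<F>)" if "y \<in> tstratum F m"
    using tstratum_flag[OF assms that] tstratum_in_rel_interior[OF assms that] by blast
  show "y \<in> tstratum F m \<longleftrightarrow> (\<exists>\<F>. is_flag M E a F \<F> \<and> y \<in> HC F m \<F>)"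
    "y \<in> tstratum F m \<longleftrightarrow> (\<exists>\<F>. is_flag M E a F \<F> \<and> y \<in> rel_interior (HC F m \<F>))"
    using 1 tstratum_HC rel_interior_subset by blast+
qed

lemma hyp_cell_HC:
  assumes "flat F" "m \<in> span M" "is_flag M E a F \<F>"
  shows "hyp_cell v M E a r F (face_at F m) \<F> = {lcone F m} \<times> HC F m \<F>"
  unfolding hyp_cell_def lawrence_cone_face[OF assms(2)] hyp_cone_eq_HC[OF assms] ..

lemma Trop_hypertoric_cells:
  "Trop_hypertoric v M E a r = (\<Union>(F, R, \<F>)\<in>cone_index M E a r. hyp_cell v M E a r F R \<F>)"
proof -
  have "p \<in> Trop_hypertoric v M E a r \<longleftrightarrow>
      (\<exists>F m \<F>. flat F \<and> m \<in> span M \<and> is_flag M E a F \<F> \<and> p \<in> {lcone F m} \<times> HC F m \<F>)" for p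
    unfolding Trop_hypertoric_eq using tstratum_iff_HC(1)[OF flat_sub] by blast
  moreover have "(\<exists>F m \<F>. flat F \<and> m \<in> span M \<and> is_flag M E a F \<F> \<and> p \<in> {lcone F m} \<times> HC F m \<F>) \<longleftrightarrow>
      (\<exists>F m \<F>. flat F \<and> m \<in> span M \<and> is_flag M E a F \<F> \<and> p \<in> hyp_cell v M E a r F (face_at F m) \<F>)" for p
    by (intro ex_cong1 conj_cong refl) (simp only: hyp_cell_HC)
  ultimately show ?thesis unfolding Union_cone_index by (intro set_eqI) (simp only: mem_Collect_eq)
qed

lemma Trop_hypertoric_rel_interiors:
  "Trop_hypertoric v M E a r = (\<Union>(F, R, \<F>)\<in>cone_index M E a r.
     {lawrence_cone M E a r F R} \<times> rel_interior (hyp_cone v M E a r F R \<F>))"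
proof -
  have "p \<in> Trop_hypertoric v M E a r \<longleftrightarrow>
      (\<exists>F m \<F>. flat F \<and> m \<in> span M \<and> is_flag M E a F \<F> \<and> p \<in> {lcone F m} \<times> rel_interior (HC F m \<F>))" for p
    unfolding Trop_hypertoric_eq using tstratum_iff_HC(2)[OF flat_sub] by blast
  moreover have "(\<exists>F m \<F>. flat F \<and> m \<in> span M \<and> is_flag M E a F \<F> \<and> p \<in> {lcone F m} \<times> rel_interior (HC F m \<F>)) \<longleftrightarrow>
      (\<exists>F m \<F>. flat F \<and> m \<in> span M \<and> is_flag M E a F \<F> \<and>
        p \<in> {lawrence_cone M E a r F (face_at F m)} \<times> rel_interior (hyp_cone v M E a r F (face_at F m) \<F>))" for p
    by (intro ex_cong1 conj_cong refl) (simp only: hyp_cone_eq_HC lawrence_cone_face)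
  ultimately show ?thesis unfolding Union_cone_index by (intro set_eqI) (simp only: mem_Collect_eq)
qed

text \<open>A point determines its index: the cone gives \<open>F\<close> and the face by
  \<open>lcone_eq_iff\<close>, and on a relative interior the flag is the set of superlevel
  sets.\<close>

lemma disjoint_rel_interiors:
  "disjoint_family_on
     (\<lambda>(F, R, \<F>). {lawrence_cone M E a r F R} \<times> rel_interior (hyp_cone v M E a r F R \<F>)) (cone_index M E a r)"
  unfolding disjoint_family_on_def
proof (intro ballI impI, rule ccontr)
  fix i j assume i: "i \<in> cone_index M E a r" and j: "j \<in> cone_index M E a r" and ne: "i \<noteq> j"
  let ?f = "\<lambda>(F, R, \<F>). {lawrence_cone M E a r F R} \<times> rel_interior (hyp_cone v M E a r F R \<F>)"
  assume "?f i \<inter> ?f j \<noteq> {}"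
  then obtain p where p: "p \<in> ?f i" "p \<in> ?f j" by blast
  obtain F m \<F> where 1: "i = (F, face_at F m, \<F>)" "flat F" "m \<in> span M" "is_flag M E a F \<F>" using i by (rule cone_indexE)
  obtain F' m' \<F>' where 2: "j = (F', face_at F' m', \<F>')" "flat F'" "m' \<in> span M" "is_flag M E a F' \<F>'" using j by (rule cone_indexE)
  have fi: "?f i = {lcone F m} \<times> rel_interior (HC F m \<F>)" and fj: "?f j = {lcone F' m'} \<times> rel_interior (HC F' m' \<F>')"
    unfolding 1(1) 2(1) prod.case lawrence_cone_face[OF 1(3)] lawrence_cone_face[OF 2(3)]
      hyp_cone_eq_HC[OF 1(2-4)] hyp_cone_eq_HC[OF 2(2-4)] by (rule refl)+
  have fst: "fst p = lcone F m" "fst p = lcone F' m'"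
    and rel: "snd p \<in> rel_interior (HC F m \<F>)" "snd p \<in> rel_interior (HC F' m' \<F>')"
    using p[unfolded fi fj] by (simp_all add: mem_Times_iff)
  have "lcone F m = lcone F' m'" using fst by (rule trans[OF sym])
  hence eq: "F = F'" "face_at F m = face_at F' m'"
    using lcone_eq_iff[OF flat_sub[OF 1(2)] flat_sub[OF 2(2)] 1(3) 2(3)] by blast+
  have "levels E (wv F (lawrence_phi (snd p))) = \<F>" "levels E (wv F' (lawrence_phi (snd p))) = \<F>'"
    using rel unfolding rel_interior_HC[OF flag_set_flag[OF 1(4)]] rel_interior_HC[OF flag_set_flag[OF 2(4)]]
    by (simp_all only: mem_Collect_eq)
  thus False using eq ne 1(1) 2(1) by simp
qed

lemma disjoint_strata:
  "\<forall>(F, R, \<F>)\<in>cone_index M E a r. \<forall>(F', R', \<F>')\<in>cone_index M E a r.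
     (F, R) \<noteq> (F', R') \<longrightarrow> hyp_cell v M E a r F R \<F> \<inter> hyp_cell v M E a r F' R' \<F>' = {}"
  unfolding ball_cone_index
proof (intro allI impI)
  fix F m \<F> F' m' \<F>'
  assume 1: "flat F \<and> m \<in> span M \<and> is_flag M E a F \<F>" and 2: "flat F' \<and> m' \<in> span M \<and> is_flag M E a F' \<F>'"
    and ne: "(F, face_at F m) \<noteq> (F', face_at F' m')"
  have "lcone F m \<noteq> lcone F' m'" using lcone_eq_iff[of F F' m m'] flat_sub 1 2 ne by auto
  thus "hyp_cell v M E a r F (face_at F m) \<F> \<inter> hyp_cell v M E a r F' (face_at F' m') \<F>' = {}"
    using 1 2 by (simp add: hyp_cell_HC Times_Int_Times)
qed

lemma aff_dim_hyp_cone: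
  "\<forall>(F, R, \<F>)\<in>cone_index M E a r.
     aff_dim (hyp_cone v M E a r F R \<F>) = int d + int (flag_length \<F>) - codim_face M R"
  unfolding ball_cone_index using aff_dim_HC_codim[OF flag_set_flag] by (simp add: hyp_cone_eq_HC)

lemma closure_relation:
  "\<forall>(F, R, \<F>)\<in>cone_index M E a r. \<forall>(F', R', \<F>')\<in>cone_index M E a r.
     hyp_cell v M E a r F' R' \<F>' \<subseteq> TT closure_of hyp_cell v M E a r F R \<F> \<longleftrightarrow>
     F \<subseteq> F' \<and> R' \<subseteq> closure R \<and> F' \<in> \<F> \<and> flag_refines (flag_trunc F' \<F>) \<F>'"
  unfolding ball_cone_index
proof (intro allI impI)
  fix F m \<F> F' m' \<F>'
  assume 1: "flat F \<and> m \<in> span M \<and> is_flag M E a F \<F>" and 2: "flat F' \<and> m' \<in> span M \<and> is_flag M E a F' \<F>'"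
  \<comment> \<open>All members of \<open>\<F>'\<close> contain \<open>F'\<close>, which is itself a
    member; so the two conditions on flags amount to a single inclusion.\<close>
  have "\<F>' \<subseteq> \<F> \<longleftrightarrow> F' \<in> \<F> \<and> flag_refines (flag_trunc F' \<F>) \<F>'"
    using 2 unfolding flag_refines_def flag_trunc_def is_flag_def by blast
  thus "hyp_cell v M E a r F' (face_at F' m') \<F>' \<subseteq> TT closure_of hyp_cell v M E a r F (face_at F m) \<F> \<longleftrightarrow>
     F \<subseteq> F' \<and> face_at F' m' \<subseteq> closure (face_at F m) \<and> F' \<in> \<F> \<and> flag_refines (flag_trunc F' \<F>) \<F>'"
    using 1 2 by (simp add: hyp_cell_HC cell_subset_closure flag_set_flag lcone_subset_iff flat_sub)
qed

lemma hyp_cones_stratum: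
  assumes "flat F" "m \<in> span M"
  shows "{hyp_cone v M E a r F (face_at F m) \<F> | \<F>. is_flag M E a F \<F>} = {HC F m \<F> | \<F>. is_flag M E a F \<F>}"
  using hyp_cone_eq_HC[OF assms] by blast

lemma stratum_fan:
  assumes F: "flat F" and m: "m \<in> span M"
  shows "\<Union>{HC F m \<F> | \<F>. is_flag M E a F \<F>} = Trop_hypertoric_orbit v M E a r F (face_at F m)"
  unfolding Trop_hypertoric_orbit_eq[OF assms] using tstratum_iff_HC(1)[OF flat_sub[OF F]] by blast

lemma polyhedral_complex_cells:
  "polyhedral_complex N \<Delta> (Trop_hypertoric v M E a r) (cone_index M E a r)
     (\<lambda>(F, R, \<F>). lawrence_cone M E a r F R) (\<lambda>(F, R, \<F>). hyp_cone v M E a r F R \<F>)"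
  unfolding polyhedral_complex_def
proof (intro conjI ballI allI impI finite_cone_index)
  let ?s = "\<lambda>(F, R, \<F>). lawrence_cone M E a r F R"
  let ?C = "\<lambda>(F, R, \<F>). hyp_cone v M E a r F R \<F>"
  show "Trop_hypertoric v M E a r = (\<Union>j\<in>cone_index M E a r. {?s j} \<times> ?C j)"
    unfolding Trop_hypertoric_cells hyp_cell_def by (intro SUP_cong refl) (simp add: case_prod_beta)
  fix j assume "j \<in> cone_index M E a r"
  then obtain F m \<F> where j: "j = (F, face_at F m, \<F>)" "flat F" "m \<in> span M" "is_flag M E a F \<F>" by (rule cone_indexE)
  have sC: "?s j = lcone F m" "?C j = HC F m \<F>"
    unfolding j(1) prod.case by (rule lawrence_cone_face[OF j(3)], rule hyp_cone_eq_HC[OF j(2-4)])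
  show "?s j \<in> \<Delta>" unfolding sC by (rule lcone_in_fan[OF flat_sub[OF j(2)] j(3)])
  show "rational_cone (quot_map (?s j) ` N) (?C j)" unfolding sC by (rule rational_cone_HC[OF flag_set_flag[OF j(4)]])
  { fix D assume D: "D face_of ?C j \<and> D \<noteq> {}"
    obtain \<F>' where f: "set_flag E F \<F>'" "\<F>' \<subseteq> \<F>" "D = HC F m \<F>'"
      using HC_face[OF flag_set_flag[OF j(4)], of D m] D unfolding sC by blast
    have f': "is_flag M E a F \<F>'" by (rule sub_flag[OF j(4) f(1,2)])
    have "(F, face_at F m, \<F>') \<in> cone_index M E a r" unfolding cone_index_iff using j(2,3) f' by blast
    moreover have "?s (F, face_at F m, \<F>') = ?s j" unfolding j(1) by simp
    moreover have "?C (F, face_at F m, \<F>') = D" unfolding prod.case f(3) by (rule hyp_cone_eq_HC[OF j(2,3) f'])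
    ultimately show "\<exists>k\<in>cone_index M E a r. ?s k = ?s j \<and> ?C k = D" by blast }
  fix i assume "i \<in> cone_index M E a r"
  then obtain F' m' \<F>' where i: "i = (F', face_at F' m', \<F>')" "flat F'" "m' \<in> span M" "is_flag M E a F' \<F>'" by (rule cone_indexE)
  have sC': "?s i = lcone F' m'" "?C i = HC F' m' \<F>'"
    unfolding i(1) prod.case by (rule lawrence_cone_face[OF i(3)], rule hyp_cone_eq_HC[OF i(2-4)])
  define Z where "Z = TT closure_of ({lcone F m} \<times> HC F m \<F>) \<inter> TT closure_of ({lcone F' m'} \<times> HC F' m' \<F>')"
  have "\<exists>k\<in>cone_index M E a r. {?s k} \<times> ?C k \<subseteq> Z \<and> p \<in> {?s k} \<times> ?C k" if p: "p \<in> Z" for p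
  proof -
    obtain G n \<G> where k: "flat G" "n \<in> span M" "is_flag M E a G \<G>" "p \<in> {lcone G n} \<times> HC G n \<G>" "{lcone G n} \<times> HC G n \<G> \<subseteq> Z"
      using closures_Int_cells[OF j(4) i(4) j(3) i(3) p[unfolded Z_def], folded Z_def]
      by (elim exE conjE) (rule that)
    have eq: "{?s (G, face_at G n, \<G>)} \<times> ?C (G, face_at G n, \<G>) = {lcone G n} \<times> HC G n \<G>"
      unfolding prod.case lawrence_cone_face[OF k(2)] hyp_cone_eq_HC[OF k(1-3)] ..
    have "(G, face_at G n, \<G>) \<in> cone_index M E a r" unfolding cone_index_iff using k(1-3) by blast
    thus ?thesis using k(4,5) unfolding eq[symmetric] by blast
  qed
  hence "Z = (\<Union>k\<in>{k\<in>cone_index M E a r. {?s k} \<times> ?C k \<subseteq> Z}. {?s k} \<times> ?C k)" by blast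
  thus "let Z = TT closure_of ({?s j} \<times> ?C j) \<inter> TT closure_of ({?s i} \<times> ?C i)
    in Z = (\<Union>k\<in>{k\<in>cone_index M E a r. {?s k} \<times> ?C k \<subseteq> Z}. {?s k} \<times> ?C k)"
    unfolding Let_def sC sC' Z_def .
qed

end

theorem theorem6p1:
  fixes v :: "'k::field \<Rightarrow> ereal"
    and d :: nat
    and M :: "'m::euclidean_space set"
    and E :: "'e::finite set"
    and a :: "'e \<Rightarrow> 'm"
    and r :: "'e \<Rightarrow> int"
  assumes "complete_valuation v"
    and "is_lattice d M"
    and "primitive_spanning M E a"
    and "residually_independent v M E a"
  shows
    "Trop_hypertoric v M E a r =
       (\<Union>(F, R, \<F>)\<in>cone_index M E a r. hyp_cell v M E a r F R \<F>) \<and>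
     Trop_hypertoric v M E a r =
       (\<Union>(F, R, \<F>)\<in>cone_index M E a r.
          {lawrence_cone M E a r F R} \<times> rel_interior (hyp_cone v M E a r F R \<F>)) \<and>
     disjoint_family_on
       (\<lambda>(F, R, \<F>). {lawrence_cone M E a r F R} \<times> rel_interior (hyp_cone v M E a r F R \<F>))
       (cone_index M E a r) \<and>
     (\<forall>(F, R, \<F>)\<in>cone_index M E a r. \<forall>(F', R', \<F>')\<in>cone_index M E a r.
        (F, R) \<noteq> (F', R') \<longrightarrow> hyp_cell v M E a r F R \<F> \<inter> hyp_cell v M E a r F' R' \<F>' = {}) \<and>
     (\<forall>(F, R, \<F>)\<in>cone_index M E a r.
        aff_dim (hyp_cone v M E a r F R \<F>) = int d + int (flag_length \<F>) - codim_face M R) \<and>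
     polyhedral_complex (lawrence_lattice E a) (lawrence_fan M E a r) (Trop_hypertoric v M E a r)
       (cone_index M E a r)
       (\<lambda>(F, R, \<F>). lawrence_cone M E a r F R) (\<lambda>(F, R, \<F>). hyp_cone v M E a r F R \<F>) \<and>
     (\<forall>(F, R, \<F>)\<in>cone_index M E a r. \<forall>(F', R', \<F>')\<in>cone_index M E a r.
        hyp_cell v M E a r F' R' \<F>' \<subseteq>
          trop_toric (lawrence_lattice E a) (lawrence_fan M E a r) closure_of
            hyp_cell v M E a r F R \<F> \<longleftrightarrow>
        F \<subseteq> F' \<and> R' \<subseteq> closure R \<and> F' \<in> \<F> \<and> flag_refines (flag_trunc F' \<F>) \<F>') \<and>
     (\<forall>F R. is_flat M E a F \<and> R \<in> arr_faces M a r F \<longrightarrow>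
        (let N\<^sub>F\<^sub>R = quot_map (lawrence_cone M E a r F R) ` lawrence_lattice E a;
             \<Sigma> = {hyp_cone v M E a r F R \<F> | \<F>. is_flag M E a F \<F>}
         in \<Union>\<Sigma> = Trop_hypertoric_orbit v M E a r F R \<and>
            polyhedral_fan N\<^sub>F\<^sub>R \<Sigma> \<and> balanced_fan N\<^sub>F\<^sub>R \<Sigma> (\<lambda>_. 1)))"
proof -
  interpret hypertoric M E a r d v
    using assms by unfold_locales (simp_all add: complete_valuation_def)
  have fan: "\<forall>F R. is_flat M E a F \<and> R \<in> arr_faces M a r F \<longrightarrow>
      (let N\<^sub>F\<^sub>R = quot_map (lawrence_cone M E a r F R) ` lawrence_lattice E a;
           \<Sigma> = {hyp_cone v M E a r F R \<F> | \<F>. is_flag M E a F \<F>}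
       in \<Union>\<Sigma> = Trop_hypertoric_orbit v M E a r F R \<and>
          polyhedral_fan N\<^sub>F\<^sub>R \<Sigma> \<and> balanced_fan N\<^sub>F\<^sub>R \<Sigma> (\<lambda>_. 1))"
  proof (intro allI impI)
    fix F R assume "is_flat M E a F \<and> R \<in> arr_faces M a r F"
    then obtain m where F: "flat F" and m: "m \<in> span M" and R: "R = face_at F m" unfolding arr_faces_iff by blast
    show "let N\<^sub>F\<^sub>R = quot_map (lawrence_cone M E a r F R) ` lawrence_lattice E a;
           \<Sigma> = {hyp_cone v M E a r F R \<F> | \<F>. is_flag M E a F \<F>}
       in \<Union>\<Sigma> = Trop_hypertoric_orbit v M E a r F R \<and>
          polyhedral_fan N\<^sub>F\<^sub>R \<Sigma> \<and> balanced_fan N\<^sub>F\<^sub>R \<Sigma> (\<lambda>_. 1)"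
      unfolding R Let_def hyp_cones_stratum[OF F m] lawrence_cone_face[OF m]
      by (intro conjI stratum_fan[OF F m] polyhedral_fan_HC[OF F] balanced_HC[OF F])
  qed
  show ?thesis
    by (intro conjI Trop_hypertoric_cells Trop_hypertoric_rel_interiors disjoint_rel_interiors disjoint_strata aff_dim_hyp_cone
        polyhedral_complex_cells closure_relation fan)
qed

end
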